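(* Let $\rho:C(X)\to C(X)\otimes A$ be a faithful isometric action of a compact quantum group $A$ on a compact metric space $(X,d)$, and let $h$ be the Haar state of $A$. Then for every $x\in X$ the following five subsets of $X$ coincide: (a) the support of the probability measure $\mu_x=x\triangleleft h$; (b) the closed subset $\mathcal M_x\subseteq X$ such that the image of the homomorphism $(\delta_x\otimes\mathrm{id})\circ\rho:C(X)\to A$ is, as a quotient of $C(X)$, the function algebra $C(\mathcal M_x)$; (c) the set $\mathrm{Orb}_x=\{x'\in X: x'\triangleleft h=x\triangleleft h\}$; (d) the set $\mathcal M'_x=\{y\in X: \exists\,\varphi\in S(A_r)\text{ such that }x\triangleleft\varphi=y\}$; (e) the set $\mathcal M''_x=\{y\in X: \exists\,\varphi\in S(A)\text{ such that }x\triangleleft\varphi=y\}$.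
   Context: All $C^*$-algebras and homomorphisms are unital, and $\otimes$ between $C^*$-algebras is the minimal tensor product. $S(A)$ denotes the set of states of $A$; $\mathrm{Prob}(X)=S(C(X))$; points $x\in X$ are identified with Dirac measures $\delta_x$. Compact quantum group: a unital $C^*$-algebra $A$ with a $C^*$-homomorphism $\Delta:A\to A\otimes A$ such that $(\Delta\otimes\mathrm{id})\Delta=(\mathrm{id}\otimes\Delta)\Delta$ and the linear spans of $\{(a\otimes 1)\Delta(b)\}$ and of $\{(1\otimes a)\Delta(b)\}$ ($a,b\in A$) are norm-dense in $A\otimes A$. It has a unique Haar state $h\in S(A)$, satisfying $(h\otimes\varphi)\Delta=(\varphi\otimes h)\Delta=h$ for all $\varphi\in S(A)$. $A$ is reduced if $h$ is faithful. In general $A_r$ is the reduced quantum group obtained as the image of $A$ in the GNS representation of $h$, with surjection $\tau:A\to A_r$. Action on a compact Hausdorff space $X$: a $C^*$-homomorphism $\rho:C(X)\to C(X)\otimes A$ with $(\rho\otimes\mathrm{id})\rho=(\mathrm{id}\otimes\Delta)\rho$ and such that the linear span of $\{(1\otimes a)\rho(f): a\in A, f\in C(X)\}$ is dense in $C(X)\otimes A$. Its reduced version is $\rho_r=(\mathrm{id}\otimes\tau)\rho$, an action of $A_r$. The action is faithful if $\{(\mu\otimes\mathrm{id})(\rho(f)): f\in C(X),\ \mu\in S(C(X))\}$ generates $A$ as a $C^*$-algebra. For $\mu\in\mathrm{Prob}(X)$, $\varphi\in S(A)$, let $\mu\triangleleft\varphi=(\mu\otimes\varphi)\circ\rho\in\mathrm{Prob}(X)$.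 States $\varphi\in S(A_r)$ act via $\rho_r$: $\mu\triangleleft\varphi=(\mu\otimes\varphi)\circ\rho_r=\mu\triangleleft(\varphi\circ\tau)$. A reduced quantum group acting faithfully on a compact space is of Kac type: it has an antipode $\kappa$, i.e. the antipode of its dense Hopf $*$-subalgebra of representative functions extends to a bounded, involutive, multiplication-reversing map $\kappa$ on the $C^*$-algebra. Isometric action: let $(X,d)$ be a compact metric space and $d_x\in C(X)$, $d_x(y)=d(x,y)$. For $f\in C(X)$ and $x\in X$ let $\rho(f)(x)\in A$ be the evaluation at $x$ of the left tensorand of $\rho(f)$. If $A$ is reduced, a faithful action $\rho$ is isometric if $\rho(d_y)(x)=\kappa(\rho(d_x)(y))$ for all $x,y\in X$. In general $\rho$ is isometric if $\rho_r$ is. *)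

theory Defs
  imports "HOL-Analysis.Analysis" "HOL-Algebra.Ring"
begin

section \<open>Unital C*-algebras with explicit carrier\<close>

record 'a cstar = "'a ring" +
  cscale :: "complex \<Rightarrow> 'a \<Rightarrow> 'a"
  adj :: "'a \<Rightarrow> 'a"
  cnorm :: "'a \<Rightarrow> real"

definition cdiff :: "('a, 'm) cstar_scheme \<Rightarrow> 'a \<Rightarrow> 'a \<Rightarrow> 'a" where
  "cdiff A a b = a \<oplus>\<^bsub>A\<^esub> cscale A (-1) b"

locale cstar_algebra = ring A for A :: "('a, 'm) cstar_scheme" (structure) +
  assumes scale_closed: "a \<in> carrier A \<Longrightarrow> cscale A z a \<in> carrier A"
    and scale_one: "a \<in> carrier A \<Longrightarrow> cscale A 1 a = a"
    and scale_scale: "a \<in> carrier A \<Longrightarrow> cscale A z (cscale A w a) = cscale A (z * w) a"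
    and scale_add_left: "a \<in> carrier A \<Longrightarrow> cscale A (z + w) a = cscale A z a \<oplus> cscale A w a"
    and scale_add_right:
      "\<lbrakk>a \<in> carrier A; b \<in> carrier A\<rbrakk> \<Longrightarrow> cscale A z (a \<oplus> b) = cscale A z a \<oplus> cscale A z b"
    and scale_mult_left:
      "\<lbrakk>a \<in> carrier A; b \<in> carrier A\<rbrakk> \<Longrightarrow> cscale A z a \<otimes> b = cscale A z (a \<otimes> b)"
    and scale_mult_right:
      "\<lbrakk>a \<in> carrier A; b \<in> carrier A\<rbrakk> \<Longrightarrow> a \<otimes> cscale A z b = cscale A z (a \<otimes> b)"
    and adj_closed: "a \<in> carrier A \<Longrightarrow> adj A a \<in> carrier A"
    and adj_adj: "a \<in> carrier A \<Longrightarrow> adj A (adj A a) = a"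
    and adj_add: "\<lbrakk>a \<in> carrier A; b \<in> carrier A\<rbrakk> \<Longrightarrow> adj A (a \<oplus> b) = adj A a \<oplus> adj A b"
    and adj_scale: "a \<in> carrier A \<Longrightarrow> adj A (cscale A z a) = cscale A (cnj z) (adj A a)"
    and adj_mult: "\<lbrakk>a \<in> carrier A; b \<in> carrier A\<rbrakk> \<Longrightarrow> adj A (a \<otimes> b) = adj A b \<otimes> adj A a"
    and norm_nonneg: "a \<in> carrier A \<Longrightarrow> 0 \<le> cnorm A a"
    and norm_eq_0: "a \<in> carrier A \<Longrightarrow> cnorm A a = 0 \<longleftrightarrow> a = \<zero>"
    and norm_scale: "a \<in> carrier A \<Longrightarrow> cnorm A (cscale A z a) = cmod z * cnorm A a"
    and norm_triangle:
      "\<lbrakk>a \<in> carrier A; b \<in> carrier A\<rbrakk> \<Longrightarrow> cnorm A (a \<oplus> b) \<le> cnorm A a + cnorm A b"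
    and norm_mult:
      "\<lbrakk>a \<in> carrier A; b \<in> carrier A\<rbrakk> \<Longrightarrow> cnorm A (a \<otimes> b) \<le> cnorm A a * cnorm A b"
    and cstar_identity: "a \<in> carrier A \<Longrightarrow> cnorm A (adj A a \<otimes> a) = (cnorm A a)\<^sup>2"
    and complete:
      "\<lbrakk>\<And>n. s n \<in> carrier A;
        \<And>e. e > 0 \<Longrightarrow> \<exists>N. \<forall>m\<ge>N. \<forall>n\<ge>N. cnorm A (cdiff A (s m) (s n)) < e\<rbrakk>
       \<Longrightarrow> \<exists>l\<in>carrier A. (\<lambda>n. cnorm A (cdiff A (s n) l)) \<longlonglongrightarrow> 0"

definition cstar_hom ::
    "('a, 'm) cstar_scheme \<Rightarrow> ('b, 'n) cstar_scheme \<Rightarrow> ('a \<Rightarrow> 'b) \<Rightarrow> bool" where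
  "cstar_hom A B f \<longleftrightarrow> f \<in> ring_hom A B \<and>
     (\<forall>z. \<forall>a\<in>carrier A. f (cscale A z a) = cscale B z (f a)) \<and>
     (\<forall>a\<in>carrier A. f (adj A a) = adj B (f a))"

definition bounded_clinear_map ::
    "('a, 'm) cstar_scheme \<Rightarrow> ('b, 'n) cstar_scheme \<Rightarrow> ('a \<Rightarrow> 'b) \<Rightarrow> bool" where
  "bounded_clinear_map A B f \<longleftrightarrow> f \<in> carrier A \<rightarrow> carrier B \<and>
     (\<forall>a\<in>carrier A. \<forall>b\<in>carrier A. f (a \<oplus>\<^bsub>A\<^esub> b) = f a \<oplus>\<^bsub>B\<^esub> f b) \<and>
     (\<forall>z. \<forall>a\<in>carrier A. f (cscale A z a) = cscale B z (f a)) \<and>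
     (\<exists>K. \<forall>a\<in>carrier A. cnorm B (f a) \<le> K * cnorm A a)"

text \<open>States are normalised to be undefined outside the carrier, so that equality of states is
  equality of functions.\<close>

definition states :: "('a, 'm) cstar_scheme \<Rightarrow> ('a \<Rightarrow> complex) set" where
  "states A = {\<phi> \<in> extensional (carrier A).
     (\<forall>a\<in>carrier A. \<forall>b\<in>carrier A. \<phi> (a \<oplus>\<^bsub>A\<^esub> b) = \<phi> a + \<phi> b) \<and>
     (\<forall>z. \<forall>a\<in>carrier A. \<phi> (cscale A z a) = z * \<phi> a) \<and>
     (\<forall>a\<in>carrier A. \<phi> (adj A a \<otimes>\<^bsub>A\<^esub> a) \<in> \<real>\<^sub>\<ge>\<^sub>0) \<and>
     \<phi> \<one>\<^bsub>A\<^esub> = 1}"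

inductive_set clin_span :: "('a, 'm) cstar_scheme \<Rightarrow> 'a set \<Rightarrow> 'a set"
  for A :: "('a, 'm) cstar_scheme" and S :: "'a set" where
  zero: "\<zero>\<^bsub>A\<^esub> \<in> clin_span A S"
| step: "\<lbrakk>a \<in> S; b \<in> clin_span A S\<rbrakk> \<Longrightarrow> cscale A z a \<oplus>\<^bsub>A\<^esub> b \<in> clin_span A S"

definition norm_dense :: "('a, 'm) cstar_scheme \<Rightarrow> 'a set \<Rightarrow> bool" where
  "norm_dense A S \<longleftrightarrow> S \<subseteq> carrier A \<and>
     (\<forall>a\<in>carrier A. \<forall>e>0. \<exists>s\<in>S. cnorm A (cdiff A a s) < e)"

definition cstar_subalgebra :: "('a, 'm) cstar_scheme \<Rightarrow> 'a set \<Rightarrow> bool" where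
  "cstar_subalgebra A B \<longleftrightarrow> B \<subseteq> carrier A \<and> \<zero>\<^bsub>A\<^esub> \<in> B \<and> \<one>\<^bsub>A\<^esub> \<in> B \<and>
     (\<forall>a\<in>B. \<forall>b\<in>B. a \<oplus>\<^bsub>A\<^esub> b \<in> B \<and> a \<otimes>\<^bsub>A\<^esub> b \<in> B) \<and>
     (\<forall>a\<in>B. adj A a \<in> B \<and> (\<forall>z. cscale A z a \<in> B)) \<and>
     (\<forall>a\<in>carrier A. (\<forall>e>0. \<exists>b\<in>B. cnorm A (cdiff A a b) < e) \<longrightarrow> a \<in> B)"

definition generates_cstar :: "('a, 'm) cstar_scheme \<Rightarrow> 'a set \<Rightarrow> bool" where
  "generates_cstar A S \<longleftrightarrow> S \<subseteq> carrier A \<and>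
     (\<forall>B. cstar_subalgebra A B \<and> S \<subseteq> B \<longrightarrow> B = carrier A)"


section \<open>The algebra of continuous functions on a compact space\<close>

text \<open>The space is a whole type; compactness of \<open>UNIV\<close> is assumed where it matters.\<close>

definition Cont :: "('x::topological_space \<Rightarrow> complex) cstar" where
  "Cont = \<lparr>carrier = {f. continuous_on UNIV f},
     monoid.mult = (\<lambda>f g x. f x * g x), one = (\<lambda>x. 1),
     zero = (\<lambda>x. 0), add = (\<lambda>f g x. f x + g x),
     cscale = (\<lambda>z f x. z * f x), adj = (\<lambda>f x. cnj (f x)),
     cnorm = (\<lambda>f. SUP x. cmod (f x))\<rparr>"

definition dirac :: "'x::topological_space \<Rightarrow> ('x \<Rightarrow> complex) \<Rightarrow> complex" where
  "dirac x = (\<lambda>f\<in>carrier Cont. f x)"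

text \<open>Probability measures on the space are states of its function algebra.  The support is the
  complement of the largest open null set, an open set being null if the state vanishes on all
  functions that are zero off it.  Lemma \<open>prob_support_eq_measure_support\<close> compares this with
  the support of a representing Borel measure.\<close>

definition prob_support :: "(('x::topological_space \<Rightarrow> complex) \<Rightarrow> complex) \<Rightarrow> 'x set" where
  "prob_support \<mu> = - \<Union>{U. open U \<and> (\<forall>f\<in>carrier Cont. (\<forall>x. x \<notin> U \<longrightarrow> f x = 0) \<longrightarrow> \<mu> f = 0)}"

lemma prob_support_eq_measure_support:
  fixes \<mu> :: "('x::metric_space \<Rightarrow> complex) \<Rightarrow> complex"
  assumes "compact (UNIV :: 'x set)" "finite_measure M" and sets: "sets M = sets borel"
    and repr: "\<And>f. f \<in> carrier Cont \<Longrightarrow> \<mu> f = (\<integral>x. f x \<partial>M)"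
  shows "prob_support \<mu> = {x. \<forall>U. open U \<and> x \<in> U \<longrightarrow> emeasure M U > 0}"
proof -
  interpret finite_measure M by fact
  have sp: "space M = UNIV" using sets_eq_imp_space_eq[OF sets] by simp
  have null: "(\<forall>f\<in>carrier Cont. (\<forall>x. x \<notin> U \<longrightarrow> f x = 0) \<longrightarrow> \<mu> f = 0) \<longleftrightarrow> emeasure M U = 0"
    (is "?L \<longleftrightarrow> ?R") if U: "open U" for U :: "'x set"
  proof
    assume ?R
    then have "U \<in> null_sets M" using U sets by (auto simp: null_sets_def)
    then have ae: "AE x in M. x \<notin> U" by (rule AE_not_in)
    show ?L
    proof (intro ballI impI)
      fix f :: "'x \<Rightarrow> complex" assume f: "f \<in> carrier Cont" "\<forall>x. x \<notin> U \<longrightarrow> f x = 0"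
      have "AE x in M. f x = 0" using ae by eventually_elim (use f(2) in auto)
      then show "\<mu> f = 0" using repr[OF f(1)] integral_eq_zero_AE by metis
    qed
  next
    assume L: ?L
    define g :: "'x \<Rightarrow> real" where "g x = (if U = UNIV then 1 else infdist x (- U))" for x
    have g0: "g x \<ge> 0" for x by (simp add: g_def infdist_nonneg)
    have gU: "g x = 0 \<longleftrightarrow> x \<notin> U" for x
      using U in_closed_iff_infdist_zero[of "- U" x] by (auto simp: g_def closed_Compl)
    have gc: "continuous_on UNIV g"
      unfolding g_def by (cases "U = UNIV") (auto intro!: continuous_intros)
    obtain B where B: "\<And>x. norm (g x) \<le> B"
      using compact_imp_bounded[OF compact_continuous_image[OF gc assms(1)]]
      unfolding bounded_iff by auto
    have gm: "g \<in> borel_measurable M"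
      using borel_measurable_continuous_onI[OF gc] measurable_cong_sets[OF sets refl] by blast
    have gi: "integrable M g" by (rule integrable_const_bound[where B = B]) (use B gm in auto)
    have "(\<lambda>x. complex_of_real (g x)) \<in> carrier Cont"
      using gc by (simp add: Cont_def continuous_on_of_real)
    then have "(\<integral>x. complex_of_real (g x) \<partial>M) = 0" using L repr gU by auto
    then have "(\<integral>x. g x \<partial>M) = 0" by simp
    then have "AE x in M. g x = 0" using integral_nonneg_eq_0_iff_AE[OF gi] g0 by auto
    then have "AE x in M. x \<notin> U" using gU by simp
    then show ?R using U sets sp by (subst (asm) AE_iff_measurable[of U]) auto
  qed
  then show ?thesis
    unfolding prob_support_def using zero_less_iff_neq_zero by fastforce
qed

lemma cstar_algebra_Cont:
  assumes cpt: "compact (UNIV :: 'x::topological_space set)"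
  shows "cstar_algebra (Cont :: ('x \<Rightarrow> complex) cstar)"
proof -
  let ?C = "Cont :: ('x \<Rightarrow> complex) cstar"
  have bdd: "bdd_above (range (\<lambda>x. cmod (f x)))" if "continuous_on UNIV f" for f :: "'x \<Rightarrow> complex"
    using compact_imp_bounded[OF compact_continuous_image[OF continuous_on_norm[OF that] cpt]]
    by (rule bounded_imp_bdd_above)
  have ub: "cmod (f x) \<le> (SUP x. cmod (f x))" if "continuous_on UNIV f" for f :: "'x \<Rightarrow> complex" and x
    by (rule cSUP_upper[OF UNIV_I bdd[OF that]])
  have ge0: "0 \<le> (SUP x. cmod (f x))" if "continuous_on UNIV f" for f :: "'x \<Rightarrow> complex"
    using order_trans[OF norm_ge_zero ub[OF that]] .
  have least: "(SUP x. cmod (f x)) \<le> c" if "\<And>x. cmod (f x) \<le> c" for f :: "'x \<Rightarrow> complex" and c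
    by (rule cSUP_least) (use that in auto)
  have ring: "ring ?C"
  proof (intro ringI abelian_groupI monoidI)
    fix f assume f: "f \<in> carrier ?C"
    show "\<exists>g\<in>carrier ?C. g \<oplus>\<^bsub>?C\<^esub> f = \<zero>\<^bsub>?C\<^esub>"
      by (rule bexI[of _ "\<lambda>x. - f x"]) (use f in \<open>auto simp: Cont_def intro!: continuous_intros\<close>)
  qed (auto simp: Cont_def algebra_simps intro!: continuous_intros)
  show ?thesis
  proof (intro cstar_algebra.intro ring cstar_algebra_axioms.intro, goal_cases)
    case (15 a z)
    then have a: "continuous_on UNIV a" by (simp add: Cont_def)
    have za: "continuous_on UNIV (\<lambda>x. z * a x)" by (intro continuous_intros a)
    have "(SUP x. cmod (z * a x)) = cmod z * (SUP x. cmod (a x))"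
    proof (cases "z = 0")
      case False
      have "(SUP x. cmod (a x)) \<le> (SUP x. cmod (z * a x)) / cmod z"
        using ub[OF za] False by (intro least) (simp add: field_simps norm_mult)
      moreover have "(SUP x. cmod (z * a x)) \<le> cmod z * (SUP x. cmod (a x))"
        using ub[OF a] by (intro least) (simp add: norm_mult mult_left_mono)
      ultimately show ?thesis using False by (simp add: field_simps)
    qed simp
    then show ?case by (simp add: Cont_def)
  next
    case (14 a)
    then have a: "continuous_on UNIV a" by (simp add: Cont_def)
    have "a = (\<lambda>x. 0)" if "(SUP x. cmod (a x)) = 0" using ub[OF a] that by fastforce
    then show ?case by (auto simp: Cont_def)
  next
    case (16 a b)
    then have ab: "continuous_on UNIV a" "continuous_on UNIV b" by (simp_all add: Cont_def)
    have "(SUP x. cmod (a x + b x)) \<le> (SUP x. cmod (a x)) + (SUP x. cmod (b x))"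
      by (intro least order_trans[OF norm_triangle_ineq] add_mono ub ab)
    then show ?case by (simp add: Cont_def)
  next
    case (17 a b)
    then have ab: "continuous_on UNIV a" "continuous_on UNIV b" by (simp_all add: Cont_def)
    have "(SUP x. cmod (a x * b x)) \<le> (SUP x. cmod (a x)) * (SUP x. cmod (b x))"
      unfolding norm_mult by (intro cSUP_least mult_mono ub ab ge0) auto
    then show ?case by (simp add: Cont_def)
  next
    case (18 a)
    then have a: "continuous_on UNIV a" by (simp add: Cont_def)
    let ?s = "SUP x. cmod (a x)" and ?t = "SUP x. cmod (cnj (a x) * a x)"
    have aa: "continuous_on UNIV (\<lambda>x. cnj (a x) * a x)" by (intro continuous_intros a)
    have "?t \<le> ?s\<^sup>2"
      using ub[OF a] by (intro least) (simp add: norm_mult power2_eq_square mult_mono ge0[OF a])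
    moreover have "?s \<le> sqrt ?t"
      using ub[OF aa] by (intro least real_le_rsqrt) (simp add: norm_mult power2_eq_square)
    then have "?s\<^sup>2 \<le> ?t"
      using ge0[OF a] ge0[OF aa] by (metis power_mono real_sqrt_pow2)
    ultimately show ?case by (simp add: Cont_def)
  next
    case (19 s)
    have s: "continuous_on UNIV (s n)" for n using 19(1)[of n] by (simp add: Cont_def)
    have d: "cnorm ?C (cdiff ?C f g) = (SUP x. cmod (f x - g x))" for f g :: "'x \<Rightarrow> complex"
      by (simp add: cdiff_def Cont_def)
    have dub: "cmod (s m x - s n x) \<le> cnorm ?C (cdiff ?C (s m) (s n))" for m n x
      unfolding d by (rule ub) (intro continuous_intros s)
    have "uniformly_Cauchy_on UNIV s"
      unfolding uniformly_Cauchy_on_def dist_norm using 19(2) dub by (meson UNIV_I order_le_less_trans)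
    then obtain l where l: "uniform_limit UNIV s l sequentially"
      using Cauchy_uniformly_convergent uniformly_convergent_on_def by blast
    have lc: "continuous_on UNIV l"
      by (rule uniform_limit_theorem[OF _ l]) (use s in auto)
    have "(\<lambda>n. cnorm ?C (cdiff ?C (s n) l)) \<longlonglongrightarrow> 0"
    proof (rule LIMSEQ_I)
      fix e :: real assume e: "0 < e"
      have "\<forall>\<^sub>F n in sequentially. \<forall>x\<in>UNIV. dist (s n x) (l x) < e / 2"
        using l half_gt_zero[OF e] unfolding uniform_limit_iff by blast
      then obtain N where N: "\<And>n x. n \<ge> N \<Longrightarrow> cmod (s n x - l x) < e / 2"
        unfolding eventually_sequentially dist_norm by auto
      have "cnorm ?C (cdiff ?C (s n) l) \<le> e / 2" if "n \<ge> N" for n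
        unfolding d by (rule least) (use N[OF that] in \<open>simp add: less_imp_le\<close>)
      moreover have "0 \<le> cnorm ?C (cdiff ?C (s n) l)" for n
        unfolding d by (rule ge0) (intro continuous_intros s lc)
      ultimately show "\<exists>N. \<forall>n\<ge>N. norm (cnorm ?C (cdiff ?C (s n) l) - 0) < e"
        using e by (intro exI[of _ N]) (smt (verit) field_sum_of_halves real_norm_def)
    qed
    then show ?case using lc by (auto simp: Cont_def)
  qed (auto simp: Cont_def algebra_simps ge0 intro!: continuous_intros)
qed


section \<open>Minimal tensor products\<close>

text \<open>A list \<open>[(a\<^sub>1, b\<^sub>1), \<dots>, (a\<^sub>n, b\<^sub>n)]\<close> stands for the element
  \<open>a\<^sub>1 \<otimes> b\<^sub>1 + \<dots> + a\<^sub>n \<otimes> b\<^sub>n\<close> of the algebraic tensor product.  Different lists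
  can stand for the same element; they are identified below, when elements at distance \<open>0\<close> in
  the minimal norm are.\<close>

definition alg_tensors :: "('a, 'm) cstar_scheme \<Rightarrow> ('b, 'n) cstar_scheme \<Rightarrow> ('a \<times> 'b) list set" where
  "alg_tensors A B = lists (carrier A \<times> carrier B)"

definition talg_scale :: "('a, 'm) cstar_scheme \<Rightarrow> complex \<Rightarrow> ('a \<times> 'b) list \<Rightarrow> ('a \<times> 'b) list" where
  "talg_scale A z xs = map (\<lambda>(a, b). (cscale A z a, b)) xs"

definition talg_mult ::
    "('a, 'm) cstar_scheme \<Rightarrow> ('b, 'n) cstar_scheme \<Rightarrow>
     ('a \<times> 'b) list \<Rightarrow> ('a \<times> 'b) list \<Rightarrow> ('a \<times> 'b) list" where
  "talg_mult A B xs ys = concat (map (\<lambda>(a, b). map (\<lambda>(c, d). (a \<otimes>\<^bsub>A\<^esub> c, b \<otimes>\<^bsub>B\<^esub> d)) ys) xs)"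

definition talg_adj ::
    "('a, 'm) cstar_scheme \<Rightarrow> ('b, 'n) cstar_scheme \<Rightarrow> ('a \<times> 'b) list \<Rightarrow> ('a \<times> 'b) list" where
  "talg_adj A B xs = map (\<lambda>(a, b). (adj A a, adj B b)) xs"

definition talg_functional ::
    "('a \<Rightarrow> complex) \<Rightarrow> ('b \<Rightarrow> complex) \<Rightarrow> ('a \<times> 'b) list \<Rightarrow> complex" where
  "talg_functional \<phi> \<psi> xs = (\<Sum>(a, b)\<leftarrow>xs. \<phi> a * \<psi> b)"

text \<open>The spatial norm, i.e. the supremum of \<open>\<parallel>(\<pi>\<^sub>\<phi> \<otimes> \<pi>\<^sub>\<psi>)(x)\<parallel>\<close> over the GNS
  representations of all pairs of states: the class of \<open>y\<close> in \<open>H\<^sub>\<phi> \<otimes> H\<^sub>\<psi>\<close> has squared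
  norm \<open>(\<phi> \<otimes> \<psi>)(y\<^sup>* y)\<close>, and these classes are dense.\<close>

definition min_norm ::
    "('a, 'm) cstar_scheme \<Rightarrow> ('b, 'n) cstar_scheme \<Rightarrow> ('a \<times> 'b) list \<Rightarrow> real" where
  "min_norm A B x = Sup {sqrt (Re (talg_functional \<phi> \<psi>
        (talg_mult A B (talg_adj A B (talg_mult A B x y)) (talg_mult A B x y)))) | \<phi> \<psi> y.
      \<phi> \<in> states A \<and> \<psi> \<in> states B \<and> y \<in> alg_tensors A B \<and>
      Re (talg_functional \<phi> \<psi> (talg_mult A B (talg_adj A B y) y)) \<le> 1}"

definition talg_dist ::
    "('a, 'm) cstar_scheme \<Rightarrow> ('b, 'n) cstar_scheme \<Rightarrow> ('a \<times> 'b) list \<Rightarrow> ('a \<times> 'b) list \<Rightarrow> real" where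
  "talg_dist A B x y = min_norm A B (x @ talg_scale A (-1) y)"

text \<open>The minimal tensor product is the completion: Cauchy sequences modulo null sequences.\<close>

type_synonym ('a, 'b) tens = "(nat \<Rightarrow> ('a \<times> 'b) list) set"

definition tens_cauchy ::
    "('a, 'm) cstar_scheme \<Rightarrow> ('b, 'n) cstar_scheme \<Rightarrow> (nat \<Rightarrow> ('a \<times> 'b) list) \<Rightarrow> bool" where
  "tens_cauchy A B X \<longleftrightarrow> range X \<subseteq> alg_tensors A B \<and>
     (\<forall>e>0. \<exists>N. \<forall>m\<ge>N. \<forall>n\<ge>N. talg_dist A B (X m) (X n) < e)"

definition tens_class ::
    "('a, 'm) cstar_scheme \<Rightarrow> ('b, 'n) cstar_scheme \<Rightarrow> (nat \<Rightarrow> ('a \<times> 'b) list) \<Rightarrow> ('a, 'b) tens" where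
  "tens_class A B X = {Y. tens_cauchy A B Y \<and> (\<lambda>n. talg_dist A B (X n) (Y n)) \<longlonglongrightarrow> 0}"

definition tens_rep :: "('a, 'b) tens \<Rightarrow> nat \<Rightarrow> ('a \<times> 'b) list" where
  "tens_rep t = (SOME X. X \<in> t)"

definition tensor ::
    "('a, 'm) cstar_scheme \<Rightarrow> ('b, 'n) cstar_scheme \<Rightarrow> ('a, 'b) tens cstar" where
  "tensor A B = \<lparr>carrier = {tens_class A B X | X. tens_cauchy A B X},
     monoid.mult = (\<lambda>s t. tens_class A B (\<lambda>n. talg_mult A B (tens_rep s n) (tens_rep t n))),
     one = tens_class A B (\<lambda>n. [(\<one>\<^bsub>A\<^esub>, \<one>\<^bsub>B\<^esub>)]),
     zero = tens_class A B (\<lambda>n. []),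
     add = (\<lambda>s t. tens_class A B (\<lambda>n. tens_rep s n @ tens_rep t n)),
     cscale = (\<lambda>z t. tens_class A B (\<lambda>n. talg_scale A z (tens_rep t n))),
     adj = (\<lambda>t. tens_class A B (\<lambda>n. talg_adj A B (tens_rep t n))),
     cnorm = (\<lambda>t. lim (\<lambda>n. min_norm A B (tens_rep t n)))\<rparr>"

definition tens_of_alg ::
    "('a, 'm) cstar_scheme \<Rightarrow> ('b, 'n) cstar_scheme \<Rightarrow> ('a \<times> 'b) list \<Rightarrow> ('a, 'b) tens" where
  "tens_of_alg A B xs = tens_class A B (\<lambda>n. xs)"

definition tens_prod ::
    "('a, 'm) cstar_scheme \<Rightarrow> ('b, 'n) cstar_scheme \<Rightarrow> 'a \<Rightarrow> 'b \<Rightarrow> ('a, 'b) tens" where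
  "tens_prod A B a b = tens_of_alg A B [(a, b)]"

text \<open>\<open>F = f \<otimes> g\<close>.  For C*-homomorphisms \<open>f\<close>, \<open>g\<close> there is exactly one such map up to
  its values outside the carrier.  The same applies to the associativity isomorphism below.\<close>

definition is_tensor_map ::
    "('a, 'm) cstar_scheme \<Rightarrow> ('b, 'n) cstar_scheme \<Rightarrow> ('c, 'k) cstar_scheme \<Rightarrow> ('d, 'l) cstar_scheme \<Rightarrow>
     ('a \<Rightarrow> 'c) \<Rightarrow> ('b \<Rightarrow> 'd) \<Rightarrow> (('a, 'b) tens \<Rightarrow> ('c, 'd) tens) \<Rightarrow> bool" where
  "is_tensor_map A B C D f g F \<longleftrightarrow> bounded_clinear_map (tensor A B) (tensor C D) F \<and>
     (\<forall>a\<in>carrier A. \<forall>b\<in>carrier B. F (tens_prod A B a b) = tens_prod C D (f a) (g b))"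

definition tensor_map ::
    "('a, 'm) cstar_scheme \<Rightarrow> ('b, 'n) cstar_scheme \<Rightarrow> ('c, 'k) cstar_scheme \<Rightarrow> ('d, 'l) cstar_scheme \<Rightarrow>
     ('a \<Rightarrow> 'c) \<Rightarrow> ('b \<Rightarrow> 'd) \<Rightarrow> ('a, 'b) tens \<Rightarrow> ('c, 'd) tens" where
  "tensor_map A B C D f g =
     (THE F. F \<in> extensional (carrier (tensor A B)) \<and> is_tensor_map A B C D f g F)"

definition is_associator ::
    "('a, 'm) cstar_scheme \<Rightarrow> ('b, 'n) cstar_scheme \<Rightarrow> ('c, 'k) cstar_scheme \<Rightarrow>
     ((('a, 'b) tens, 'c) tens \<Rightarrow> ('a, ('b, 'c) tens) tens) \<Rightarrow> bool" where
  "is_associator A B C F \<longleftrightarrow>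
     bounded_clinear_map (tensor (tensor A B) C) (tensor A (tensor B C)) F \<and>
     (\<forall>a\<in>carrier A. \<forall>b\<in>carrier B. \<forall>c\<in>carrier C.
        F (tens_prod (tensor A B) C (tens_prod A B a b) c) =
        tens_prod A (tensor B C) a (tens_prod B C b c))"

text \<open>\<open>\<phi> \<otimes> \<psi>\<close> and \<open>\<phi> \<otimes> id\<close> for states \<open>\<phi>\<close>, \<open>\<psi>\<close>, extended by continuity from the
  algebraic tensor product.\<close>

definition tensor_functional ::
    "('a \<Rightarrow> complex) \<Rightarrow> ('b \<Rightarrow> complex) \<Rightarrow> ('a, 'b) tens \<Rightarrow> complex" where
  "tensor_functional \<phi> \<psi> t = lim (\<lambda>n. talg_functional \<phi> \<psi> (tens_rep t n))"

definition talg_contract ::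
    "('b, 'n) cstar_scheme \<Rightarrow> ('p \<Rightarrow> 'b) \<Rightarrow> 'p list \<Rightarrow> 'b" where
  "talg_contract B m xs = foldr (\<lambda>p s. m p \<oplus>\<^bsub>B\<^esub> s) xs \<zero>\<^bsub>B\<^esub>"

definition slice :: "('b, 'n) cstar_scheme \<Rightarrow> ('a \<Rightarrow> complex) \<Rightarrow> ('a, 'b) tens \<Rightarrow> 'b" where
  "slice B \<phi> t = (THE b. b \<in> carrier B \<and>
     (\<lambda>n. cnorm B (cdiff B (talg_contract B (\<lambda>(a, b). cscale B (\<phi> a) b) (tens_rep t n)) b)) \<longlonglongrightarrow> 0)"


section \<open>Compact quantum groups\<close>

definition compact_quantum_group :: "('a, 'm) cstar_scheme \<Rightarrow> ('a \<Rightarrow> ('a, 'a) tens) \<Rightarrow> bool" where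
  "compact_quantum_group A \<Delta> \<longleftrightarrow> cstar_algebra A \<and> cstar_hom A (tensor A A) \<Delta> \<and>
     (\<exists>\<Delta>_id id_\<Delta> \<alpha>.
        is_tensor_map A A (tensor A A) A \<Delta> id \<Delta>_id \<and>
        is_tensor_map A A A (tensor A A) id \<Delta> id_\<Delta> \<and>
        is_associator A A A \<alpha> \<and>
        (\<forall>a\<in>carrier A. \<alpha> (\<Delta>_id (\<Delta> a)) = id_\<Delta> (\<Delta> a))) \<and>
     norm_dense (tensor A A) (clin_span (tensor A A)
       {tens_prod A A a \<one>\<^bsub>A\<^esub> \<otimes>\<^bsub>tensor A A\<^esub> \<Delta> b | a b. a \<in> carrier A \<and> b \<in> carrier A}) \<and>
     norm_dense (tensor A A) (clin_span (tensor A A)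
       {tens_prod A A \<one>\<^bsub>A\<^esub> a \<otimes>\<^bsub>tensor A A\<^esub> \<Delta> b | a b. a \<in> carrier A \<and> b \<in> carrier A})"

definition haar_state ::
    "('a, 'm) cstar_scheme \<Rightarrow> ('a \<Rightarrow> ('a, 'a) tens) \<Rightarrow> ('a \<Rightarrow> complex) \<Rightarrow> bool" where
  "haar_state A \<Delta> h \<longleftrightarrow> h \<in> states A \<and>
     (\<forall>\<phi>\<in>states A. \<forall>a\<in>carrier A.
        tensor_functional h \<phi> (\<Delta> a) = h a \<and> tensor_functional \<phi> h (\<Delta> a) = h a)"

subsection \<open>The reduced quantum group\<close>

text \<open>The GNS Hilbert space of \<open>h\<close> is the completion of the quotient of \<open>A\<close> by the left ideal
  of all \<open>a\<close> with \<open>h(a\<^sup>* a) = 0\<close>; a GNS operator is determined by its restriction to that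
  quotient and is encoded as this restriction.\<close>

definition gns_vec :: "('a, 'm) cstar_scheme \<Rightarrow> ('a \<Rightarrow> complex) \<Rightarrow> 'a \<Rightarrow> 'a set" where
  "gns_vec A h b = {c \<in> carrier A. h (adj A (cdiff A c b) \<otimes>\<^bsub>A\<^esub> cdiff A c b) = 0}"

definition gns_space :: "('a, 'm) cstar_scheme \<Rightarrow> ('a \<Rightarrow> complex) \<Rightarrow> 'a set set" where
  "gns_space A h = gns_vec A h ` carrier A"

definition gns_vnorm :: "('a, 'm) cstar_scheme \<Rightarrow> ('a \<Rightarrow> complex) \<Rightarrow> 'a set \<Rightarrow> real" where
  "gns_vnorm A h \<xi> = (let b = (SOME b. b \<in> \<xi>) in sqrt (Re (h (adj A b \<otimes>\<^bsub>A\<^esub> b))))"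

definition gns_rep :: "('a, 'm) cstar_scheme \<Rightarrow> ('a \<Rightarrow> complex) \<Rightarrow> 'a \<Rightarrow> 'a set \<Rightarrow> 'a set" where
  "gns_rep A h a = (\<lambda>\<xi>\<in>gns_space A h. gns_vec A h (a \<otimes>\<^bsub>A\<^esub> (SOME b. b \<in> \<xi>)))"

text \<open>The image of the GNS representation with the operator norm.  As the representation is a
  *-homomorphism, the operator sum, composite, adjoint etc. of elements of the image can be computed
  on preimages.\<close>

definition reduced_algebra ::
    "('a, 'm) cstar_scheme \<Rightarrow> ('a \<Rightarrow> complex) \<Rightarrow> ('a set \<Rightarrow> 'a set) cstar" where
  "reduced_algebra A h =
     (let \<tau> = gns_rep A h; pre = (\<lambda>T. SOME a. a \<in> carrier A \<and> \<tau> a = T) in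
     \<lparr>carrier = \<tau> ` carrier A,
      monoid.mult = (\<lambda>S T. \<tau> (pre S \<otimes>\<^bsub>A\<^esub> pre T)), one = \<tau> \<one>\<^bsub>A\<^esub>,
      zero = \<tau> \<zero>\<^bsub>A\<^esub>, add = (\<lambda>S T. \<tau> (pre S \<oplus>\<^bsub>A\<^esub> pre T)),
      cscale = (\<lambda>z T. \<tau> (cscale A z (pre T))), adj = (\<lambda>T. \<tau> (adj A (pre T))),
      cnorm = (\<lambda>T. Sup {gns_vnorm A h (T \<xi>) | \<xi>. \<xi> \<in> gns_space A h \<and> gns_vnorm A h \<xi> \<le> 1})\<rparr>)"

text \<open>The comultiplication \<open>\<Delta>\<^sub>r\<close> of the reduced quantum group is determined by
  \<open>\<Delta>\<^sub>r \<tau> = (\<tau> \<otimes> \<tau>) \<Delta>\<close>.\<close>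

definition is_reduced_comult ::
    "('a, 'm) cstar_scheme \<Rightarrow> ('a \<Rightarrow> ('a, 'a) tens) \<Rightarrow> ('a \<Rightarrow> complex) \<Rightarrow>
     (('a set \<Rightarrow> 'a set) \<Rightarrow> ('a set \<Rightarrow> 'a set, 'a set \<Rightarrow> 'a set) tens) \<Rightarrow> bool" where
  "is_reduced_comult A \<Delta> h \<Delta>r \<longleftrightarrow>
     (\<forall>a\<in>carrier A. \<Delta>r (gns_rep A h a) =
        tensor_map A A (reduced_algebra A h) (reduced_algebra A h) (gns_rep A h) (gns_rep A h) (\<Delta> a))"

subsection \<open>The antipode\<close>

definition unitary_corep ::
    "('a, 'm) cstar_scheme \<Rightarrow> ('a \<Rightarrow> ('a, 'a) tens) \<Rightarrow> nat \<Rightarrow> (nat \<Rightarrow> nat \<Rightarrow> 'a) \<Rightarrow> bool" where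
  "unitary_corep A \<Delta> n u \<longleftrightarrow>
     (\<forall>i<n. \<forall>j<n. u i j \<in> carrier A \<and>
        \<Delta> (u i j) = tens_of_alg A A (map (\<lambda>k. (u i k, u k j)) [0..<n]) \<and>
        (\<Oplus>\<^bsub>A\<^esub>k\<in>{..<n}. adj A (u k i) \<otimes>\<^bsub>A\<^esub> u k j) = (if i = j then \<one>\<^bsub>A\<^esub> else \<zero>\<^bsub>A\<^esub>) \<and>
        (\<Oplus>\<^bsub>A\<^esub>k\<in>{..<n}. u i k \<otimes>\<^bsub>A\<^esub> adj A (u j k)) = (if i = j then \<one>\<^bsub>A\<^esub> else \<zero>\<^bsub>A\<^esub>))"

definition representative_functions ::
    "('a, 'm) cstar_scheme \<Rightarrow> ('a \<Rightarrow> ('a, 'a) tens) \<Rightarrow> 'a set" where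
  "representative_functions A \<Delta> =
     clin_span A {u i j | u i j n. unitary_corep A \<Delta> n u \<and> i < n \<and> j < n}"

text \<open>The Hopf algebra axioms for counit \<open>\<epsilon>\<close> and antipode \<open>S\<close> on the representative functions;
  \<open>xs\<close> ranges over the ways of writing \<open>\<Delta>(a)\<close> as a finite sum \<open>\<Sum> b \<otimes> c\<close>.\<close>

definition hopf_counit ::
    "('a, 'm) cstar_scheme \<Rightarrow> ('a \<Rightarrow> ('a, 'a) tens) \<Rightarrow> ('a \<Rightarrow> complex) \<Rightarrow> bool" where
  "hopf_counit A \<Delta> \<epsilon> \<longleftrightarrow> (let R = representative_functions A \<Delta> in
     (\<forall>a\<in>R. \<forall>b\<in>R. \<epsilon> (a \<oplus>\<^bsub>A\<^esub> b) = \<epsilon> a + \<epsilon> b) \<and>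
     (\<forall>z. \<forall>a\<in>R. \<epsilon> (cscale A z a) = z * \<epsilon> a) \<and>
     (\<forall>a\<in>R. \<forall>xs\<in>lists (R \<times> R). \<Delta> a = tens_of_alg A A xs \<longrightarrow>
        talg_contract A (\<lambda>(b, c). cscale A (\<epsilon> b) c) xs = a \<and>
        talg_contract A (\<lambda>(b, c). cscale A (\<epsilon> c) b) xs = a))"

definition hopf_antipode ::
    "('a, 'm) cstar_scheme \<Rightarrow> ('a \<Rightarrow> ('a, 'a) tens) \<Rightarrow> ('a \<Rightarrow> 'a) \<Rightarrow> bool" where
  "hopf_antipode A \<Delta> S \<longleftrightarrow> (let R = representative_functions A \<Delta> in
     S \<in> R \<rightarrow> R \<and>
     (\<forall>a\<in>R. \<forall>b\<in>R. S (a \<oplus>\<^bsub>A\<^esub> b) = S a \<oplus>\<^bsub>A\<^esub> S b) \<and>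
     (\<forall>z. \<forall>a\<in>R. S (cscale A z a) = cscale A z (S a)) \<and>
     (\<exists>\<epsilon>. hopf_counit A \<Delta> \<epsilon> \<and>
       (\<forall>a\<in>R. \<forall>xs\<in>lists (R \<times> R). \<Delta> a = tens_of_alg A A xs \<longrightarrow>
          talg_contract A (\<lambda>(b, c). S b \<otimes>\<^bsub>A\<^esub> c) xs = cscale A (\<epsilon> a) \<one>\<^bsub>A\<^esub> \<and>
          talg_contract A (\<lambda>(b, c). b \<otimes>\<^bsub>A\<^esub> S c) xs = cscale A (\<epsilon> a) \<one>\<^bsub>A\<^esub>)))"

text \<open>The bounded antipode of a reduced quantum group of Kac type.\<close>

definition kac_antipode ::
    "('a, 'm) cstar_scheme \<Rightarrow> ('a \<Rightarrow> ('a, 'a) tens) \<Rightarrow> ('a \<Rightarrow> 'a) \<Rightarrow> bool" where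
  "kac_antipode A \<Delta> \<kappa> \<longleftrightarrow> bounded_clinear_map A A \<kappa> \<and>
     (\<forall>a\<in>carrier A. \<kappa> (\<kappa> a) = a) \<and>
     (\<forall>a\<in>carrier A. \<forall>b\<in>carrier A. \<kappa> (a \<otimes>\<^bsub>A\<^esub> b) = \<kappa> b \<otimes>\<^bsub>A\<^esub> \<kappa> a) \<and>
     hopf_antipode A \<Delta> \<kappa>"


section \<open>Actions on compact spaces\<close>

definition cqg_action ::
    "('a, 'm) cstar_scheme \<Rightarrow> ('a \<Rightarrow> ('a, 'a) tens) \<Rightarrow>
     (('x::t2_space \<Rightarrow> complex) \<Rightarrow> ('x \<Rightarrow> complex, 'a) tens) \<Rightarrow> bool" where
  "cqg_action A \<Delta> \<rho> \<longleftrightarrow> cstar_hom Cont (tensor Cont A) \<rho> \<and>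
     (\<exists>\<rho>_id id_\<Delta> \<alpha>.
        is_tensor_map Cont A (tensor Cont A) A \<rho> id \<rho>_id \<and>
        is_tensor_map Cont A Cont (tensor A A) id \<Delta> id_\<Delta> \<and>
        is_associator Cont A A \<alpha> \<and>
        (\<forall>f\<in>carrier Cont. \<alpha> (\<rho>_id (\<rho> f)) = id_\<Delta> (\<rho> f))) \<and>
     norm_dense (tensor Cont A) (clin_span (tensor Cont A)
       {tens_prod Cont A \<one>\<^bsub>Cont\<^esub> a \<otimes>\<^bsub>tensor Cont A\<^esub> \<rho> f | a f. a \<in> carrier A \<and> f \<in> carrier Cont})"

definition faithful_action ::
    "('a, 'm) cstar_scheme \<Rightarrow> (('x::t2_space \<Rightarrow> complex) \<Rightarrow> ('x \<Rightarrow> complex, 'a) tens) \<Rightarrow> bool" where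
  "faithful_action A \<rho> \<longleftrightarrow>
     generates_cstar A {slice A \<mu> (\<rho> f) | \<mu> f. \<mu> \<in> states Cont \<and> f \<in> carrier Cont}"

text \<open>\<open>act \<rho> \<mu> \<phi>\<close> is \<open>\<mu> \<triangleleft> \<phi>\<close>, and \<open>eval_at A \<rho> f x\<close> is \<open>\<rho>(f)(x)\<close>.\<close>

definition act ::
    "(('x::t2_space \<Rightarrow> complex) \<Rightarrow> ('x \<Rightarrow> complex, 'a) tens) \<Rightarrow>
     (('x \<Rightarrow> complex) \<Rightarrow> complex) \<Rightarrow> ('a \<Rightarrow> complex) \<Rightarrow> ('x \<Rightarrow> complex) \<Rightarrow> complex" where
  "act \<rho> \<mu> \<phi> = (\<lambda>f\<in>carrier Cont. tensor_functional \<mu> \<phi> (\<rho> f))"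

definition eval_at ::
    "('a, 'm) cstar_scheme \<Rightarrow> (('x::t2_space \<Rightarrow> complex) \<Rightarrow> ('x \<Rightarrow> complex, 'a) tens) \<Rightarrow>
     ('x \<Rightarrow> complex) \<Rightarrow> 'x \<Rightarrow> 'a" where
  "eval_at A \<rho> f x = slice A (dirac x) (\<rho> f)"

definition reduced_action ::
    "('a, 'm) cstar_scheme \<Rightarrow> ('a \<Rightarrow> complex) \<Rightarrow>
     (('x::t2_space \<Rightarrow> complex) \<Rightarrow> ('x \<Rightarrow> complex, 'a) tens) \<Rightarrow>
     ('x \<Rightarrow> complex) \<Rightarrow> ('x \<Rightarrow> complex, 'a set \<Rightarrow> 'a set) tens" where
  "reduced_action A h \<rho> f = tensor_map Cont A Cont (reduced_algebra A h) id (gns_rep A h) (\<rho> f)"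

text \<open>The isometry condition for a reduced quantum group.  The antipode is unique, since the
  representative functions are dense.\<close>

definition isometric_of_reduced ::
    "('a, 'm) cstar_scheme \<Rightarrow> ('a \<Rightarrow> ('a, 'a) tens) \<Rightarrow>
     (('x::metric_space \<Rightarrow> complex) \<Rightarrow> ('x \<Rightarrow> complex, 'a) tens) \<Rightarrow> bool" where
  "isometric_of_reduced A \<Delta> \<rho> \<longleftrightarrow> (\<exists>\<kappa>. kac_antipode A \<Delta> \<kappa> \<and>
     (\<forall>x y. eval_at A \<rho> (\<lambda>z. of_real (dist y z)) x = \<kappa> (eval_at A \<rho> (\<lambda>z. of_real (dist x z)) y)))"

definition isometric_action ::
    "('a, 'm) cstar_scheme \<Rightarrow> ('a \<Rightarrow> ('a, 'a) tens) \<Rightarrow> ('a \<Rightarrow> complex) \<Rightarrow>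
     (('x::metric_space \<Rightarrow> complex) \<Rightarrow> ('x \<Rightarrow> complex, 'a) tens) \<Rightarrow> bool" where
  "isometric_action A \<Delta> h \<rho> \<longleftrightarrow> (\<exists>\<Delta>r. is_reduced_comult A \<Delta> h \<Delta>r \<and>
     isometric_of_reduced (reduced_algebra A h) \<Delta>r (reduced_action A h \<rho>))"

subsection \<open>The five sets\<close>

definition haar_support ::
    "(('x::t2_space \<Rightarrow> complex) \<Rightarrow> ('x \<Rightarrow> complex, 'a) tens) \<Rightarrow> ('a \<Rightarrow> complex) \<Rightarrow> 'x \<Rightarrow> 'x set" where
  "haar_support \<rho> h x = prob_support (act \<rho> (dirac x) h)"

text \<open>The closed set \<open>K\<close> for which \<open>f \<mapsto> \<rho>(f)(x)\<close> and the restriction from \<open>C(X)\<close> to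
  \<open>C(K)\<close> have the same kernel, i.e. define the same quotient of \<open>C(X)\<close>.\<close>

definition quotient_space ::
    "('a, 'm) cstar_scheme \<Rightarrow> (('x::t2_space \<Rightarrow> complex) \<Rightarrow> ('x \<Rightarrow> complex, 'a) tens) \<Rightarrow>
     'x \<Rightarrow> 'x set" where
  "quotient_space A \<rho> x = (THE K. closed K \<and>
     (\<forall>f\<in>carrier Cont. eval_at A \<rho> f x = \<zero>\<^bsub>A\<^esub> \<longleftrightarrow> (\<forall>y\<in>K. f y = 0)))"

definition Orb ::
    "(('x::t2_space \<Rightarrow> complex) \<Rightarrow> ('x \<Rightarrow> complex, 'a) tens) \<Rightarrow> ('a \<Rightarrow> complex) \<Rightarrow> 'x \<Rightarrow> 'x set" where
  "Orb \<rho> h x = {x'. act \<rho> (dirac x') h = act \<rho> (dirac x) h}"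

definition state_orbit ::
    "('a, 'm) cstar_scheme \<Rightarrow> (('x::t2_space \<Rightarrow> complex) \<Rightarrow> ('x \<Rightarrow> complex, 'a) tens) \<Rightarrow>
     'x \<Rightarrow> 'x set" where
  "state_orbit A \<rho> x = {y. \<exists>\<phi>\<in>states A. act \<rho> (dirac x) \<phi> = dirac y}"

end

theory Submission
  imports Defs
begin

text \<open>Write \<open>\<rho>\<^sub>x(f) = \<rho>(f)(x)\<close> and \<open>\<mu>\<^sub>x = h \<circ> \<rho>\<^sub>x\<close>.  If \<open>y\<close> lies in the support of \<open>\<mu>\<^sub>x\<close>, cutting \<open>h\<close> down by
  \<open>\<rho>\<^sub>x(f\<^sub>n)\<close> for bump functions \<open>f\<^sub>n\<close> at \<open>y\<close> gives vector states of the GNS representation, and a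
  generalised limit of them is a state \<open>\<phi>\<close> of \<open>A\<^sub>r\<close> with \<open>x \<triangleleft> \<phi> = y\<close>.  Coassociativity and
  invariance of \<open>h\<close> give \<open>\<mu>\<^sub>y = \<mu>\<^sub>x\<close> for every such \<open>y\<close>, also with \<open>A\<close> in place of \<open>A\<^sub>r\<close>.  So
  everything reduces to the claim that \<open>x\<close> belongs to the support of \<open>\<mu>\<^sub>x\<close>, which would follow from a
  bounded counit; in its absence the isometry condition is needed.  Pick \<open>y\<close> in the support.  Since
  \<open>\<mu>\<^sub>x \<triangleleft> \<phi> = \<mu>\<^sub>x\<close> for all \<open>\<phi>\<close>, the homomorphism \<open>\<rho>\<^sub>y\<close> kills every function vanishing near the support.
  If \<open>x\<close> were outside the support, \<open>\<rho>\<^sub>y(d\<^sub>x)\<close> would therefore be invertible, hence so would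
  \<open>\<rho>\<^sub>x(d\<^sub>y) = \<kappa>(\<rho>\<^sub>y(d\<^sub>x))\<close> in \<open>A\<^sub>r\<close>, contradicting \<open>d\<^sub>y(y) = 0\<close> and \<open>x \<triangleleft> \<phi> = y\<close>.

  That slices of tensors exist, and that points of \<open>\<M>\<^sub>x\<close> extend to states of \<open>A\<close>, rests on the
  existence of norming states on C*-algebras (Hahn-Banach and Fukamiya's theorem).\<close>


section \<open>Unital *-algebras and linear functionals\<close>

text \<open>The tensor product is given by Cauchy sequences of formal sums under a norm built from
  product states, and \<open>slice\<close> and \<open>tensor_map\<close> by definite descriptions.
  Before orbits can be discussed, product functionals must be shown positive, the completion a
  C*-algebra, and the described objects existent and unique. Maps such as
  \<open>\<rho> \<otimes> id\<close> are known only on elementary tensors, so identities between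
  them are tested by bounded functionals and density.

  The reduced algebra serves as a *-algebra with an operator norm, without completeness. This
  dictates the layers: \<open>star_algebra\<close> has no norm; \<open>bounded_star_algebra\<close>
  adds a state and, for each a, some s with adj a a + adj s s scalar; the full axioms are assumed
  where limits or norming states are needed. That identity stands in for adj a a \<le> K and passes
  through homomorphisms and states by pure algebra.

  Spectra do not appear: roots and inverses are fixed points of contractions in the bicommutant of
  one element, and positivity is a norm condition.

  At the end the antipode reverses a product, and this leaves a one-sided inverse on the side where
  Cauchy-Schwarz can use it.\<close>

locale star_algebra = ring A for A :: "('a, 'm) cstar_scheme" (structure) +
  assumes sc_closed [simp, intro]: "a \<in> carrier A \<Longrightarrow> cscale A z a \<in> carrier A"
    and sc_one [simp]: "a \<in> carrier A \<Longrightarrow> cscale A 1 a = a"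
    and sc_sc: "a \<in> carrier A \<Longrightarrow> cscale A z (cscale A w a) = cscale A (z * w) a"
    and sc_add_left: "a \<in> carrier A \<Longrightarrow> cscale A (z + w) a = cscale A z a \<oplus> cscale A w a"
    and sc_add_right:
      "\<lbrakk>a \<in> carrier A; b \<in> carrier A\<rbrakk> \<Longrightarrow> cscale A z (a \<oplus> b) = cscale A z a \<oplus> cscale A z b"
    and sc_mult_left:
      "\<lbrakk>a \<in> carrier A; b \<in> carrier A\<rbrakk> \<Longrightarrow> cscale A z a \<otimes> b = cscale A z (a \<otimes> b)"
    and sc_mult_right:
      "\<lbrakk>a \<in> carrier A; b \<in> carrier A\<rbrakk> \<Longrightarrow> a \<otimes> cscale A z b = cscale A z (a \<otimes> b)"
    and st_closed [simp, intro]: "a \<in> carrier A \<Longrightarrow> adj A a \<in> carrier A"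
    and st_st [simp]: "a \<in> carrier A \<Longrightarrow> adj A (adj A a) = a"
    and st_add: "\<lbrakk>a \<in> carrier A; b \<in> carrier A\<rbrakk> \<Longrightarrow> adj A (a \<oplus> b) = adj A a \<oplus> adj A b"
    and st_sc: "a \<in> carrier A \<Longrightarrow> adj A (cscale A z a) = cscale A (cnj z) (adj A a)"
    and st_mult: "\<lbrakk>a \<in> carrier A; b \<in> carrier A\<rbrakk> \<Longrightarrow> adj A (a \<otimes> b) = adj A b \<otimes> adj A a"

sublocale cstar_algebra \<subseteq> star_algebra
  by unfold_locales
    (simp_all add: scale_closed scale_one scale_scale scale_add_left scale_add_right
      scale_mult_left scale_mult_right adj_closed adj_adj adj_add adj_scale adj_mult)

lemma cstar_hom_closed:
  assumes "cstar_hom A B f" "a \<in> carrier A"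
  shows "f a \<in> carrier B"
  using assms by (auto simp: cstar_hom_def ring_hom_def)

context star_algebra begin

lemma sc_0 [simp]: "a \<in> carrier A \<Longrightarrow> cscale A 0 a = \<zero>"
  using sc_add_left[of a 0 0] by (metis add.right_cancel add_0 l_zero sc_closed zero_closed)

lemma sc_zero [simp]: "cscale A z \<zero> = \<zero>"
  using sc_sc[of \<zero> z 0] sc_0[of \<zero>] by simp

lemma minus_sc: "a \<in> carrier A \<Longrightarrow> \<ominus> a = cscale A (-1) a"
  using sc_add_left[of a "-1" 1] by (simp add: minus_equality)

lemma cdiff_closed [simp, intro]: "a \<in> carrier A \<Longrightarrow> b \<in> carrier A \<Longrightarrow> cdiff A a b \<in> carrier A"
  by (simp add: cdiff_def)

lemma cdiff_minus: "a \<in> carrier A \<Longrightarrow> b \<in> carrier A \<Longrightarrow> cdiff A a b = a \<ominus> b"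
  by (simp add: cdiff_def minus_sc a_minus_def)

lemma cdiff_self [simp]: "a \<in> carrier A \<Longrightarrow> cdiff A a a = \<zero>"
  by (simp add: cdiff_minus a_minus_def r_neg)

lemma cdiff_eq_zero: "a \<in> carrier A \<Longrightarrow> b \<in> carrier A \<Longrightarrow> cdiff A a b = \<zero> \<longleftrightarrow> a = b"
  using minus_equality[of a "\<ominus> b"] by (auto simp: cdiff_minus a_minus_def r_neg)

lemma st_zero [simp]: "adj A \<zero> = \<zero>"
  using st_sc[of \<zero> 0] by simp

lemma st_one [simp]: "adj A \<one> = \<one>"
  using st_mult[of "adj A \<one>" \<one>] by simp

text \<open>Algebraic linearity on the carrier, without continuity, so that one notion serves
  algebras with and without a norm.\<close>

definition linf :: "('a \<Rightarrow> complex) \<Rightarrow> bool" where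
  "linf g \<longleftrightarrow> (\<forall>a\<in>carrier A. \<forall>b\<in>carrier A. g (a \<oplus> b) = g a + g b) \<and>
     (\<forall>z. \<forall>a\<in>carrier A. g (cscale A z a) = z * g a)"

lemma linf_add: "linf g \<Longrightarrow> a \<in> carrier A \<Longrightarrow> b \<in> carrier A \<Longrightarrow> g (a \<oplus> b) = g a + g b"
  and linf_sc: "linf g \<Longrightarrow> a \<in> carrier A \<Longrightarrow> g (cscale A z a) = z * g a"
  by (auto simp: linf_def)

lemma linf_minus: "linf g \<Longrightarrow> a \<in> carrier A \<Longrightarrow> g (\<ominus> a) = - g a"
  by (simp add: minus_sc linf_sc)

lemma linf_diff: "linf g \<Longrightarrow> a \<in> carrier A \<Longrightarrow> b \<in> carrier A \<Longrightarrow> g (a \<ominus> b) = g a - g b"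
  by (simp add: a_minus_def linf_add linf_minus)

lemma linf_cdiff: "linf g \<Longrightarrow> a \<in> carrier A \<Longrightarrow> b \<in> carrier A \<Longrightarrow> g (cdiff A a b) = g a - g b"
  by (simp add: cdiff_minus linf_diff)

lemma linf_zero: "linf g \<Longrightarrow> g \<zero> = 0"
  using linf_sc[of g \<zero> 0] by simp

lemmas linf_simps = linf_add linf_sc linf_minus linf_diff linf_cdiff linf_zero

section \<open>The Hahn-Banach theorem for real sublinear functionals\<close>

definition sublin :: "('a \<Rightarrow> real) \<Rightarrow> bool" where
  "sublin p \<longleftrightarrow> (\<forall>a\<in>carrier A. \<forall>b\<in>carrier A. p (a \<oplus> b) \<le> p a + p b) \<and>
     (\<forall>t\<ge>0. \<forall>a\<in>carrier A. p (cscale A (of_real t) a) = t * p a)"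

lemma sublin_add: "sublin p \<Longrightarrow> a \<in> carrier A \<Longrightarrow> b \<in> carrier A \<Longrightarrow> p (a \<oplus> b) \<le> p a + p b"
  and sublin_sc: "sublin p \<Longrightarrow> t \<ge> 0 \<Longrightarrow> a \<in> carrier A \<Longrightarrow> p (cscale A (of_real t) a) = t * p a"
  by (auto simp: sublin_def)

lemma sublin_zero: "sublin p \<Longrightarrow> p \<zero> = 0"
  using sublin_sc[of p 0 \<zero>] by simp

lemma sublin_ge: "sublin p \<Longrightarrow> a \<in> carrier A \<Longrightarrow> - p (\<ominus> a) \<le> p a"
  using sublin_add[of p a "\<ominus> a"] by (simp add: r_neg sublin_zero)

text \<open>The witness is q a = inf over t \<ge> 0 of p (a + t u) - t p u. Taking t = 0 gives q
  \<le> p, and t = 1 at -u gives q (-u) \<le> - p u. It serves twice below: to fix the value of the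
  functional at a prescribed point, and to show that minimal sublinear functionals are odd.\<close>

lemma sublin_shift:
  assumes p: "sublin p" and u: "u \<in> carrier A"
  obtains q where "sublin q" "q \<in> extensional (carrier A)" "\<And>a. a \<in> carrier A \<Longrightarrow> q a \<le> p a" "q (\<ominus> u) \<le> - p u"
proof
  define S where "S a = {p (a \<oplus> cscale A (of_real t) u) - t * p u | t. t \<ge> 0}" for a
  define q where "q = (\<lambda>a\<in>carrier A. Inf (S a))"
  have q: "q a = Inf (S a)" if "a \<in> carrier A" for a using that by (simp add: q_def)
  have lower: "- p (\<ominus> a) \<le> y" if "a \<in> carrier A" "y \<in> S a" for a y
  proof -
    obtain t where t: "t \<ge> 0" "y = p (a \<oplus> cscale A (of_real t) u) - t * p u"
      using \<open>y \<in> S a\<close> unfolding S_def by blast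
    have "p (cscale A (of_real t) u) \<le> p (a \<oplus> cscale A (of_real t) u) + p (\<ominus> a)"
      using sublin_add[OF p, of "a \<oplus> cscale A (of_real t) u" "\<ominus> a"] that(1) u
      by (simp add: a_comm a_assoc r_neg r_neg1)
    then show ?thesis using t sublin_sc[OF p t(1) u] by simp
  qed
  have bdd: "bdd_below (S a)" if "a \<in> carrier A" for a using lower[OF that] by (rule bdd_belowI)
  have upper: "q a \<le> p (a \<oplus> cscale A (of_real t) u) - t * p u" if "a \<in> carrier A" "t \<ge> 0" for a t
    unfolding q[OF that(1)] by (rule cInf_lower[OF _ bdd[OF that(1)]]) (use that in \<open>auto simp: S_def\<close>)
  have ne: "S a \<noteq> {}" for a by (auto simp: S_def intro: exI[of _ 0])
  show "q \<in> extensional (carrier A)" by (simp add: q_def)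
  show "q a \<le> p a" if "a \<in> carrier A" for a using upper[OF that, of 0] that u by simp
  show "q (\<ominus> u) \<le> - p u" using upper[of "\<ominus> u" 1] u sublin_zero[OF p] by (simp add: l_neg)
  have add: "q (a \<oplus> b) \<le> q a + q b" if ab: "a \<in> carrier A" "b \<in> carrier A" for a b
  proof -
    have "q (a \<oplus> b) \<le> y + z" if "y \<in> S a" "z \<in> S b" for y z
    proof -
      obtain t s where t: "t \<ge> 0" "y = p (a \<oplus> cscale A (of_real t) u) - t * p u"
        "s \<ge> 0" "z = p (b \<oplus> cscale A (of_real s) u) - s * p u" using \<open>y \<in> S a\<close> \<open>z \<in> S b\<close> by (auto simp: S_def)
      have eq: "a \<oplus> b \<oplus> cscale A (of_real (t + s)) u
        = (a \<oplus> cscale A (of_real t) u) \<oplus> (b \<oplus> cscale A (of_real s) u)"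
        using ab u by (simp add: sc_add_left a_ac)
      show ?thesis using upper[of "a \<oplus> b" "t + s"] ab u t
        sublin_add[OF p, of "a \<oplus> cscale A (of_real t) u" "b \<oplus> cscale A (of_real s) u"]
        unfolding eq by (simp add: algebra_simps)
    qed
    then have "q (a \<oplus> b) - y \<le> z" if "y \<in> S a" "z \<in> S b" for y z using that by (simp add: algebra_simps)
    then have "q (a \<oplus> b) - y \<le> q b" if "y \<in> S a" for y
      unfolding q[OF ab(2)] by (intro cInf_greatest ne) (use that in auto)
    then have "q (a \<oplus> b) - q b \<le> y" if "y \<in> S a" for y using that by (simp add: algebra_simps)
    then have "q (a \<oplus> b) - q b \<le> q a" unfolding q[OF ab(1)] by (intro cInf_greatest ne) auto
    then show ?thesis by simp
  qed
  have le: "q (cscale A (of_real t) a) \<le> t * q a" if ta: "t > 0" "a \<in> carrier A" for t a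
  proof -
    have "q (cscale A (of_real t) a) / t \<le> y" if "y \<in> S a" for y
    proof -
      obtain s where s: "s \<ge> 0" "y = p (a \<oplus> cscale A (of_real s) u) - s * p u" using \<open>y \<in> S a\<close> by (auto simp: S_def)
      have eq: "cscale A (of_real t) a \<oplus> cscale A (of_real (t * s)) u
        = cscale A (of_real t) (a \<oplus> cscale A (of_real s) u)"
        using ta u by (simp add: sc_add_right sc_sc)
      have "q (cscale A (of_real t) a) \<le> t * y"
        using upper[of "cscale A (of_real t) a" "t * s"] ta u s
          sublin_sc[OF p, of t "a \<oplus> cscale A (of_real s) u"]
        unfolding eq s(2) by (simp add: algebra_simps)
      then show ?thesis using ta by (simp add: field_simps)
    qed
    then have "q (cscale A (of_real t) a) / t \<le> q a" unfolding q[OF ta(2)] by (intro cInf_greatest ne)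
    then show ?thesis using ta by (simp add: field_simps)
  qed
  have "q \<zero> \<le> 0" using upper[of \<zero> 0] u sublin_zero[OF p] by simp
  moreover have "q \<zero> \<ge> 0"
    unfolding q[OF zero_closed] by (intro cInf_greatest ne) (use lower[of \<zero>] sublin_zero[OF p] in auto)
  ultimately have q0: "q \<zero> = 0" by simp
  show "sublin q" unfolding sublin_def
  proof (intro conjI ballI allI impI add)
    fix t :: real and a assume ta: "t \<ge> 0" "a \<in> carrier A"
    show "q (cscale A (of_real t) a) = t * q a"
    proof (cases "t = 0")
      case False
      \<comment> \<open>The one-sided homogeneity \<open>le\<close>, applied with factor 1/t at the
        element t a, yields the reverse inequality.\<close>
      then have "q (cscale A (of_real (1/t)) (cscale A (of_real t) a)) \<le> 1/t * q (cscale A (of_real t) a)"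
        using ta by (intro le) auto
      then have "t * q a \<le> q (cscale A (of_real t) a)"
        using False ta by (simp add: sc_sc field_simps)
      then show ?thesis using le[of t a] False ta by simp
    qed (use q0 ta in simp)
  qed
qed

definition real_linf :: "('a \<Rightarrow> real) \<Rightarrow> bool" where
  "real_linf g \<longleftrightarrow> (\<forall>a\<in>carrier A. \<forall>b\<in>carrier A. g (a \<oplus> b) = g a + g b) \<and>
     (\<forall>t. \<forall>a\<in>carrier A. g (cscale A (of_real t) a) = t * g a)"

text \<open>For odd p, subadditivity at a, b and again at -a, -b bounds p (a + b) from both
  sides.\<close>

lemma sublin_odd_imp_linear:
  assumes p: "sublin p" and odd: "\<And>a. a \<in> carrier A \<Longrightarrow> p (\<ominus> a) \<le> - p a"
  shows "real_linf p"
proof -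
  have m: "p (\<ominus> a) = - p a" if "a \<in> carrier A" for a
    using odd[OF that] sublin_ge[OF p that] by simp
  have "p (a \<oplus> b) = p a + p b" if ab: "a \<in> carrier A" "b \<in> carrier A" for a b
    using sublin_add[OF p ab] sublin_add[OF p, of "\<ominus> a" "\<ominus> b"] ab m[of "a \<oplus> b"] m[of a] m[of b]
    by (simp add: minus_add)
  moreover have "p (cscale A (of_real t) a) = t * p a" if "a \<in> carrier A" for t a
  proof (cases "t \<ge> 0")
    case False
    have "cscale A (of_real t) a = \<ominus> (cscale A (of_real (-t)) a)" using that by (simp add: minus_sc sc_sc)
    then show ?thesis using sublin_sc[OF p, of "-t" a] m[of "cscale A (of_real (-t)) a"] that False by simp
  qed (use sublin_sc[OF p _ that] in simp)
  ultimately show ?thesis by (simp add: real_linf_def)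
qed

text \<open>A minimal sublinear functional is linear.\<close>

theorem hahn_banach:
  assumes p: "sublin p" and u: "u \<in> carrier A"
  obtains g where "real_linf g" "\<And>a. a \<in> carrier A \<Longrightarrow> g a \<le> p a" "g u = p u"
proof -
  \<comment> \<open>Minimising below this q settles the value at u in advance: every linear g below
    q has - g u = g (-u) \<le> - p u.\<close>
  obtain q where q: "sublin q" "q \<in> extensional (carrier A)" "\<And>a. a \<in> carrier A \<Longrightarrow> q a \<le> p a" "q (\<ominus> u) \<le> - p u"
    using sublin_shift[OF p u] by blast
  \<comment> \<open>Functionals are kept extensional so that comparison on the carrier is
    antisymmetric.\<close>
  define S where "S = {r \<in> extensional (carrier A). sublin r \<and> (\<forall>a\<in>carrier A. r a \<le> q a)}"
  \<comment> \<open>The order is reversed, so a maximal element in the sense of Zorn is a minimal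
    functional.\<close>
  define P where "P r s \<longleftrightarrow> (\<forall>a\<in>carrier A. s a \<le> r a)" for r s :: "'a \<Rightarrow> real"
  have "\<exists>m\<in>S. \<forall>a\<in>S. P m a \<longrightarrow> a = m"
  proof (rule predicate_Zorn)
    show "partial_order_on S (relation_of P S)"
      unfolding P_def
      by (rule partial_order_on_relation_ofI)
        (auto simp: S_def intro: order_trans extensionalityI dest: antisym intro!: extensionalityI[of _ "carrier A"])
    fix C assume C: "C \<in> Chains (relation_of P S)"
    then have CS: "C \<subseteq> S" and tot: "\<And>r s. r \<in> C \<Longrightarrow> s \<in> C \<Longrightarrow> P r s \<or> P s r"
      by (auto simp: Chains_def relation_of_def)
    show "\<exists>r\<in>S. \<forall>s\<in>C. P s r"
    proof (cases "C = {}")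
      case True
      then show ?thesis using q by (auto simp: S_def)
    next
      case False
      \<comment> \<open>The pointwise infimum bounds the chain; it is finite since all members are
        at least - q (-a) at a.\<close>
      define r where "r = (\<lambda>a\<in>carrier A. INF s\<in>C. s a)"
      have r: "r a = (INF s\<in>C. s a)" if "a \<in> carrier A" for a using that by (simp add: r_def)
      have sl: "sublin s" "s a \<le> q a" if "s \<in> C" "a \<in> carrier A" for s a using that CS by (auto simp: S_def)
      have low: "- q (\<ominus> a) \<le> s a" if "s \<in> C" "a \<in> carrier A" for s a
        using sublin_ge[OF sl(1)[OF that] that(2)] sl(2)[OF that(1), of "\<ominus> a"] that by simp
      have bdd: "bdd_below ((\<lambda>s. s a) ` C)" if "a \<in> carrier A" for a
        using low that by (auto intro!: bdd_belowI)
      have le: "r a \<le> s a" if "s \<in> C" "a \<in> carrier A" for s a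
        unfolding r[OF that(2)] by (rule cINF_lower[OF bdd[OF that(2)] that(1)])
      have ge: "c \<le> r a" if "\<And>s. s \<in> C \<Longrightarrow> c \<le> s a" "a \<in> carrier A" for c a
        unfolding r[OF that(2)] by (rule cINF_greatest[OF False that(1)])
      have "r (a \<oplus> b) \<le> r a + r b" if ab: "a \<in> carrier A" "b \<in> carrier A" for a b
      proof -
        have *: "r (a \<oplus> b) \<le> s a + t b" if st: "s \<in> C" "t \<in> C" for s t
        proof -
          obtain w where w: "w \<in> C" "P s w" "P t w" using tot[OF st] st by (auto simp: P_def)
          have "r (a \<oplus> b) \<le> w (a \<oplus> b)" using le w ab by simp
          also have "\<dots> \<le> w a + w b" using sublin_add[OF sl(1)[OF w(1)]] ab by blast
          also have "\<dots> \<le> s a + t b" using w ab by (intro add_mono) (auto simp: P_def)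
          finally show ?thesis .
        qed
        have "r (a \<oplus> b) - s a \<le> r b" if "s \<in> C" for s
          by (intro ge) (use *[OF that] ab in \<open>auto simp: algebra_simps\<close>)
        then have "r (a \<oplus> b) - r b \<le> r a" by (intro ge) (use ab in \<open>auto simp: algebra_simps\<close>)
        then show ?thesis by simp
      qed
      moreover have "r (cscale A (of_real t) a) = t * r a" if t: "t \<ge> 0" "a \<in> carrier A" for t a
      proof (cases "t = 0")
        case True
        have "r \<zero> = 0" proof -
            have "(INF s\<in>C. s \<zero>) = (INF s\<in>C. 0 :: real)"
              by (rule INF_cong) (use sublin_zero[OF sl(1)[OF _ zero_closed]] in auto)
            then show ?thesis using False r by simp
          qed
        then show ?thesis using True t by simp
      next
        case t0: False
        have "r (cscale A (of_real t) a) \<le> t * s a" if "s \<in> C" for s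
          using le[OF that, of "cscale A (of_real t) a"] sublin_sc[OF sl(1)[OF that] t] t by simp
        then have "r (cscale A (of_real t) a) / t \<le> r a"
          by (intro ge) (use t t0 in \<open>auto simp: field_simps\<close>)
        moreover have "t * r a \<le> r (cscale A (of_real t) a)"
        proof (intro ge)
          fix s assume "s \<in> C"
          then show "t * r a \<le> s (cscale A (of_real t) a)"
            using le[of s a] sublin_sc[OF sl(1)[OF _ t(2)] t, of s] t by (simp add: mult_left_mono)
        qed (use t in auto)
        ultimately show ?thesis using t t0 by (simp add: field_simps)
      qed
      ultimately have "sublin r" by (simp add: sublin_def)
      moreover have "r a \<le> q a" if "a \<in> carrier A" for a
        using False le sl(2) that by (meson ex_in_conv order_trans)
      ultimately have "r \<in> S" by (simp add: S_def r_def)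
      then show ?thesis using le by (auto simp: P_def)
    qed
  qed
  then obtain g where g: "g \<in> S" and min: "\<And>r. r \<in> S \<Longrightarrow> P g r \<Longrightarrow> r = g" by blast
  have sg: "sublin g" and gq: "\<And>a. a \<in> carrier A \<Longrightarrow> g a \<le> q a" using g by (auto simp: S_def)
  \<comment> \<open>The shift of g along a lies below g and in S, so by minimality it is g
    itself.\<close>
  have "g (\<ominus> a) \<le> - g a" if a: "a \<in> carrier A" for a
  proof -
    obtain r where r: "sublin r" "r \<in> extensional (carrier A)" "\<And>b. b \<in> carrier A \<Longrightarrow> r b \<le> g b" "r (\<ominus> a) \<le> - g a"
      using sublin_shift[OF sg a] by blast
    have "r \<in> S" using r gq unfolding S_def by (blast intro: order_trans)
    then have "r = g" using min r by (auto simp: P_def)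
    then show ?thesis using r by simp
  qed
  then have lin: "real_linf g" using sublin_odd_imp_linear sg by blast
  moreover have gp: "g a \<le> p a" if "a \<in> carrier A" for a using gq q(3) that by (meson order_trans)
  moreover have "g u = p u"
  proof -
    have "g (\<ominus> u) = - g u" using lin u minus_sc[OF u] by (auto simp: real_linf_def dest!: spec[of _ "-1"])
    then show ?thesis using gq[of "\<ominus> u"] q(4) gp[OF u] u by simp
  qed
  ultimately show ?thesis using that by blast
qed

end

section \<open>Positivity and states in C*-algebras\<close>

context star_algebra begin

definition herm :: "'a \<Rightarrow> bool" where
  "herm a \<longleftrightarrow> a \<in> carrier A \<and> adj A a = a"

text \<open>The double commutant of b. It is closed under the algebra operations and under limits,
  and for b in the carrier any two of its elements commute. It plays the role of the commutative
  algebra generated by b in which all roots and inverses are found.\<close>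

definition bicomm :: "'a \<Rightarrow> 'a set" where
  "bicomm b = {c \<in> carrier A. \<forall>d\<in>carrier A. d \<otimes> b = b \<otimes> d \<longrightarrow> d \<otimes> c = c \<otimes> d}"

lemma herm_st: "herm a \<Longrightarrow> adj A a = a"
  by (simp add: herm_def)

lemma herm_add: "herm a \<Longrightarrow> herm b \<Longrightarrow> herm (a \<oplus> b)" by (simp add: herm_def st_add)
lemma herm_sc: "herm a \<Longrightarrow> herm (cscale A (of_real t) a)" by (simp add: herm_def st_sc)
lemma herm_minus: "herm a \<Longrightarrow> herm (\<ominus> a)" using herm_sc[of a "-1"] by (simp add: minus_sc herm_def)
lemma herm_diff: "herm a \<Longrightarrow> herm b \<Longrightarrow> herm (a \<ominus> b)" by (simp add: a_minus_def herm_add herm_minus)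
lemma herm_one: "herm \<one>" and herm_zero: "herm \<zero>" by (simp_all add: herm_def)
lemma herm_mult: "herm a \<Longrightarrow> herm b \<Longrightarrow> a \<otimes> b = b \<otimes> a \<Longrightarrow> herm (a \<otimes> b)" by (simp add: herm_def st_mult)
lemma herm_sq: "herm a \<Longrightarrow> herm (a \<otimes> a)" by (simp add: herm_mult)
lemma herm_square: "a \<in> carrier A \<Longrightarrow> herm (adj A a \<otimes> a)" by (simp add: herm_def st_mult)
lemma herm_conj: "a \<in> carrier A \<Longrightarrow> herm b \<Longrightarrow> herm (a \<otimes> b \<otimes> adj A a)"
  by (simp add: herm_def st_mult m_assoc)

lemma bicomm_carrier: "c \<in> bicomm b \<Longrightarrow> c \<in> carrier A" by (simp add: bicomm_def)

lemma bicomm_commute: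
  assumes c: "c \<in> bicomm b" and d: "d \<in> bicomm b" and b: "b \<in> carrier A" shows "c \<otimes> d = d \<otimes> c"
proof -
  have "b \<otimes> d = d \<otimes> b" using d b unfolding bicomm_def by blast
  then have "d \<otimes> b = b \<otimes> d" by (rule sym)
  with c d have "d \<otimes> c = c \<otimes> d" unfolding bicomm_def by blast
  then show ?thesis by (rule sym)
qed

lemma bicomm_self: "b \<in> carrier A \<Longrightarrow> b \<in> bicomm b" by (simp add: bicomm_def)
lemma bicomm_one: "\<one> \<in> bicomm b" by (simp add: bicomm_def)
lemma bicomm_add: "c \<in> bicomm b \<Longrightarrow> d \<in> bicomm b \<Longrightarrow> c \<oplus> d \<in> bicomm b"
  by (simp add: bicomm_def l_distr r_distr)
lemma bicomm_sc: "c \<in> bicomm b \<Longrightarrow> cscale A z c \<in> bicomm b"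
  by (auto simp: bicomm_def sc_mult_left sc_mult_right)
lemma bicomm_minus: "c \<in> bicomm b \<Longrightarrow> \<ominus> c \<in> bicomm b"
  using bicomm_sc[of c b "-1"] minus_sc bicomm_carrier by simp
lemma bicomm_diff: "c \<in> bicomm b \<Longrightarrow> d \<in> bicomm b \<Longrightarrow> c \<ominus> d \<in> bicomm b"
  by (simp add: a_minus_def bicomm_add bicomm_minus)
lemma bicomm_mult:
  assumes c: "c \<in> bicomm b" and d: "d \<in> bicomm b" shows "c \<otimes> d \<in> bicomm b"
proof -
  have "e \<otimes> (c \<otimes> d) = c \<otimes> d \<otimes> e" if e: "e \<in> carrier A" "e \<otimes> b = b \<otimes> e" for e
  proof -
    have "e \<otimes> c = c \<otimes> e" "e \<otimes> d = d \<otimes> e" "c \<in> carrier A" "d \<in> carrier A"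
      using c d e by (auto simp: bicomm_def)
    then show ?thesis using e(1) by (metis m_assoc)
  qed
  then show ?thesis using c d by (auto simp: bicomm_def)
qed

lemmas herm_intros = herm_add herm_sc herm_minus herm_diff herm_one herm_zero herm_sq
lemmas bicomm_intros = bicomm_self bicomm_one bicomm_add bicomm_sc bicomm_minus bicomm_diff bicomm_mult

end

section \<open>Norm estimates, limits, and fixed points of contractions\<close>

context cstar_algebra begin

abbreviation nrm :: "'a \<Rightarrow> real" ("\<parallel>_\<parallel>") where "\<parallel>a\<parallel> \<equiv> cnorm A a"

lemma nrm_zero [simp]: "\<parallel>\<zero>\<parallel> = 0" by (simp add: norm_eq_0)

lemma nrm_minus [simp]: "a \<in> carrier A \<Longrightarrow> \<parallel>\<ominus> a\<parallel> = \<parallel>a\<parallel>" by (simp add: minus_sc norm_scale)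

lemma nrm_diff_commute: "a \<in> carrier A \<Longrightarrow> b \<in> carrier A \<Longrightarrow> \<parallel>a \<ominus> b\<parallel> = \<parallel>b \<ominus> a\<parallel>"
  using nrm_minus[of "a \<ominus> b"] by (simp add: a_minus_def minus_add a_comm)

lemma nrm_triangle3: "a \<in> carrier A \<Longrightarrow> b \<in> carrier A \<Longrightarrow> c \<in> carrier A \<Longrightarrow> \<parallel>a \<ominus> c\<parallel> \<le> \<parallel>a \<ominus> b\<parallel> + \<parallel>b \<ominus> c\<parallel>"
  using norm_triangle[of "a \<ominus> b" "b \<ominus> c"] by (simp add: a_minus_def a_ac r_neg1 r_neg2)

lemma nrm_diff_le: "a \<in> carrier A \<Longrightarrow> b \<in> carrier A \<Longrightarrow> \<parallel>a \<ominus> b\<parallel> \<le> \<parallel>a\<parallel> + \<parallel>b\<parallel>"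
  using norm_triangle[of a "\<ominus> b"] by (simp add: a_minus_def)

lemma nrm_diff_ge: "a \<in> carrier A \<Longrightarrow> b \<in> carrier A \<Longrightarrow> \<bar>\<parallel>a\<parallel> - \<parallel>b\<parallel>\<bar> \<le> \<parallel>a \<ominus> b\<parallel>"
  using nrm_triangle3[of a b \<zero>] nrm_triangle3[of b a \<zero>] nrm_diff_commute[of a b]
  by (simp add: a_minus_def)

lemma nrm_st [simp]: assumes a: "a \<in> carrier A" shows "\<parallel>adj A a\<parallel> = \<parallel>a\<parallel>"
proof -
  have *: "\<parallel>a\<parallel> \<le> \<parallel>adj A a\<parallel>" if a: "a \<in> carrier A" for a
  proof (cases "\<parallel>a\<parallel> = 0")
    case False
    then have "\<parallel>a\<parallel> > 0" using norm_nonneg[OF a] by simp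
    moreover have "\<parallel>a\<parallel> * \<parallel>a\<parallel> \<le> \<parallel>adj A a\<parallel> * \<parallel>a\<parallel>"
      using cstar_identity[OF a] norm_mult[of "adj A a" a] a by (simp add: power2_eq_square)
    ultimately show ?thesis by simp
  qed (use a norm_nonneg in simp)
  show ?thesis using *[OF a] *[of "adj A a"] a by simp
qed

text \<open>The C*-identity makes the norm of the unit idempotent, hence 0 or 1. The value 0 occurs
  in the zero algebra, which the axioms admit.\<close>

lemma nrm_one_le: "\<parallel>\<one>\<parallel> \<le> 1"
proof (cases "\<parallel>\<one>\<parallel> = 0")
  case False
  then show ?thesis using cstar_identity[of \<one>] by (simp add: power2_eq_square)
qed simp

lemma nrm_sq: "herm a \<Longrightarrow> \<parallel>a \<otimes> a\<parallel> = \<parallel>a\<parallel>\<^sup>2"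
  using cstar_identity[of a] by (simp add: herm_def)

lemma sublin_nrm: "sublin (cnorm A)"
  by (auto simp: sublin_def norm_triangle norm_scale)

lemma nrm_zeroD: "a \<in> carrier A \<Longrightarrow> \<parallel>a\<parallel> = 0 \<Longrightarrow> a = \<zero>" by (simp add: norm_eq_0)

text \<open>Bilinear identities in the algebra are reduced in this way to identities of complex numbers.\<close>

lemma linf_eqI:
  assumes ab: "a \<in> carrier A" "b \<in> carrier A" and eq: "\<And>g. linf g \<Longrightarrow> g a = g b"
  shows "a = b"
proof -
  obtain g where g: "real_linf g" "g (a \<ominus> b) = \<parallel>a \<ominus> b\<parallel>"
    using hahn_banach[OF sublin_nrm, of "a \<ominus> b"] ab by auto
  \<comment> \<open>The standard complexification of a real-linear functional; its real part is
    g.\<close>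
  define f where "f c = of_real (g c) - \<i> * of_real (g (cscale A \<i> c))" for c
  have add: "g (c \<oplus> d) = g c + g d" if "c \<in> carrier A" "d \<in> carrier A" for c d
    using g that by (simp add: real_linf_def)
  have sc: "g (cscale A (of_real t) c) = t * g c" if "c \<in> carrier A" for c t
    using g that by (simp add: real_linf_def)
  have exp: "g (cscale A z c) = Re z * g c + Im z * g (cscale A \<i> c)" if c: "c \<in> carrier A" for c z
  proof -
    have "cscale A z c = cscale A (of_real (Re z)) c \<oplus> cscale A (of_real (Im z)) (cscale A \<i> c)"
      using c by (simp add: sc_sc flip: sc_add_left) (metis complex_eq mult.commute)
    then show ?thesis using c by (simp only: add sc sc_closed)
  qed
  have "f (cscale A z c) = z * f c" if c: "c \<in> carrier A" for c z
    using exp[OF c, of z] exp[OF c, of "\<i> * z"] c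
    by (simp add: f_def sc_sc complex_eq_iff)
  moreover have "f (c \<oplus> d) = f c + f d" if "c \<in> carrier A" "d \<in> carrier A" for c d
    using that by (simp add: f_def sc_add_right add algebra_simps)
  ultimately have "linf f" by (simp add: linf_def)
  then have "f (a \<ominus> b) = 0" using eq ab by (simp add: linf_diff)
  then have "\<parallel>a \<ominus> b\<parallel> = 0" using g(2) by (simp add: f_def complex_eq_iff)
  then show ?thesis using nrm_zeroD[of "a \<ominus> b"] ab cdiff_eq_zero[OF ab] by (simp add: cdiff_minus)
qed


lemma contraction_fixpoint:
  assumes S: "S \<subseteq> carrier A" "S \<noteq> {}"
    and closed: "\<And>s l. (\<And>n. s n \<in> S) \<Longrightarrow> l \<in> carrier A \<Longrightarrow> (\<lambda>n. \<parallel>s n \<ominus> l\<parallel>) \<longlonglongrightarrow> 0 \<Longrightarrow> l \<in> S"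
    and T: "\<And>x. x \<in> S \<Longrightarrow> T x \<in> S" and k: "k < 1"
    and con: "\<And>x y. x \<in> S \<Longrightarrow> y \<in> S \<Longrightarrow> \<parallel>T x \<ominus> T y\<parallel> \<le> k * \<parallel>x \<ominus> y\<parallel>"
  obtains x where "x \<in> S" "T x = x"
proof -
  \<comment> \<open>\<open>Metric_space\<close> asks for nonnegativity and symmetry at all
    arguments, hence the default value 0 outside the carrier.\<close>
  define d where "d x y = (if x \<in> carrier A \<and> y \<in> carrier A then \<parallel>x \<ominus> y\<parallel> else 0)" for x y
  interpret M: Metric_space S d
    using S nrm_diff_commute nrm_triangle3 cdiff_eq_zero cdiff_minus
    by unfold_locales (auto simp: d_def norm_nonneg subset_iff norm_eq_0)
  have "M.mcomplete" unfolding M.mcomplete_def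
  proof (intro allI impI)
    fix s assume s: "M.MCauchy s"
    then have sS: "s n \<in> S" for n by (auto simp: M.MCauchy_def)
    then have sc: "s n \<in> carrier A" for n using S(1) by blast
    have "\<exists>l\<in>carrier A. (\<lambda>n. cnorm A (cdiff A (s n) l)) \<longlonglongrightarrow> 0"
    proof (rule complete[OF sc])
      fix e :: real assume "e > 0"
      then show "\<exists>N. \<forall>m\<ge>N. \<forall>n\<ge>N. cnorm A (cdiff A (s m) (s n)) < e"
        using s sc by (auto simp: M.MCauchy_def d_def cdiff_minus)
    qed
    then obtain l where l: "l \<in> carrier A" "(\<lambda>n. \<parallel>s n \<ominus> l\<parallel>) \<longlonglongrightarrow> 0"
      by (auto simp: cdiff_minus sc)
    then show "\<exists>x. limitin M.mtopology s x sequentially"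
      using closed[OF sS l] sS sc by (auto simp: M.limitin_metric_dist_null d_def)
  qed
  then obtain x where "x \<in> S" "T x = x"
  proof (rule M.Banach_fixedpoint_thm[of T k])
    show "d (T x) (T y) \<le> k * d x y" if "x \<in> S" "y \<in> S" for x y
      using con[OF that] T[OF that(1)] T[OF that(2)] that S(1) by (simp add: d_def subset_iff)
  qed (use S(2) k in \<open>auto intro: T\<close>)
  then show ?thesis using that by blast
qed

lemma tendsto_nrm_bound:
  assumes "\<And>n. s n \<in> carrier A" "l \<in> carrier A" "(\<lambda>n. \<parallel>s n \<ominus> l\<parallel>) \<longlonglongrightarrow> 0" "\<And>n. \<parallel>s n\<parallel> \<le> r"
  shows "\<parallel>l\<parallel> \<le> r"
proof (rule field_le_epsilon)
  fix e :: real assume "e > 0"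
  then obtain n where "\<parallel>s n \<ominus> l\<parallel> < e" using LIMSEQ_D[OF assms(3)] norm_nonneg assms by fastforce
  then show "\<parallel>l\<parallel> \<le> r + e" using nrm_diff_ge[OF assms(1)[of n] assms(2)] assms(4)[of n] by linarith
qed

lemma limit_unique:
  assumes "\<And>n. s n \<in> carrier A" "l \<in> carrier A" "m \<in> carrier A"
    "(\<lambda>n. \<parallel>s n \<ominus> l\<parallel>) \<longlonglongrightarrow> 0" "(\<lambda>n. \<parallel>s n \<ominus> m\<parallel>) \<longlonglongrightarrow> 0"
  shows "l = m"
proof -
  have "\<parallel>l \<ominus> m\<parallel> \<le> \<parallel>s n \<ominus> l\<parallel> + \<parallel>s n \<ominus> m\<parallel>" for n
    using nrm_triangle3[of l "s n" m] nrm_diff_commute[of l "s n"] assms by simp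
  then have "\<parallel>l \<ominus> m\<parallel> \<le> 0"
    using tendsto_add[OF assms(4,5)] by (intro LIMSEQ_le_const[where a = "\<parallel>l \<ominus> m\<parallel>"]) auto
  then have "l \<ominus> m = \<zero>" using nrm_zeroD[of "l \<ominus> m"] norm_nonneg[of "l \<ominus> m"] assms by simp
  then show ?thesis using cdiff_eq_zero[of l m] assms by (simp add: cdiff_minus)
qed

lemma limit_lmult:
  assumes "\<And>n. s n \<in> carrier A" "l \<in> carrier A" "c \<in> carrier A" "(\<lambda>n. \<parallel>s n \<ominus> l\<parallel>) \<longlonglongrightarrow> 0"
  shows "(\<lambda>n. \<parallel>c \<otimes> s n \<ominus> c \<otimes> l\<parallel>) \<longlonglongrightarrow> 0"
proof (rule tendsto_sandwich[OF _ _ tendsto_const])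
  have "c \<otimes> s n \<ominus> c \<otimes> l = c \<otimes> (s n \<ominus> l)" for n
    using assms by (simp add: a_minus_def r_distr r_minus)
  then show "\<forall>\<^sub>F n in sequentially. \<parallel>c \<otimes> s n \<ominus> c \<otimes> l\<parallel> \<le> \<parallel>c\<parallel> * \<parallel>s n \<ominus> l\<parallel>"
    using norm_mult assms by simp
  show "(\<lambda>n. \<parallel>c\<parallel> * \<parallel>s n \<ominus> l\<parallel>) \<longlonglongrightarrow> 0" using tendsto_mult_left[OF assms(4), of "\<parallel>c\<parallel>"] by simp
qed (use norm_nonneg assms in auto)

lemma limit_rmult:
  assumes "\<And>n. s n \<in> carrier A" "l \<in> carrier A" "c \<in> carrier A" "(\<lambda>n. \<parallel>s n \<ominus> l\<parallel>) \<longlonglongrightarrow> 0"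
  shows "(\<lambda>n. \<parallel>s n \<otimes> c \<ominus> l \<otimes> c\<parallel>) \<longlonglongrightarrow> 0"
proof (rule tendsto_sandwich[OF _ _ tendsto_const])
  have "s n \<otimes> c \<ominus> l \<otimes> c = (s n \<ominus> l) \<otimes> c" for n
    using assms by (simp add: a_minus_def l_distr l_minus)
  then show "\<forall>\<^sub>F n in sequentially. \<parallel>s n \<otimes> c \<ominus> l \<otimes> c\<parallel> \<le> \<parallel>s n \<ominus> l\<parallel> * \<parallel>c\<parallel>"
    using norm_mult assms by simp
  show "(\<lambda>n. \<parallel>s n \<ominus> l\<parallel> * \<parallel>c\<parallel>) \<longlonglongrightarrow> 0" using tendsto_mult_right[OF assms(4), of "\<parallel>c\<parallel>"] by simp
qed (use norm_nonneg assms in auto)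

lemma limit_st:
  assumes "\<And>n. s n \<in> carrier A" "l \<in> carrier A" "(\<lambda>n. \<parallel>s n \<ominus> l\<parallel>) \<longlonglongrightarrow> 0"
  shows "(\<lambda>n. \<parallel>adj A (s n) \<ominus> adj A l\<parallel>) \<longlonglongrightarrow> 0"
proof -
  have "adj A (s n) \<ominus> adj A l = adj A (s n \<ominus> l)" for n
    using assms by (simp add: a_minus_def st_add minus_sc st_sc)
  then show ?thesis using assms by simp
qed

text \<open>The domain of the fixed-point iterations. Since it is closed under limits, fixed points
  inherit self-adjointness, membership in the bicommutant and the norm bound.\<close>

definition hball :: "'a \<Rightarrow> real \<Rightarrow> 'a set" where
  "hball b r = {t. herm t \<and> t \<in> bicomm b \<and> \<parallel>t\<parallel> \<le> r}"

lemma hball_closed: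
  assumes b: "b \<in> carrier A" and s: "\<And>n. s n \<in> hball b r" and l: "l \<in> carrier A" "(\<lambda>n. \<parallel>s n \<ominus> l\<parallel>) \<longlonglongrightarrow> 0"
  shows "l \<in> hball b r"
proof -
  have sc: "s n \<in> carrier A" and st: "adj A (s n) = s n" for n using s by (auto simp: hball_def herm_def)
  have "adj A l = l" using limit_unique[OF sc _ _ limit_st[OF sc l, unfolded st]] l by simp
  moreover have "d \<otimes> l = l \<otimes> d" if d: "d \<in> carrier A" "d \<otimes> b = b \<otimes> d" for d
  proof -
    have eq: "d \<otimes> s n = s n \<otimes> d" for n using s[of n] d by (auto simp: hball_def bicomm_def)
    show ?thesis
      using limit_unique[of "\<lambda>n. d \<otimes> s n", OF _ _ _ limit_lmult[OF sc l(1) d(1) l(2)]]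
        limit_rmult[OF sc l(1) d(1) l(2)] sc d l by (simp add: eq)
  qed
  moreover have "\<parallel>l\<parallel> \<le> r" using tendsto_nrm_bound[OF sc l] s by (auto simp: hball_def)
  ultimately show ?thesis using l by (auto simp: hball_def herm_def bicomm_def)
qed

text \<open>The root is \<open>1 - t\<close> for the fixed point \<open>t\<close> of the contraction \<open>t \<mapsto> (a + t\<^sup>2) / 2\<close>.\<close>

lemma herm_sqrt_one_minus:
  assumes a: "herm a" "a \<in> bicomm b" "\<parallel>a\<parallel> < 1" and b: "b \<in> carrier A"
  obtains t where "herm t" "t \<in> bicomm b" "\<parallel>t\<parallel> < 1" "(\<one> \<ominus> t) \<otimes> (\<one> \<ominus> t) = \<one> \<ominus> a"
proof -
  have ac: "a \<in> carrier A" using a by (simp add: herm_def)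
  \<comment> \<open>The smaller root of ||a|| + r^2 = 2 r. Hence T maps the ball of radius r into
    itself and is a contraction with constant r < 1.\<close>
  define r where "r = 1 - sqrt (1 - \<parallel>a\<parallel>)"
  have na: "0 \<le> \<parallel>a\<parallel>" by (rule norm_nonneg[OF ac])
  have r: "0 \<le> r" "r < 1" using a(3) na by (auto simp: r_def)
  have rr: "\<parallel>a\<parallel> = 2 * r - r\<^sup>2" using a(3) by (simp add: r_def power2_eq_square algebra_simps)
  define T where "T t = cscale A (1/2) (a \<oplus> t \<otimes> t)" for t
  have cl: "t \<in> carrier A" if "t \<in> hball b r" for t using that by (simp add: hball_def herm_def)
  have "\<exists>t\<in>hball b r. T t = t"
  proof (rule contraction_fixpoint[of "hball b r" T r])
    show "hball b r \<subseteq> carrier A" using cl by auto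
    have "\<zero> \<in> hball b r" using r by (simp add: hball_def herm_zero bicomm_def)
    then show "hball b r \<noteq> {}" by auto
    fix x assume x: "x \<in> hball b r"
    have "\<parallel>x \<otimes> x\<parallel> \<le> r * r" using norm_mult[OF cl[OF x] cl[OF x]] x r norm_nonneg[OF cl[OF x]]
      by (auto simp: hball_def intro: order_trans mult_mono)
    then have "\<parallel>a \<oplus> x \<otimes> x\<parallel> \<le> 2 * r" using norm_triangle[of a "x \<otimes> x"] cl[OF x] ac rr by (simp add: power2_eq_square)
    then have "\<parallel>T x\<parallel> \<le> r" using cl[OF x] ac by (simp add: T_def norm_scale)
    moreover have "herm (T x)" using herm_sc[of "a \<oplus> x \<otimes> x" "1/2"] x a
      by (simp add: T_def hball_def herm_add herm_sq)
    ultimately show "T x \<in> hball b r" using x a b by (auto simp: hball_def T_def intro!: bicomm_intros)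
    fix y assume y: "y \<in> hball b r"
    \<comment> \<open>A difference of squares arranged so that x and y need not commute.\<close>
    have "T x \<ominus> T y = cscale A (1/2) (x \<otimes> (x \<ominus> y) \<oplus> (x \<ominus> y) \<otimes> y)"
      using cl[OF x] cl[OF y] ac
      by (intro linf_eqI) (simp_all add: T_def linf_simps r_distr l_distr a_minus_def l_minus r_minus algebra_simps)
    then have "\<parallel>T x \<ominus> T y\<parallel> = 1/2 * \<parallel>x \<otimes> (x \<ominus> y) \<oplus> (x \<ominus> y) \<otimes> y\<parallel>"
      using cl[OF x] cl[OF y] by (simp add: norm_scale)
    also have "\<dots> \<le> 1/2 * (\<parallel>x\<parallel> * \<parallel>x \<ominus> y\<parallel> + \<parallel>x \<ominus> y\<parallel> * \<parallel>y\<parallel>)"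
      using cl[OF x] cl[OF y] norm_triangle[of "x \<otimes> (x \<ominus> y)" "(x \<ominus> y) \<otimes> y"]
        norm_mult[of x "x \<ominus> y"] norm_mult[of "x \<ominus> y" y] by simp
    also have "\<dots> \<le> 1/2 * (r * \<parallel>x \<ominus> y\<parallel> + \<parallel>x \<ominus> y\<parallel> * r)"
      using x y norm_nonneg[of "x \<ominus> y"] cl by (intro mult_left_mono add_mono mult_mono) (auto simp: hball_def norm_nonneg r)
    finally show "\<parallel>T x \<ominus> T y\<parallel> \<le> r * \<parallel>x \<ominus> y\<parallel>" by simp
  qed (erule (2) hball_closed[OF b], fact r(2), blast)
  then obtain t where t: "t \<in> hball b r" "T t = t" by blast
  have tc: "t \<in> carrier A" using cl t by blast
  have "a \<oplus> t \<otimes> t = cscale A 2 (T t)" using ac tc by (simp add: T_def sc_sc)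
  then have e: "a \<oplus> t \<otimes> t = cscale A 2 t" using t by simp
  have "(\<one> \<ominus> t) \<otimes> (\<one> \<ominus> t) = \<one> \<ominus> a"
  proof (rule linf_eqI)
    fix g assume g: "linf g"
    have "g a + g (t \<otimes> t) = 2 * g t" using arg_cong[OF e, of g] g ac tc by (simp add: linf_simps)
    then show "g ((\<one> \<ominus> t) \<otimes> (\<one> \<ominus> t)) = g (\<one> \<ominus> a)"
      using g ac tc by (simp add: linf_simps a_minus_def r_distr l_distr l_minus r_minus algebra_simps)
  qed (use ac tc in auto)
  then show ?thesis using that[of t] t r by (auto simp: hball_def)
qed

text \<open>The geometric series as fixed point of t \<mapsto> 1 + a t. The radius 1 / (1 - ||a||)
  solves 1 + ||a|| r = r, so the ball is preserved.\<close>

lemma neumann_inverse: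
  assumes a: "herm a" "a \<in> bicomm b" "\<parallel>a\<parallel> < 1" and b: "b \<in> carrier A"
  obtains x where "herm x" "x \<in> bicomm b" "x \<otimes> (\<one> \<ominus> a) = \<one>"
proof -
  have ac: "a \<in> carrier A" using a by (simp add: herm_def)
  define r where "r = 1 / (1 - \<parallel>a\<parallel>)"
  have na: "0 \<le> \<parallel>a\<parallel>" by (rule norm_nonneg[OF ac])
  have r: "r > 0" "1 + \<parallel>a\<parallel> * r = r" using a(3) na by (auto simp: r_def field_simps)
  define T where "T t = \<one> \<oplus> a \<otimes> t" for t
  have cl: "t \<in> carrier A" if "t \<in> hball b r" for t using that by (simp add: hball_def herm_def)
  have "\<exists>t\<in>hball b r. T t = t"
  proof (rule contraction_fixpoint[of "hball b r" T "\<parallel>a\<parallel>"])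
    show "hball b r \<subseteq> carrier A" using cl by auto
    have "\<zero> \<in> hball b r" using r by (simp add: hball_def herm_zero bicomm_def)
    then show "hball b r \<noteq> {}" by auto
    fix x assume x: "x \<in> hball b r"
    have "\<parallel>a \<otimes> x\<parallel> \<le> \<parallel>a\<parallel> * r" using norm_mult[OF ac cl[OF x]] x r na
      by (auto simp: hball_def intro: order_trans mult_left_mono)
    then have "\<parallel>T x\<parallel> \<le> r" using norm_triangle[of \<one> "a \<otimes> x"] cl[OF x] ac nrm_one_le r by (simp add: T_def)
    moreover have "herm (T x)" unfolding T_def using x a bicomm_commute[OF a(2) _ b, of x]
      by (intro herm_add herm_one herm_mult) (auto simp: hball_def)
    ultimately show "T x \<in> hball b r" using x a b by (auto simp: hball_def T_def intro!: bicomm_intros)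
    fix y assume y: "y \<in> hball b r"
    have "T x \<ominus> T y = a \<otimes> (x \<ominus> y)"
      using cl[OF x] cl[OF y] ac
      by (intro linf_eqI) (simp_all add: T_def linf_simps r_distr a_minus_def r_minus)
    then show "\<parallel>T x \<ominus> T y\<parallel> \<le> \<parallel>a\<parallel> * \<parallel>x \<ominus> y\<parallel>"
      using norm_mult[of a "x \<ominus> y"] cl x y ac by simp
  qed (erule (2) hball_closed[OF b], fact a(3), blast)
  then obtain t where t: "t \<in> hball b r" "T t = t" by blast
  have tc: "t \<in> carrier A" and ta: "t \<otimes> a = a \<otimes> t"
    using cl t bicomm_commute[OF a(2) _ b, of t] by (auto simp: hball_def)
  have "t \<otimes> (\<one> \<ominus> a) = \<one>"
  proof (rule linf_eqI)
    fix g assume g: "linf g"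
    have "g \<one> + g (a \<otimes> t) = g t" using arg_cong[OF t(2), of g] g ac tc by (simp add: linf_simps T_def)
    then show "g (t \<otimes> (\<one> \<ominus> a)) = g \<one>"
      using g ac tc by (simp add: linf_simps a_minus_def r_distr r_minus ta algebra_simps)
  qed (use ac tc in auto)
  then show ?thesis using that[of t] t by (auto simp: hball_def)
qed

end

section \<open>Positive elements, square roots, Fukamiya's theorem and norming states\<close>

context cstar_algebra begin

abbreviation cst :: "real \<Rightarrow> 'a" where "cst t \<equiv> cscale A (of_real t) \<one>"

text \<open>A spectrum-free form of positivity: for self-adjoint v the norm condition means that the
  spectrum lies in [0, 2 t]. In this form closure under sums is just the triangle
  inequality.\<close>

definition pos :: "'a \<Rightarrow> bool" where
  "pos v \<longleftrightarrow> herm v \<and> (\<exists>t\<ge>0. \<parallel>cst t \<ominus> v\<parallel> \<le> t)"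

lemmas linf_expand = linf_simps a_minus_def l_distr r_distr l_minus r_minus sc_mult_left sc_mult_right
  sc_sc m_assoc

lemma pos_herm: "pos v \<Longrightarrow> herm v" and pos_carrier: "pos v \<Longrightarrow> v \<in> carrier A"
  by (auto simp: pos_def herm_def)

lemma nrm_cst_le: "\<parallel>cst t\<parallel> \<le> \<bar>t\<bar>"
  using mult_left_mono[OF nrm_one_le, of "\<bar>t\<bar>"] by (simp add: norm_scale)

lemma pos_add: assumes "pos v" "pos w" shows "pos (v \<oplus> w)"
proof -
  obtain t s where t: "t \<ge> 0" "\<parallel>cst t \<ominus> v\<parallel> \<le> t" and s: "s \<ge> 0" "\<parallel>cst s \<ominus> w\<parallel> \<le> s"
    using assms by (auto simp: pos_def)
  note c = assms[THEN pos_carrier]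
  have "cst (t + s) \<ominus> (v \<oplus> w) = (cst t \<ominus> v) \<oplus> (cst s \<ominus> w)"
    by (rule linf_eqI) (use c in \<open>simp_all add: linf_expand algebra_simps\<close>)
  then have "\<parallel>cst (t + s) \<ominus> (v \<oplus> w)\<parallel> \<le> t + s"
    using norm_triangle[of "cst t \<ominus> v" "cst s \<ominus> w"] t s c by simp
  then show ?thesis using t s assms by (auto simp: pos_def herm_add intro!: exI[of _ "t + s"])
qed

lemma pos_sc: assumes "pos v" "r \<ge> 0" shows "pos (cscale A (of_real r) v)"
proof -
  obtain t where t: "t \<ge> 0" "\<parallel>cst t \<ominus> v\<parallel> \<le> t" using assms by (auto simp: pos_def)
  note c = assms(1)[THEN pos_carrier]
  have "cst (r * t) \<ominus> cscale A (of_real r) v = cscale A (of_real r) (cst t \<ominus> v)"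
    by (rule linf_eqI) (use c in \<open>simp_all add: linf_expand algebra_simps\<close>)
  then have "\<parallel>cst (r * t) \<ominus> cscale A (of_real r) v\<parallel> \<le> r * t"
    using t assms c by (simp add: norm_scale mult_left_mono)
  then show ?thesis using t assms by (auto simp: pos_def herm_sc intro!: exI[of _ "r * t"])
qed

lemma pos_cst: "t \<ge> 0 \<Longrightarrow> pos (cst t)"
  by (auto simp: pos_def herm_sc herm_one a_minus_def r_neg)

lemma pos_cst_minus: assumes v: "herm v" "\<parallel>v\<parallel> \<le> t" shows "pos (cst t \<ominus> v)"
proof -
  have "v \<in> carrier A" using v by (simp add: herm_def)
  moreover have "cst t \<ominus> (cst t \<ominus> v) = v" using calculation by (simp add: a_minus_def minus_add r_neg2)
  ultimately show ?thesis using v norm_nonneg[of v]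
    by (auto simp: pos_def herm_diff herm_sc herm_one intro!: exI[of _ t])
qed

text \<open>The strict bound says that v / t is 1 - a with ||a|| < 1. The root is delivered in the
  shape c (1 - s) with ||s|| < 1 because \<open>commuting_halves\<close> also has to invert
  it.\<close>

lemma herm_sqrt_near:
  assumes v: "herm v" "v \<in> bicomm b" "\<parallel>cst t \<ominus> v\<parallel> < t" and b: "b \<in> carrier A"
  obtains c s where "c > 0" "herm s" "s \<in> bicomm b" "\<parallel>s\<parallel> < 1"
    "cscale A (of_real c) (\<one> \<ominus> s) \<otimes> cscale A (of_real c) (\<one> \<ominus> s) = v"
proof -
  have vc: "v \<in> carrier A" using v by (simp add: herm_def)
  have t: "t > 0" using v(3) norm_nonneg[of "cst t \<ominus> v"] vc by simp
  define a where "a = \<one> \<ominus> cscale A (of_real (1/t)) v"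
  have ac: "a \<in> carrier A" using vc by (simp add: a_def)
  have "cst t \<ominus> v = cscale A (of_real t) a"
    by (rule linf_eqI) (use vc t in \<open>simp_all add: a_def linf_expand algebra_simps\<close>)
  then have "\<parallel>a\<parallel> < 1" using v(3) t ac by (simp add: norm_scale)
  moreover have "herm a" "a \<in> bicomm b" unfolding a_def using v
    by (simp_all add: herm_intros bicomm_intros del: of_real_divide)
  ultimately obtain s where s: "herm s" "s \<in> bicomm b" "\<parallel>s\<parallel> < 1" "(\<one> \<ominus> s) \<otimes> (\<one> \<ominus> s) = \<one> \<ominus> a"
    using herm_sqrt_one_minus b by metis
  have sc: "s \<in> carrier A" using s by (simp add: herm_def)
  have "cscale A (of_real (sqrt t)) (\<one> \<ominus> s) \<otimes> cscale A (of_real (sqrt t)) (\<one> \<ominus> s)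
    = cscale A (of_real (sqrt t * sqrt t)) ((\<one> \<ominus> s) \<otimes> (\<one> \<ominus> s))"
    using sc by (simp add: sc_mult_left sc_mult_right sc_sc del: real_sqrt_mult_self)
  also have "\<dots> = v" unfolding s(4)
    by (rule linf_eqI) (use vc t in \<open>simp_all add: a_def linf_expand algebra_simps\<close>)
  finally show ?thesis using that[of "sqrt t" s] t s by simp
qed

text \<open>Moving the centre from t to t + e leaves the difference unchanged and makes the bound
  strict, as \<open>herm_sqrt_near\<close> requires.\<close>

lemma pos_plus_eps_near:
  assumes "pos v" "e > 0"
  obtains t where "\<parallel>cst t \<ominus> (v \<oplus> cst e)\<parallel> < t"
proof -
  obtain t where t: "t \<ge> 0" "\<parallel>cst t \<ominus> v\<parallel> \<le> t" using assms by (auto simp: pos_def)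
  have "cst (t + e) \<ominus> (v \<oplus> cst e) = cst t \<ominus> v"
    by (rule linf_eqI) (use pos_carrier[OF assms(1)] in \<open>simp_all add: linf_expand algebra_simps\<close>)
  then show ?thesis using that[of "t + e"] t assms by simp
qed

lemma pos_sqrt_eps:
  assumes v: "pos v" "v \<in> bicomm b" "e > 0" and b: "b \<in> carrier A"
  obtains r where "herm r" "r \<in> bicomm b" "r \<otimes> r = v \<oplus> cst e"
proof -
  obtain t where t: "\<parallel>cst t \<ominus> (v \<oplus> cst e)\<parallel> < t" using pos_plus_eps_near v by blast
  have "herm (v \<oplus> cst e)" "v \<oplus> cst e \<in> bicomm b" using v pos_herm by (auto simp: herm_intros bicomm_intros)
  then obtain c s where s: "herm s" "s \<in> bicomm b"
    "cscale A (of_real c) (\<one> \<ominus> s) \<otimes> cscale A (of_real c) (\<one> \<ominus> s) = v \<oplus> cst e"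
    using herm_sqrt_near t b by metis
  then show ?thesis using that[of "cscale A (of_real c) (\<one> \<ominus> s)"] by (simp add: herm_intros bicomm_intros)
qed

text \<open>Here \<open>s + i r\<close> is a multiple of a unitary.\<close>

lemma nrm_commuting_squares:
  assumes s: "herm s" and r: "herm r" and sr: "s \<otimes> r = r \<otimes> s"
    and sum: "s \<otimes> s \<oplus> r \<otimes> r = cst K" and K: "K \<ge> 0"
  shows "\<parallel>s \<otimes> s\<parallel> \<le> K" "\<parallel>s \<otimes> s \<ominus> r \<otimes> r\<parallel> \<le> K"
proof -
  have c: "s \<in> carrier A" "r \<in> carrier A" and st: "adj A s = s" "adj A r = r" using s r by (auto simp: herm_def)
  define u where "u = s \<oplus> cscale A \<i> r"
  have uc: "u \<in> carrier A" using c by (simp add: u_def)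
  have su: "adj A u = s \<ominus> cscale A \<i> r" using c st by (simp add: u_def st_add st_sc a_minus_def minus_sc sc_sc)
  have "adj A u \<otimes> u = s \<otimes> s \<oplus> r \<otimes> r" unfolding su unfolding u_def
    by (rule linf_eqI) (use c sr in \<open>simp_all add: linf_expand algebra_simps\<close>)
  \<comment> \<open>Since adj u u = K, the C*-identity bounds the norm of u by the square root of
    K.\<close>
  then have "\<parallel>u\<parallel>\<^sup>2 \<le> K" using cstar_identity[OF uc] sum nrm_cst_le[of K] K by simp
  have "s = cscale A (1/2) (u \<oplus> adj A u)" unfolding su unfolding u_def
    by (rule linf_eqI) (use c sr in \<open>simp_all add: linf_expand algebra_simps\<close>)
  then have "\<parallel>s\<parallel> = 1/2 * \<parallel>u \<oplus> adj A u\<parallel>" using uc norm_scale[of "u \<oplus> adj A u" "1/2"] by simp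
  then have "\<parallel>s\<parallel> \<le> \<parallel>u\<parallel>" using norm_triangle[of u "adj A u"] uc by simp
  then show "\<parallel>s \<otimes> s\<parallel> \<le> K"
    using \<open>\<parallel>u\<parallel>\<^sup>2 \<le> K\<close> power_mono[OF _ norm_nonneg[OF c(1)], of "\<parallel>u\<parallel>" 2] by (simp add: nrm_sq[OF s])
  \<comment> \<open>This difference is the real part of u^2.\<close>
  have "s \<otimes> s \<ominus> r \<otimes> r = cscale A (1/2) (u \<otimes> u \<oplus> adj A u \<otimes> adj A u)" unfolding su unfolding u_def
    by (rule linf_eqI) (use c sr in \<open>simp_all add: linf_expand algebra_simps\<close>)
  then have "\<parallel>s \<otimes> s \<ominus> r \<otimes> r\<parallel> = 1/2 * \<parallel>u \<otimes> u \<oplus> adj A u \<otimes> adj A u\<parallel>"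
    using uc norm_scale[of "u \<otimes> u \<oplus> adj A u \<otimes> adj A u" "1/2"] by simp
  also have "\<dots> \<le> 1/2 * (\<parallel>u\<parallel> * \<parallel>u\<parallel> + \<parallel>u\<parallel> * \<parallel>u\<parallel>)"
    using norm_triangle[of "u \<otimes> u" "adj A u \<otimes> adj A u"] norm_mult[of u u] norm_mult[of "adj A u" "adj A u"] uc
    by simp
  finally show "\<parallel>s \<otimes> s \<ominus> r \<otimes> r\<parallel> \<le> K" using \<open>\<parallel>u\<parallel>\<^sup>2 \<le> K\<close> by (simp add: power2_eq_square)
qed

lemma complement_sqrt:
  assumes a: "herm a" "a \<in> bicomm b" "\<parallel>a\<parallel> < t" and b: "b \<in> carrier A"
  obtains r where "herm r" "r \<in> bicomm b" "r \<otimes> r = cst t \<ominus> a"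
proof -
  have ac: "a \<in> carrier A" using a by (simp add: herm_def)
  have "cst t \<ominus> (cst t \<ominus> a) = a" using ac by (simp add: a_minus_def minus_add r_neg2)
  moreover have "herm (cst t \<ominus> a)" "cst t \<ominus> a \<in> bicomm b" using a by (auto simp: herm_intros bicomm_intros)
  ultimately obtain c s where s: "herm s" "s \<in> bicomm b"
    "cscale A (of_real c) (\<one> \<ominus> s) \<otimes> cscale A (of_real c) (\<one> \<ominus> s) = cst t \<ominus> a"
    using herm_sqrt_near[of "cst t \<ominus> a" b t] a b by metis
  then show ?thesis using that[of "cscale A (of_real c) (\<one> \<ominus> s)"] by (simp add: herm_intros bicomm_intros)
qed

text \<open>For t > ||s^2|| take r with r^2 = t - s^2. Then s^2 + r^2 = t with s and r commuting, so
  ||t - s^2|| = ||r^2|| \<le> t, which is positivity of s^2.\<close>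

lemma pos_sq: assumes s: "herm s" shows "pos (s \<otimes> s)"
proof -
  have sc: "s \<in> carrier A" using s by (simp add: herm_def)
  define t where "t = \<parallel>s \<otimes> s\<parallel> + 1"
  have t: "t > 0" "\<parallel>s \<otimes> s\<parallel> < t" using norm_nonneg[of "s \<otimes> s"] sc by (auto simp: t_def)
  obtain r where r: "herm r" "r \<in> bicomm s" "r \<otimes> r = cst t \<ominus> s \<otimes> s"
    using complement_sqrt[of "s \<otimes> s" s t] s sc t by (metis herm_sq bicomm_mult bicomm_self)
  have rc: "r \<in> carrier A" using r by (simp add: herm_def)
  have "r \<otimes> r \<oplus> s \<otimes> s = cst t" unfolding r(3) using sc by (simp add: a_minus_def a_assoc l_neg)
  then have "\<parallel>r \<otimes> r\<parallel> \<le> t"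
    using nrm_commuting_squares(1)[OF r(1) s _ _ less_imp_le[OF t(1)]] bicomm_commute[OF r(2) bicomm_self sc] sc by simp
  then show ?thesis using t s r(3) by (auto simp: pos_def herm_sq intro!: exI[of _ t])
qed

text \<open>With roots q^2 = K + u + e and r^2 = K - u + e the sum is scalar and the difference is 2
  u; \<open>nrm_commuting_squares\<close> bounds the latter.\<close>

lemma nrm_le_of_pos:
  assumes u: "herm u" and p: "pos (cst K \<ominus> u)" "pos (cst K \<oplus> u)" and K: "K \<ge> 0"
  shows "\<parallel>u\<parallel> \<le> K"
proof (rule field_le_epsilon)
  fix e :: real assume e: "e > 0"
  have c: "u \<in> carrier A" using u by (simp add: herm_def)
  obtain r where r: "herm r" "r \<in> bicomm u" "r \<otimes> r = cst K \<ominus> u \<oplus> cst e"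
    using pos_sqrt_eps[OF p(1) _ e, of u] c by (auto simp: bicomm_intros)
  obtain q where q: "herm q" "q \<in> bicomm u" "q \<otimes> q = cst K \<oplus> u \<oplus> cst e"
    using pos_sqrt_eps[OF p(2) _ e, of u] c by (auto simp: bicomm_intros)
  have "q \<otimes> q \<oplus> r \<otimes> r = cst (2 * (K + e))" unfolding r(3) q(3)
    by (rule linf_eqI) (use c in \<open>simp_all add: linf_expand algebra_simps\<close>)
  then have "\<parallel>q \<otimes> q \<ominus> r \<otimes> r\<parallel> \<le> 2 * (K + e)"
    using nrm_commuting_squares(2)[OF q(1) r(1) bicomm_commute[OF q(2) r(2) c]] e K by simp
  moreover have "q \<otimes> q \<ominus> r \<otimes> r = cscale A 2 u" unfolding r(3) q(3)
    by (rule linf_eqI) (use c in \<open>simp_all add: linf_expand algebra_simps\<close>)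
  ultimately show "\<parallel>u\<parallel> \<le> K + e" using c by (simp add: norm_scale)
qed

text \<open>Every t above the norm is a witness for positivity, not merely some t. This uniformity
  is what makes the positive elements closed.\<close>

lemma pos_nrm_bound: assumes w: "pos w" "\<parallel>w\<parallel> \<le> t" shows "\<parallel>cst t \<ominus> w\<parallel> \<le> t"
proof (rule nrm_le_of_pos)
  have c: "w \<in> carrier A" and h: "herm w" using w pos_carrier pos_herm by auto
  show t: "t \<ge> 0" using norm_nonneg[OF c] w by simp
  show "herm (cst t \<ominus> w)" using h by (simp add: herm_intros)
  have "cst t \<ominus> (cst t \<ominus> w) = w" using c by (simp add: a_minus_def minus_add r_neg2)
  then show "pos (cst t \<ominus> (cst t \<ominus> w))" using w by simp
  show "pos (cst t \<oplus> (cst t \<ominus> w))" by (intro pos_add pos_cst pos_cst_minus t h w)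
qed

lemma pos_closed:
  assumes v: "herm v" and ap: "\<And>e. e > 0 \<Longrightarrow> \<exists>w. pos w \<and> \<parallel>v \<ominus> w\<parallel> \<le> e"
  shows "pos v"
proof -
  have c: "v \<in> carrier A" using v by (simp add: herm_def)
  define t where "t = \<parallel>v\<parallel> + 1"
  have t: "t \<ge> 0" using norm_nonneg[OF c] by (simp add: t_def)
  have "\<parallel>cst t \<ominus> v\<parallel> \<le> t"
  proof (rule field_le_epsilon)
    fix e :: real assume "e > 0"
    then obtain w where w: "pos w" "\<parallel>v \<ominus> w\<parallel> \<le> e" "\<parallel>v \<ominus> w\<parallel> \<le> 1" using ap[of "min e 1"] by auto
    have wc: "w \<in> carrier A" using w pos_carrier by blast
    have "\<parallel>w\<parallel> \<le> t" using nrm_diff_ge[OF c wc] w(3) by (simp add: t_def)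
    then show "\<parallel>cst t \<ominus> v\<parallel> \<le> t + e"
      using pos_nrm_bound[OF w(1)] nrm_triangle3[of "cst t" w v] nrm_diff_commute[OF c wc] w(2) wc c by fastforce
  qed
  then show ?thesis using v t by (auto simp: pos_def)
qed

text \<open>With m the root of b^2 + \<delta>, the element r^2 = m - b approximates |b| - b, twice
  the negative part of b. Then r^2 + 2 b = m + b is again a square, and r^4 + 2 r^2 b = m^2 - b^2 =
  \<delta>.\<close>

lemma commuting_halves:
  assumes b: "herm b" and d: "\<delta> > 0"
  obtains r q where "herm r" "r \<in> bicomm b" "pos (r \<otimes> r \<oplus> cscale A 2 b)"
    "r \<otimes> r \<otimes> (r \<otimes> r) \<oplus> cscale A 2 (r \<otimes> r \<otimes> b) = cst \<delta>"
proof -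
  have bc: "b \<in> carrier A" using b by (simp add: herm_def)
  note comm = bicomm_commute[of _ b, OF _ _ bc]
  obtain t where "\<parallel>cst t \<ominus> (b \<otimes> b \<oplus> cst \<delta>)\<parallel> < t" using pos_plus_eps_near[OF pos_sq[OF b] d] by blast
  moreover have "herm (b \<otimes> b \<oplus> cst \<delta>)" "b \<otimes> b \<oplus> cst \<delta> \<in> bicomm b"
    using b bc by (auto simp: herm_intros bicomm_intros)
  ultimately obtain c s where s: "c > 0" "herm s" "s \<in> bicomm b" "\<parallel>s\<parallel> < 1"
    and mm: "cscale A (of_real c) (\<one> \<ominus> s) \<otimes> cscale A (of_real c) (\<one> \<ominus> s) = b \<otimes> b \<oplus> cst \<delta>"
    using herm_sqrt_near[of "b \<otimes> b \<oplus> cst \<delta>" b t] bc by metis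
  define m where "m = cscale A (of_real c) (\<one> \<ominus> s)"
  obtain s' where s': "herm s'" "s' \<in> bicomm b" "\<parallel>s'\<parallel> < 1" "(\<one> \<ominus> s') \<otimes> (\<one> \<ominus> s') = \<one> \<ominus> s"
    using herm_sqrt_one_minus[OF s(2-4) bc] by metis
  \<comment> \<open>As m = c (1 - s) and (1 - s')^2 = 1 - s, the inverse x of 1 - s' satisfies x^2 m
    = c: a commuting square root of c times the inverse of m.\<close>
  obtain x where x: "herm x" "x \<in> bicomm b" "x \<otimes> (\<one> \<ominus> s') = \<one>" using neumann_inverse[OF s'(1-3) bc] by metis
  have cc: "s \<in> carrier A" "s' \<in> carrier A" "x \<in> carrier A" "m \<in> carrier A"
    using s s' x by (auto simp: herm_def m_def)
  have mh: "herm m" "m \<in> bicomm b" using s by (auto simp: m_def herm_intros bicomm_intros)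
  have "x \<otimes> x \<otimes> (\<one> \<ominus> s) = x \<otimes> (x \<otimes> (\<one> \<ominus> s')) \<otimes> (\<one> \<ominus> s')" using cc by (simp add: m_assoc flip: s'(4))
  also have "\<dots> = \<one>" using x cc by simp
  finally have xx: "x \<otimes> x \<otimes> (\<one> \<ominus> s) = \<one>" .
  have xm: "x \<otimes> x \<otimes> m = cst c" using cc xx by (simp add: m_def sc_mult_right)
  \<comment> \<open>From m^2 = f^2 + \<delta> follows (m - f)^2 + \<delta> = 2 m (m - f). The left
    side has a root k by \<open>pos_sqrt_eps\<close>, and multiplying by x cancels m: (x k)^2 = 2 c
    (m - f). It is applied to f = b and f = -b.\<close>
  have half: "\<exists>r. herm r \<and> r \<in> bicomm b \<and> r \<otimes> r = m \<ominus> f"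
    if f: "herm f" "f \<in> bicomm b" "f \<otimes> f = b \<otimes> b" for f
  proof -
    have fc: "f \<in> carrier A" using f by (simp add: herm_def)
    have n: "herm (m \<ominus> f)" "m \<ominus> f \<in> bicomm b" using mh f by (auto simp: herm_intros bicomm_intros)
    obtain k where k: "herm k" "k \<in> bicomm b" "k \<otimes> k = (m \<ominus> f) \<otimes> (m \<ominus> f) \<oplus> cst \<delta>"
      using pos_sqrt_eps[OF pos_sq[OF n(1)] bicomm_mult[OF n(2) n(2)] d bc] by metis
    have kc: "k \<in> carrier A" using k by (simp add: herm_def)
    have "k \<otimes> k = cscale A 2 (m \<otimes> (m \<ominus> f))"
    proof (unfold k(3), rule linf_eqI)
      fix g assume g: "linf g"
      have "g (m \<otimes> m) = g (f \<otimes> f) + \<delta> * g \<one>" using mm g bc fc by (simp add: m_def[symmetric] f(3) linf_simps)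
      moreover have "f \<otimes> m = m \<otimes> f" using comm f mh by blast
      ultimately show "g ((m \<ominus> f) \<otimes> (m \<ominus> f) \<oplus> cst \<delta>) = g (cscale A 2 (m \<otimes> (m \<ominus> f)))"
        using g cc fc by (simp add: linf_expand algebra_simps)
    qed (use cc fc in auto)
    then have kk: "x \<otimes> x \<otimes> (k \<otimes> k) = cscale A (2 * of_real c) (m \<ominus> f)"
      using xm cc fc by (simp add: sc_mult_right sc_mult_left sc_sc m_assoc[symmetric])
    define r where "r = cscale A (of_real (1 / sqrt (2 * c))) (x \<otimes> k)"
    have xk: "x \<otimes> k = k \<otimes> x" using comm x k by blast
    have "x \<otimes> k \<otimes> (x \<otimes> k) = x \<otimes> (k \<otimes> x) \<otimes> k" using cc kc by (simp add: m_assoc)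
    also have "\<dots> = x \<otimes> x \<otimes> (k \<otimes> k)" unfolding xk[symmetric] using cc kc by (simp add: m_assoc)
    finally have "r \<otimes> r = cscale A (of_real (1 / (2 * c))) (x \<otimes> x \<otimes> (k \<otimes> k))"
      using cc kc s(1) by (simp add: r_def sc_mult_right sc_mult_left sc_sc flip: of_real_mult)
    also have "\<dots> = m \<ominus> f" unfolding kk using cc fc s(1) by (simp add: sc_sc)
    finally have "r \<otimes> r = m \<ominus> f" .
    moreover have "herm r" "r \<in> bicomm b" unfolding r_def
      using herm_sc[OF herm_mult[OF x(1) k(1) xk]] x k by (auto intro: bicomm_intros simp del: of_real_divide)
    ultimately show ?thesis by blast
  qed
  obtain r where r: "herm r" "r \<in> bicomm b" "r \<otimes> r = m \<ominus> b"
    using half[of b] b bc by (auto simp: bicomm_self)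
  obtain q where q: "herm q" "q \<otimes> q = m \<ominus> (\<ominus> b)"
    using half[of "\<ominus> b"] b bc by (auto simp: bicomm_intros herm_intros l_minus r_minus)
  have "r \<otimes> r \<oplus> cscale A 2 b = q \<otimes> q" unfolding r(3) q(2)
    by (rule linf_eqI) (use bc cc in \<open>simp_all add: linf_expand algebra_simps\<close>)
  then have 1: "pos (r \<otimes> r \<oplus> cscale A 2 b)" using pos_sq[OF q(1)] by simp
  have 2: "r \<otimes> r \<otimes> (r \<otimes> r) \<oplus> cscale A 2 (r \<otimes> r \<otimes> b) = cst \<delta>"
  proof (unfold r(3), rule linf_eqI)
    fix g assume g: "linf g"
    have "g (m \<otimes> m) = g (b \<otimes> b) + \<delta> * g \<one>" using mm g bc by (simp add: m_def[symmetric] linf_simps)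
    moreover have "b \<otimes> m = m \<otimes> b" using comm bicomm_self[OF bc] mh by blast
    ultimately show "g ((m \<ominus> b) \<otimes> (m \<ominus> b) \<oplus> cscale A 2 ((m \<ominus> b) \<otimes> b)) = g (cst \<delta>)"
      using g cc bc by (simp add: linf_expand algebra_simps)
  qed (use cc bc in auto)
  show ?thesis using that[OF r(1,2) 1 2] .
qed

text \<open>Fukamiya's theorem.  If \<open>b = a\<^sup>* a\<close> and \<open>n\<close> approximates twice the negative part of \<open>b\<close>, then for
  \<open>e = a n\<^sup>3\<^sup>/\<^sup>2\<close> both \<open>- e\<^sup>* e\<close> and \<open>- e e\<^sup>*\<close> are approximately squares, whereas
  \<open>e\<^sup>* e + e e\<^sup>*\<close> is positive; so \<open>e\<close> is small.\<close>

theorem pos_star_mult: assumes a: "a \<in> carrier A" shows "pos (adj A a \<otimes> a)"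
proof (rule pos_closed)
  define b where "b = adj A a \<otimes> a"
  have bh: "herm b" using a by (simp add: b_def herm_square)
  then have bc: "b \<in> carrier A" by (simp add: herm_def)
  show "herm (adj A a \<otimes> a)" using bh by (simp add: b_def)
  fix \<epsilon> :: real assume \<epsilon>: "\<epsilon> > 0"
  \<comment> \<open>The final estimate bounds ||n||^2 by a multiple of \<delta>, so \<delta> is of
    the order of \<epsilon> squared.\<close>
  define \<delta> where "\<delta> = \<epsilon>\<^sup>2"
  have \<delta>: "\<delta> > 0" using \<epsilon> by (simp add: \<delta>_def)
  obtain r where r: "herm r" "r \<in> bicomm b" and p: "pos (r \<otimes> r \<oplus> cscale A 2 b)"
    and nn: "r \<otimes> r \<otimes> (r \<otimes> r) \<oplus> cscale A 2 (r \<otimes> r \<otimes> b) = cst \<delta>"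
    using commuting_halves[OF bh \<delta>] by metis
  define n where "n = r \<otimes> r"
  have rc: "r \<in> carrier A" and nc: "n \<in> carrier A" using r by (auto simp: herm_def n_def)
  have nh: "herm n" and nb: "n \<in> bicomm b" using r bc by (auto simp: n_def herm_intros bicomm_intros)
  have br: "b \<otimes> r = r \<otimes> b" "b \<otimes> n = n \<otimes> b" using bicomm_commute[OF bicomm_self[OF bc] _ bc] r nb by auto
  \<comment> \<open>The relation n^2 + 2 n b = \<delta> solved for n b; it eliminates b from all
    later expressions.\<close>
  have nb2: "n \<otimes> b = cscale A (1/2) (cst \<delta> \<ominus> n \<otimes> n)"
  proof (rule linf_eqI)
    fix g assume g: "linf g"
    have "g (n \<otimes> n) + 2 * g (n \<otimes> b) = \<delta> * g \<one>"
      using arg_cong[OF nn, of g] g bc nc by (simp add: n_def[symmetric] linf_simps)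
    then show "g (n \<otimes> b) = g (cscale A (1/2) (cst \<delta> \<ominus> n \<otimes> n))"
      using g bc nc by (simp add: linf_simps field_simps)
  qed (use bc nc in auto)
  \<comment> \<open>As r is a root of n, this is the element a n^(3/2).\<close>
  define e where "e = a \<otimes> (r \<otimes> n)"
  have ec: "e \<in> carrier A" using a rc nc by (simp add: e_def)
  define w where "w = a \<otimes> n \<otimes> adj A a"
  have wh: "herm w" using herm_conj[OF a nh] by (simp add: w_def)
  then have wc: "w \<in> carrier A" by (simp add: herm_def)
  have rn: "r \<otimes> n = n \<otimes> r" using rc by (simp add: n_def m_assoc)
  have "adj A e = n \<otimes> r \<otimes> adj A a" using a rc nc herm_st[OF r(1)] herm_st[OF nh] by (simp add: e_def st_mult)
  then have "adj A e \<otimes> e = n \<otimes> (r \<otimes> b \<otimes> r) \<otimes> n"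
    using a rc nc by (simp add: e_def b_def m_assoc)
  also have "r \<otimes> b \<otimes> r = n \<otimes> b" using rc bc br by (metis m_assoc n_def)
  also have "n \<otimes> (n \<otimes> b) \<otimes> n = n \<otimes> (n \<otimes> b \<otimes> n)" using nc bc by (simp add: m_assoc)
  finally have ee1: "adj A e \<otimes> e = n \<otimes> (n \<otimes> b \<otimes> n)" .
  have "e \<otimes> adj A e = a \<otimes> (r \<otimes> n \<otimes> (n \<otimes> r)) \<otimes> adj A a"
    using a rc nc herm_st[OF r(1)] herm_st[OF nh] by (simp add: e_def st_mult m_assoc)
  also have "r \<otimes> n \<otimes> (n \<otimes> r) = n \<otimes> n \<otimes> n" using rc nc rn by (metis m_assoc m_closed n_def)
  finally have ee2: "e \<otimes> adj A e = a \<otimes> (n \<otimes> n \<otimes> n) \<otimes> adj A a" .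
  have ww: "w \<otimes> w = a \<otimes> (n \<otimes> b \<otimes> n) \<otimes> adj A a" using a nc by (simp add: w_def b_def m_assoc)
  \<comment> \<open>Completion of squares. By \<open>nb2\<close>, adj e e = (\<delta> n^2 - n^4) / 2
    and e adj e = \<delta> w - 2 w^2, that is, \<delta>^2/8 - s1^2/2 and \<delta>^2/8 - 2
    s2^2.\<close>
  define s1 where "s1 = n \<otimes> n \<ominus> cst (\<delta>/2)"
  define s2 where "s2 = w \<ominus> cst (\<delta>/4)"
  have sh: "herm s1" "herm s2" using nh wh by (auto simp: s1_def s2_def herm_intros simp del: of_real_divide)
  then have sc: "s1 \<in> carrier A" "s2 \<in> carrier A" by (auto simp: herm_def)
  define x where "x = cscale A (1/2) (e \<oplus> adj A e)"
  define y where "y = cscale A (\<i>/2) (adj A e \<ominus> e)"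
  have xyc: "x \<in> carrier A" "y \<in> carrier A" using ec by (auto simp: x_def y_def)
  have "adj A x = x" "adj A y = y" unfolding x_def y_def
    by (rule linf_eqI, use ec in \<open>simp_all add: st_sc st_add a_minus_def minus_sc linf_simps algebra_simps\<close>)+
  then have xyh: "herm x" "herm y" using xyc by (auto simp: herm_def)
  have exy: "e = x \<oplus> cscale A \<i> y" unfolding x_def y_def
    by (rule linf_eqI) (use ec in \<open>simp_all add: linf_expand field_simps\<close>)
  define P where "P = cscale A (of_real (1/2)) (s1 \<otimes> s1) \<oplus> cscale A (of_real 2) (s2 \<otimes> s2)"
  have Pp: "pos P" unfolding P_def by (intro pos_add pos_sc pos_sq sh) auto
  have Pc: "P \<in> carrier A" by (rule pos_carrier[OF Pp])
  \<comment> \<open>With e = x + i y, the sum adj e e + e adj e equals 2 x^2 + 2 y^2; the completed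
    squares make it \<delta>^2/4 minus the positive element P.\<close>
  have sum: "cscale A 2 (x \<otimes> x) \<oplus> cscale A 2 (y \<otimes> y) = cst (\<delta>\<^sup>2/4) \<ominus> P"
  proof (rule linf_eqI)
    fix g assume g: "linf g"
    have h1: "g (cscale A 2 (x \<otimes> x) \<oplus> cscale A 2 (y \<otimes> y)) = g (adj A e \<otimes> e) + g (e \<otimes> adj A e)"
      using g ec unfolding x_def y_def by (simp add: linf_expand field_simps)
    have h2: "g (adj A e \<otimes> e) = (\<delta> * g (n \<otimes> n) - g (n \<otimes> (n \<otimes> (n \<otimes> n)))) / 2"
      unfolding ee1 nb2 using g nc by (simp add: linf_expand field_simps)
    have "g (w \<otimes> w) = (\<delta> * g w - g (e \<otimes> adj A e)) / 2"
      unfolding ee2 ww nb2 using g nc a by (simp add: w_def linf_expand field_simps)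
    then have h3: "g (e \<otimes> adj A e) = \<delta> * g w - 2 * g (w \<otimes> w)" by (simp add: field_simps)
    have h4: "g P = (g (n \<otimes> (n \<otimes> (n \<otimes> n))) - \<delta> * g (n \<otimes> n) + \<delta>\<^sup>2/4 * g \<one>) / 2
        + 2 * (g (w \<otimes> w) - \<delta> / 2 * g w + \<delta>\<^sup>2/16 * g \<one>)"
      using g sc nc wc unfolding P_def s1_def s2_def by (simp add: linf_expand field_simps power2_eq_square)
    show "g (cscale A 2 (x \<otimes> x) \<oplus> cscale A 2 (y \<otimes> y)) = g (cst (\<delta>\<^sup>2/4) \<ominus> P)"
      unfolding h1 h2 h3 using g Pc by (simp add: linf_simps h4 field_simps power2_eq_square)
  qed (use xyc Pc in auto)
  \<comment> \<open>Hence 0 \<le> 2 z^2 \<le> \<delta>^2/4 for each of the two parts, and a norm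
    bound by \<open>nrm_le_of_pos\<close>.\<close>
  have small: "\<parallel>z\<parallel> \<le> \<delta> / 2 * (1 / sqrt 2)" if z: "herm z" "herm z'"
    and s: "cscale A 2 (z \<otimes> z) \<oplus> cscale A 2 (z' \<otimes> z') = cst (\<delta>\<^sup>2/4) \<ominus> P" for z z'
  proof -
    have zc: "z \<in> carrier A" "z' \<in> carrier A" using z by (auto simp: herm_def)
    have "\<parallel>cscale A (of_real 2) (z \<otimes> z)\<parallel> \<le> \<delta>\<^sup>2/4"
    proof (rule nrm_le_of_pos)
      have eq: "cst (\<delta>\<^sup>2/4) \<ominus> cscale A (of_real 2) (z \<otimes> z) = P \<oplus> cscale A (of_real 2) (z' \<otimes> z')"
      proof (rule linf_eqI)
        fix g assume g: "linf g"
        show "g (cst (\<delta>\<^sup>2/4) \<ominus> cscale A (of_real 2) (z \<otimes> z)) = g (P \<oplus> cscale A (of_real 2) (z' \<otimes> z'))"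
          using arg_cong[OF s, of g] g zc Pc by (simp add: linf_simps algebra_simps)
      qed (use zc Pc in auto)
      show "pos (cst (\<delta>\<^sup>2/4) \<ominus> cscale A (of_real 2) (z \<otimes> z))" unfolding eq
        by (intro pos_add Pp pos_sc pos_sq z) auto
      show "pos (cst (\<delta>\<^sup>2/4) \<oplus> cscale A (of_real 2) (z \<otimes> z))"
        by (intro pos_add pos_cst pos_sc pos_sq z) auto
      show "herm (cscale A (of_real 2) (z \<otimes> z))" by (intro herm_sc herm_sq z)
    qed simp
    then have "\<parallel>z\<parallel>\<^sup>2 \<le> (\<delta> / 2 * (1 / sqrt 2))\<^sup>2"
      using zc nrm_sq[OF z(1)] by (simp add: norm_scale power_mult_distrib power_divide)
    then show ?thesis by (rule power2_le_imp_le) (use \<delta> in simp)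
  qed
  have "\<parallel>e\<parallel> \<le> \<parallel>x\<parallel> + \<parallel>y\<parallel>" using norm_triangle[of x "cscale A \<i> y"] xyc by (simp add: exy[symmetric] norm_scale)
  also have "\<dots> \<le> \<delta> * (1 / sqrt 2)"
    using small[OF xyh(1,2) sum] small[OF xyh(2,1)] sum xyc by (simp add: a_comm)
  finally have "\<parallel>e\<parallel>\<^sup>2 \<le> (\<delta> * (1 / sqrt 2))\<^sup>2" using norm_nonneg[OF ec] by (intro power_mono)
  then have e2: "\<parallel>adj A e \<otimes> e\<parallel> \<le> \<delta>\<^sup>2 / 2" using ec by (simp add: cstar_identity power_mult_distrib power_divide)
  \<comment> \<open>The formula for adj e e read backwards: a small e forces n^4 to be nearly
    \<delta> n^2, which bounds n.\<close>
  have "n \<otimes> n \<otimes> (n \<otimes> n) = cscale A (of_real \<delta>) (n \<otimes> n) \<ominus> cscale A 2 (adj A e \<otimes> e)"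
    unfolding ee1 nb2 by (rule linf_eqI) (use nc in \<open>simp_all add: linf_expand field_simps\<close>)
  then have "\<parallel>n \<otimes> n \<otimes> (n \<otimes> n)\<parallel> \<le> \<delta> * \<parallel>n \<otimes> n\<parallel> + 2 * \<parallel>adj A e \<otimes> e\<parallel>"
    using nrm_diff_le[of "cscale A (of_real \<delta>) (n \<otimes> n)" "cscale A 2 (adj A e \<otimes> e)"] nc ec \<delta> by (simp add: norm_scale)
  then have q: "(\<parallel>n\<parallel>\<^sup>2)\<^sup>2 \<le> \<delta> * \<parallel>n\<parallel>\<^sup>2 + \<delta>\<^sup>2" using e2 nrm_sq[OF nh] nrm_sq[OF herm_sq[OF nh]] by simp
  have "\<parallel>n\<parallel>\<^sup>2 \<le> (2 * \<epsilon>)\<^sup>2"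
  proof (rule ccontr)
    assume "\<not> ?thesis"
    moreover have "(2 * \<epsilon>)\<^sup>2 = 4 * \<delta>" by (simp add: \<delta>_def power_mult_distrib)
    ultimately have *: "\<parallel>n\<parallel>\<^sup>2 > 2 * \<delta>" using \<delta> by linarith
    have "\<parallel>n\<parallel>\<^sup>2 * \<parallel>n\<parallel>\<^sup>2 \<ge> 2 * \<delta> * \<parallel>n\<parallel>\<^sup>2" using * by (intro mult_right_mono) auto
    moreover have "\<delta> * \<parallel>n\<parallel>\<^sup>2 > \<delta> * \<delta>" using * \<delta> by (intro mult_strict_left_mono) auto
    ultimately show False using q by (simp add: power2_eq_square)
  qed
  then have nle: "\<parallel>n\<parallel> \<le> 2 * \<epsilon>" by (rule power2_le_imp_le) (use \<epsilon> in simp)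
  \<comment> \<open>The positive approximant is b + n/2, half of the square n + 2 b supplied by
    \<open>commuting_halves\<close>.\<close>
  have "b \<ominus> cscale A (of_real (1/2)) (n \<oplus> cscale A 2 b) = cscale A (- 1/2) n"
    by (rule linf_eqI) (use nc bc in \<open>simp_all add: linf_simps field_simps\<close>)
  then have "\<parallel>b \<ominus> cscale A (of_real (1/2)) (n \<oplus> cscale A 2 b)\<parallel> \<le> \<epsilon>" using nle nc by (simp add: norm_scale)
  moreover have "pos (cscale A (of_real (1/2)) (n \<oplus> cscale A 2 b))" using p by (intro pos_sc) (auto simp: n_def)
  ultimately show "\<exists>w. pos w \<and> \<parallel>adj A a \<otimes> a \<ominus> w\<parallel> \<le> \<epsilon>" by (auto simp: b_def)
qed

text \<open>An exact identity in place of the inequality adj a a \<le> K. It is the source of all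
  boundedness estimates for states, GNS operators and tensors below.\<close>

lemma star_mult_complement:
  assumes a: "a \<in> carrier A" and K: "K > \<parallel>a\<parallel>\<^sup>2"
  obtains s where "s \<in> carrier A" "adj A a \<otimes> a \<oplus> adj A s \<otimes> s = cst K"
proof -
  obtain s where s: "herm s" "s \<otimes> s = cst K \<ominus> adj A a \<otimes> a"
    using complement_sqrt[of "adj A a \<otimes> a" "adj A a \<otimes> a" K] herm_square[OF a] a K
    by (metis bicomm_self cstar_identity m_closed st_closed)
  have "adj A a \<otimes> a \<oplus> (cst K \<ominus> adj A a \<otimes> a) = cst K"
    by (rule linf_eqI) (use a in \<open>simp_all add: linf_simps\<close>)
  then show ?thesis using that[of s] s by (auto simp: herm_def)
qed

text \<open>Only the values of g on self-adjoint elements are used: \<phi> is the complex extension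
  g (Re a) + i g (Im a) of that restriction, and so agrees with g there.\<close>

lemma states_of_real_linf:
  assumes g: "real_linf g" "g \<one> = 1" "\<And>a. a \<in> carrier A \<Longrightarrow> g (adj A a \<otimes> a) \<ge> 0"
  obtains \<phi> where "\<phi> \<in> states A" "\<And>v. herm v \<Longrightarrow> \<phi> v = of_real (g v)"
proof
  define re where "re a = cscale A (1/2) (a \<oplus> adj A a)" for a
  define im where "im a = cscale A (\<i>/2) (adj A a \<ominus> a)" for a
  define \<phi> where "\<phi> = (\<lambda>a\<in>carrier A. of_real (g (re a)) + \<i> * of_real (g (im a)))"
  have c: "re a \<in> carrier A" "im a \<in> carrier A" if "a \<in> carrier A" for a using that by (auto simp: re_def im_def)
  have add: "g (a \<oplus> b) = g a + g b" if "a \<in> carrier A" "b \<in> carrier A" for a b using g that by (simp add: real_linf_def)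
  have sc: "g (cscale A (of_real t) a) = t * g a" if "a \<in> carrier A" for a t using g that by (simp add: real_linf_def)
  have g0: "g \<zero> = 0" using sc[of \<zero> 0] by simp
  show herm: "\<phi> v = of_real (g v)" if "herm v" for v
  proof -
    have "re v = v" by (rule linf_eqI) (use that in \<open>simp_all add: re_def herm_def linf_simps\<close>)
    moreover have "im v = \<zero>" by (rule linf_eqI) (use that in \<open>simp_all add: im_def herm_def linf_simps\<close>)
    ultimately show ?thesis using that by (simp add: \<phi>_def herm_def g0)
  qed
  have "\<phi> (a \<oplus> b) = \<phi> a + \<phi> b" if ab: "a \<in> carrier A" "b \<in> carrier A" for a b
  proof -
    have "re (a \<oplus> b) = re a \<oplus> re b" "im (a \<oplus> b) = im a \<oplus> im b" unfolding re_def im_def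
      by (rule linf_eqI, use ab in \<open>simp_all add: linf_simps st_add algebra_simps add_divide_distrib\<close>)+
    then show ?thesis using ab c by (simp add: \<phi>_def add algebra_simps)
  qed
  moreover have "\<phi> (cscale A z a) = z * \<phi> a" if a: "a \<in> carrier A" for z a
  proof -
    have e: "re (cscale A z a) = cscale A (of_real (Re z)) (re a) \<oplus> cscale A (of_real (- Im z)) (im a)"
      "im (cscale A z a) = cscale A (of_real (Re z)) (im a) \<oplus> cscale A (of_real (Im z)) (re a)" unfolding re_def im_def
      by (rule linf_eqI, use a in \<open>simp_all add: linf_simps st_sc complex_eq_iff add_divide_distrib diff_divide_distrib algebra_simps\<close>)+
    have "g (re (cscale A z a)) = Re z * g (re a) - Im z * g (im a)"
      "g (im (cscale A z a)) = Re z * g (im a) + Im z * g (re a)"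
      unfolding e using c[OF a] by (simp_all only: add sc sc_closed)
    then show ?thesis using a by (simp add: \<phi>_def complex_eq_iff algebra_simps)
  qed
  moreover have "\<phi> \<one> = 1" using herm[OF herm_one] g by simp
  moreover have "\<phi> (adj A a \<otimes> a) \<in> \<real>\<^sub>\<ge>\<^sub>0" if "a \<in> carrier A" for a using herm[OF herm_square[OF that]] g(3)[OF that] by simp
  ultimately show "\<phi> \<in> states A" by (simp add: states_def \<phi>_def)
qed

text \<open>For u = adj c c, positivity gives ||1 + u|| = 1 + ||u||. A functional of norm at most
  one attaining its norm at 1 + u must therefore attain it at 1 and at u simultaneously, and g 1 = 1
  makes it positive.\<close>

theorem norming_state:
  assumes nz: "\<one> \<noteq> \<zero>" and c: "c \<in> carrier A"
  obtains \<phi> where "\<phi> \<in> states A" "\<phi> (adj A c \<otimes> c) = of_real (\<parallel>c\<parallel>\<^sup>2)"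
proof -
  define u where "u = adj A c \<otimes> c"
  have up: "pos u" using c by (simp add: u_def pos_star_mult)
  have uc: "u \<in> carrier A" and uh: "herm u" using up pos_carrier pos_herm by auto
  have n1: "\<parallel>\<one>\<parallel> = 1"
  proof -
    have "\<parallel>\<one>\<parallel> * \<parallel>\<one>\<parallel> = \<parallel>\<one>\<parallel>" using cstar_identity[of \<one>] by (simp add: power2_eq_square)
    then show ?thesis using nz nrm_zeroD[of \<one>] by auto
  qed
  \<comment> \<open>From 1 + u \<le> l follows 0 \<le> u \<le> l - 1, hence ||u|| \<le> l - 1, the
    nontrivial half of the norm identity.\<close>
  define l where "l = \<parallel>\<one> \<oplus> u\<parallel>"
  have e1: "cst l \<ominus> (\<one> \<oplus> u) = cst (l - 1) \<ominus> u"
    by (rule linf_eqI) (use uc in \<open>simp_all add: linf_simps algebra_simps\<close>)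
  have p1: "pos (cst (l - 1) \<ominus> u)"
    using pos_cst_minus[of "\<one> \<oplus> u" l] uh by (simp add: l_def herm_intros e1[unfolded l_def])
  have "cst (l - 1) \<ominus> u \<oplus> u = cst (l - 1)" using uc by (simp add: a_minus_def a_assoc l_neg)
  then have "pos (cst (l - 1))" using pos_add[OF p1 up] by simp
  then obtain t where "t \<ge> 0" "\<parallel>cst t \<ominus> cst (l - 1)\<parallel> \<le> t" by (auto simp: pos_def)
  moreover have "cst t \<ominus> cst (l - 1) = cst (t - (l - 1))"
    by (rule linf_eqI) (simp_all add: linf_simps algebra_simps)
  ultimately have l1: "l \<ge> 1" using n1 by (simp add: norm_scale flip: of_real_diff)
  have "\<parallel>u\<parallel> \<le> l - 1" using l1 by (intro nrm_le_of_pos[OF uh p1 pos_add[OF pos_cst up]]) auto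
  then have l: "l = 1 + \<parallel>u\<parallel>" using norm_triangle[of \<one> u] uc n1 by (simp add: l_def)
  obtain g where g: "real_linf g" "\<And>a. a \<in> carrier A \<Longrightarrow> g a \<le> \<parallel>a\<parallel>" "g (\<one> \<oplus> u) = \<parallel>\<one> \<oplus> u\<parallel>"
    using hahn_banach[OF sublin_nrm, of "\<one> \<oplus> u"] uc by auto
  have add: "g (a \<oplus> b) = g a + g b" if "a \<in> carrier A" "b \<in> carrier A" for a b using g that by (simp add: real_linf_def)
  have sc: "g (cscale A (of_real t) a) = t * g a" if "a \<in> carrier A" for a t using g that by (simp add: real_linf_def)
  have "g \<one> + g u = 1 + \<parallel>u\<parallel>" using g(3) l uc by (simp add: l_def add)
  then have g1: "g \<one> = 1" and gu: "g u = \<parallel>u\<parallel>" using g(2)[of \<one>] g(2)[OF uc] n1 by auto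
  have "g v \<ge> 0" if "pos v" for v
  proof -
    have vc: "v \<in> carrier A" using that by (rule pos_carrier)
    obtain t where t: "\<parallel>cst t \<ominus> v\<parallel> \<le> t" using \<open>pos v\<close> by (auto simp: pos_def)
    have "g (cst t \<ominus> v) = t - g v" using vc add[of "cst t" "\<ominus> v"] sc[of \<one> t] sc[of v "-1"] g1
      by (simp add: a_minus_def minus_sc)
    then show ?thesis using g(2)[of "cst t \<ominus> v"] t vc by simp
  qed
  then obtain \<phi> where "\<phi> \<in> states A" "\<And>v. herm v \<Longrightarrow> \<phi> v = of_real (g v)"
    using states_of_real_linf[OF g(1) g1] pos_star_mult by metis
  then show ?thesis using that[of \<phi>] uh gu cstar_identity[OF c] by (simp add: u_def)
qed

end

section \<open>States and operator seminorms\<close>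

text \<open>Symmetry comes from z = 1 and z = \<i>, the inequality from minimising over real
  multiples of cnj \<beta>. This yields Cauchy-Schwarz both for states and for the form on
  tensors.\<close>

lemma psd_quadratic:
  fixes \<alpha> \<beta> \<beta>' \<gamma> :: complex
  assumes p: "\<And>z. \<alpha> + z * \<beta> + cnj z * \<beta>' + cnj z * z * \<gamma> \<in> \<real>\<^sub>\<ge>\<^sub>0" and g: "\<gamma> \<in> \<real>\<^sub>\<ge>\<^sub>0"
  shows "\<beta>' = cnj \<beta>" "(cmod \<beta>)\<^sup>2 \<le> Re \<alpha> * Re \<gamma>"
proof -
  have re: "\<alpha> = of_real (Re \<alpha>)" "Re \<alpha> \<ge> 0" "\<gamma> = of_real (Re \<gamma>)" "Re \<gamma> \<ge> 0"
    using p[of 0] g by (auto simp: complex_nonneg_Reals_iff complex_eq_iff)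
  show b: "\<beta>' = cnj \<beta>"
    using p[of 1] p[of \<i>] re(1,3) by (auto simp: complex_nonneg_Reals_iff complex_eq_iff)
  have q: "Re \<alpha> + 2 * Re (z * \<beta>) + (cmod z)\<^sup>2 * Re \<gamma> \<ge> 0" for z
  proof -
    have "Re (\<alpha> + z * \<beta> + cnj z * \<beta>' + cnj z * z * \<gamma>) = Re \<alpha> + 2 * Re (z * \<beta>) + (cmod z)\<^sup>2 * Re \<gamma>"
      unfolding b cmod_power2 by (subst re(3)) (simp add: algebra_simps power2_eq_square)
    then show ?thesis using complex_nonneg_Reals_iff[THEN iffD1, OF p[of z]] by linarith
  qed
  have z: "Re (of_real t * cnj \<beta> * \<beta>) = t * (cmod \<beta>)\<^sup>2" "(cmod (of_real t * cnj \<beta>))\<^sup>2 = t\<^sup>2 * (cmod \<beta>)\<^sup>2" for t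
    unfolding cmod_power2 by (simp_all add: algebra_simps power2_eq_square)
  show "(cmod \<beta>)\<^sup>2 \<le> Re \<alpha> * Re \<gamma>"
  proof (cases "Re \<gamma> = 0")
    case True
    have "cmod \<beta> = 0"
    proof (rule ccontr)
      assume n: "cmod \<beta> \<noteq> 0"
      \<comment> \<open>For \<gamma> = 0 the expression is affine along cnj \<beta>; this multiple
        makes it equal to -1.\<close>
      then show False using q[of "of_real (- (Re \<alpha> + 1) / (2 * (cmod \<beta>)\<^sup>2)) * cnj \<beta>"] True
        unfolding z by (simp add: field_simps)
    qed
    then show ?thesis using True by simp
  next
    case False
    then have g0: "Re \<gamma> > 0" using re by simp
    have "0 \<le> Re \<alpha> - (cmod \<beta>)\<^sup>2 / Re \<gamma>"
      using q[of "of_real (- 1 / Re \<gamma>) * cnj \<beta>"] g0 unfolding z by (simp add: field_simps power2_eq_square)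
    then show ?thesis using g0 by (simp add: field_simps)
  qed
qed

context star_algebra begin

lemma linf_state: "\<phi> \<in> states A \<Longrightarrow> linf \<phi>" by (simp add: states_def linf_def)

lemma state_one: "\<phi> \<in> states A \<Longrightarrow> \<phi> \<one> = 1" by (simp add: states_def)

lemma state_nonneg: "\<phi> \<in> states A \<Longrightarrow> a \<in> carrier A \<Longrightarrow> \<phi> (adj A a \<otimes> a) \<in> \<real>\<^sub>\<ge>\<^sub>0" by (simp add: states_def)

lemma state_cauchy_schwarz:
  assumes \<phi>: "\<phi> \<in> states A" and a: "a \<in> carrier A" and b: "b \<in> carrier A"
  shows "\<phi> (adj A b \<otimes> a) = cnj (\<phi> (adj A a \<otimes> b))"
    and "(cmod (\<phi> (adj A a \<otimes> b)))\<^sup>2 \<le> Re (\<phi> (adj A a \<otimes> a)) * Re (\<phi> (adj A b \<otimes> b))"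
proof -
  have "\<phi> (adj A a \<otimes> a) + z * \<phi> (adj A a \<otimes> b) + cnj z * \<phi> (adj A b \<otimes> a) + cnj z * z * \<phi> (adj A b \<otimes> b)
    = \<phi> (adj A (a \<oplus> cscale A z b) \<otimes> (a \<oplus> cscale A z b))" for z
    using a b linf_state[OF \<phi>]
    by (simp add: st_add st_sc l_distr r_distr sc_mult_left sc_mult_right sc_sc linf_simps algebra_simps)
  then have "\<phi> (adj A a \<otimes> a) + z * \<phi> (adj A a \<otimes> b) + cnj z * \<phi> (adj A b \<otimes> a) + cnj z * z * \<phi> (adj A b \<otimes> b) \<in> \<real>\<^sub>\<ge>\<^sub>0" for z
    using state_nonneg[OF \<phi>, of "a \<oplus> cscale A z b"] a b by simp
  from psd_quadratic[OF this state_nonneg[OF \<phi> b]]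
  show "\<phi> (adj A b \<otimes> a) = cnj (\<phi> (adj A a \<otimes> b))"
    and "(cmod (\<phi> (adj A a \<otimes> b)))\<^sup>2 \<le> Re (\<phi> (adj A a \<otimes> a)) * Re (\<phi> (adj A b \<otimes> b))" by auto
qed

lemma state_st: "\<phi> \<in> states A \<Longrightarrow> a \<in> carrier A \<Longrightarrow> \<phi> (adj A a) = cnj (\<phi> a)"
  using state_cauchy_schwarz(1)[of \<phi> \<one> a] by simp

end

text \<open>What a tensor factor must provide: a state, so that suprema over states are not empty,
  and complements, so that left multiplication is bounded in every GNS seminorm. The reduced algebra
  satisfies this.\<close>

locale bounded_star_algebra = star_algebra +
  assumes states_ne: "states A \<noteq> {}"
    and bounded: "a \<in> carrier A \<Longrightarrow>
      \<exists>K. \<exists>s\<in>carrier A. adj A a \<otimes> a \<oplus> adj A s \<otimes> s = cscale A (of_real K) \<one>"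

lemma (in cstar_algebra) bounded_star_algebraI: "\<one> \<noteq> \<zero> \<Longrightarrow> bounded_star_algebra A"
proof unfold_locales
  show "states A \<noteq> {}" if "\<one> \<noteq> \<zero>" using norming_state[OF that one_closed] by blast
  show "\<exists>K. \<exists>s\<in>carrier A. adj A a \<otimes> a \<oplus> adj A s \<otimes> s = cscale A (of_real K) \<one>" if a: "a \<in> carrier A" for a
  proof -
    obtain s where "s \<in> carrier A" "adj A a \<otimes> a \<oplus> adj A s \<otimes> s = cst (\<parallel>a\<parallel>\<^sup>2 + 1)"
      by (rule star_mult_complement[OF a, of "\<parallel>a\<parallel>\<^sup>2 + 1"]) simp
    then show ?thesis by blast
  qed
qed

text \<open>Operator norms relative to a family of Hilbert seminorms. The algebra laws are required
  only under the seminorms, since lists representing tensors satisfy several of them only up to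
  equivalence. The two instances are the spatial norm and the operator norm of the GNS
  representation.\<close>

locale seminorm_family =
  fixes R :: "'r set" and I :: "'i set" and q :: "'i \<Rightarrow> 'r \<Rightarrow> real" and add mul :: "'r \<Rightarrow> 'r \<Rightarrow> 'r"
    and sc :: "complex \<Rightarrow> 'r \<Rightarrow> 'r" and st :: "'r \<Rightarrow> 'r"
  assumes cl: "x \<in> R \<Longrightarrow> y \<in> R \<Longrightarrow> add x y \<in> R" "x \<in> R \<Longrightarrow> y \<in> R \<Longrightarrow> mul x y \<in> R"
      "x \<in> R \<Longrightarrow> sc z x \<in> R" "x \<in> R \<Longrightarrow> st x \<in> R"
    and q_nonneg: "i \<in> I \<Longrightarrow> x \<in> R \<Longrightarrow> 0 \<le> q i x"
    and q_sc: "i \<in> I \<Longrightarrow> x \<in> R \<Longrightarrow> q i (sc z x) = cmod z * q i x"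
    and q_addl: "i \<in> I \<Longrightarrow> x \<in> R \<Longrightarrow> y \<in> R \<Longrightarrow> w \<in> R \<Longrightarrow> q i (mul (add x y) w) \<le> q i (mul x w) + q i (mul y w)"
    and q_scl: "i \<in> I \<Longrightarrow> x \<in> R \<Longrightarrow> w \<in> R \<Longrightarrow> q i (mul (sc z x) w) = cmod z * q i (mul x w)"
    and q_scr: "i \<in> I \<Longrightarrow> x \<in> R \<Longrightarrow> w \<in> R \<Longrightarrow> q i (mul x (sc z w)) = cmod z * q i (mul x w)"
    and q_assoc: "i \<in> I \<Longrightarrow> x \<in> R \<Longrightarrow> y \<in> R \<Longrightarrow> w \<in> R \<Longrightarrow> q i (mul (mul x y) w) = q i (mul x (mul y w))"
    and q_star: "i \<in> I \<Longrightarrow> x \<in> R \<Longrightarrow> w \<in> R \<Longrightarrow> (q i (mul x w))\<^sup>2 \<le> q i w * q i (mul (mul (st x) x) w)"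
    and q_starstar: "i \<in> I \<Longrightarrow> x \<in> R \<Longrightarrow> w \<in> R \<Longrightarrow> q i (mul (st (st x)) w) = q i (mul x w)"
    and q_bounded: "x \<in> R \<Longrightarrow> \<exists>K. \<forall>i\<in>I. \<forall>w\<in>R. q i (mul x w) \<le> K * q i w"
    and ne: "I \<noteq> {}" and zero: "\<exists>z\<in>R. \<forall>i\<in>I. q i z \<le> 1"
begin

definition opnorm :: "'r \<Rightarrow> real" where
  "opnorm x = Sup {q i (mul x y) | i y. i \<in> I \<and> y \<in> R \<and> q i y \<le> 1}"

lemma opnorm_bdd: assumes x: "x \<in> R" shows "bdd_above {q i (mul x y) | i y. i \<in> I \<and> y \<in> R \<and> q i y \<le> 1}"
proof -
  obtain K where K: "\<And>i w. i \<in> I \<Longrightarrow> w \<in> R \<Longrightarrow> q i (mul x w) \<le> K * q i w" using q_bounded[OF x] by blast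
  have "q i (mul x y) \<le> \<bar>K\<bar>" if "i \<in> I" "y \<in> R" "q i y \<le> 1" for i y
  proof -
    have "K * q i y \<le> \<bar>K\<bar> * 1" using q_nonneg[of i y] that by (intro mult_mono) auto
    then show ?thesis using K[of i y] that by simp
  qed
  then show ?thesis by (intro bdd_aboveI) auto
qed

lemma opnorm_upper: "i \<in> I \<Longrightarrow> x \<in> R \<Longrightarrow> y \<in> R \<Longrightarrow> q i y \<le> 1 \<Longrightarrow> q i (mul x y) \<le> opnorm x"
  unfolding opnorm_def by (rule cSup_upper[OF _ opnorm_bdd]) blast+

lemma q_mul_le: assumes i: "i \<in> I" and x: "x \<in> R" and y: "y \<in> R" shows "q i (mul x y) \<le> opnorm x * q i y"
proof (cases "q i y = 0")
  case True
  \<comment> \<open>A null vector cannot be normalised; the boundedness axiom sends it to a null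
    vector.\<close>
  obtain K where "\<And>i w. i \<in> I \<Longrightarrow> w \<in> R \<Longrightarrow> q i (mul x w) \<le> K * q i w" using q_bounded[OF x] by blast
  then show ?thesis using True i y by fastforce
next
  case False
  then have p: "q i y > 0" using q_nonneg[OF i y] by simp
  define z where "z = sc (of_real (1 / q i y)) y"
  have z: "z \<in> R" "q i z = 1" using p q_sc[OF i y] y cl by (auto simp: z_def norm_divide)
  then have "q i (mul x z) \<le> opnorm x" using opnorm_upper i x by simp
  moreover have "q i (mul x z) = q i (mul x y) / q i y" unfolding z_def using q_scr[OF i x y] p by (simp add: norm_divide)
  ultimately show ?thesis using p by (simp add: field_simps)
qed

lemma opnorm_le:
  assumes "\<And>i y. i \<in> I \<Longrightarrow> y \<in> R \<Longrightarrow> q i (mul x y) \<le> K * q i y" and K: "K \<ge> 0"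
  shows "opnorm x \<le> K"
  unfolding opnorm_def
proof (rule cSup_least)
  obtain i z where "i \<in> I" "z \<in> R" "q i z \<le> 1" using ne zero by blast
  then show "{q i (mul x y) | i y. i \<in> I \<and> y \<in> R \<and> q i y \<le> 1} \<noteq> {}" by blast
  fix v assume "v \<in> {q i (mul x y) | i y. i \<in> I \<and> y \<in> R \<and> q i y \<le> 1}"
  then obtain i y where *: "v = q i (mul x y)" "i \<in> I" "y \<in> R" "q i y \<le> 1" by blast
  have "v \<le> K * q i y" using assms(1) * by simp
  also have "\<dots> \<le> K" using * K mult_left_le by blast
  finally show "v \<le> K" .
qed

lemma opnorm_nonneg: assumes x: "x \<in> R" shows "0 \<le> opnorm x"
proof -
  obtain i z where "i \<in> I" "z \<in> R" "q i z \<le> 1" using ne zero by blast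
  then have "q i (mul x z) \<le> opnorm x" using opnorm_upper x by simp
  then show ?thesis using q_nonneg[of i "mul x z"] cl x \<open>i \<in> I\<close> \<open>z \<in> R\<close> by fastforce
qed

lemma opnorm_add: assumes x: "x \<in> R" and y: "y \<in> R" shows "opnorm (add x y) \<le> opnorm x + opnorm y"
proof (rule opnorm_le)
  fix i w assume iw: "i \<in> I" "w \<in> R"
  then show "q i (mul (add x y) w) \<le> (opnorm x + opnorm y) * q i w"
    using q_addl[of i x y w] q_mul_le[of i x w] q_mul_le[of i y w] x y by (simp add: algebra_simps)
qed (use opnorm_nonneg x y in simp)

lemma opnorm_mul: assumes x: "x \<in> R" and y: "y \<in> R" shows "opnorm (mul x y) \<le> opnorm x * opnorm y"
proof (rule opnorm_le)
  fix i w assume iw: "i \<in> I" "w \<in> R"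
  have "q i (mul x (mul y w)) \<le> opnorm x * q i (mul y w)" by (rule q_mul_le) (use iw x y cl in auto)
  also have "\<dots> \<le> opnorm x * (opnorm y * q i w)" by (intro mult_left_mono q_mul_le opnorm_nonneg iw x y)
  finally show "q i (mul (mul x y) w) \<le> opnorm x * opnorm y * q i w" using q_assoc iw x y by simp
qed (use opnorm_nonneg x y in simp)

lemma opnorm_sc: assumes x: "x \<in> R" shows "opnorm (sc z x) = cmod z * opnorm x"
proof -
  have le: "opnorm (sc z x) \<le> cmod z * opnorm x" if x: "x \<in> R" for z x
  proof (rule opnorm_le)
    fix i w assume iw: "i \<in> I" "w \<in> R"
    then show "q i (mul (sc z x) w) \<le> cmod z * opnorm x * q i w"
      using q_scl[OF iw(1) x iw(2)] q_mul_le[OF iw(1) x iw(2)] by (simp add: mult.assoc mult_left_mono)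
  qed (use opnorm_nonneg x in simp)
  show ?thesis
  proof (cases "z = 0")
    case True
    then show ?thesis using le[OF x, of z] opnorm_nonneg[of "sc z x"] x cl by fastforce
  next
    case False
    have "opnorm x \<le> opnorm (sc z x) / cmod z"
    proof (rule opnorm_le)
      fix i w assume iw: "i \<in> I" "w \<in> R"
      then show "q i (mul x w) \<le> opnorm (sc z x) / cmod z * q i w"
        using q_scl[OF iw(1) x iw(2), of z] q_mul_le[OF iw(1) cl(3)[OF x] iw(2), of z] False by (simp add: field_simps)
    qed (use opnorm_nonneg x cl in simp)
    then show ?thesis using le[OF x, of z] False by (simp add: field_simps)
  qed
qed

text \<open>Cauchy-Schwarz in each seminorm, \<open>q_star\<close>, gives this half of the
  C*-identity; it in turn forces the adjoint to be isometric and so gives the other half.\<close>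

lemma opnorm_square_le: assumes x: "x \<in> R" shows "(opnorm x)\<^sup>2 \<le> opnorm (mul (st x) x)"
proof -
  have n: "0 \<le> opnorm (mul (st x) x)" using opnorm_nonneg x cl by simp
  have "opnorm x \<le> sqrt (opnorm (mul (st x) x))"
  proof (rule opnorm_le)
    fix i w assume iw: "i \<in> I" "w \<in> R"
    have "(q i (mul x w))\<^sup>2 \<le> q i w * (opnorm (mul (st x) x) * q i w)"
      using q_star[OF iw(1) x iw(2)] mult_left_mono[OF q_mul_le[OF iw(1), of "mul (st x) x" w] q_nonneg[OF iw]] x cl iw
      by simp
    also have "\<dots> = (sqrt (opnorm (mul (st x) x)) * q i w)\<^sup>2"
      using n by (simp add: power_mult_distrib power2_eq_square[of "q i w"])
    finally show "q i (mul x w) \<le> sqrt (opnorm (mul (st x) x)) * q i w"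
      by (rule power2_le_imp_le) (use n q_nonneg[OF iw] in simp)
  qed (use n in simp)
  then have "(opnorm x)\<^sup>2 \<le> (sqrt (opnorm (mul (st x) x)))\<^sup>2" by (intro power_mono opnorm_nonneg x)
  then show ?thesis using n by simp
qed

lemma opnorm_st: assumes x: "x \<in> R" shows "opnorm (st x) = opnorm x"
proof -
  have le: "opnorm x \<le> opnorm (st x)" if x: "x \<in> R" for x
  proof (cases "opnorm x = 0")
    case False
    then have "opnorm x > 0" using opnorm_nonneg[OF x] by simp
    moreover have "opnorm x * opnorm x \<le> opnorm (st x) * opnorm x"
      using opnorm_square_le[OF x] opnorm_mul[of "st x" x] x cl by (simp add: power2_eq_square)
    ultimately show ?thesis by simp
  qed (use opnorm_nonneg x cl in simp)
  have "opnorm (st (st x)) \<le> opnorm x"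
    by (rule opnorm_le) (use x cl q_starstar q_mul_le opnorm_nonneg in auto)
  then show ?thesis using le[OF x] le[OF cl(4)[OF x]] by simp
qed

lemma opnorm_cstar: assumes x: "x \<in> R" shows "opnorm (mul (st x) x) = (opnorm x)\<^sup>2"
  using opnorm_square_le[OF x] opnorm_mul[OF cl(4)[OF x] x] opnorm_st[OF x] by (simp add: power2_eq_square)

end

lemma sqrt_add_le_of_cs:
  fixes a b c :: real
  assumes a: "0 \<le> a" "0 \<le> b" and c: "c\<^sup>2 \<le> a * b" shows "sqrt (a + 2 * c + b) \<le> sqrt a + sqrt b"
proof -
  have "\<bar>c\<bar> \<le> sqrt a * sqrt b" using c real_le_rsqrt[of "\<bar>c\<bar>" "a * b"] by (simp add: real_sqrt_mult)
  then have "a + 2 * c + b \<le> (sqrt a + sqrt b)\<^sup>2" using a by (simp add: power2_sum)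
  then show ?thesis using a by (intro real_le_lsqrt) auto
qed

section \<open>The algebraic tensor product\<close>

text \<open>The functional on formal sums induced by a bilinear \<beta>. Equality of algebraic
  tensors is tested by all of these, which avoids forming a quotient.\<close>

definition ev :: "('a \<Rightarrow> 'b \<Rightarrow> complex) \<Rightarrow> ('a \<times> 'b) list \<Rightarrow> complex" where
  "ev \<beta> xs = (\<Sum>(a, b)\<leftarrow>xs. \<beta> a b)"

lemma ev_Nil [simp]: "ev \<beta> [] = 0" and ev_Cons [simp]: "ev \<beta> ((a, b) # xs) = \<beta> a b + ev \<beta> xs"
  and ev_append [simp]: "ev \<beta> (xs @ ys) = ev \<beta> xs + ev \<beta> ys"
  by (simp_all add: ev_def)

lemma ev_map: "ev \<beta> (map (\<lambda>(a, b). (f a b, g a b)) xs) = ev (\<lambda>a b. \<beta> (f a b) (g a b)) xs"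
  by (induction xs) auto

lemma ev_swap: "ev (\<lambda>a b. ev (\<lambda>c d. F a b c d) ys) xs = ev (\<lambda>c d. ev (\<lambda>a b. F a b c d) xs) ys"
proof -
  have add: "ev (\<lambda>c d. f c d + g c d) zs = ev f zs + ev g zs" for f g :: "'c \<Rightarrow> 'd \<Rightarrow> complex" and zs
    by (induction zs) auto
  have "ev (\<lambda>c d. 0) zs = 0" for zs :: "('c \<times> 'd) list" by (induction zs) auto
  then show ?thesis by (induction xs) (auto simp: add)
qed

lemma ev_cnj: "ev (\<lambda>a b. cnj (\<beta> a b)) xs = cnj (ev \<beta> xs)"
  by (induction xs) auto

lemma ev_cmult: "ev (\<lambda>a b. z * \<beta> a b) xs = z * ev \<beta> xs"
  by (induction xs) (auto simp: algebra_simps)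

lemma ev_add: "ev (\<lambda>a b. \<beta> a b + \<beta>' a b) xs = ev \<beta> xs + ev \<beta>' xs"
  by (induction xs) auto

lemma talg_functional_ev: "talg_functional \<phi> \<psi> xs = ev (\<lambda>a b. \<phi> a * \<psi> b) xs"
  by (simp add: talg_functional_def ev_def)

lemma talg_mult_Nil [simp]: "talg_mult A B [] ys = []"
  and talg_mult_Cons: "talg_mult A B ((a, b) # xs) ys =
    map (\<lambda>(c, d). (a \<otimes>\<^bsub>A\<^esub> c, b \<otimes>\<^bsub>B\<^esub> d)) ys @ talg_mult A B xs ys"
  by (simp_all add: talg_mult_def)

lemma talg_mult_append: "talg_mult A B (xs @ xs') ys = talg_mult A B xs ys @ talg_mult A B xs' ys"
  by (simp add: talg_mult_def)

lemma ev_mult: "ev \<beta> (talg_mult A B xs ys) = ev (\<lambda>a b. ev (\<lambda>c d. \<beta> (a \<otimes>\<^bsub>A\<^esub> c) (b \<otimes>\<^bsub>B\<^esub> d)) ys) xs"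
  by (induction xs) (auto simp: talg_mult_Cons ev_map)

lemma ev_adj: "ev \<beta> (talg_adj A B xs) = ev (\<lambda>a b. \<beta> (adj A a) (adj B b)) xs"
  by (simp add: talg_adj_def ev_map)

lemma alg_tensors_Nil [simp]: "[] \<in> alg_tensors A B"
  and alg_tensors_Cons [simp]: "((a, b) # xs \<in> alg_tensors A B) = (a \<in> carrier A \<and> b \<in> carrier B \<and> xs \<in> alg_tensors A B)"
  and alg_tensors_append [simp]: "(xs @ ys \<in> alg_tensors A B) = (xs \<in> alg_tensors A B \<and> ys \<in> alg_tensors A B)"
  by (auto simp: alg_tensors_def)

lemma alg_tensors_induct [consumes 1, case_names Nil Cons]:
  assumes "xs \<in> alg_tensors A B" "P []"
    "\<And>a b xs. a \<in> carrier A \<Longrightarrow> b \<in> carrier B \<Longrightarrow> xs \<in> alg_tensors A B \<Longrightarrow> P xs \<Longrightarrow> P ((a, b) # xs)"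
  shows "P xs"
  using assms(1) by (induction xs) (auto intro: assms(2,3))

lemma alg_tensors_map:
  assumes "xs \<in> alg_tensors A B" "\<And>a b. a \<in> carrier A \<Longrightarrow> b \<in> carrier B \<Longrightarrow> f a b \<in> carrier C \<and> g a b \<in> carrier D"
  shows "map (\<lambda>(a, b). (f a b, g a b)) xs \<in> alg_tensors C D"
  using assms(1) by (induction rule: alg_tensors_induct) (auto simp: assms(2))

lemma ev_cong:
  assumes "xs \<in> alg_tensors A B" "\<And>a b. a \<in> carrier A \<Longrightarrow> b \<in> carrier B \<Longrightarrow> \<beta> a b = \<beta>' a b"
  shows "ev \<beta> xs = ev \<beta>' xs"
  using assms(1) by (induction rule: alg_tensors_induct) (auto simp: assms(2))

locale tensor_factors = A: bounded_star_algebra A + B: bounded_star_algebra B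
  for A :: "('a, 'm) cstar_scheme" and B :: "('b, 'n) cstar_scheme"
begin

abbreviation "R \<equiv> alg_tensors A B"
abbreviation "mul \<equiv> talg_mult A B"
abbreviation "star \<equiv> talg_adj A B"
abbreviation "scl \<equiv> talg_scale A"
abbreviation "N \<equiv> min_norm A B"
abbreviation "one2 \<equiv> [(\<one>\<^bsub>A\<^esub>, \<one>\<^bsub>B\<^esub>)]"

lemma mul_closed [simp, intro]: "x \<in> R \<Longrightarrow> y \<in> R \<Longrightarrow> mul x y \<in> R"
proof (induction x rule: alg_tensors_induct)
  case (Cons a b xs)
  then show ?case
    using alg_tensors_map[OF Cons(5), of "\<lambda>c d. a \<otimes>\<^bsub>A\<^esub> c" A "\<lambda>c d. b \<otimes>\<^bsub>B\<^esub> d" B] by (simp add: talg_mult_Cons)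
qed simp

lemma star_closed [simp, intro]: "x \<in> R \<Longrightarrow> star x \<in> R"
  unfolding talg_adj_def by (rule alg_tensors_map) auto

lemma scl_closed [simp, intro]: "x \<in> R \<Longrightarrow> scl z x \<in> R"
  unfolding talg_scale_def by (rule alg_tensors_map) auto

lemma star_star [simp]: "x \<in> R \<Longrightarrow> star (star x) = x"
  by (induction x rule: alg_tensors_induct) (auto simp: talg_adj_def)

lemma mul_assoc: "x \<in> R \<Longrightarrow> y \<in> R \<Longrightarrow> w \<in> R \<Longrightarrow> mul (mul x y) w = mul x (mul y w)"
proof (induction x rule: alg_tensors_induct)
  case (Cons a b x)
  have "mul (map (\<lambda>(c, d). (a \<otimes>\<^bsub>A\<^esub> c, b \<otimes>\<^bsub>B\<^esub> d)) y) w = map (\<lambda>(c, d). (a \<otimes>\<^bsub>A\<^esub> c, b \<otimes>\<^bsub>B\<^esub> d)) (mul y w)"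
    using Cons(5)
  proof (induction y rule: alg_tensors_induct)
    case inner: (Cons c d y)
    have "map (\<lambda>(e, f). (a \<otimes>\<^bsub>A\<^esub> c \<otimes>\<^bsub>A\<^esub> e, b \<otimes>\<^bsub>B\<^esub> d \<otimes>\<^bsub>B\<^esub> f)) w
        = map (\<lambda>(e, f). (a \<otimes>\<^bsub>A\<^esub> (c \<otimes>\<^bsub>A\<^esub> e), b \<otimes>\<^bsub>B\<^esub> (d \<otimes>\<^bsub>B\<^esub> f))) w"
      using Cons(6) by (induction rule: alg_tensors_induct) (use Cons inner in \<open>auto simp: A.m_assoc B.m_assoc\<close>)
    then show ?case using inner by (simp add: talg_mult_Cons comp_def split_def)
  qed simp
  then show ?case using Cons by (simp add: talg_mult_Cons talg_mult_append)
qed simp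

definition bilin :: "('a \<Rightarrow> 'b \<Rightarrow> complex) \<Rightarrow> bool" where
  "bilin \<beta> \<longleftrightarrow> (\<forall>b\<in>carrier B. A.linf (\<lambda>a. \<beta> a b)) \<and> (\<forall>a\<in>carrier A. B.linf (\<beta> a))"

lemma ev_scl: "bilin \<beta> \<Longrightarrow> x \<in> R \<Longrightarrow> ev \<beta> (scl z x) = z * ev \<beta> x"
  unfolding talg_scale_def
  by (subst ev_map, subst ev_cmult[symmetric], rule ev_cong) (auto simp: bilin_def A.linf_def)

lemma bilin_translate: "bilin \<beta> \<Longrightarrow> a \<in> carrier A \<Longrightarrow> b \<in> carrier B \<Longrightarrow>
    bilin (\<lambda>c d. \<beta> (a \<otimes>\<^bsub>A\<^esub> c) (b \<otimes>\<^bsub>B\<^esub> d))"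
  by (auto simp: bilin_def A.linf_def B.linf_def A.r_distr B.r_distr A.sc_mult_right B.sc_mult_right)

lemma bilin_translate_right: "bilin \<beta> \<Longrightarrow> c \<in> carrier A \<Longrightarrow> d \<in> carrier B \<Longrightarrow>
    bilin (\<lambda>a b. \<beta> (a \<otimes>\<^bsub>A\<^esub> c) (b \<otimes>\<^bsub>B\<^esub> d))"
  by (auto simp: bilin_def A.linf_def B.linf_def A.l_distr B.l_distr A.sc_mult_left B.sc_mult_left)

lemma bilin_translate_ev: "bilin \<beta> \<Longrightarrow> y \<in> R \<Longrightarrow>
    bilin (\<lambda>a b. ev (\<lambda>c d. \<beta> (a \<otimes>\<^bsub>A\<^esub> c) (b \<otimes>\<^bsub>B\<^esub> d)) y)"
proof -
  assume b: "bilin \<beta>" and y: "y \<in> R"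
  show ?thesis using y
  proof (induction rule: alg_tensors_induct)
    case (Cons c d y)
    then show ?case using bilin_translate_right[OF b Cons(1,2)]
      by (simp add: bilin_def A.linf_def B.linf_def algebra_simps)
  qed (simp add: bilin_def A.linf_def B.linf_def)
qed

lemma bilin_star: "bilin \<beta> \<Longrightarrow> bilin (\<lambda>a b. cnj (\<beta> (adj A a) (adj B b)))"
  by (simp add: bilin_def A.linf_def B.linf_def A.st_add B.st_add A.st_sc B.st_sc)

text \<open>Two lists are equivalent if they represent the same element of the algebraic tensor product.\<close>

definition aeq :: "('a \<times> 'b) list \<Rightarrow> ('a \<times> 'b) list \<Rightarrow> bool" (infix "\<triangleq>" 50) where
  "x \<triangleq> y \<longleftrightarrow> (\<forall>\<beta>. bilin \<beta> \<longrightarrow> ev \<beta> x = ev \<beta> y)"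

lemma aeq_refl [simp]: "x \<triangleq> x" and aeq_sym: "x \<triangleq> y \<Longrightarrow> y \<triangleq> x"
  by (auto simp: aeq_def)

lemma aeq_mul:
  assumes "x \<triangleq> x'" "y \<triangleq> y'" "x \<in> R" "x' \<in> R" "y \<in> R" "y' \<in> R" shows "mul x y \<triangleq> mul x' y'"
  unfolding aeq_def
proof (intro allI impI)
  fix \<beta> assume b: "bilin \<beta>"
  have "ev \<beta> (mul x y) = ev (\<lambda>a b. ev (\<lambda>c d. \<beta> (a \<otimes>\<^bsub>A\<^esub> c) (b \<otimes>\<^bsub>B\<^esub> d)) y) x" by (rule ev_mult)
  also have "\<dots> = ev (\<lambda>a b. ev (\<lambda>c d. \<beta> (a \<otimes>\<^bsub>A\<^esub> c) (b \<otimes>\<^bsub>B\<^esub> d)) y) x'"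
    using assms(1) bilin_translate_ev[OF b assms(5)] by (simp add: aeq_def)
  also have "\<dots> = ev (\<lambda>a b. ev (\<lambda>c d. \<beta> (a \<otimes>\<^bsub>A\<^esub> c) (b \<otimes>\<^bsub>B\<^esub> d)) y') x'"
    by (rule ev_cong[OF assms(4)]) (use bilin_translate[OF b] assms(2) in \<open>auto simp: aeq_def\<close>)
  finally show "ev \<beta> (mul x y) = ev \<beta> (mul x' y')" by (simp add: ev_mult)
qed

lemma aeq_star: "x \<triangleq> x' \<Longrightarrow> star x \<triangleq> star x'"
  unfolding aeq_def
proof (intro allI impI)
  fix \<beta> assume "\<forall>\<beta>. bilin \<beta> \<longrightarrow> ev \<beta> x = ev \<beta> x'" "bilin \<beta>"
  then have "ev (\<lambda>a b. cnj (\<beta> (adj A a) (adj B b))) x = ev (\<lambda>a b. cnj (\<beta> (adj A a) (adj B b))) x'"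
    using bilin_star by blast
  then show "ev \<beta> (star x) = ev \<beta> (star x')" by (simp add: ev_adj ev_cnj)
qed

lemma ev_mul_append_right: "ev \<beta> (mul x (y @ y')) = ev \<beta> (mul x y) + ev \<beta> (mul x y')"
  by (simp add: ev_mult ev_add)

lemma ev_mul_append_left: "ev \<beta> (mul (x @ x') y) = ev \<beta> (mul x y) + ev \<beta> (mul x' y)"
  by (simp add: ev_mult)

lemma ev_mul_scl_left: "bilin \<beta> \<Longrightarrow> x \<in> R \<Longrightarrow> y \<in> R \<Longrightarrow> ev \<beta> (mul (scl z x) y) = z * ev \<beta> (mul x y)"
  unfolding ev_mult by (rule ev_scl[OF bilin_translate_ev])

lemma ev_mul_scl_right:
  assumes b: "bilin \<beta>" and x: "x \<in> R" and y: "y \<in> R" shows "ev \<beta> (mul x (scl z y)) = z * ev \<beta> (mul x y)"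
proof -
  have "ev \<beta> (mul x (scl z y)) = ev (\<lambda>a b. z * ev (\<lambda>c d. \<beta> (a \<otimes>\<^bsub>A\<^esub> c) (b \<otimes>\<^bsub>B\<^esub> d)) y) x"
    unfolding ev_mult by (rule ev_cong[OF x]) (use y b in \<open>auto simp: ev_scl bilin_translate\<close>)
  then show ?thesis by (simp add: ev_cmult ev_mult[symmetric])
qed

lemma ev_star_scl: assumes b: "bilin \<beta>" and x: "x \<in> R" shows "ev \<beta> (star (scl z x)) = cnj z * ev \<beta> (star x)"
proof -
  have "cnj (ev \<beta> (star (scl z x))) = z * cnj (ev \<beta> (star x))"
    using ev_scl[OF bilin_star[OF b] x, of z] by (simp add: ev_adj ev_cnj)
  then show ?thesis by (metis complex_cnj_cnj complex_cnj_mult)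
qed

lemma ev_star_append: "ev \<beta> (star (x @ y)) = ev \<beta> (star x) + ev \<beta> (star y)"
  by (simp add: ev_adj)

text \<open>As lists the two sides enumerate their terms in different orders, so the law can hold
  only after evaluation.\<close>

lemma ev_star_mul: assumes w: "w \<in> R" and x: "x \<in> R" shows "ev \<beta> (star (mul w x)) = ev \<beta> (mul (star x) (star w))"
proof -
  have "ev \<beta> (star (mul w x)) = ev (\<lambda>a b. ev (\<lambda>c d. \<beta> (adj A (a \<otimes>\<^bsub>A\<^esub> c)) (adj B (b \<otimes>\<^bsub>B\<^esub> d))) x) w"
    by (simp add: ev_adj ev_mult)
  also have "\<dots> = ev (\<lambda>a b. ev (\<lambda>c d. \<beta> (adj A c \<otimes>\<^bsub>A\<^esub> adj A a) (adj B d \<otimes>\<^bsub>B\<^esub> adj B b)) x) w"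
    by (intro ev_cong[OF w] ev_cong[OF x]) (simp add: A.st_mult B.st_mult)
  also have "\<dots> = ev \<beta> (mul (star x) (star w))" by (subst ev_swap) (simp add: ev_adj ev_mult)
  finally show ?thesis .
qed

lemmas ev_rules = ev_scl ev_mul_append_right ev_mul_append_left ev_mul_scl_left ev_mul_scl_right
  ev_star_scl ev_star_append ev_star_mul

text \<open>The inner product of the classes of x and y in the tensor product of the two GNS
  spaces.\<close>

definition form :: "('a \<Rightarrow> complex) \<times> ('b \<Rightarrow> complex) \<Rightarrow> ('a \<times> 'b) list \<Rightarrow> ('a \<times> 'b) list \<Rightarrow> complex" where
  "form i x y = talg_functional (fst i) (snd i) (mul (star x) y)"

abbreviation "I \<equiv> states A \<times> states B"

lemma form_ev: "form (\<phi>, \<psi>) x y = ev (\<lambda>a b. ev (\<lambda>c d. \<phi> (adj A a \<otimes>\<^bsub>A\<^esub> c) * \<psi> (adj B b \<otimes>\<^bsub>B\<^esub> d)) y) x"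
  by (simp add: form_def talg_functional_ev ev_mult ev_adj)

lemma bilin_states: "\<phi> \<in> states A \<Longrightarrow> \<psi> \<in> states B \<Longrightarrow> bilin (\<lambda>a b. \<phi> a * \<psi> b)"
proof -
  assume "\<phi> \<in> states A" "\<psi> \<in> states B"
  from A.linf_state[OF this(1)] B.linf_state[OF this(2)] show ?thesis
    unfolding bilin_def A.linf_def B.linf_def by (simp add: distrib_left distrib_right)
qed

lemma talg_functional_aeq: "i \<in> I \<Longrightarrow> x \<triangleq> y \<Longrightarrow> talg_functional (fst i) (snd i) x = talg_functional (fst i) (snd i) y"
  using bilin_states by (auto simp: talg_functional_ev aeq_def)

lemma form_aeq:
  assumes "i \<in> I" "x \<triangleq> x'" "y \<triangleq> y'" "x \<in> R" "x' \<in> R" "y \<in> R" "y' \<in> R" shows "form i x y = form i x' y'"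
  unfolding form_def by (intro talg_functional_aeq aeq_mul aeq_star star_closed assms)

lemma form_hermitian: assumes i: "i \<in> I" and x: "x \<in> R" and y: "y \<in> R" shows "form i y x = cnj (form i x y)"
proof -
  obtain \<phi> \<psi> where i': "i = (\<phi>, \<psi>)" "\<phi> \<in> states A" "\<psi> \<in> states B" using i by auto
  have "cnj (form i x y) = ev (\<lambda>a b. ev (\<lambda>c d. cnj (\<phi> (adj A a \<otimes>\<^bsub>A\<^esub> c) * \<psi> (adj B b \<otimes>\<^bsub>B\<^esub> d))) y) x"
    unfolding i' form_ev by (simp only: ev_cnj[symmetric])
  also have "\<dots> = ev (\<lambda>a b. ev (\<lambda>c d. \<phi> (adj A c \<otimes>\<^bsub>A\<^esub> a) * \<psi> (adj B d \<otimes>\<^bsub>B\<^esub> b)) y) x"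
    by (intro ev_cong[OF x] ev_cong[OF y])
      (simp only: complex_cnj_mult A.state_cauchy_schwarz(1)[OF i'(2), symmetric]
        B.state_cauchy_schwarz(1)[OF i'(3), symmetric])
  also have "\<dots> = form i y x" unfolding i' form_ev by (rule ev_swap)
  finally show ?thesis by simp
qed

lemma form_append_right: "form i x (y @ y') = form i x y + form i x y'"
  by (cases i) (simp add: form_ev ev_add)

lemma form_append_left: "form i (x @ x') y = form i x y + form i x' y"
  by (cases i) (simp add: form_ev)

lemma form_scl_right:
  assumes "i \<in> I" "x \<in> R" "y \<in> R"
  shows "form i x (scl z y) = z * form i x y"
proof -
  have "bilin (\<lambda>a b. fst i a * snd i b)" using assms bilin_states by auto
  then show ?thesis using assms by (simp add: form_def talg_functional_ev ev_mul_scl_right)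
qed

lemma form_scl_left: "i \<in> I \<Longrightarrow> x \<in> R \<Longrightarrow> y \<in> R \<Longrightarrow> form i (scl z x) y = cnj z * form i x y"
  using form_hermitian[of i y "scl z x"] form_hermitian[of i y x] form_scl_right[of i y x z] by simp

text \<open>The Schur product theorem, by Gram-Schmidt orthogonalisation in the second factor.\<close>

lemma form_nonneg: assumes i: "i \<in> I" and x: "x \<in> R" shows "form i x x \<in> \<real>\<^sub>\<ge>\<^sub>0"
  using x
proof (induction x rule: length_induct)
  case (1 x)
  obtain \<phi> \<psi> where i': "i = (\<phi>, \<psi>)" "\<phi> \<in> states A" "\<psi> \<in> states B" using i by auto
  show ?case
  proof (cases x)
    case Nil
    then show ?thesis by (simp add: i' form_ev)
  next
    case (Cons ab ys)
    then obtain a0 b0 where x: "x = (a0, b0) # ys" by (cases ab) auto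
    then have c0: "a0 \<in> carrier A" "b0 \<in> carrier B" and ys: "ys \<in> R" using 1(2) by auto
    define \<gamma> where "\<gamma> = \<psi> (adj B b0 \<otimes>\<^bsub>B\<^esub> b0)"
    have \<gamma>: "\<gamma> \<in> \<real>\<^sub>\<ge>\<^sub>0" using B.state_nonneg[OF i'(3) c0(2)] by (simp add: \<gamma>_def)
    \<comment> \<open>The coefficient of the projection onto b0. If \<gamma> = 0, division gives l =
      0, and b is already orthogonal to b0 by Cauchy-Schwarz.\<close>
    define l where "l b = \<psi> (adj B b0 \<otimes>\<^bsub>B\<^esub> b) / \<gamma>" for b
    define p where "p b = b \<oplus>\<^bsub>B\<^esub> cscale B (- l b) b0" for b
    have pc: "p b \<in> carrier B" if "b \<in> carrier B" for b using that c0 by (simp add: p_def)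
    have orth: "\<psi> (adj B b0 \<otimes>\<^bsub>B\<^esub> p b) = 0" if b: "b \<in> carrier B" for b
    proof -
      have "\<gamma> = 0 \<Longrightarrow> \<psi> (adj B b0 \<otimes>\<^bsub>B\<^esub> b) = 0"
        using B.state_cauchy_schwarz(2)[OF i'(3) c0(2) b] by (simp add: \<gamma>_def)
      then show ?thesis using b c0 B.linf_state[OF i'(3)]
        by (auto simp: p_def l_def B.r_distr B.sc_mult_right B.linf_simps simp flip: \<gamma>_def)
    qed
    define ys' where "ys' = map (\<lambda>(a, b). (a, p b)) ys"
    have ys': "ys' \<in> R" "length ys' = length ys" unfolding ys'_def using pc by (auto intro: alg_tensors_map[OF ys])
    \<comment> \<open>All components along b0 are collected in one term a' \<otimes> b0. The
      remaining list has second entries orthogonal to b0 and the length of ys, so the induction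
      applies to it.\<close>
    have "\<exists>a'\<in>carrier A. ys \<triangleq> (a', b0) # ys'" unfolding ys'_def using ys
    proof (induction rule: alg_tensors_induct)
      case Nil
      have "[] \<triangleq> [(\<zero>\<^bsub>A\<^esub>, b0)]" using A.linf_zero c0 by (auto simp: aeq_def bilin_def)
      then show ?case by auto
    next
      case (Cons a b xs)
      then obtain a' where a': "a' \<in> carrier A" "xs \<triangleq> (a', b0) # map (\<lambda>(a, b). (a, p b)) xs" by auto
      have "(a, b) # xs \<triangleq> (a' \<oplus>\<^bsub>A\<^esub> cscale A (l b) a, b0) # (a, p b) # map (\<lambda>(a, b). (a, p b)) xs"
        unfolding aeq_def
      proof (intro allI impI)
        fix \<beta> assume b: "bilin \<beta>"
        have "\<beta> (a' \<oplus>\<^bsub>A\<^esub> cscale A (l b) a) b0 = \<beta> a' b0 + l b * \<beta> a b0"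
          using b Cons(1) a'(1) c0 by (simp add: bilin_def A.linf_def)
        moreover have "\<beta> a (p b) = \<beta> a b - l b * \<beta> a b0"
          using b Cons(1,2) c0 by (simp add: bilin_def p_def B.linf_simps)
        moreover have "ev \<beta> xs = \<beta> a' b0 + ev \<beta> (map (\<lambda>(a, b). (a, p b)) xs)" using a'(2) b by (simp add: aeq_def)
        ultimately show "ev \<beta> ((a, b) # xs) =
            ev \<beta> ((a' \<oplus>\<^bsub>A\<^esub> cscale A (l b) a, b0) # (a, p b) # map (\<lambda>(a, b). (a, p b)) xs)" by simp
      qed
      then show ?case using a' Cons(1) by (intro bexI[of _ "a' \<oplus>\<^bsub>A\<^esub> cscale A (l b) a"]) auto
    qed
    then obtain a1 where a1: "a1 \<in> carrier A" "ys \<triangleq> (a1, b0) # ys'" by blast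
    define a' where "a' = a0 \<oplus>\<^bsub>A\<^esub> a1"
    have ac: "a' \<in> carrier A" using a1 c0 by (simp add: a'_def)
    have "x \<triangleq> [(a', b0)] @ ys'"
      using a1 c0 unfolding x a'_def aeq_def by (auto simp: bilin_def A.linf_def)
    then have "form i x x = form i ([(a', b0)] @ ys') ([(a', b0)] @ ys')"
      by (intro form_aeq i) (use ac c0 ys' ys x in auto)
    also have "\<dots> = form i [(a', b0)] [(a', b0)] + form i [(a', b0)] ys' + form i ys' [(a', b0)] + form i ys' ys'"
      by (simp only: form_append_left form_append_right) simp
    also have z: "form i [(a', b0)] ys' = 0"
    proof -
      have "form i [(a', b0)] ys' = ev (\<lambda>a b. \<phi> (adj A a' \<otimes>\<^bsub>A\<^esub> a) * \<psi> (adj B b0 \<otimes>\<^bsub>B\<^esub> p b)) ys"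
        by (simp add: i' form_ev ys'_def ev_map)
      also have "\<dots> = ev (\<lambda>a b. 0 * 0) ys" by (rule ev_cong[OF ys]) (simp add: orth)
      finally show ?thesis by (simp only: ev_cmult) simp
    qed
    also have "form i ys' [(a', b0)] = 0"
      using form_hermitian[OF i, of "[(a', b0)]" ys'] z ac c0 ys' by simp
    also have "form i [(a', b0)] [(a', b0)] = \<phi> (adj A a' \<otimes>\<^bsub>A\<^esub> a') * \<gamma>" by (simp add: i' form_ev \<gamma>_def)
    finally have "form i x x = \<phi> (adj A a' \<otimes>\<^bsub>A\<^esub> a') * \<gamma> + form i ys' ys'" by simp
    moreover have "form i ys' ys' \<in> \<real>\<^sub>\<ge>\<^sub>0" using 1(1) ys' x by auto
    ultimately show ?thesis using \<gamma> A.state_nonneg[OF i'(2) ac] by simp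
  qed
qed

lemma form_cs:
  assumes i: "i \<in> I" and x: "x \<in> R" and y: "y \<in> R"
  shows "(cmod (form i x y))\<^sup>2 \<le> Re (form i x x) * Re (form i y y)"
proof -
  have "form i x x + z * form i x y + cnj z * form i y x + cnj z * z * form i y y
      = form i (x @ scl z y) (x @ scl z y)" for z
    using i x y by (simp add: form_append_left form_append_right form_scl_left form_scl_right algebra_simps)
  then have "form i x x + z * form i x y + cnj z * form i y x + cnj z * z * form i y y \<in> \<real>\<^sub>\<ge>\<^sub>0" for z
    using form_nonneg[OF i, of "x @ scl z y"] x y by simp
  from psd_quadratic(2)[OF this form_nonneg[OF i y]] show ?thesis .
qed

definition q :: "('a \<Rightarrow> complex) \<times> ('b \<Rightarrow> complex) \<Rightarrow> ('a \<times> 'b) list \<Rightarrow> real" where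
  "q i x = sqrt (Re (form i x x))"

lemma Re_form_nonneg: "i \<in> I \<Longrightarrow> x \<in> R \<Longrightarrow> 0 \<le> Re (form i x x)"
  using form_nonneg[of i x] by (simp add: complex_nonneg_Reals_iff)

lemma q_sq: "i \<in> I \<Longrightarrow> x \<in> R \<Longrightarrow> (q i x)\<^sup>2 = Re (form i x x)"
  by (simp add: q_def Re_form_nonneg)

lemma q_aeq: "i \<in> I \<Longrightarrow> x \<triangleq> y \<Longrightarrow> x \<in> R \<Longrightarrow> y \<in> R \<Longrightarrow> q i x = q i y"
  unfolding q_def using form_aeq by metis

lemma form_le_q: "i \<in> I \<Longrightarrow> x \<in> R \<Longrightarrow> y \<in> R \<Longrightarrow> cmod (form i x y) \<le> q i x * q i y"
  using form_cs[of i x y] unfolding q_def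
  by (metis abs_norm_cancel real_sqrt_abs real_sqrt_le_mono real_sqrt_mult)

lemma q_append: assumes i: "i \<in> I" and x: "x \<in> R" and y: "y \<in> R" shows "q i (x @ y) \<le> q i x + q i y"
proof -
  have "form i y x = cnj (form i x y)" by (rule form_hermitian[OF i x y])
  then have "Re (form i (x @ y) (x @ y)) = Re (form i x x) + 2 * Re (form i x y) + Re (form i y y)"
    by (simp add: form_append_left form_append_right)
  moreover have "(Re (form i x y))\<^sup>2 \<le> Re (form i x x) * Re (form i y y)"
    using form_cs[OF assms] power_mono[OF abs_Re_le_cmod[of "form i x y"] abs_ge_zero, of 2] by simp
  ultimately show ?thesis unfolding q_def using sqrt_add_le_of_cs Re_form_nonneg i x y by simp
qed

lemma q_scl: assumes i: "i \<in> I" and x: "x \<in> R" shows "q i (scl z x) = cmod z * q i x"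
proof -
  have "form i (scl z x) (scl z x) = (cmod z)\<^sup>2 * form i x x"
    using i x by (simp add: form_scl_left form_scl_right mult_ac complex_norm_square[symmetric])
  then have "Re (form i (scl z x) (scl z x)) = (cmod z)\<^sup>2 * Re (form i x x)"
    by (simp add: Re_complex_of_real flip: of_real_power)
  then show ?thesis by (simp add: q_def real_sqrt_mult)
qed

lemma form_mul_right: assumes i: "i \<in> I" and x: "x \<in> R" and y: "y \<in> R" and w: "w \<in> R"
  shows "form i (mul w x) y = form i x (mul (star w) y)"
proof -
  have "star (mul w x) \<triangleq> mul (star x) (star w)" using x w by (simp add: aeq_def ev_star_mul)
  then have "mul (star (mul w x)) y \<triangleq> mul (mul (star x) (star w)) y" using x y w by (intro aeq_mul) auto
  then show ?thesis using x y w unfolding form_def by (simp add: talg_functional_aeq[OF i] mul_assoc)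
qed

lemma mul_one2: "w \<in> R \<Longrightarrow> mul one2 w = w" and mul_one2_right: "w \<in> R \<Longrightarrow> mul w one2 = w"
  and mul_scl_one2: "w \<in> R \<Longrightarrow> mul (scl z one2) w = scl z w"
  by (induction w rule: alg_tensors_induct) (auto simp: talg_mult_Cons talg_scale_def A.sc_mult_left)

text \<open>Pairing the identity with w gives q (x w)^2 + q (s w)^2 = K q (w)^2; dropping the second
  square is the claim.\<close>

lemma q_mul_le_of_complement:
  assumes eq: "mul (star x) x @ mul (star s) s \<triangleq> scl (of_real K) one2"
    and i: "i \<in> I" and x: "x \<in> R" and s: "s \<in> R" and w: "w \<in> R"
  shows "q i (mul x w) \<le> sqrt \<bar>K\<bar> * q i w"
proof -
  have "mul (mul (star x) x @ mul (star s) s) w \<triangleq> mul (scl (of_real K) one2) w"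
    using x s w by (intro aeq_mul eq) auto
  then have "form i w (mul (mul (star x) x @ mul (star s) s) w) = form i w (scl (of_real K) w)"
    by (intro form_aeq i) (use x s w in \<open>auto simp: mul_scl_one2\<close>)
  then have "form i (mul x w) (mul x w) + form i (mul s w) (mul s w) = of_real K * form i w w"
    using i x s w by (simp add: talg_mult_append form_append_right form_scl_right form_mul_right mul_assoc)
  then have "Re (form i (mul x w) (mul x w)) + Re (form i (mul s w) (mul s w)) = K * Re (form i w w)"
    by (drule_tac arg_cong[where f = Re]) simp
  moreover have "Re (form i (mul s w) (mul s w)) \<ge> 0" using i w s by (intro Re_form_nonneg) auto
  moreover have "K * Re (form i w w) \<le> \<bar>K\<bar> * Re (form i w w)" using Re_form_nonneg[OF i w] by (intro mult_right_mono) auto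
  ultimately have "Re (form i (mul x w) (mul x w)) \<le> \<bar>K\<bar> * Re (form i w w)" by linarith
  then show ?thesis unfolding q_def real_sqrt_mult[symmetric] by (rule real_sqrt_le_mono)
qed

lemma complement_left:
  assumes a: "a \<in> carrier A" and s: "s \<in> carrier A"
    and eq: "adj A a \<otimes>\<^bsub>A\<^esub> a \<oplus>\<^bsub>A\<^esub> adj A s \<otimes>\<^bsub>A\<^esub> s = cscale A (of_real K) \<one>\<^bsub>A\<^esub>"
  shows "mul (star [(a, \<one>\<^bsub>B\<^esub>)]) [(a, \<one>\<^bsub>B\<^esub>)] @ mul (star [(s, \<one>\<^bsub>B\<^esub>)]) [(s, \<one>\<^bsub>B\<^esub>)] \<triangleq> scl (of_real K) one2"
  unfolding aeq_def
proof (intro allI impI)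
  fix \<beta> assume "bilin \<beta>"
  then have "A.linf (\<lambda>a. \<beta> a \<one>\<^bsub>B\<^esub>)" by (simp add: bilin_def)
  from A.linf_add[OF this, of "adj A a \<otimes>\<^bsub>A\<^esub> a" "adj A s \<otimes>\<^bsub>A\<^esub> s"]
  show "ev \<beta> (mul (star [(a, \<one>\<^bsub>B\<^esub>)]) [(a, \<one>\<^bsub>B\<^esub>)] @ mul (star [(s, \<one>\<^bsub>B\<^esub>)]) [(s, \<one>\<^bsub>B\<^esub>)]) = ev \<beta> (scl (of_real K) one2)"
    using a s by (simp add: talg_adj_def talg_mult_Cons talg_scale_def flip: eq)
qed

lemma complement_right:
  assumes b: "b \<in> carrier B" and t: "t \<in> carrier B"
    and eq: "adj B b \<otimes>\<^bsub>B\<^esub> b \<oplus>\<^bsub>B\<^esub> adj B t \<otimes>\<^bsub>B\<^esub> t = cscale B (of_real L) \<one>\<^bsub>B\<^esub>"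
  shows "mul (star [(\<one>\<^bsub>A\<^esub>, b)]) [(\<one>\<^bsub>A\<^esub>, b)] @ mul (star [(\<one>\<^bsub>A\<^esub>, t)]) [(\<one>\<^bsub>A\<^esub>, t)] \<triangleq> scl (of_real L) one2"
  unfolding aeq_def
proof (intro allI impI)
  fix \<beta> assume \<beta>: "bilin \<beta>"
  then have "B.linf (\<beta> \<one>\<^bsub>A\<^esub>)" by (simp add: bilin_def)
  from B.linf_add[OF this, of "adj B b \<otimes>\<^bsub>B\<^esub> b" "adj B t \<otimes>\<^bsub>B\<^esub> t"] B.linf_sc[OF this, of "\<one>\<^bsub>B\<^esub>" "of_real L"]
  show "ev \<beta> (mul (star [(\<one>\<^bsub>A\<^esub>, b)]) [(\<one>\<^bsub>A\<^esub>, b)] @ mul (star [(\<one>\<^bsub>A\<^esub>, t)]) [(\<one>\<^bsub>A\<^esub>, t)]) = ev \<beta> (scl (of_real L) one2)"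
    using b t eq \<beta> by (simp add: talg_adj_def talg_mult_Cons ev_scl)
qed

text \<open>An elementary tensor factors as (a \<otimes> 1)(1 \<otimes> b), and each factor inherits
  a complement from its algebra. The bound is uniform over all pairs of states, which makes the
  supremum in the spatial norm finite.\<close>

lemma q_mul_bounded: assumes x: "x \<in> R" shows "\<exists>K. \<forall>i\<in>I. \<forall>w\<in>R. q i (mul x w) \<le> K * q i w"
  using x
proof (induction x rule: alg_tensors_induct)
  case Nil
  have "\<forall>i\<in>I. \<forall>w\<in>R. q i (mul [] w) \<le> 0 * q i w" by (auto simp: q_def form_ev)
  then show ?case by blast
next
  case (Cons a b x)
  obtain K s where s: "s \<in> carrier A" "adj A a \<otimes>\<^bsub>A\<^esub> a \<oplus>\<^bsub>A\<^esub> adj A s \<otimes>\<^bsub>A\<^esub> s = cscale A (of_real K) \<one>\<^bsub>A\<^esub>"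
    using A.bounded[OF Cons(1)] by blast
  note 1 = complement_left[OF Cons(1) s]
  obtain L t where t: "t \<in> carrier B" "adj B b \<otimes>\<^bsub>B\<^esub> b \<oplus>\<^bsub>B\<^esub> adj B t \<otimes>\<^bsub>B\<^esub> t = cscale B (of_real L) \<one>\<^bsub>B\<^esub>"
    using B.bounded[OF Cons(2)] by blast
  note 2 = complement_right[OF Cons(2) t]
  obtain M where M: "\<And>i w. i \<in> I \<Longrightarrow> w \<in> R \<Longrightarrow> q i (mul x w) \<le> M * q i w" using Cons(4) by blast
  have "q i (mul ((a, b) # x) w) \<le> (sqrt \<bar>K\<bar> * sqrt \<bar>L\<bar> + M) * q i w" if i: "i \<in> I" and w: "w \<in> R" for i w
  proof -
    have "mul ((a, b) # x) w = mul [(a, \<one>\<^bsub>B\<^esub>)] (mul [(\<one>\<^bsub>A\<^esub>, b)] w) @ mul x w"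
    proof -
      have "mul [(a, \<one>\<^bsub>B\<^esub>)] [(\<one>\<^bsub>A\<^esub>, b)] = [(a, b)]" using Cons by (simp add: talg_mult_Cons)
      then show ?thesis using mul_assoc[of "[(a, \<one>\<^bsub>B\<^esub>)]" "[(\<one>\<^bsub>A\<^esub>, b)]" w] Cons w
          talg_mult_append[of A B "[(a, b)]" x w] by simp
    qed
    then have "q i (mul ((a, b) # x) w) \<le> q i (mul [(a, \<one>\<^bsub>B\<^esub>)] (mul [(\<one>\<^bsub>A\<^esub>, b)] w)) + q i (mul x w)"
      using q_append[OF i, of "mul [(a, \<one>\<^bsub>B\<^esub>)] (mul [(\<one>\<^bsub>A\<^esub>, b)] w)" "mul x w"] Cons w by simp
    moreover have "q i (mul [(a, \<one>\<^bsub>B\<^esub>)] (mul [(\<one>\<^bsub>A\<^esub>, b)] w)) \<le> sqrt \<bar>K\<bar> * q i (mul [(\<one>\<^bsub>A\<^esub>, b)] w)"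
      by (rule q_mul_le_of_complement[OF 1 i]) (use Cons s t w in auto)
    moreover have "q i (mul [(\<one>\<^bsub>A\<^esub>, b)] w) \<le> sqrt \<bar>L\<bar> * q i w"
      by (rule q_mul_le_of_complement[OF 2 i]) (use Cons s t w in auto)
    then have "sqrt \<bar>K\<bar> * q i (mul [(\<one>\<^bsub>A\<^esub>, b)] w) \<le> sqrt \<bar>K\<bar> * (sqrt \<bar>L\<bar> * q i w)"
      by (rule mult_left_mono) simp
    ultimately show ?thesis using M[OF i w] by (simp add: algebra_simps)
  qed
  then show ?case by blast
qed

end

section \<open>The minimal tensor product is a C*-algebra\<close>

context tensor_factors begin

sublocale SN: seminorm_family R I q "(@)" mul scl star
proof
  show "I \<noteq> {}" using A.states_ne B.states_ne by auto
  show "\<exists>z\<in>R. \<forall>i\<in>I. q i z \<le> 1" by (intro bexI[of _ "[]"]) (auto simp: q_def form_ev)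
  show "\<exists>K. \<forall>i\<in>I. \<forall>w\<in>R. q i (mul x w) \<le> K * q i w" if "x \<in> R" for x by (rule q_mul_bounded[OF that])
  fix i x y w z assume i: "i \<in> I"
  show "0 \<le> q i x" if "x \<in> R" using Re_form_nonneg[OF i that] by (simp add: q_def)
  show "q i (scl z x) = cmod z * q i x" if "x \<in> R" by (rule q_scl[OF i that])
  show "q i (mul (x @ y) w) \<le> q i (mul x w) + q i (mul y w)" if "x \<in> R" "y \<in> R" "w \<in> R"
    using q_append[OF i, of "mul x w" "mul y w"] that by (simp add: talg_mult_append)
  have l: "mul (scl z x) w \<triangleq> scl z (mul x w)" and r: "mul x (scl z w) \<triangleq> scl z (mul x w)" if "x \<in> R" "w \<in> R"
    using that by (auto simp: aeq_def ev_rules)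
  show "q i (mul (scl z x) w) = cmod z * q i (mul x w)" if "x \<in> R" "w \<in> R"
    using q_aeq[OF i l] q_scl[OF i, of "mul x w"] that by simp
  show "q i (mul x (scl z w)) = cmod z * q i (mul x w)" if "x \<in> R" "w \<in> R"
    using q_aeq[OF i r] q_scl[OF i, of "mul x w"] that by simp
  show "q i (mul (mul x y) w) = q i (mul x (mul y w))" if "x \<in> R" "y \<in> R" "w \<in> R" using that by (simp add: mul_assoc)
  show "(q i (mul x w))\<^sup>2 \<le> q i w * q i (mul (mul (star x) x) w)" if x: "x \<in> R" and w: "w \<in> R"
  proof -
    have "(q i (mul x w))\<^sup>2 = Re (form i w (mul (mul (star x) x) w))"
      using i x w by (simp add: q_sq form_mul_right mul_assoc)
    also have "\<dots> \<le> q i w * q i (mul (mul (star x) x) w)"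
      using form_le_q[OF i, of w "mul (mul (star x) x) w"] x w complex_Re_le_cmod order_trans by fastforce
    finally show ?thesis .
  qed
qed auto

lemma N_opnorm: "N x = SN.opnorm x"
proof -
  have "{sqrt (Re (talg_functional \<phi> \<psi> (mul (star (mul x y)) (mul x y)))) | \<phi> \<psi> y.
      \<phi> \<in> states A \<and> \<psi> \<in> states B \<and> y \<in> R \<and> Re (talg_functional \<phi> \<psi> (mul (star y) y)) \<le> 1}
    = {q i (mul x y) | i y. i \<in> I \<and> y \<in> R \<and> q i y \<le> 1}"
    by (auto simp: q_def form_def)
  then show ?thesis by (simp add: min_norm_def SN.opnorm_def)
qed

lemmas N_nonneg = SN.opnorm_nonneg[folded N_opnorm]
  and N_append = SN.opnorm_add[folded N_opnorm]
  and N_mul = SN.opnorm_mul[folded N_opnorm]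
  and N_scl = SN.opnorm_sc[folded N_opnorm]
  and N_star = SN.opnorm_st[folded N_opnorm]
  and N_cstar = SN.opnorm_cstar[folded N_opnorm]
  and q_mul_le = SN.q_mul_le[folded N_opnorm]
  and N_le = SN.opnorm_le[folded N_opnorm]

lemma N_aeq: assumes "x \<triangleq> y" "x \<in> R" "y \<in> R" shows "N x = N y"
proof -
  have "N x \<le> N y" if "x \<triangleq> y" "x \<in> R" "y \<in> R" for x y
  proof (rule N_le)
    fix i w assume iw: "i \<in> I" "w \<in> R"
    have "q i (mul x w) = q i (mul y w)" by (intro q_aeq aeq_mul) (use that iw in auto)
    then show "q i (mul x w) \<le> N y * q i w" using q_mul_le[OF iw(1) that(3) iw(2)] by simp
  qed (rule N_nonneg[OF that(3)])
  then show ?thesis using assms aeq_sym by (meson order_antisym)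
qed

section \<open>The completion: Cauchy sequences modulo null sequences\<close>

abbreviation "d \<equiv> talg_dist A B"
abbreviation neg where "neg x \<equiv> scl (-1) x"

lemma d_def: "d x y = N (x @ neg y)" by (simp add: talg_dist_def)

lemma d_nonneg: "x \<in> R \<Longrightarrow> y \<in> R \<Longrightarrow> 0 \<le> d x y" by (simp add: d_def N_nonneg)

lemma N_Nil [simp]: "N [] = 0" using N_scl[of "[]" 0] by (simp add: talg_scale_def)

lemma d_aeq: "x \<triangleq> y \<Longrightarrow> x \<in> R \<Longrightarrow> y \<in> R \<Longrightarrow> d x y = 0"
  unfolding d_def by (subst N_aeq[of _ "[]"]) (auto simp: aeq_def ev_scl)

lemma d_sym: "x \<in> R \<Longrightarrow> y \<in> R \<Longrightarrow> d x y = d y x"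
  using N_aeq[of "x @ neg y" "neg (y @ neg x)"] N_scl[of "y @ neg x" "-1"]
  by (auto simp: d_def aeq_def ev_scl)

lemma d_tri: "x \<in> R \<Longrightarrow> y \<in> R \<Longrightarrow> w \<in> R \<Longrightarrow> d x w \<le> d x y + d y w"
  using N_append[of "x @ neg y" "y @ neg w"] N_aeq[of "x @ neg w" "(x @ neg y) @ (y @ neg w)"]
  by (auto simp: d_def aeq_def ev_scl)

lemma d_append: "x \<in> R \<Longrightarrow> y \<in> R \<Longrightarrow> x' \<in> R \<Longrightarrow> y' \<in> R \<Longrightarrow> d (x @ y) (x' @ y') \<le> d x x' + d y y'"
  using N_append[of "x @ neg x'" "y @ neg y'"] N_aeq[of "(x @ y) @ neg (x' @ y')" "(x @ neg x') @ (y @ neg y')"]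
  by (auto simp: d_def aeq_def ev_scl algebra_simps)

lemma d_scl: "x \<in> R \<Longrightarrow> y \<in> R \<Longrightarrow> d (scl z x) (scl z y) = cmod z * d x y"
  using N_scl[of "x @ neg y" z] N_aeq[of "scl z x @ neg (scl z y)" "scl z (x @ neg y)"]
  by (auto simp: d_def aeq_def ev_scl algebra_simps)

lemma d_star: "x \<in> R \<Longrightarrow> y \<in> R \<Longrightarrow> d (star x) (star y) = d x y"
  using N_star[of "x @ neg y"] N_aeq[of "star x @ neg (star y)" "star (x @ neg y)"]
  by (auto simp: d_def aeq_def ev_rules)

lemma d_mul: assumes "x \<in> R" "y \<in> R" "x' \<in> R" "y' \<in> R" shows "d (mul x y) (mul x' y') \<le> N x * d y y' + d x x' * N y'"
proof -
  have "d (mul x y) (mul x' y') = N (mul x (y @ neg y') @ mul (x @ neg x') y')"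
    unfolding d_def by (rule N_aeq) (use assms in \<open>auto simp: aeq_def ev_rules\<close>)
  also have "\<dots> \<le> N (mul x (y @ neg y')) + N (mul (x @ neg x') y')" using assms by (intro N_append) auto
  also have "\<dots> \<le> N x * d y y' + d x x' * N y'" unfolding d_def using assms by (intro add_mono N_mul) auto
  finally show ?thesis .
qed

lemma N_d: assumes "x \<in> R" "y \<in> R" shows "\<bar>N x - N y\<bar> \<le> d x y"
proof -
  have "N x = d x []" if "x \<in> R" for x by (simp add: d_def talg_scale_def)
  then show ?thesis using d_tri[of x y "[]"] d_tri[of y x "[]"] d_sym[of x y] assms by (simp add: abs_le_iff)
qed

abbreviation "T \<equiv> tensor A B"
abbreviation "Cy \<equiv> tens_cauchy A B"
abbreviation "cls \<equiv> tens_class A B"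

lemma Cy_R: "Cy X \<Longrightarrow> X n \<in> R" by (auto simp: tens_cauchy_def)

lemma Cy_N_Cauchy: assumes X: "Cy X" shows "convergent (\<lambda>n. N (X n))"
  unfolding Cauchy_convergent_iff[symmetric] Cauchy_iff real_norm_def
  using X N_d[OF Cy_R[OF X] Cy_R[OF X]] unfolding tens_cauchy_def by (meson order_le_less_trans)

lemma Cy_N_bounded: assumes X: "Cy X" obtains M where "M > 0" "\<And>n. N (X n) \<le> M"
proof -
  obtain K where "K > 0" "\<And>n. norm (N (X n)) \<le> K"
    using convergent_imp_Bseq[OF Cy_N_Cauchy[OF X]] by (auto elim: BseqE)
  then show ?thesis using that[of K] by (simp add: abs_le_iff)
qed

text \<open>One domination criterion for all operations; for unary ones X and Y are the same
  sequence.\<close>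

lemma CyI:
  assumes X: "Cy X" and Y: "Cy Y" and R: "\<And>n. Z n \<in> R" and K: "K > 0"
    and le: "\<And>m n. d (Z m) (Z n) \<le> K * (d (X m) (X n) + d (Y m) (Y n))"
  shows "Cy Z"
  unfolding tens_cauchy_def
proof (intro conjI allI impI)
  show "range Z \<subseteq> R" using R by auto
  fix e :: real assume e: "e > 0"
  then have e': "e / (2 * K) > 0" using K by simp
  obtain M where M: "\<And>m n. m \<ge> M \<Longrightarrow> n \<ge> M \<Longrightarrow> d (X m) (X n) < e / (2 * K)"
    using X e' unfolding tens_cauchy_def by meson
  obtain L where L: "\<And>m n. m \<ge> L \<Longrightarrow> n \<ge> L \<Longrightarrow> d (Y m) (Y n) < e / (2 * K)"
    using Y e' unfolding tens_cauchy_def by meson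
  have "d (Z m) (Z n) < e" if "m \<ge> max M L" "n \<ge> max M L" for m n
  proof -
    have "d (X m) (X n) + d (Y m) (Y n) < e / K" using M[of m n] L[of m n] that K by (simp add: field_simps)
    then show ?thesis using le[of m n] K by (simp add: field_simps)
  qed
  then show "\<exists>N. \<forall>m\<ge>N. \<forall>n\<ge>N. d (Z m) (Z n) < e" by blast
qed

lemma Cy_const [simp]: "x \<in> R \<Longrightarrow> Cy (\<lambda>n. x)"
  by (auto simp: tens_cauchy_def d_aeq)

lemma Cy_append: assumes X: "Cy X" and Y: "Cy Y" shows "Cy (\<lambda>n. X n @ Y n)"
  by (rule CyI[OF X Y, of _ 1]) (use d_append Cy_R[OF X] Cy_R[OF Y] in auto)

lemma Cy_scl: assumes X: "Cy X" shows "Cy (\<lambda>n. scl z (X n))"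
proof (rule CyI[OF X X, of _ "cmod z + 1"])
  fix m n
  have "0 \<le> d (X m) (X n)" using d_nonneg Cy_R[OF X] by blast
  then show "d (scl z (X m)) (scl z (X n)) \<le> (cmod z + 1) * (d (X m) (X n) + d (X m) (X n))"
    using d_scl[OF Cy_R[OF X] Cy_R[OF X]] by (simp add: algebra_simps)
qed (use Cy_R[OF X] in \<open>auto simp: add_nonneg_pos\<close>)

lemma Cy_star: assumes X: "Cy X" shows "Cy (\<lambda>n. star (X n))"
  by (rule CyI[OF X X, of _ 1]) (use d_star d_nonneg Cy_R[OF X] in auto)

lemma Cy_mul: assumes X: "Cy X" and Y: "Cy Y" shows "Cy (\<lambda>n. mul (X n) (Y n))"
proof -
  obtain M where M: "M > 0" "\<And>n. N (X n) \<le> M" using Cy_N_bounded[OF X] by blast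
  obtain L where L: "L > 0" "\<And>n. N (Y n) \<le> L" using Cy_N_bounded[OF Y] by blast
  show ?thesis
  proof (rule CyI[OF X Y, of _ "M + L"])
    fix m n
    have nn: "0 \<le> d (X m) (X n)" "0 \<le> d (Y m) (Y n)" using d_nonneg Cy_R[OF X] Cy_R[OF Y] by blast+
    have "d (mul (X m) (Y m)) (mul (X n) (Y n)) \<le> N (X m) * d (Y m) (Y n) + d (X m) (X n) * N (Y n)"
      using d_mul Cy_R[OF X] Cy_R[OF Y] by blast
    also have "\<dots> \<le> M * d (Y m) (Y n) + d (X m) (X n) * L"
      using M L nn by (intro add_mono mult_right_mono mult_left_mono) auto
    also have "\<dots> \<le> (M + L) * (d (X m) (X n) + d (Y m) (Y n))" using M L nn by (simp add: algebra_simps)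
    finally show "d (mul (X m) (Y m)) (mul (X n) (Y n)) \<le> (M + L) * (d (X m) (X n) + d (Y m) (Y n))" .
  qed (use M L Cy_R[OF X] Cy_R[OF Y] in auto)
qed

lemma cls_eqI:
  assumes X: "Cy X" and Y: "Cy Y" and lim: "(\<lambda>n. d (X n) (Y n)) \<longlonglongrightarrow> 0" shows "cls X = cls Y"
proof -
  have "cls X \<subseteq> cls Y" if X: "Cy X" and Y: "Cy Y" and lim: "(\<lambda>n. d (X n) (Y n)) \<longlonglongrightarrow> 0" for X Y
  proof
    fix Z assume Z: "Z \<in> cls X"
    then have ZC: "Cy Z" and l: "(\<lambda>n. d (X n) (Z n)) \<longlonglongrightarrow> 0" by (auto simp: tens_class_def)
    have "(\<lambda>n. d (Y n) (Z n)) \<longlonglongrightarrow> 0"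
    proof (rule tendsto_sandwich[OF _ _ tendsto_const])
      show "\<forall>\<^sub>F n in sequentially. d (Y n) (Z n) \<le> d (X n) (Y n) + d (X n) (Z n)"
        using d_tri d_sym Cy_R[OF X] Cy_R[OF Y] Cy_R[OF ZC] by (intro always_eventually allI) metis
      show "(\<lambda>n. d (X n) (Y n) + d (X n) (Z n)) \<longlonglongrightarrow> 0" using tendsto_add[OF lim l] by simp
    qed (use d_nonneg Cy_R[OF Y] Cy_R[OF ZC] in auto)
    then show "Z \<in> cls Y" using ZC by (simp add: tens_class_def)
  qed
  moreover have "(\<lambda>n. d (Y n) (X n)) \<longlonglongrightarrow> 0" using lim d_sym Cy_R[OF X] Cy_R[OF Y] by simp
  ultimately show ?thesis using X Y lim by blast
qed

lemma cls_eqD: assumes Y: "Cy Y" and eq: "cls X = cls Y" shows "(\<lambda>n. d (X n) (Y n)) \<longlonglongrightarrow> 0"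
proof -
  have "Y \<in> cls Y" using Y d_aeq[OF aeq_refl] Cy_R[OF Y] by (simp add: tens_class_def)
  then show ?thesis unfolding eq[symmetric] by (simp add: tens_class_def)
qed

lemma cls_aeq: assumes "Cy X" "Cy Y" "\<And>n. X n \<triangleq> Y n" shows "cls X = cls Y"
  by (rule cls_eqI) (use assms d_aeq Cy_R in auto)

lemma rep_cls: assumes X: "Cy X" shows "Cy (tens_rep (cls X))" "(\<lambda>n. d (X n) (tens_rep (cls X) n)) \<longlonglongrightarrow> 0"
proof -
  have "X \<in> cls X" using X d_aeq[OF aeq_refl] Cy_R[OF X] by (simp add: tens_class_def)
  then have "tens_rep (cls X) \<in> cls X" unfolding tens_rep_def by (rule someI[of "\<lambda>Y. Y \<in> cls X" X])
  then show "Cy (tens_rep (cls X))" "(\<lambda>n. d (X n) (tens_rep (cls X) n)) \<longlonglongrightarrow> 0" by (auto simp: tens_class_def)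
qed

lemma cls_carrier: "Cy X \<Longrightarrow> cls X \<in> carrier T" by (auto simp: tensor_def)

lemma carrier_cls: assumes "t \<in> carrier T" obtains X where "Cy X" "t = cls X"
  using assms by (auto simp: tensor_def)

lemma rep_carrier: assumes t: "t \<in> carrier T" shows "Cy (tens_rep t)" "cls (tens_rep t) = t"
proof -
  obtain X where X: "Cy X" "t = cls X" using carrier_cls[OF t] by blast
  show "Cy (tens_rep t)" unfolding X(2) by (rule rep_cls(1)[OF X(1)])
  show "cls (tens_rep t) = t" unfolding X(2) by (rule cls_eqI[OF X(1) rep_cls[OF X(1)], symmetric])
qed

text \<open>\<open>tensor\<close> computes with representatives fixed by choice. This lemma and its
  analogues for the other operations allow any Cauchy representative instead.\<close>

lemma add_cls: assumes X: "Cy X" and Y: "Cy Y" shows "cls X \<oplus>\<^bsub>T\<^esub> cls Y = cls (\<lambda>n. X n @ Y n)"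
proof -
  note x = rep_cls[OF X] and y = rep_cls[OF Y]
  have "cls (\<lambda>n. X n @ Y n) = cls (\<lambda>n. tens_rep (cls X) n @ tens_rep (cls Y) n)"
  proof (rule cls_eqI[OF Cy_append[OF X Y] Cy_append[OF x(1) y(1)] tendsto_sandwich[OF _ _ tendsto_const]])
    show "(\<lambda>n. d (X n) (tens_rep (cls X) n) + d (Y n) (tens_rep (cls Y) n)) \<longlonglongrightarrow> 0"
      using tendsto_add[OF x(2) y(2)] by simp
  qed (use d_append d_nonneg Cy_R[OF X] Cy_R[OF Y] Cy_R[OF x(1)] Cy_R[OF y(1)] in auto)
  then show ?thesis by (simp add: tensor_def)
qed

lemma scl_cls: assumes X: "Cy X" shows "cscale T z (cls X) = cls (\<lambda>n. scl z (X n))"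
proof -
  note x = rep_cls[OF X]
  have "cls (\<lambda>n. scl z (X n)) = cls (\<lambda>n. scl z (tens_rep (cls X) n))"
    by (rule cls_eqI[OF Cy_scl[OF X] Cy_scl[OF x(1)]])
      (use tendsto_mult_left[OF x(2), of "cmod z"] d_scl Cy_R[OF X] Cy_R[OF x(1)] in simp)
  then show ?thesis by (simp add: tensor_def)
qed

lemma star_cls: assumes X: "Cy X" shows "adj T (cls X) = cls (\<lambda>n. star (X n))"
proof -
  note x = rep_cls[OF X]
  have "cls (\<lambda>n. star (X n)) = cls (\<lambda>n. star (tens_rep (cls X) n))"
    by (rule cls_eqI[OF Cy_star[OF X] Cy_star[OF x(1)]]) (use x(2) d_star Cy_R[OF X] Cy_R[OF x(1)] in simp)
  then show ?thesis by (simp add: tensor_def)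
qed

lemma mul_cls: assumes X: "Cy X" and Y: "Cy Y" shows "cls X \<otimes>\<^bsub>T\<^esub> cls Y = cls (\<lambda>n. mul (X n) (Y n))"
proof -
  note x = rep_cls[OF X] and y = rep_cls[OF Y]
  obtain M where M: "M > 0" "\<And>n. N (X n) \<le> M" using Cy_N_bounded[OF X] by blast
  obtain L where L: "L > 0" "\<And>n. N (tens_rep (cls Y) n) \<le> L" using Cy_N_bounded[OF y(1)] by blast
  have "cls (\<lambda>n. mul (X n) (Y n)) = cls (\<lambda>n. mul (tens_rep (cls X) n) (tens_rep (cls Y) n))"
  proof (rule cls_eqI[OF Cy_mul[OF X Y] Cy_mul[OF x(1) y(1)] tendsto_sandwich[OF _ _ tendsto_const]])
    show "(\<lambda>n. M * d (Y n) (tens_rep (cls Y) n) + d (X n) (tens_rep (cls X) n) * L) \<longlonglongrightarrow> 0"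
      using tendsto_add[OF tendsto_mult_left[OF y(2), of M] tendsto_mult_right[OF x(2), of L]] by simp
    have "d (mul (X n) (Y n)) (mul (tens_rep (cls X) n) (tens_rep (cls Y) n))
      \<le> M * d (Y n) (tens_rep (cls Y) n) + d (X n) (tens_rep (cls X) n) * L" for n
    proof -
      have "d (mul (X n) (Y n)) (mul (tens_rep (cls X) n) (tens_rep (cls Y) n))
        \<le> N (X n) * d (Y n) (tens_rep (cls Y) n) + d (X n) (tens_rep (cls X) n) * N (tens_rep (cls Y) n)"
        by (intro d_mul Cy_R[OF X] Cy_R[OF Y] Cy_R[OF x(1)] Cy_R[OF y(1)])
      also have "\<dots> \<le> M * d (Y n) (tens_rep (cls Y) n) + d (X n) (tens_rep (cls X) n) * L"
        using M L by (intro add_mono mult_right_mono mult_left_mono d_nonneg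
          Cy_R[OF X] Cy_R[OF Y] Cy_R[OF x(1)] Cy_R[OF y(1)]) auto
      finally show ?thesis .
    qed
    then show "\<forall>\<^sub>F n in sequentially. d (mul (X n) (Y n)) (mul (tens_rep (cls X) n) (tens_rep (cls Y) n))
      \<le> M * d (Y n) (tens_rep (cls Y) n) + d (X n) (tens_rep (cls X) n) * L" by simp
  qed (use d_nonneg Cy_R[OF X] Cy_R[OF Y] Cy_R[OF x(1)] Cy_R[OF y(1)] in auto)
  then show ?thesis by (simp add: tensor_def)
qed

lemma norm_cls: assumes X: "Cy X" shows "(\<lambda>n. N (X n)) \<longlonglongrightarrow> cnorm T (cls X)"
proof -
  note x = rep_cls[OF X]
  obtain l where l: "(\<lambda>n. N (tens_rep (cls X) n)) \<longlonglongrightarrow> l" using Cy_N_Cauchy[OF x(1)] by (auto simp: convergent_def)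
  have "(\<lambda>n. N (X n) - N (tens_rep (cls X) n)) \<longlonglongrightarrow> 0"
    by (rule tendsto_rabs_zero_cancel, rule tendsto_sandwich[OF _ _ tendsto_const x(2)])
      (use N_d Cy_R[OF X] Cy_R[OF x(1)] in auto)
  then have "(\<lambda>n. N (X n)) \<longlonglongrightarrow> l" using tendsto_add[OF _ l] by fastforce
  moreover have "cnorm T (cls X) = l" using limI[OF l] by (simp add: tensor_def)
  ultimately show ?thesis by simp
qed

lemma one_T: "\<one>\<^bsub>T\<^esub> = cls (\<lambda>n. one2)" and zero_T: "\<zero>\<^bsub>T\<^esub> = cls (\<lambda>n. [])"
  by (simp_all add: tensor_def)

lemma cdiff_cls: "Cy X \<Longrightarrow> Cy Y \<Longrightarrow> cdiff T (cls X) (cls Y) = cls (\<lambda>n. X n @ neg (Y n))"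
  by (simp add: cdiff_def scl_cls add_cls Cy_scl)

lemma norm_cdiff_cls: "Cy X \<Longrightarrow> Cy Y \<Longrightarrow> (\<lambda>n. d (X n) (Y n)) \<longlonglongrightarrow> cnorm T (cdiff T (cls X) (cls Y))"
  unfolding d_def by (simp add: cdiff_cls norm_cls Cy_append Cy_scl)

lemmas cls_ops = one_T zero_T add_cls scl_cls star_cls mul_cls
  and Cy_ops = Cy_append Cy_scl Cy_star Cy_mul

lemma tensor_complete:
  assumes s: "\<And>n. s n \<in> carrier T"
    and cauchy: "\<And>e. e > 0 \<Longrightarrow> \<exists>N. \<forall>m\<ge>N. \<forall>n\<ge>N. cnorm T (cdiff T (s m) (s n)) < e"
  shows "\<exists>l\<in>carrier T. (\<lambda>n. cnorm T (cdiff T (s n) l)) \<longlonglongrightarrow> 0"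
proof -
  define X where "X m = tens_rep (s m)" for m
  have X: "Cy (X m)" "s m = cls (X m)" for m using rep_carrier[OF s] by (auto simp: X_def)
  have "\<exists>k. \<forall>i\<ge>k. \<forall>j\<ge>k. d (X m i) (X m j) < 1 / real (Suc m)" for m
    using X(1)[of m] unfolding tens_cauchy_def by simp
  \<comment> \<open>From stage k m on, the representative of s m varies by less than 1 / (m + 1);
    the diagonal sequence picks that stage.\<close>
  then obtain k where k: "\<And>m i j. i \<ge> k m \<Longrightarrow> j \<ge> k m \<Longrightarrow> d (X m i) (X m j) < 1 / real (Suc m)" by metis
  define Z where "Z m = X m (k m)" for m
  have ZR: "Z m \<in> R" for m using Cy_R[OF X(1)] by (simp add: Z_def)
  have XR: "X m n \<in> R" for m n using Cy_R[OF X(1)] by simp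
  have dl: "(\<lambda>i. d (X m i) (X n i)) \<longlonglongrightarrow> cnorm T (cdiff T (s m) (s n))" for m n
    using norm_cdiff_cls[OF X(1)[of m] X(1)[of n]] by (simp add: X(2)[symmetric])
  \<comment> \<open>Both diagonal terms are compared with the terms at a late common index i, and i
    then tends to infinity.\<close>
  have dZ: "d (Z m) (Z n) \<le> 1 / real (Suc m) + cnorm T (cdiff T (s m) (s n)) + 1 / real (Suc n)" for m n
  proof (rule LIMSEQ_le_const[OF tendsto_add[OF tendsto_add[OF tendsto_const dl] tendsto_const]], intro exI allI impI)
    fix i assume i: "i \<ge> max (k m) (k n)"
    show "d (Z m) (Z n) \<le> 1 / real (Suc m) + d (X m i) (X n i) + 1 / real (Suc n)"
      using d_tri[of "Z m" "X m i" "Z n"] d_tri[of "X m i" "X n i" "Z n"] ZR XR i k[of m "k m" i] k[of n i "k n"]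
      by (simp add: Z_def)
  qed
  have ZC: "Cy Z" unfolding tens_cauchy_def
  proof (intro conjI allI impI)
    show "range Z \<subseteq> R" using ZR by auto
    fix e :: real assume e: "e > 0"
    then obtain M where M: "\<And>m n. m \<ge> M \<Longrightarrow> n \<ge> M \<Longrightarrow> cnorm T (cdiff T (s m) (s n)) < e / 3"
      using cauchy[of "e / 3"] by auto
    obtain L where L: "1 / real (Suc L) < e / 3" using nat_approx_posE[of "e / 3"] e by auto
    have L': "1 / real (Suc n) < e / 3" if "n \<ge> L" for n
      using L that by (smt (verit) Suc_le_mono frac_le of_nat_0_less_iff of_nat_mono zero_less_Suc)
    have "d (Z m) (Z n) < e" if "m \<ge> max M L" "n \<ge> max M L" for m n
      using dZ[of m n] M[of m n] L'[of m] L'[of n] that by simp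
    then show "\<exists>N. \<forall>m\<ge>N. \<forall>n\<ge>N. d (Z m) (Z n) < e" by blast
  qed
  have "(\<lambda>m. cnorm T (cdiff T (s m) (cls Z))) \<longlonglongrightarrow> 0"
  proof (rule LIMSEQ_I)
    fix e :: real assume e: "e > 0"
    obtain M where M: "\<And>m n. m \<ge> M \<Longrightarrow> n \<ge> M \<Longrightarrow> d (Z m) (Z n) < e / 3"
      using ZC e unfolding tens_cauchy_def by (meson divide_pos_pos zero_less_numeral)
    obtain L where L: "1 / real (Suc L) < e / 3" using nat_approx_posE[of "e / 3"] e by auto
    have L': "1 / real (Suc n) < e / 3" if "n \<ge> L" for n
      using L that by (smt (verit) Suc_le_mono frac_le of_nat_0_less_iff of_nat_mono zero_less_Suc)
    have "\<bar>cnorm T (cdiff T (s m) (cls Z))\<bar> < e" if m: "m \<ge> max M L" for m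
    proof -
      have l: "(\<lambda>i. d (X m i) (Z i)) \<longlonglongrightarrow> cnorm T (cdiff T (s m) (cls Z))"
        using norm_cdiff_cls[OF X(1)[of m] ZC] by (simp add: X(2)[symmetric])
      have "cnorm T (cdiff T (s m) (cls Z)) \<le> 2 * e / 3"
      proof (rule LIMSEQ_le_const2[OF l], intro exI allI impI)
        fix i assume i: "i \<ge> max (k m) M"
        show "d (X m i) (Z i) \<le> 2 * e / 3"
          using d_tri[of "X m i" "Z m" "Z i"] XR ZR k[of m i "k m"] M[of m i] L'[of m] i m by (simp add: Z_def)
      qed
      moreover have "0 \<le> cnorm T (cdiff T (s m) (cls Z))"
        by (rule LIMSEQ_le_const[OF l]) (use d_nonneg XR ZR in auto)
      ultimately show ?thesis using e by simp
    qed
    then show "\<exists>no. \<forall>n\<ge>no. norm (cnorm T (cdiff T (s n) (cls Z)) - 0) < e"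
      by (intro exI[of _ "max M L"]) simp
  qed
  then show ?thesis using cls_carrier[OF ZC] by blast
qed

lemma tensor_ring: "ring T"
proof (intro ringI abelian_groupI monoidI)
  show "\<zero>\<^bsub>T\<^esub> \<in> carrier T" "\<one>\<^bsub>T\<^esub> \<in> carrier T" by (auto simp: cls_ops intro!: cls_carrier)
  fix a b c assume "a \<in> carrier T" "b \<in> carrier T" "c \<in> carrier T"
  then obtain X Y Z where X: "Cy X" "a = cls X" and Y: "Cy Y" "b = cls Y" and Z: "Cy Z" "c = cls Z"
    by (metis carrier_cls)
  note cy = X(1) Y(1) Z(1) and R = Cy_R[OF X(1)] Cy_R[OF Y(1)] Cy_R[OF Z(1)]
  note eq = X(2) Y(2) Z(2)
  show "a \<oplus>\<^bsub>T\<^esub> b \<in> carrier T" "a \<otimes>\<^bsub>T\<^esub> b \<in> carrier T"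
    unfolding eq using cy by (auto simp: cls_ops intro!: cls_carrier Cy_ops)
  show "a \<oplus>\<^bsub>T\<^esub> b \<oplus>\<^bsub>T\<^esub> c = a \<oplus>\<^bsub>T\<^esub> (b \<oplus>\<^bsub>T\<^esub> c)" "a \<otimes>\<^bsub>T\<^esub> b \<otimes>\<^bsub>T\<^esub> c = a \<otimes>\<^bsub>T\<^esub> (b \<otimes>\<^bsub>T\<^esub> c)"
    unfolding eq using cy R by (simp_all add: cls_ops Cy_ops mul_assoc)
  show "\<zero>\<^bsub>T\<^esub> \<oplus>\<^bsub>T\<^esub> a = a" "\<one>\<^bsub>T\<^esub> \<otimes>\<^bsub>T\<^esub> a = a" "a \<otimes>\<^bsub>T\<^esub> \<one>\<^bsub>T\<^esub> = a"
    unfolding eq using cy R by (simp_all add: cls_ops mul_one2 mul_one2_right)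
  show "a \<oplus>\<^bsub>T\<^esub> b = b \<oplus>\<^bsub>T\<^esub> a"
    unfolding eq using cy R by (simp add: cls_ops) (rule cls_aeq, simp_all add: Cy_ops aeq_def)
  show "(a \<oplus>\<^bsub>T\<^esub> b) \<otimes>\<^bsub>T\<^esub> c = a \<otimes>\<^bsub>T\<^esub> c \<oplus>\<^bsub>T\<^esub> b \<otimes>\<^bsub>T\<^esub> c"
    unfolding eq using cy R by (simp add: cls_ops Cy_ops talg_mult_append)
  show "c \<otimes>\<^bsub>T\<^esub> (a \<oplus>\<^bsub>T\<^esub> b) = c \<otimes>\<^bsub>T\<^esub> a \<oplus>\<^bsub>T\<^esub> c \<otimes>\<^bsub>T\<^esub> b"
    unfolding eq using cy R by (simp add: cls_ops Cy_ops) (rule cls_aeq, simp_all add: Cy_ops aeq_def ev_rules)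
  have "cscale T (-1) a \<oplus>\<^bsub>T\<^esub> a = \<zero>\<^bsub>T\<^esub>"
    unfolding eq using cy R by (simp add: cls_ops Cy_ops) (rule cls_aeq, simp_all add: Cy_ops aeq_def ev_rules)
  moreover have "cscale T (-1) a \<in> carrier T"
    unfolding eq using cy by (auto simp: cls_ops intro!: cls_carrier Cy_ops)
  ultimately show "\<exists>y\<in>carrier T. y \<oplus>\<^bsub>T\<^esub> a = \<zero>\<^bsub>T\<^esub>" by blast
qed

theorem tensor_cstar: "cstar_algebra T"
proof (intro cstar_algebra.intro tensor_ring cstar_algebra_axioms.intro)
  fix a b z w assume a: "a \<in> carrier T"
  then obtain X where X: "Cy X" "a = cls X" by (metis carrier_cls)
  note R = Cy_R[OF X(1)] and nX = norm_cls[OF X(1), folded X(2)]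
  show "cscale T z a \<in> carrier T" "adj T a \<in> carrier T"
    unfolding X using X(1) by (auto simp: cls_ops intro!: cls_carrier Cy_ops)
  show "cscale T 1 a = a" "cscale T z (cscale T w a) = cscale T (z * w) a"
    "cscale T (z + w) a = cscale T z a \<oplus>\<^bsub>T\<^esub> cscale T w a" "adj T (adj T a) = a"
    "adj T (cscale T z a) = cscale T (cnj z) (adj T a)"
    unfolding X(2) by - (simp add: cls_ops Cy_ops X(1) R, (rule cls_aeq; simp add: Cy_ops X(1) R aeq_def ev_rules algebra_simps)?)+
  show n0: "0 \<le> cnorm T a" by (rule LIMSEQ_le_const[OF nX]) (use N_nonneg R in auto)
  show "(cnorm T a = 0) = (a = \<zero>\<^bsub>T\<^esub>)"
  proof
    assume "cnorm T a = 0"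
    then have "(\<lambda>n. d (X n) []) \<longlonglongrightarrow> 0" using nX by (simp add: d_def talg_scale_def)
    then show "a = \<zero>\<^bsub>T\<^esub>" unfolding X(2) zero_T using X(1) by (intro cls_eqI) auto
  next
    assume a0: "a = \<zero>\<^bsub>T\<^esub>"
    have "(\<lambda>n::nat. 0) \<longlonglongrightarrow> cnorm T (cls (\<lambda>n. []))" using norm_cls[of "\<lambda>n. []"] by simp
    then show "cnorm T a = 0" unfolding a0 zero_T by (simp add: LIMSEQ_const_iff)
  qed
  show "cnorm T (cscale T z a) = cmod z * cnorm T a"
  proof (rule LIMSEQ_unique)
    show "(\<lambda>n. N (scl z (X n))) \<longlonglongrightarrow> cnorm T (cscale T z a)"
      using norm_cls[OF Cy_scl[OF X(1), of z]] X(1) by (simp add: X(2) scl_cls)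
    show "(\<lambda>n. N (scl z (X n))) \<longlonglongrightarrow> cmod z * cnorm T a"
      using tendsto_mult_left[OF nX, of "cmod z"] R by (simp add: N_scl)
  qed
  show "cnorm T (adj T a \<otimes>\<^bsub>T\<^esub> a) = (cnorm T a)\<^sup>2"
  proof (rule LIMSEQ_unique)
    show "(\<lambda>n. N (mul (star (X n)) (X n))) \<longlonglongrightarrow> cnorm T (adj T a \<otimes>\<^bsub>T\<^esub> a)"
      using norm_cls[OF Cy_mul[OF Cy_star[OF X(1)] X(1)]] X(1) by (simp add: X(2) cls_ops Cy_ops)
    show "(\<lambda>n. N (mul (star (X n)) (X n))) \<longlonglongrightarrow> (cnorm T a)\<^sup>2"
      using tendsto_power[OF nX, of 2] R by (simp add: N_cstar)
  qed
  assume b: "b \<in> carrier T"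
  then obtain Y where Y: "Cy Y" "b = cls Y" by (metis carrier_cls)
  note R2 = Cy_R[OF Y(1)] and nY = norm_cls[OF Y(1), folded Y(2)]
  show "cscale T z (a \<oplus>\<^bsub>T\<^esub> b) = cscale T z a \<oplus>\<^bsub>T\<^esub> cscale T z b"
    "cscale T z a \<otimes>\<^bsub>T\<^esub> b = cscale T z (a \<otimes>\<^bsub>T\<^esub> b)" "a \<otimes>\<^bsub>T\<^esub> cscale T z b = cscale T z (a \<otimes>\<^bsub>T\<^esub> b)"
    "adj T (a \<oplus>\<^bsub>T\<^esub> b) = adj T a \<oplus>\<^bsub>T\<^esub> adj T b" "adj T (a \<otimes>\<^bsub>T\<^esub> b) = adj T b \<otimes>\<^bsub>T\<^esub> adj T a"
    unfolding X(2) Y(2)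
    by - (simp add: cls_ops Cy_ops X(1) Y(1) R R2,
      (rule cls_aeq; simp add: Cy_ops X(1) Y(1) R R2 aeq_def ev_rules algebra_simps)?)+
  show "cnorm T (a \<oplus>\<^bsub>T\<^esub> b) \<le> cnorm T a + cnorm T b"
    unfolding X Y add_cls[OF X(1) Y(1)]
    by (rule LIMSEQ_le[OF norm_cls[OF Cy_append[OF X(1) Y(1)]] tendsto_add[OF nX nY, unfolded X Y]])
      (use N_append R R2 in auto)
  show "cnorm T (a \<otimes>\<^bsub>T\<^esub> b) \<le> cnorm T a * cnorm T b"
    unfolding X Y mul_cls[OF X(1) Y(1)]
    by (rule LIMSEQ_le[OF norm_cls[OF Cy_mul[OF X(1) Y(1)]] tendsto_mult[OF nX nY, unfolded X Y]])
      (use N_mul R R2 in auto)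
qed (use tensor_complete in blast)

end

section \<open>Functionals on tensor products\<close>

context cstar_algebra begin

text \<open>By Cauchy-Schwarz |\<phi> a|^2 \<le> \<phi> (adj a a), and the complement of a at
  ||a||^2 + e bounds the right side.\<close>

lemma state_norm_le: assumes \<phi>: "\<phi> \<in> states A" and a: "a \<in> carrier A" shows "cmod (\<phi> a) \<le> \<parallel>a\<parallel>"
proof -
  have sq: "(cmod (\<phi> a))\<^sup>2 \<le> Re (\<phi> (adj A a \<otimes> a))"
    using state_cauchy_schwarz(2)[OF \<phi> one_closed a] a by (simp add: state_one[OF \<phi>])
  have "(cmod (\<phi> a))\<^sup>2 \<le> \<parallel>a\<parallel>\<^sup>2"
  proof (rule field_le_epsilon)
    fix e :: real assume "e > 0"
    then obtain s where s: "s \<in> carrier A" "adj A a \<otimes> a \<oplus> adj A s \<otimes> s = cst (\<parallel>a\<parallel>\<^sup>2 + e)"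
      using star_mult_complement[OF a, of "\<parallel>a\<parallel>\<^sup>2 + e"] by auto
    have "\<phi> (adj A a \<otimes> a) + \<phi> (adj A s \<otimes> s) = of_real (\<parallel>a\<parallel>\<^sup>2 + e)"
      using arg_cong[OF s(2), of \<phi>] linf_state[OF \<phi>] a s(1) by (simp add: linf_simps state_one[OF \<phi>])
    then have "Re (\<phi> (adj A a \<otimes> a)) + Re (\<phi> (adj A s \<otimes> s)) = \<parallel>a\<parallel>\<^sup>2 + e"
      by (metis Re_complex_of_real plus_complex.sel(1))
    then show "(cmod (\<phi> a))\<^sup>2 \<le> \<parallel>a\<parallel>\<^sup>2 + e"
      using sq state_nonneg[OF \<phi> s(1)] by (simp add: complex_nonneg_Reals_iff)
  qed
  then show ?thesis by (rule power2_le_imp_le) (rule norm_nonneg[OF a])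
qed

definition blinf :: "('a \<Rightarrow> complex) \<Rightarrow> bool" where
  "blinf g \<longleftrightarrow> linf g \<and> (\<exists>K. \<forall>a\<in>carrier A. cmod (g a) \<le> K * \<parallel>a\<parallel>)"

lemma blinf_state: "\<phi> \<in> states A \<Longrightarrow> blinf \<phi>"
  unfolding blinf_def using linf_state state_norm_le by (auto intro!: exI[of _ 1])

lemma blinf_eqI_approx:
  assumes g: "blinf g" and g': "blinf g'" and a: "a \<in> carrier A"
    and ap: "\<And>e. e > 0 \<Longrightarrow> \<exists>s\<in>carrier A. cnorm A (cdiff A a s) < e \<and> g s = g' s"
  shows "g a = g' a"
proof -
  obtain K where K: "\<And>a. a \<in> carrier A \<Longrightarrow> cmod (g a) \<le> K * \<parallel>a\<parallel>" using g by (auto simp: blinf_def)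
  obtain L where L: "\<And>a. a \<in> carrier A \<Longrightarrow> cmod (g' a) \<le> L * \<parallel>a\<parallel>" using g' by (auto simp: blinf_def)
  have lin: "linf g" "linf g'" using g g' by (auto simp: blinf_def)
  have "cmod (g a - g' a) \<le> 0"
  proof (rule field_le_epsilon)
    fix e :: real assume e: "e > 0"
    define M where "M = \<bar>K\<bar> + \<bar>L\<bar> + 1"
    have M: "M > 0" by (simp add: M_def)
    obtain s where s: "s \<in> carrier A" "cnorm A (cdiff A a s) < e / M" "g s = g' s" using ap[of "e / M"] e M by auto
    have "g a - g' a = g (cdiff A a s) - g' (cdiff A a s)" using lin a s by (simp add: linf_cdiff)
    also have "cmod \<dots> \<le> K * cnorm A (cdiff A a s) + L * cnorm A (cdiff A a s)"
      using K[of "cdiff A a s"] L[of "cdiff A a s"] a s norm_triangle_ineq4[of "g (cdiff A a s)" "g' (cdiff A a s)"] by simp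
    also have "\<dots> \<le> M * cnorm A (cdiff A a s)"
      unfolding distrib_right[symmetric] M_def using norm_nonneg[of "cdiff A a s"] a s by (intro mult_right_mono) auto
    also have "\<dots> \<le> e" using s(2) M by (simp add: field_simps)
    finally show "cmod (g a - g' a) \<le> 0 + e" by simp
  qed
  then show ?thesis by simp
qed

end

lemma state_pullback:
  assumes f: "f \<in> carrier A \<rightarrow> carrier B" and A: "star_algebra A"
    and add: "\<And>a b. a \<in> carrier A \<Longrightarrow> b \<in> carrier A \<Longrightarrow> f (a \<oplus>\<^bsub>A\<^esub> b) = f a \<oplus>\<^bsub>B\<^esub> f b"
    and mult: "\<And>a b. a \<in> carrier A \<Longrightarrow> b \<in> carrier A \<Longrightarrow> f (a \<otimes>\<^bsub>A\<^esub> b) = f a \<otimes>\<^bsub>B\<^esub> f b"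
    and one: "f \<one>\<^bsub>A\<^esub> = \<one>\<^bsub>B\<^esub>"
    and sc: "\<And>z a. a \<in> carrier A \<Longrightarrow> f (cscale A z a) = cscale B z (f a)"
    and st: "\<And>a. a \<in> carrier A \<Longrightarrow> f (adj A a) = adj B (f a)"
    and \<phi>: "\<phi> \<in> states B"
  shows "(\<lambda>a\<in>carrier A. \<phi> (f a)) \<in> states A"
proof -
  interpret star_algebra A by fact
  show ?thesis using \<phi> f by (auto simp: states_def add mult one sc st Pi_iff)
qed

lemma state_pullback_hom:
  assumes f: "cstar_hom A B f" and A: "star_algebra A" and \<phi>: "\<phi> \<in> states B"
  shows "(\<lambda>a\<in>carrier A. \<phi> (f a)) \<in> states A"
  using f by (intro state_pullback[OF _ A _ _ _ _ _ \<phi>]) (auto simp: cstar_hom_def ring_hom_def)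

context tensor_factors begin

sublocale T: cstar_algebra "tensor A B" by (rule tensor_cstar)

lemma toa_cls: "tens_of_alg A B xs = cls (\<lambda>n. xs)" by (simp add: tens_of_alg_def)

lemma toa_carrier [simp, intro]: "xs \<in> R \<Longrightarrow> tens_of_alg A B xs \<in> carrier T"
  by (simp add: toa_cls cls_carrier)

lemma prod_carrier [simp, intro]: "a \<in> carrier A \<Longrightarrow> b \<in> carrier B \<Longrightarrow> tens_prod A B a b \<in> carrier T"
  by (simp add: tens_prod_def)

lemma toa_Nil: "tens_of_alg A B [] = \<zero>\<^bsub>T\<^esub>" by (simp add: toa_cls zero_T)

lemma toa_append: "x \<in> R \<Longrightarrow> y \<in> R \<Longrightarrow> tens_of_alg A B (x @ y) = tens_of_alg A B x \<oplus>\<^bsub>T\<^esub> tens_of_alg A B y"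
  by (simp add: toa_cls add_cls)

lemma toa_Cons: "a \<in> carrier A \<Longrightarrow> b \<in> carrier B \<Longrightarrow> xs \<in> R \<Longrightarrow>
    tens_of_alg A B ((a, b) # xs) = tens_prod A B a b \<oplus>\<^bsub>T\<^esub> tens_of_alg A B xs"
  using toa_append[of "[(a, b)]" xs] by (simp add: tens_prod_def)

lemma norm_toa: "xs \<in> R \<Longrightarrow> cnorm T (tens_of_alg A B xs) = N xs"
  using norm_cls[of "\<lambda>n. xs"] by (simp add: toa_cls LIMSEQ_const_iff)

lemma toa_aeq: "x \<triangleq> y \<Longrightarrow> x \<in> R \<Longrightarrow> y \<in> R \<Longrightarrow> tens_of_alg A B x = tens_of_alg A B y"
  unfolding toa_cls by (intro cls_aeq) auto

lemma prod_add_left: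
  assumes "a \<in> carrier A" "a' \<in> carrier A" "b \<in> carrier B"
  shows "tens_prod A B (a \<oplus>\<^bsub>A\<^esub> a') b = tens_prod A B a b \<oplus>\<^bsub>T\<^esub> tens_prod A B a' b"
proof -
  have "[(a \<oplus>\<^bsub>A\<^esub> a', b)] \<triangleq> [(a, b)] @ [(a', b)]" using assms by (simp add: aeq_def bilin_def A.linf_def)
  from toa_aeq[OF this] toa_append[of "[(a, b)]" "[(a', b)]"] show ?thesis
    using assms by (simp add: tens_prod_def)
qed

lemma prod_sc_left: "a \<in> carrier A \<Longrightarrow> b \<in> carrier B \<Longrightarrow>
    tens_prod A B (cscale A z a) b = cscale T z (tens_prod A B a b)"
  by (simp add: tens_prod_def toa_cls scl_cls) (simp add: talg_scale_def)

lemma dense_toa: assumes t: "t \<in> carrier T" and e: "e > 0"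
  obtains xs where "xs \<in> R" "cnorm T (cdiff T t (tens_of_alg A B xs)) < e"
proof -
  obtain X where X: "Cy X" "t = cls X" using carrier_cls[OF t] by blast
  obtain M where M: "\<And>m n. m \<ge> M \<Longrightarrow> n \<ge> M \<Longrightarrow> d (X m) (X n) < e / 2"
    using X(1) e unfolding tens_cauchy_def by (meson half_gt_zero)
  have "(\<lambda>n. d (X n) (X M)) \<longlonglongrightarrow> cnorm T (cdiff T t (tens_of_alg A B (X M)))"
    using norm_cdiff_cls[OF X(1) Cy_const[OF Cy_R[OF X(1)]]] by (simp add: X(2) toa_cls)
  then have "cnorm T (cdiff T t (tens_of_alg A B (X M))) \<le> e / 2"
    by (rule LIMSEQ_le_const2) (use M less_imp_le in blast)
  then have "cnorm T (cdiff T t (tens_of_alg A B (X M))) < e" using e by linarith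
  then show ?thesis by (rule that[OF Cy_R[OF X(1)]])
qed

lemma linf_toa:
  assumes g: "T.linf g" and xs: "xs \<in> R" shows "g (tens_of_alg A B xs) = ev (\<lambda>a b. g (tens_prod A B a b)) xs"
  using xs by (induction rule: alg_tensors_induct) (auto simp: toa_Nil toa_Cons T.linf_simps[OF g])

text \<open>The means to compute with \<open>\<rho> \<otimes> id\<close>,
  \<open>id \<otimes> \<Delta>\<close> and the associator, whose values are prescribed only on
  elementary tensors.\<close>

lemma blinf_eqI:
  assumes g: "T.blinf g" and g': "T.blinf g'" and t: "t \<in> carrier T"
    and eq: "\<And>a b. a \<in> carrier A \<Longrightarrow> b \<in> carrier B \<Longrightarrow> g (tens_prod A B a b) = g' (tens_prod A B a b)"
  shows "g t = g' t"
proof (rule T.blinf_eqI_approx[OF g g' t])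
  fix e :: real assume "e > 0"
  then obtain xs where xs: "xs \<in> R" "cnorm T (cdiff T t (tens_of_alg A B xs)) < e" using dense_toa[OF t] by blast
  have "g (tens_of_alg A B xs) = g' (tens_of_alg A B xs)"
  proof -
    have "ev (\<lambda>a b. g (tens_prod A B a b)) xs = ev (\<lambda>a b. g' (tens_prod A B a b)) xs"
      by (rule ev_cong[OF xs(1) eq])
    then show ?thesis using linf_toa[OF _ xs(1)] g g' unfolding T.blinf_def by metis
  qed
  then show "\<exists>s\<in>carrier T. cnorm T (cdiff T t s) < e \<and> g s = g' s" using xs by blast
qed

text \<open>The value is the inner product of the unit vector 1 \<otimes> 1 with x applied to
  it.\<close>

lemma talg_functional_le: assumes i: "i \<in> I" and x: "x \<in> R" shows "cmod (talg_functional (fst i) (snd i) x) \<le> N x"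
proof -
  have so: "star one2 = one2" by (simp add: talg_adj_def)
  have "talg_functional (fst i) (snd i) x = form i one2 x" using x by (simp add: form_def so mul_one2)
  moreover have "q i one2 = 1"
    using i by (auto simp: q_def form_def so mul_one2 talg_functional_ev A.state_one B.state_one)
  moreover have "q i x \<le> N x" using q_mul_le[OF i x, of one2] x \<open>q i one2 = 1\<close> by (simp add: mul_one2_right)
  ultimately show ?thesis using form_le_q[OF i, of one2 x] x by simp
qed

lemma tensor_functional_tendsto:
  assumes \<phi>: "\<phi> \<in> states A" and \<psi>: "\<psi> \<in> states B" and X: "Cy X"
  shows "(\<lambda>n. talg_functional \<phi> \<psi> (X n)) \<longlonglongrightarrow> tensor_functional \<phi> \<psi> (cls X)"
proof -
  have dd: "cmod (talg_functional \<phi> \<psi> x - talg_functional \<phi> \<psi> y) \<le> d x y" if "x \<in> R" "y \<in> R" for x y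
    using talg_functional_le[of "(\<phi>, \<psi>)" "x @ neg y"] that \<phi> \<psi> bilin_states[OF \<phi> \<psi>]
    by (simp add: d_def talg_functional_ev ev_scl)
  note x = rep_cls[OF X]
  have "Cauchy (\<lambda>n. talg_functional \<phi> \<psi> (tens_rep (cls X) n))"
    unfolding Cauchy_iff using x(1) dd[OF Cy_R[OF x(1)] Cy_R[OF x(1)]]
    unfolding tens_cauchy_def by (meson order_le_less_trans)
  then obtain l where l: "(\<lambda>n. talg_functional \<phi> \<psi> (tens_rep (cls X) n)) \<longlonglongrightarrow> l"
    using Cauchy_convergent_iff convergent_def by blast
  have "(\<lambda>n. talg_functional \<phi> \<psi> (X n) - talg_functional \<phi> \<psi> (tens_rep (cls X) n)) \<longlonglongrightarrow> 0"
    by (rule tendsto_norm_zero_cancel, rule tendsto_sandwich[OF _ _ tendsto_const x(2)])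
      (use dd Cy_R[OF X] Cy_R[OF x(1)] in auto)
  then have "(\<lambda>n. talg_functional \<phi> \<psi> (X n)) \<longlonglongrightarrow> l" using tendsto_add[OF _ l] by fastforce
  moreover have "tensor_functional \<phi> \<psi> (cls X) = l" using limI[OF l] by (simp add: tensor_functional_def)
  ultimately show ?thesis by simp
qed

lemma tensor_functional_state:
  assumes \<phi>: "\<phi> \<in> states A" and \<psi>: "\<psi> \<in> states B"
  shows "(\<lambda>t\<in>carrier T. tensor_functional \<phi> \<psi> t) \<in> states T"
proof -
  let ?g = "tensor_functional \<phi> \<psi>" and ?f = "talg_functional \<phi> \<psi>"
  note lim = tensor_functional_tendsto[OF \<phi> \<psi>]
  have bl: "bilin (\<lambda>a b. \<phi> a * \<psi> b)" by (rule bilin_states[OF \<phi> \<psi>])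
  have "?g (s \<oplus>\<^bsub>T\<^esub> t) = ?g s + ?g t" if s: "s \<in> carrier T" and t: "t \<in> carrier T" for s t
  proof -
    obtain X where X: "Cy X" "s = cls X" using carrier_cls[OF s] by blast
    obtain Y where Y: "Cy Y" "t = cls Y" using carrier_cls[OF t] by blast
    have "(\<lambda>n. ?f (X n @ Y n)) \<longlonglongrightarrow> ?g (s \<oplus>\<^bsub>T\<^esub> t)" using lim[OF Cy_append[OF X(1) Y(1)]] X Y by (simp add: add_cls)
    then show ?thesis using tendsto_add[OF lim[OF X(1)] lim[OF Y(1)]] X Y
      by (intro LIMSEQ_unique[of "\<lambda>n. ?f (X n @ Y n)"]) (simp_all add: talg_functional_ev)
  qed
  moreover have "?g (cscale T z t) = z * ?g t" if t: "t \<in> carrier T" for z t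
  proof -
    obtain X where X: "Cy X" "t = cls X" using carrier_cls[OF t] by blast
    have "(\<lambda>n. ?f (scl z (X n))) \<longlonglongrightarrow> ?g (cscale T z t)" using lim[OF Cy_scl[OF X(1)]] X by (simp add: scl_cls)
    then show ?thesis using tendsto_mult_left[OF lim[OF X(1)], of z] X Cy_R[OF X(1)]
      by (intro LIMSEQ_unique[of "\<lambda>n. ?f (scl z (X n))"]) (simp_all add: talg_functional_ev ev_scl bl)
  qed
  moreover have "?g (adj T t \<otimes>\<^bsub>T\<^esub> t) \<in> \<real>\<^sub>\<ge>\<^sub>0" if t: "t \<in> carrier T" for t
  proof -
    obtain X where X: "Cy X" "t = cls X" using carrier_cls[OF t] by blast
    have "(\<lambda>n. ?f (mul (star (X n)) (X n))) \<longlonglongrightarrow> ?g (adj T t \<otimes>\<^bsub>T\<^esub> t)"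
      using lim[OF Cy_mul[OF Cy_star[OF X(1)] X(1)]] X by (simp add: cls_ops Cy_ops)
    moreover have "?f (mul (star (X n)) (X n)) \<in> \<real>\<^sub>\<ge>\<^sub>0" for n
      using form_nonneg[of "(\<phi>, \<psi>)" "X n"] \<phi> \<psi> Cy_R[OF X(1)] by (simp add: form_def)
    ultimately show ?thesis by (intro Lim_in_closed_set[OF closed_nonneg_Reals_complex]) auto
  qed
  moreover have "?g \<one>\<^bsub>T\<^esub> = 1"
    using lim[of "\<lambda>n. one2"] \<phi> \<psi> by (simp add: one_T talg_functional_ev A.state_one B.state_one LIMSEQ_const_iff)
  ultimately show ?thesis by (simp add: states_def T.sc_closed)
qed

lemma tensor_functional_prod:
  "\<phi> \<in> states A \<Longrightarrow> \<psi> \<in> states B \<Longrightarrow> a \<in> carrier A \<Longrightarrow> b \<in> carrier B \<Longrightarrow>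
    tensor_functional \<phi> \<psi> (tens_prod A B a b) = \<phi> a * \<psi> b"
  using tensor_functional_tendsto[of \<phi> \<psi> "\<lambda>n. [(a, b)]"]
  by (simp add: tens_prod_def toa_cls talg_functional_ev LIMSEQ_const_iff)

lemma one_neq_zero_T: "\<one>\<^bsub>T\<^esub> \<noteq> \<zero>\<^bsub>T\<^esub>"
proof -
  obtain \<phi> \<psi> where "\<phi> \<in> states A" "\<psi> \<in> states B" using A.states_ne B.states_ne by blast
  from tensor_functional_state[OF this] show ?thesis
    using T.state_one T.linf_zero[OF T.linf_state] by (metis zero_neq_one)
qed

lemma tensor_bounded: "bounded_star_algebra T" by (rule T.bounded_star_algebraI[OF one_neq_zero_T])

lemma blinf_tensor_functional:
  assumes "\<phi> \<in> states A" "\<psi> \<in> states B" shows "T.blinf (tensor_functional \<phi> \<psi>)"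
  using T.blinf_state[OF tensor_functional_state[OF assms]]
  by (simp add: T.blinf_def T.linf_def T.sc_closed)

text \<open>Makes a \<mapsto> a \<otimes> b a bounded map, so that density can be used in the first
  leg when that leg is itself a completed tensor product. The complement at (||a|| + e)^2 bounds a
  \<otimes> 1.\<close>

lemma N_prod_le:
  assumes "cstar_algebra A" and b: "b \<in> carrier B"
  obtains K where "K \<ge> 0" "\<And>a. a \<in> carrier A \<Longrightarrow> cnorm T (tens_prod A B a b) \<le> K * cnorm A a"
proof -
  interpret CA: cstar_algebra A by fact
  have *: "N [(a, \<one>\<^bsub>B\<^esub>)] \<le> cnorm A a" if a: "a \<in> carrier A" for a
  proof (rule field_le_epsilon)
    fix e :: real assume e: "e > 0"
    have na: "0 \<le> cnorm A a" by (rule CA.norm_nonneg[OF a])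
    then have "(cnorm A a)\<^sup>2 < (cnorm A a + e)\<^sup>2" using e by (intro power_strict_mono) auto
    then obtain s where s: "s \<in> carrier A"
      "adj A a \<otimes>\<^bsub>A\<^esub> a \<oplus>\<^bsub>A\<^esub> adj A s \<otimes>\<^bsub>A\<^esub> s = cscale A (of_real ((cnorm A a + e)\<^sup>2)) \<one>\<^bsub>A\<^esub>"
      using CA.star_mult_complement[OF a] by metis
    show "N [(a, \<one>\<^bsub>B\<^esub>)] \<le> cnorm A a + e"
    proof (rule N_le)
      fix i w assume iw: "i \<in> I" "w \<in> R"
      show "q i (mul [(a, \<one>\<^bsub>B\<^esub>)] w) \<le> (cnorm A a + e) * q i w"
        using q_mul_le_of_complement[OF complement_left[OF a s] iw(1) _ _ iw(2)] a s(1) na e by simp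
    qed (use na e in simp)
  qed
  have "cnorm T (tens_prod A B a b) \<le> N [(\<one>\<^bsub>A\<^esub>, b)] * cnorm A a" if a: "a \<in> carrier A" for a
  proof -
    have "mul [(a, \<one>\<^bsub>B\<^esub>)] [(\<one>\<^bsub>A\<^esub>, b)] = [(a, b)]" using a b by (simp add: talg_mult_Cons)
    then have "N [(a, b)] \<le> N [(a, \<one>\<^bsub>B\<^esub>)] * N [(\<one>\<^bsub>A\<^esub>, b)]" using N_mul[of "[(a, \<one>\<^bsub>B\<^esub>)]" "[(\<one>\<^bsub>A\<^esub>, b)]"] a b by simp
    also have "\<dots> \<le> cnorm A a * N [(\<one>\<^bsub>A\<^esub>, b)]" using *[OF a] b by (intro mult_right_mono N_nonneg) auto
    finally show ?thesis using a b by (simp add: tens_prod_def norm_toa mult.commute)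
  qed
  then show ?thesis using that[of "N [(\<one>\<^bsub>A\<^esub>, b)]"] b by (simp add: N_nonneg)
qed

end

section \<open>Coassociativity on the level of states\<close>

lemma blinf_comp:
  assumes A: "cstar_algebra A" and B: "cstar_algebra B"
    and F: "bounded_clinear_map A B F" and g: "cstar_algebra.blinf B g"
  shows "cstar_algebra.blinf A (\<lambda>a. g (F a))"
proof -
  interpret A: cstar_algebra A by fact
  interpret B: cstar_algebra B by fact
  obtain K where K: "\<And>a. a \<in> carrier A \<Longrightarrow> cnorm B (F a) \<le> K * cnorm A a"
    using F unfolding bounded_clinear_map_def by blast
  obtain L where L: "\<And>b. b \<in> carrier B \<Longrightarrow> cmod (g b) \<le> L * cnorm B b" using g unfolding B.blinf_def by blast
  have Fc: "F a \<in> carrier B" if "a \<in> carrier A" for a using F that by (auto simp: bounded_clinear_map_def)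
  have "cmod (g (F a)) \<le> (\<bar>L\<bar> * K) * cnorm A a" if a: "a \<in> carrier A" for a
  proof -
    have "cmod (g (F a)) \<le> \<bar>L\<bar> * cnorm B (F a)"
      using L[OF Fc[OF a]] B.norm_nonneg[OF Fc[OF a]] by (smt (verit) mult_right_mono)
    also have "\<dots> \<le> \<bar>L\<bar> * (K * cnorm A a)" using K[OF a] by (intro mult_left_mono) auto
    finally show ?thesis by (simp add: mult.assoc)
  qed
  moreover have "A.linf (\<lambda>a. g (F a))"
    using F g by (auto simp: A.linf_def B.blinf_def B.linf_def bounded_clinear_map_def Pi_iff)
  ultimately show ?thesis by (auto simp: A.blinf_def)
qed

text \<open>Acting by \<phi> and then by \<psi> is acting by the convolution of \<phi> and \<psi>.
  The two sides are (\<mu> \<otimes> \<phi>) \<otimes> \<psi> and \<mu> \<otimes> (\<phi> \<otimes>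
  \<psi>) applied to the two sides of the coassociativity law.\<close>

theorem coaction_states:
  assumes C: "bounded_star_algebra C" and A: "bounded_star_algebra A"
    and \<rho>: "cstar_hom C (tensor C A) \<rho>" and \<Delta>: "cstar_hom A (tensor A A) \<Delta>"
    and \<rho>_id: "is_tensor_map C A (tensor C A) A \<rho> id \<rho>_id"
    and id_\<Delta>: "is_tensor_map C A C (tensor A A) id \<Delta> id_\<Delta>"
    and \<alpha>: "is_associator C A A \<alpha>"
    and coassoc: "\<And>f. f \<in> carrier C \<Longrightarrow> \<alpha> (\<rho>_id (\<rho> f)) = id_\<Delta> (\<rho> f)"
    and \<mu>: "\<mu> \<in> states C" and \<phi>: "\<phi> \<in> states A" and \<psi>: "\<psi> \<in> states A" and f: "f \<in> carrier C"
  shows "tensor_functional (\<lambda>f\<in>carrier C. tensor_functional \<mu> \<phi> (\<rho> f)) \<psi> (\<rho> f)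
    = tensor_functional \<mu> (\<lambda>a\<in>carrier A. tensor_functional \<phi> \<psi> (\<Delta> a)) (\<rho> f)"
proof -
  interpret C: bounded_star_algebra C by fact
  interpret A: bounded_star_algebra A by fact
  interpret CA: tensor_factors C A ..
  interpret AA: tensor_factors A A ..
  interpret BCA: bounded_star_algebra "tensor C A" by (rule CA.tensor_bounded)
  interpret BAA: bounded_star_algebra "tensor A A" by (rule AA.tensor_bounded)
  interpret CA_A: tensor_factors "tensor C A" A ..
  interpret C_AA: tensor_factors C "tensor A A" ..
  have \<rho>c: "\<rho> g \<in> carrier (tensor C A)" if "g \<in> carrier C" for g using \<rho> that by (rule cstar_hom_closed)
  have \<Delta>c: "\<Delta> a \<in> carrier (tensor A A)" if "a \<in> carrier A" for a using \<Delta> that by (rule cstar_hom_closed)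
  define \<omega>1 where "\<omega>1 = (\<lambda>t\<in>carrier (tensor C A). tensor_functional \<mu> \<phi> t)"
  define \<omega>2 where "\<omega>2 = (\<lambda>t\<in>carrier (tensor A A). tensor_functional \<phi> \<psi> t)"
  have \<omega>1: "\<omega>1 \<in> states (tensor C A)" unfolding \<omega>1_def by (rule CA.tensor_functional_state[OF \<mu> \<phi>])
  have \<omega>2: "\<omega>2 \<in> states (tensor A A)" unfolding \<omega>2_def by (rule AA.tensor_functional_state[OF \<phi> \<psi>])
  define \<mu>' where "\<mu>' = (\<lambda>f\<in>carrier C. tensor_functional \<mu> \<phi> (\<rho> f))"
  define \<psi>' where "\<psi>' = (\<lambda>a\<in>carrier A. tensor_functional \<phi> \<psi> (\<Delta> a))"
  have "\<mu>' = (\<lambda>f\<in>carrier C. \<omega>1 (\<rho> f))" using \<rho>c by (auto simp: \<mu>'_def \<omega>1_def)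
  then have \<mu>': "\<mu>' \<in> states C" using state_pullback_hom[OF \<rho> C.star_algebra_axioms \<omega>1] by simp
  have "\<psi>' = (\<lambda>f\<in>carrier A. \<omega>2 (\<Delta> f))" using \<Delta>c by (auto simp: \<psi>'_def \<omega>2_def)
  then have \<psi>': "\<psi>' \<in> states A" using state_pullback_hom[OF \<Delta> A.star_algebra_axioms \<omega>2] by simp
  have m: "bounded_clinear_map (tensor C A) (tensor (tensor C A) A) \<rho>_id"
    "bounded_clinear_map (tensor C A) (tensor C (tensor A A)) id_\<Delta>"
    "bounded_clinear_map (tensor (tensor C A) A) (tensor C (tensor A A)) \<alpha>"
    using \<rho>_id id_\<Delta> \<alpha> by (auto simp: is_tensor_map_def is_associator_def)
  have 1: "tensor_functional \<mu>' \<psi> (\<rho> f) = tensor_functional \<omega>1 \<psi> (\<rho>_id (\<rho> f))"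
  proof (rule CA.blinf_eqI[OF CA.blinf_tensor_functional[OF \<mu>' \<psi>]
        blinf_comp[OF CA.tensor_cstar CA_A.tensor_cstar m(1) CA_A.blinf_tensor_functional[OF \<omega>1 \<psi>]] \<rho>c[OF f]])
    fix c a assume ca: "c \<in> carrier C" "a \<in> carrier A"
    then have "\<rho>_id (tens_prod C A c a) = tens_prod (tensor C A) A (\<rho> c) a" using \<rho>_id by (simp add: is_tensor_map_def)
    then show "tensor_functional \<mu>' \<psi> (tens_prod C A c a) = tensor_functional \<omega>1 \<psi> (\<rho>_id (tens_prod C A c a))"
      using ca \<rho>c by (simp add: CA.tensor_functional_prod[OF \<mu>' \<psi>] CA_A.tensor_functional_prod[OF \<omega>1 \<psi>])
        (simp add: \<mu>'_def \<omega>1_def)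
  qed
  have 2: "tensor_functional \<mu> \<psi>' (\<rho> f) = tensor_functional \<mu> \<omega>2 (id_\<Delta> (\<rho> f))"
  proof (rule CA.blinf_eqI[OF CA.blinf_tensor_functional[OF \<mu> \<psi>']
        blinf_comp[OF CA.tensor_cstar C_AA.tensor_cstar m(2) C_AA.blinf_tensor_functional[OF \<mu> \<omega>2]] \<rho>c[OF f]])
    fix c a assume ca: "c \<in> carrier C" "a \<in> carrier A"
    then have "id_\<Delta> (tens_prod C A c a) = tens_prod C (tensor A A) c (\<Delta> a)" using id_\<Delta> by (simp add: is_tensor_map_def)
    then show "tensor_functional \<mu> \<psi>' (tens_prod C A c a) = tensor_functional \<mu> \<omega>2 (id_\<Delta> (tens_prod C A c a))"
      using ca \<Delta>c by (simp add: CA.tensor_functional_prod[OF \<mu> \<psi>'] C_AA.tensor_functional_prod[OF \<mu> \<omega>2])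
        (simp add: \<psi>'_def \<omega>2_def)
  qed
  have bl: "CA_A.T.blinf (\<lambda>t. tensor_functional \<mu> \<omega>2 (\<alpha> t))"
    by (rule blinf_comp[OF CA_A.tensor_cstar C_AA.tensor_cstar m(3) C_AA.blinf_tensor_functional[OF \<mu> \<omega>2]])
  \<comment> \<open>Density is used twice: first to reduce to s \<otimes> a with s in the completed
    product, then to s = c \<otimes> b.\<close>
  have 3: "tensor_functional \<omega>1 \<psi> t = tensor_functional \<mu> \<omega>2 (\<alpha> t)" if t: "t \<in> carrier (tensor (tensor C A) A)" for t
  proof (rule CA_A.blinf_eqI[OF CA_A.blinf_tensor_functional[OF \<omega>1 \<psi>] bl t])
    fix s a assume s: "s \<in> carrier (tensor C A)" and a: "a \<in> carrier A"
    obtain K where K: "K \<ge> 0" "\<And>s. s \<in> carrier (tensor C A) \<Longrightarrow>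
        cnorm (tensor (tensor C A) A) (tens_prod (tensor C A) A s a) \<le> K * cnorm (tensor C A) s"
      using CA_A.N_prod_le[OF CA.tensor_cstar a] by blast
    have "bounded_clinear_map (tensor C A) (tensor (tensor C A) A) (\<lambda>s. tens_prod (tensor C A) A s a)"
      using a K(2) by (auto simp: bounded_clinear_map_def CA_A.prod_add_left CA_A.prod_sc_left)
    note bp = blinf_comp[OF CA.tensor_cstar CA_A.tensor_cstar this]
    show "tensor_functional \<omega>1 \<psi> (tens_prod (tensor C A) A s a) = tensor_functional \<mu> \<omega>2 (\<alpha> (tens_prod (tensor C A) A s a))"
    proof (rule CA.blinf_eqI[OF bp[OF CA_A.blinf_tensor_functional[OF \<omega>1 \<psi>]] bp[OF bl] s])
      fix c b assume cb: "c \<in> carrier C" "b \<in> carrier A"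
      then have "\<alpha> (tens_prod (tensor C A) A (tens_prod C A c b) a) = tens_prod C (tensor A A) c (tens_prod A A b a)"
        using \<alpha> a by (simp add: is_associator_def)
      then show "tensor_functional \<omega>1 \<psi> (tens_prod (tensor C A) A (tens_prod C A c b) a)
          = tensor_functional \<mu> \<omega>2 (\<alpha> (tens_prod (tensor C A) A (tens_prod C A c b) a))"
        using cb a by (simp add: CA_A.tensor_functional_prod[OF \<omega>1 \<psi>] C_AA.tensor_functional_prod[OF \<mu> \<omega>2])
          (simp add: \<omega>1_def \<omega>2_def CA.tensor_functional_prod[OF \<mu> \<phi>] AA.tensor_functional_prod[OF \<phi> \<psi>])
    qed
  qed
  have "\<rho>_id (\<rho> f) \<in> carrier (tensor (tensor C A) A)" using m(1) \<rho>c[OF f] by (auto simp: bounded_clinear_map_def)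
  from 1 2 3[OF this] coassoc[OF f] show ?thesis by (simp add: \<mu>'_def \<psi>'_def)
qed

section \<open>Evaluation of function-valued tensors\<close>

context cstar_algebra begin

definition conv :: "(nat \<Rightarrow> 'a) \<Rightarrow> 'a \<Rightarrow> bool" where
  "conv s l \<longleftrightarrow> (\<forall>n. s n \<in> carrier A) \<and> l \<in> carrier A \<and> (\<lambda>n. \<parallel>s n \<ominus> l\<parallel>) \<longlonglongrightarrow> 0"

lemma conv_unique: "conv s l \<Longrightarrow> conv s m \<Longrightarrow> l = m"
  using limit_unique[of s l m] by (simp add: conv_def)

lemma convI_le:
  assumes "\<And>n. s n \<in> carrier A" "l \<in> carrier A" "f \<longlonglongrightarrow> 0" "\<And>n. \<parallel>s n \<ominus> l\<parallel> \<le> f n"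
  shows "conv s l"
proof -
  have "(\<lambda>n. \<parallel>s n \<ominus> l\<parallel>) \<longlonglongrightarrow> 0"
    by (rule tendsto_sandwich[OF _ _ tendsto_const assms(3)]) (use assms norm_nonneg in auto)
  then show ?thesis using assms by (simp add: conv_def)
qed

lemma conv_close:
  assumes s: "conv s l" and t: "\<And>n. t n \<in> carrier A" and f: "f \<longlonglongrightarrow> 0" "\<And>n. \<parallel>s n \<ominus> t n\<parallel> \<le> f n"
  shows "conv t l"
proof (rule convI_le[where f = "\<lambda>n. f n + \<parallel>s n \<ominus> l\<parallel>"])
  show "(\<lambda>n. f n + \<parallel>s n \<ominus> l\<parallel>) \<longlonglongrightarrow> 0" using tendsto_add[OF f(1), of "\<lambda>n. \<parallel>s n \<ominus> l\<parallel>" 0] s by (simp add: conv_def)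
  have "\<parallel>t n \<ominus> l\<parallel> \<le> \<parallel>t n \<ominus> s n\<parallel> + \<parallel>s n \<ominus> l\<parallel>" for n using s t by (intro nrm_triangle3) (auto simp: conv_def)
  then show "\<parallel>t n \<ominus> l\<parallel> \<le> f n + \<parallel>s n \<ominus> l\<parallel>" for n
    using f(2)[of n] nrm_diff_commute[of "t n" "s n"] s t by (simp add: conv_def) (smt (verit))
qed (use s t in \<open>auto simp: conv_def\<close>)

lemma conv_const: "l \<in> carrier A \<Longrightarrow> conv (\<lambda>n. l) l"
  by (simp add: conv_def a_minus_def r_neg)

lemma conv_add: assumes "conv s l" "conv t m" shows "conv (\<lambda>n. s n \<oplus> t n) (l \<oplus> m)"
proof (rule convI_le)
  show "(\<lambda>n. \<parallel>s n \<ominus> l\<parallel> + \<parallel>t n \<ominus> m\<parallel>) \<longlonglongrightarrow> 0"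
    using tendsto_add[of "\<lambda>n. \<parallel>s n \<ominus> l\<parallel>" 0 _ "\<lambda>n. \<parallel>t n \<ominus> m\<parallel>" 0] assms by (simp add: conv_def)
  fix n
  have "s n \<oplus> t n \<ominus> (l \<oplus> m) = (s n \<ominus> l) \<oplus> (t n \<ominus> m)"
    by (rule linf_eqI) (use assms in \<open>simp_all add: conv_def linf_simps\<close>)
  then show "\<parallel>s n \<oplus> t n \<ominus> (l \<oplus> m)\<parallel> \<le> \<parallel>s n \<ominus> l\<parallel> + \<parallel>t n \<ominus> m\<parallel>"
    using norm_triangle[of "s n \<ominus> l" "t n \<ominus> m"] assms by (simp add: conv_def)
qed (use assms in \<open>auto simp: conv_def\<close>)

lemma conv_mult: assumes "conv s l" "conv t m" shows "conv (\<lambda>n. s n \<otimes> t n) (l \<otimes> m)"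
proof (rule convI_le)
  have c: "s n \<in> carrier A" "t n \<in> carrier A" "l \<in> carrier A" "m \<in> carrier A" for n using assms by (auto simp: conv_def)
  have l: "(\<lambda>n. \<parallel>s n \<ominus> l\<parallel>) \<longlonglongrightarrow> 0" "(\<lambda>n. \<parallel>t n \<ominus> m\<parallel>) \<longlonglongrightarrow> 0" using assms by (auto simp: conv_def)
  show "(\<lambda>n. (\<parallel>l\<parallel> + \<parallel>s n \<ominus> l\<parallel>) * \<parallel>t n \<ominus> m\<parallel> + \<parallel>s n \<ominus> l\<parallel> * \<parallel>m\<parallel>) \<longlonglongrightarrow> 0"
    by (auto intro!: tendsto_eq_intros l)
  fix n
  have "s n \<otimes> t n \<ominus> l \<otimes> m = s n \<otimes> (t n \<ominus> m) \<oplus> (s n \<ominus> l) \<otimes> m"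
    by (rule linf_eqI) (use c in \<open>simp_all add: linf_expand\<close>)
  then have "\<parallel>s n \<otimes> t n \<ominus> l \<otimes> m\<parallel> \<le> \<parallel>s n \<otimes> (t n \<ominus> m)\<parallel> + \<parallel>(s n \<ominus> l) \<otimes> m\<parallel>"
    using norm_triangle[of "s n \<otimes> (t n \<ominus> m)" "(s n \<ominus> l) \<otimes> m"] c by simp
  also have "\<dots> \<le> \<parallel>s n\<parallel> * \<parallel>t n \<ominus> m\<parallel> + \<parallel>s n \<ominus> l\<parallel> * \<parallel>m\<parallel>" by (intro add_mono norm_mult) (use c in auto)
  also have "\<parallel>s n\<parallel> * \<parallel>t n \<ominus> m\<parallel> \<le> (\<parallel>l\<parallel> + \<parallel>s n \<ominus> l\<parallel>) * \<parallel>t n \<ominus> m\<parallel>"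
    using nrm_diff_ge[of "s n" l] c by (intro mult_right_mono norm_nonneg) auto
  finally show "\<parallel>s n \<otimes> t n \<ominus> l \<otimes> m\<parallel> \<le> (\<parallel>l\<parallel> + \<parallel>s n \<ominus> l\<parallel>) * \<parallel>t n \<ominus> m\<parallel> + \<parallel>s n \<ominus> l\<parallel> * \<parallel>m\<parallel>" by simp
qed (use assms in \<open>auto simp: conv_def\<close>)

lemma conv_st: "conv s l \<Longrightarrow> conv (\<lambda>n. adj A (s n)) (adj A l)"
  using limit_st[of s l] by (simp add: conv_def)

lemma conv_sc: "conv s l \<Longrightarrow> conv (\<lambda>n. cscale A z (s n)) (cscale A z l)"
  using conv_mult[OF conv_const[of "cscale A z \<one>"], of s l] by (simp add: conv_def sc_mult_left)

lemma conv_state: assumes \<phi>: "\<phi> \<in> states A" and s: "conv s l" shows "(\<lambda>n. \<phi> (s n)) \<longlonglongrightarrow> \<phi> l"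
proof -
  have "(\<lambda>n. \<phi> (s n) - \<phi> l) \<longlonglongrightarrow> 0"
  proof (rule tendsto_norm_zero_cancel, rule tendsto_sandwich[OF _ _ tendsto_const])
    show "(\<lambda>n. \<parallel>s n \<ominus> l\<parallel>) \<longlonglongrightarrow> 0" using s by (simp add: conv_def)
    have "cmod (\<phi> (s n) - \<phi> l) \<le> \<parallel>s n \<ominus> l\<parallel>" for n
      using state_norm_le[OF \<phi>, of "s n \<ominus> l"] linf_diff[OF linf_state[OF \<phi>]] s by (simp add: conv_def)
    then show "\<forall>\<^sub>F n in sequentially. cmod (\<phi> (s n) - \<phi> l) \<le> \<parallel>s n \<ominus> l\<parallel>" by simp
  qed simp
  then show ?thesis by (simp add: LIM_zero_iff)
qed

lemma convergent_of_Cauchy: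
  assumes s: "\<And>n. s n \<in> carrier A" and c: "\<And>e. e > 0 \<Longrightarrow> \<exists>N. \<forall>m\<ge>N. \<forall>n\<ge>N. \<parallel>s m \<ominus> s n\<parallel> < e"
  obtains l where "conv s l"
  using complete[of s] s c by (auto simp: conv_def cdiff_minus)

end

section \<open>Slices along characters\<close>

definition ctr :: "('b, 'n) cstar_scheme \<Rightarrow> ('a \<Rightarrow> complex) \<Rightarrow> ('a \<times> 'b) list \<Rightarrow> 'b" where
  "ctr B \<phi> xs = talg_contract B (\<lambda>(a, b). cscale B (\<phi> a) b) xs"

lemma ctr_Nil [simp]: "ctr B \<phi> [] = \<zero>\<^bsub>B\<^esub>"
  and ctr_Cons [simp]: "ctr B \<phi> ((a, b) # xs) = cscale B (\<phi> a) b \<oplus>\<^bsub>B\<^esub> ctr B \<phi> xs"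
  by (simp_all add: ctr_def talg_contract_def)

text \<open>For a multiplicative state the slice map is a *-homomorphism; Dirac states are the case
  needed for evaluation at points.\<close>

definition character :: "('a, 'm) cstar_scheme \<Rightarrow> ('a \<Rightarrow> complex) \<Rightarrow> bool" where
  "character A \<phi> \<longleftrightarrow> \<phi> \<in> states A \<and> (\<forall>a\<in>carrier A. \<forall>b\<in>carrier A. \<phi> (a \<otimes>\<^bsub>A\<^esub> b) = \<phi> a * \<phi> b)"

context tensor_factors begin

lemma ctr_closed [simp, intro]: "xs \<in> R \<Longrightarrow> ctr B \<phi> xs \<in> carrier B"
  by (induction rule: alg_tensors_induct) auto

lemma linf_ctr: assumes "B.linf g" and xs: "xs \<in> R" shows "g (ctr B \<phi> xs) = ev (\<lambda>a b. \<phi> a * g b) xs"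
  using xs assms(1) by (induction xs rule: alg_tensors_induct) (auto simp: B.linf_simps)

lemma ctr_append: "xs \<in> R \<Longrightarrow> ys \<in> R \<Longrightarrow> ctr B \<phi> (xs @ ys) = ctr B \<phi> xs \<oplus>\<^bsub>B\<^esub> ctr B \<phi> ys"
  by (induction xs rule: alg_tensors_induct) (auto simp: B.a_assoc)

lemma ctr_scl: assumes "\<phi> \<in> states A" and xs: "xs \<in> R" shows "ctr B \<phi> (scl z xs) = cscale B z (ctr B \<phi> xs)"
  using xs assms(1) by (induction xs rule: alg_tensors_induct)
    (auto simp: talg_scale_def A.linf_sc[OF A.linf_state] B.sc_add_right B.sc_sc)

lemma ctr_minus: "\<phi> \<in> states A \<Longrightarrow> xs \<in> R \<Longrightarrow> ys \<in> R \<Longrightarrow> ctr B \<phi> (xs @ neg ys) = cdiff B (ctr B \<phi> xs) (ctr B \<phi> ys)"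
  by (simp add: ctr_append ctr_scl cdiff_def)

lemma ctr_star: assumes "\<phi> \<in> states A" and xs: "xs \<in> R" shows "ctr B \<phi> (star xs) = adj B (ctr B \<phi> xs)"
  using xs assms(1) by (induction xs rule: alg_tensors_induct) (auto simp: talg_adj_def A.state_st B.st_add B.st_sc)

lemma ctr_mul:
  assumes \<phi>: "character A \<phi>" and x: "x \<in> R" and y: "y \<in> R"
  shows "ctr B \<phi> (mul x y) = ctr B \<phi> x \<otimes>\<^bsub>B\<^esub> ctr B \<phi> y"
  using x
proof (induction x rule: alg_tensors_induct)
  case (Cons a b x)
  have "ctr B \<phi> (map (\<lambda>(c, d). (a \<otimes>\<^bsub>A\<^esub> c, b \<otimes>\<^bsub>B\<^esub> d)) y) = cscale B (\<phi> a) b \<otimes>\<^bsub>B\<^esub> ctr B \<phi> y"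
    using y by (induction y rule: alg_tensors_induct)
      (use Cons \<phi> in \<open>auto simp: character_def B.r_distr B.sc_mult_left B.sc_mult_right B.sc_sc B.sc_add_right mult.commute\<close>)
  moreover have "map (\<lambda>(c, d). (a \<otimes>\<^bsub>A\<^esub> c, b \<otimes>\<^bsub>B\<^esub> d)) y \<in> R" by (rule alg_tensors_map[OF y]) (use Cons in auto)
  ultimately show ?case using Cons y by (simp add: talg_mult_Cons ctr_append B.l_distr)
qed (use y in simp)

lemma ctr_one2: "\<phi> \<in> states A \<Longrightarrow> ctr B \<phi> one2 = \<one>\<^bsub>B\<^esub>" by (simp add: A.state_one)

text \<open>The GNS space of a character is one-dimensional, so the form reduces to that of \<psi>
  on the contracted elements.\<close>

lemma form_character:
  assumes \<phi>: "character A \<phi>" and \<psi>: "\<psi> \<in> states B" and x: "x \<in> R" and y: "y \<in> R"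
  shows "form (\<phi>, \<psi>) x y = \<psi> (adj B (ctr B \<phi> x) \<otimes>\<^bsub>B\<^esub> ctr B \<phi> y)"
proof -
  have \<phi>s: "\<phi> \<in> states A" using \<phi> by (simp add: character_def)
  have "form (\<phi>, \<psi>) x y = ev (\<lambda>a b. \<phi> a * \<psi> b) (mul (star x) y)" by (simp add: form_def talg_functional_ev)
  also have "\<dots> = \<psi> (ctr B \<phi> (mul (star x) y))" using x y by (simp add: linf_ctr[OF B.linf_state[OF \<psi>]])
  finally show ?thesis using x y by (simp add: ctr_mul[OF \<phi>] ctr_star[OF \<phi>s])
qed

text \<open>Test vectors of the form \<open>1 \<otimes> b\<close> in the spatial norm.\<close>

lemma state_ctr_le_N:
  assumes \<phi>: "character A \<phi>" and \<psi>: "\<psi> \<in> states B" and x: "x \<in> R" and b: "b \<in> carrier B"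
  shows "sqrt (Re (\<psi> (adj B (ctr B \<phi> x \<otimes>\<^bsub>B\<^esub> b) \<otimes>\<^bsub>B\<^esub> (ctr B \<phi> x \<otimes>\<^bsub>B\<^esub> b)))) \<le> N x * sqrt (Re (\<psi> (adj B b \<otimes>\<^bsub>B\<^esub> b)))"
proof -
  have \<phi>s: "\<phi> \<in> states A" using \<phi> by (simp add: character_def)
  have i: "(\<phi>, \<psi>) \<in> I" using \<phi>s \<psi> by simp
  have c: "ctr B \<phi> [(\<one>\<^bsub>A\<^esub>, b)] = b" using b \<phi>s by (simp add: A.state_one)
  have "q (\<phi>, \<psi>) (mul x [(\<one>\<^bsub>A\<^esub>, b)]) \<le> N x * q (\<phi>, \<psi>) [(\<one>\<^bsub>A\<^esub>, b)]" by (rule q_mul_le[OF i x]) (use b in simp)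
  then show ?thesis using x b c by (simp add: q_def form_character[OF \<phi> \<psi>] ctr_mul[OF \<phi>])
qed

text \<open>A norming state for the contracted element, tested against 1 \<otimes> 1, recovers its
  whole norm from the spatial norm.\<close>

lemma norm_ctr_le:
  assumes B: "cstar_algebra B" and \<phi>: "character A \<phi>" and x: "x \<in> R"
  shows "cnorm B (ctr B \<phi> x) \<le> N x"
proof -
  interpret CB: cstar_algebra B by fact
  have "\<one>\<^bsub>B\<^esub> \<noteq> \<zero>\<^bsub>B\<^esub>" using B.states_ne B.state_one B.linf_zero[OF B.linf_state] by (metis ex_in_conv zero_neq_one)
  then obtain \<psi> where \<psi>: "\<psi> \<in> states B" "\<psi> (adj B (ctr B \<phi> x) \<otimes>\<^bsub>B\<^esub> ctr B \<phi> x) = of_real ((cnorm B (ctr B \<phi> x))\<^sup>2)"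
    using CB.norming_state[of "ctr B \<phi> x"] x by blast
  have "sqrt ((cnorm B (ctr B \<phi> x))\<^sup>2) \<le> N x"
    using state_ctr_le_N[OF \<phi> \<psi>(1) x B.one_closed] \<psi>(2) x by (simp add: B.state_one[OF \<psi>(1)])
  then show ?thesis using CB.norm_nonneg[of "ctr B \<phi> x"] x by simp
qed

text \<open>\<open>slice\<close> is a definite description about a chosen representative.
  Contractions of any representing sequence are Cauchy by \<open>norm_ctr_le\<close>, and sequences
  at distance tending to 0 have the same limit.\<close>

lemma slice_conv:
  assumes B: "cstar_algebra B" and \<phi>: "character A \<phi>" and X: "Cy X"
  shows "cstar_algebra.conv B (\<lambda>n. ctr B \<phi> (X n)) (slice B \<phi> (cls X))"
proof -
  interpret CB: cstar_algebra B by fact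
  have \<phi>s: "\<phi> \<in> states A" using \<phi> by (simp add: character_def)
  have dd: "cnorm B (ctr B \<phi> x \<ominus>\<^bsub>B\<^esub> ctr B \<phi> y) \<le> d x y" if "x \<in> R" "y \<in> R" for x y
    using norm_ctr_le[OF B \<phi>, of "x @ neg y"] that by (simp add: ctr_minus[OF \<phi>s] d_def B.cdiff_minus)
  note x = rep_cls[OF X] and R = Cy_R[OF X] Cy_R[OF rep_cls(1)[OF X]]
  obtain l where l: "CB.conv (\<lambda>n. ctr B \<phi> (X n)) l"
  proof (rule CB.convergent_of_Cauchy)
    show "ctr B \<phi> (X n) \<in> carrier B" for n using R by simp
    fix e :: real assume "e > 0"
    then obtain M where "\<And>m n. m \<ge> M \<Longrightarrow> n \<ge> M \<Longrightarrow> d (X m) (X n) < e" using X unfolding tens_cauchy_def by meson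
    then show "\<exists>N. \<forall>m\<ge>N. \<forall>n\<ge>N. cnorm B (ctr B \<phi> (X m) \<ominus>\<^bsub>B\<^esub> ctr B \<phi> (X n)) < e"
      using dd[OF R(1) R(1)] order_le_less_trans by blast
  qed
  have rl: "CB.conv (\<lambda>n. ctr B \<phi> (tens_rep (cls X) n)) l"
    by (rule CB.conv_close[OF l _ x(2)]) (use dd R in auto)
  have "slice B \<phi> (cls X) = l" unfolding slice_def ctr_def[symmetric]
  proof (rule the_equality)
    show "l \<in> carrier B \<and> (\<lambda>n. cnorm B (cdiff B (ctr B \<phi> (tens_rep (cls X) n)) l)) \<longlonglongrightarrow> 0"
      using rl R by (simp add: CB.conv_def B.cdiff_minus)
    fix m assume "m \<in> carrier B \<and> (\<lambda>n. cnorm B (cdiff B (ctr B \<phi> (tens_rep (cls X) n)) m)) \<longlonglongrightarrow> 0"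
    then have "CB.conv (\<lambda>n. ctr B \<phi> (tens_rep (cls X) n)) m" using R by (auto simp: CB.conv_def B.cdiff_minus)
    then show "m = l" using CB.conv_unique rl by blast
  qed
  then show ?thesis using l by simp
qed

lemma slice_state:
  assumes B: "cstar_algebra B" and \<phi>: "character A \<phi>" and \<psi>: "\<psi> \<in> states B" and t: "t \<in> carrier T"
  shows "\<psi> (slice B \<phi> t) = tensor_functional \<phi> \<psi> t"
proof -
  interpret CB: cstar_algebra B by fact
  have \<phi>s: "\<phi> \<in> states A" using \<phi> by (simp add: character_def)
  obtain X where X: "Cy X" "t = cls X" using carrier_cls[OF t] by blast
  have "(\<lambda>n. \<psi> (ctr B \<phi> (X n))) \<longlonglongrightarrow> \<psi> (slice B \<phi> t)"
    using CB.conv_state[OF \<psi> slice_conv[OF B \<phi> X(1)]] X(2) by simp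
  moreover have "\<psi> (ctr B \<phi> (X n)) = talg_functional \<phi> \<psi> (X n)" for n
    using linf_ctr[OF B.linf_state[OF \<psi>] Cy_R[OF X(1)]] by (simp add: talg_functional_ev)
  ultimately show ?thesis using tensor_functional_tendsto[OF \<phi>s \<psi> X(1)] X(2) by (auto intro: LIMSEQ_unique)
qed

lemma slice_hom:
  assumes B: "cstar_algebra B" and \<phi>: "character A \<phi>" shows "cstar_hom T B (slice B \<phi>)"
proof -
  interpret CB: cstar_algebra B by fact
  have \<phi>s: "\<phi> \<in> states A" using \<phi> by (simp add: character_def)
  note sc = slice_conv[OF B \<phi>]
  have cl: "slice B \<phi> t \<in> carrier B" if t: "t \<in> carrier T" for t
  proof -
    obtain X where X: "Cy X" "t = cls X" using carrier_cls[OF t] by blast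
    then show ?thesis using sc[OF X(1)] by (simp add: CB.conv_def)
  qed
  have add: "slice B \<phi> (s \<oplus>\<^bsub>T\<^esub> t) = slice B \<phi> s \<oplus>\<^bsub>B\<^esub> slice B \<phi> t" and mult: "slice B \<phi> (s \<otimes>\<^bsub>T\<^esub> t) = slice B \<phi> s \<otimes>\<^bsub>B\<^esub> slice B \<phi> t"
    if s: "s \<in> carrier T" and t: "t \<in> carrier T" for s t
  proof -
    obtain X where X: "Cy X" "s = cls X" using carrier_cls[OF s] by blast
    obtain Y where Y: "Cy Y" "t = cls Y" using carrier_cls[OF t] by blast
    have "CB.conv (\<lambda>n. ctr B \<phi> (X n @ Y n)) (slice B \<phi> (s \<oplus>\<^bsub>T\<^esub> t))"
      using sc[OF Cy_append[OF X(1) Y(1)]] X Y by (simp add: add_cls)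
    moreover have "CB.conv (\<lambda>n. ctr B \<phi> (X n @ Y n)) (slice B \<phi> s \<oplus>\<^bsub>B\<^esub> slice B \<phi> t)"
      using CB.conv_add[OF sc[OF X(1)] sc[OF Y(1)]] X Y Cy_R[OF X(1)] Cy_R[OF Y(1)] by (simp add: ctr_append)
    ultimately show "slice B \<phi> (s \<oplus>\<^bsub>T\<^esub> t) = slice B \<phi> s \<oplus>\<^bsub>B\<^esub> slice B \<phi> t" by (rule CB.conv_unique)
    have "CB.conv (\<lambda>n. ctr B \<phi> (mul (X n) (Y n))) (slice B \<phi> (s \<otimes>\<^bsub>T\<^esub> t))"
      using sc[OF Cy_mul[OF X(1) Y(1)]] X Y by (simp add: mul_cls)
    moreover have "CB.conv (\<lambda>n. ctr B \<phi> (mul (X n) (Y n))) (slice B \<phi> s \<otimes>\<^bsub>B\<^esub> slice B \<phi> t)"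
      using CB.conv_mult[OF sc[OF X(1)] sc[OF Y(1)]] X Y Cy_R[OF X(1)] Cy_R[OF Y(1)] by (simp add: ctr_mul[OF \<phi>])
    ultimately show "slice B \<phi> (s \<otimes>\<^bsub>T\<^esub> t) = slice B \<phi> s \<otimes>\<^bsub>B\<^esub> slice B \<phi> t" by (rule CB.conv_unique)
  qed
  have scale: "slice B \<phi> (cscale T z t) = cscale B z (slice B \<phi> t)" and adj: "slice B \<phi> (adj T t) = adj B (slice B \<phi> t)"
    if t: "t \<in> carrier T" for z t
  proof -
    obtain X where X: "Cy X" "t = cls X" using carrier_cls[OF t] by blast
    have "CB.conv (\<lambda>n. ctr B \<phi> (scl z (X n))) (slice B \<phi> (cscale T z t))"
      using sc[OF Cy_scl[OF X(1)]] X by (simp add: scl_cls)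
    moreover have "CB.conv (\<lambda>n. ctr B \<phi> (scl z (X n))) (cscale B z (slice B \<phi> t))"
      using CB.conv_sc[OF sc[OF X(1)]] X Cy_R[OF X(1)] by (simp add: ctr_scl[OF \<phi>s])
    ultimately show "slice B \<phi> (cscale T z t) = cscale B z (slice B \<phi> t)" by (rule CB.conv_unique)
    have "CB.conv (\<lambda>n. ctr B \<phi> (star (X n))) (slice B \<phi> (adj T t))"
      using sc[OF Cy_star[OF X(1)]] X by (simp add: star_cls)
    moreover have "CB.conv (\<lambda>n. ctr B \<phi> (star (X n))) (adj B (slice B \<phi> t))"
      using CB.conv_st[OF sc[OF X(1)]] X Cy_R[OF X(1)] by (simp add: ctr_star[OF \<phi>s])
    ultimately show "slice B \<phi> (adj T t) = adj B (slice B \<phi> t)" by (rule CB.conv_unique)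
  qed
  have one: "slice B \<phi> \<one>\<^bsub>T\<^esub> = \<one>\<^bsub>B\<^esub>"
  proof (rule CB.conv_unique)
    show "CB.conv (\<lambda>n. ctr B \<phi> one2) (slice B \<phi> \<one>\<^bsub>T\<^esub>)" using sc[of "\<lambda>n. one2"] by (simp add: one_T)
    show "CB.conv (\<lambda>n. ctr B \<phi> one2) \<one>\<^bsub>B\<^esub>" unfolding ctr_one2[OF \<phi>s] by (rule CB.conv_const) simp
  qed
  show ?thesis unfolding cstar_hom_def ring_hom_def using cl add mult scale adj one by auto
qed

end

lemma cstar_hom_comp:
  assumes f: "cstar_hom A B f" and g: "cstar_hom B C g" shows "cstar_hom A C (\<lambda>a. g (f a))"
  using assms by (auto simp: cstar_hom_def ring_hom_def Pi_iff)

lemma dirac_character: "character (Cont :: ('x::topological_space \<Rightarrow> complex) cstar) (dirac x)"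
  unfolding character_def states_def dirac_def Cont_def
  by (auto intro!: continuous_intros simp: complex_nonneg_Reals_iff)

lemma bounded_star_algebra_Cont:
  assumes "compact (UNIV :: 'x::topological_space set)"
  shows "bounded_star_algebra (Cont :: ('x \<Rightarrow> complex) cstar)"
proof -
  interpret cstar_algebra "Cont :: ('x \<Rightarrow> complex) cstar" by (rule cstar_algebra_Cont[OF assms])
  show ?thesis by (rule bounded_star_algebraI) (simp add: Cont_def fun_eq_iff)
qed

section \<open>The reduced algebra\<close>

locale gns = cstar_algebra +
  fixes h :: "'a \<Rightarrow> complex"
  assumes h: "h \<in> states A"
begin

definition qh :: "'a \<Rightarrow> real" where "qh a = sqrt (Re (h (adj A a \<otimes> a)))"

lemma Re_h_nonneg: "a \<in> carrier A \<Longrightarrow> 0 \<le> Re (h (adj A a \<otimes> a))"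
  using state_nonneg[OF h] by (simp add: complex_nonneg_Reals_iff)

lemma qh_nonneg: "a \<in> carrier A \<Longrightarrow> 0 \<le> qh a" by (simp add: qh_def Re_h_nonneg)

lemma qh_sq: "a \<in> carrier A \<Longrightarrow> (qh a)\<^sup>2 = Re (h (adj A a \<otimes> a))" by (simp add: qh_def Re_h_nonneg)

lemma qh_eq_0: "a \<in> carrier A \<Longrightarrow> qh a = 0 \<longleftrightarrow> h (adj A a \<otimes> a) = 0"
  using state_nonneg[OF h, of a] by (auto simp: qh_def complex_nonneg_Reals_iff complex_eq_iff)

lemma h_le_qh: assumes a: "a \<in> carrier A" and b: "b \<in> carrier A" shows "cmod (h (adj A a \<otimes> b)) \<le> qh a * qh b"
proof -
  have "(cmod (h (adj A a \<otimes> b)))\<^sup>2 \<le> (qh a * qh b)\<^sup>2"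
    using state_cauchy_schwarz(2)[OF h a b] a b by (simp add: power_mult_distrib qh_sq)
  then show ?thesis by (rule power2_le_imp_le) (simp add: qh_nonneg a b)
qed

lemma qh_add: assumes a: "a \<in> carrier A" and b: "b \<in> carrier A" shows "qh (a \<oplus> b) \<le> qh a + qh b"
proof -
  have "h (adj A (a \<oplus> b) \<otimes> (a \<oplus> b)) = h (adj A a \<otimes> a) + h (adj A a \<otimes> b) + cnj (h (adj A a \<otimes> b)) + h (adj A b \<otimes> b)"
    using a b linf_state[OF h] state_cauchy_schwarz(1)[OF h a b]
    by (simp add: st_add l_distr r_distr linf_simps)
  then have e: "Re (h (adj A (a \<oplus> b) \<otimes> (a \<oplus> b))) = Re (h (adj A a \<otimes> a)) + 2 * Re (h (adj A a \<otimes> b)) + Re (h (adj A b \<otimes> b))" by simp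
  have "(Re (h (adj A a \<otimes> b)))\<^sup>2 \<le> Re (h (adj A a \<otimes> a)) * Re (h (adj A b \<otimes> b))"
    using state_cauchy_schwarz(2)[OF h a b] power_mono[OF abs_Re_le_cmod[of "h (adj A a \<otimes> b)"] abs_ge_zero, of 2] by simp
  from sqrt_add_le_of_cs[OF Re_h_nonneg[OF a] Re_h_nonneg[OF b] this] show ?thesis unfolding qh_def e .
qed

lemma qh_sc: assumes a: "a \<in> carrier A" shows "qh (cscale A z a) = cmod z * qh a"
proof -
  have "h (adj A (cscale A z a) \<otimes> cscale A z a) = of_real ((cmod z)\<^sup>2) * h (adj A a \<otimes> a)"
    using a linf_state[OF h] by (simp add: st_sc sc_mult_left sc_mult_right sc_sc linf_simps complex_norm_square[symmetric] mult_ac)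
  then have "Re (h (adj A (cscale A z a) \<otimes> cscale A z a)) = (cmod z)\<^sup>2 * Re (h (adj A a \<otimes> a))"
    by (simp only: Re_complex_of_real times_complex.sel Im_complex_of_real)
  then show ?thesis by (simp add: qh_def real_sqrt_mult)
qed

text \<open>Conjugating the complement of a at (||a|| + e)^2 by w and applying h gives the bound up
  to e.\<close>

lemma qh_mult_le: assumes a: "a \<in> carrier A" and w: "w \<in> carrier A" shows "qh (a \<otimes> w) \<le> \<parallel>a\<parallel> * qh w"
proof -
  have *: "qh (a \<otimes> w) \<le> (\<parallel>a\<parallel> + e) * qh w" if e: "e > 0" for e
  proof -
    have na: "0 \<le> \<parallel>a\<parallel>" by (rule norm_nonneg[OF a])
    then have "\<parallel>a\<parallel>\<^sup>2 < (\<parallel>a\<parallel> + e)\<^sup>2" using e by (intro power_strict_mono) auto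
    then obtain s where s: "s \<in> carrier A" "adj A a \<otimes> a \<oplus> adj A s \<otimes> s = cst ((\<parallel>a\<parallel> + e)\<^sup>2)"
      using star_mult_complement[OF a] by metis
    have "adj A (a \<otimes> w) \<otimes> (a \<otimes> w) \<oplus> adj A (s \<otimes> w) \<otimes> (s \<otimes> w) = adj A w \<otimes> (adj A a \<otimes> a \<oplus> adj A s \<otimes> s) \<otimes> w"
      using a s(1) w by (simp add: st_mult l_distr r_distr m_assoc)
    also have "\<dots> = cscale A (of_real ((\<parallel>a\<parallel> + e)\<^sup>2)) (adj A w \<otimes> w)" unfolding s(2) using w by (simp add: sc_mult_left sc_mult_right)
    finally have "h (adj A (a \<otimes> w) \<otimes> (a \<otimes> w)) + h (adj A (s \<otimes> w) \<otimes> (s \<otimes> w)) = of_real ((\<parallel>a\<parallel> + e)\<^sup>2) * h (adj A w \<otimes> w)"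
      using a s(1) w linf_state[OF h] linf_add[OF linf_state[OF h], of "adj A (a \<otimes> w) \<otimes> (a \<otimes> w)" "adj A (s \<otimes> w) \<otimes> (s \<otimes> w)"]
      by (simp add: linf_sc)
    then have "Re (h (adj A (a \<otimes> w) \<otimes> (a \<otimes> w))) + Re (h (adj A (s \<otimes> w) \<otimes> (s \<otimes> w))) = (\<parallel>a\<parallel> + e)\<^sup>2 * Re (h (adj A w \<otimes> w))"
      by (drule_tac arg_cong[where f = Re]) simp
    then have "(qh (a \<otimes> w))\<^sup>2 \<le> ((\<parallel>a\<parallel> + e) * qh w)\<^sup>2"
      using Re_h_nonneg[of "s \<otimes> w"] a s w by (simp add: qh_sq power_mult_distrib)
    then show ?thesis by (rule power2_le_imp_le) (use na e qh_nonneg[OF w] in simp)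
  qed
  show ?thesis
  proof (rule field_le_epsilon)
    fix e :: real assume e: "e > 0"
    have w1: "qh w + 1 > 0" using qh_nonneg[OF w] by simp
    have "qh (a \<otimes> w) \<le> (\<parallel>a\<parallel> + e / (qh w + 1)) * qh w" using *[of "e / (qh w + 1)"] e w1 by simp
    also have "\<dots> \<le> \<parallel>a\<parallel> * qh w + e" using e w1 qh_nonneg[OF w] by (simp add: field_simps)
    finally show "qh (a \<otimes> w) \<le> \<parallel>a\<parallel> * qh w + e" .
  qed
qed

text \<open>With the single index h, the abstract operator norm is the norm of the GNS operator of
  h.\<close>

sublocale SN: seminorm_family "carrier A" "{h}" "\<lambda>i a. sqrt (Re (i (adj A a \<otimes> a)))" "add A" "monoid.mult A" "cscale A" "adj A"
proof (unfold_locales, goal_cases)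
  case (5 i x) then show ?case by (simp add: Re_h_nonneg)
next
  case (6 i x z) then show ?case using qh_sc[of x z] by (simp add: qh_def)
next
  case (7 i x y w) then show ?case using qh_add[of "x \<otimes> w" "y \<otimes> w"] by (simp add: qh_def l_distr)
next
  case (8 i x w z) then show ?case using qh_sc[of "x \<otimes> w" z] by (simp add: qh_def sc_mult_left)
next
  case (9 i x w z) then show ?case using qh_sc[of "x \<otimes> w" z] by (simp add: qh_def sc_mult_right)
next
  case (11 i x w)
  have "(qh (x \<otimes> w))\<^sup>2 = Re (h (adj A w \<otimes> (adj A x \<otimes> x \<otimes> w)))" using 11 by (simp add: qh_sq st_mult m_assoc)
  also have "\<dots> \<le> qh w * qh (adj A x \<otimes> x \<otimes> w)"
    using h_le_qh[of w "adj A x \<otimes> x \<otimes> w"] complex_Re_le_cmod[of "h (adj A w \<otimes> (adj A x \<otimes> x \<otimes> w))"] 11 by simp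
  finally show ?case using 11 by (simp add: qh_def)
next
  case (13 x) then show ?case using qh_mult_le by (auto simp: qh_def)
next
  case 15 show ?case by (intro bexI[of _ \<zero>]) (auto simp: linf_zero[OF linf_state[OF h]])
qed (auto simp: m_assoc)

abbreviation "Nh \<equiv> SN.opnorm"

lemma qh_mul_le: "a \<in> carrier A \<Longrightarrow> w \<in> carrier A \<Longrightarrow> qh (a \<otimes> w) \<le> Nh a * qh w"
  using SN.q_mul_le[of h a w] by (simp add: qh_def)

lemma Nh_le: "(\<And>w. w \<in> carrier A \<Longrightarrow> qh (a \<otimes> w) \<le> K * qh w) \<Longrightarrow> 0 \<le> K \<Longrightarrow> Nh a \<le> K"
  by (rule SN.opnorm_le) (auto simp: qh_def)

lemma Nh_le_nrm: "a \<in> carrier A \<Longrightarrow> Nh a \<le> \<parallel>a\<parallel>"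
  by (rule Nh_le) (auto simp: qh_mult_le norm_nonneg)

lemma Nh_minus: "a \<in> carrier A \<Longrightarrow> Nh (\<ominus> a) = Nh a"
  by (simp add: minus_sc SN.opnorm_sc)

lemma qh_diff_commute: "a \<in> carrier A \<Longrightarrow> b \<in> carrier A \<Longrightarrow> qh (a \<ominus> b) = qh (b \<ominus> a)"
  using qh_sc[of "b \<ominus> a" "-1"] by (simp add: minus_sc[symmetric] a_minus_def minus_add a_comm)

lemma qh_triangle3: "a \<in> carrier A \<Longrightarrow> b \<in> carrier A \<Longrightarrow> c \<in> carrier A \<Longrightarrow> qh (a \<ominus> c) \<le> qh (a \<ominus> b) + qh (b \<ominus> c)"
  using qh_add[of "a \<ominus> b" "b \<ominus> c"] by (simp add: a_minus_def a_ac r_neg1 r_neg2)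

abbreviation "gv \<equiv> gns_vec A h"

lemma gv_mem: "b \<in> carrier A \<Longrightarrow> c \<in> gv b \<longleftrightarrow> c \<in> carrier A \<and> qh (c \<ominus> b) = 0"
  by (auto simp: gns_vec_def cdiff_minus qh_eq_0)

lemma gv_eq: assumes b: "b \<in> carrier A" and c: "c \<in> carrier A" shows "gv b = gv c \<longleftrightarrow> qh (b \<ominus> c) = 0"
proof
  have "qh (b \<ominus> b) = 0" using b linf_zero[OF linf_state[OF h]] by (simp add: a_minus_def r_neg qh_def)
  then show "gv b = gv c \<Longrightarrow> qh (b \<ominus> c) = 0" using gv_mem[OF b, of b] gv_mem[OF c, of b] b by auto
  assume z: "qh (b \<ominus> c) = 0"
  have "qh (x \<ominus> b) = 0 \<longleftrightarrow> qh (x \<ominus> c) = 0" if x: "x \<in> carrier A" for x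
    using qh_triangle3[OF x b c] qh_triangle3[OF x c b] qh_diff_commute[OF b c] z qh_nonneg[of "x \<ominus> b"] qh_nonneg[of "x \<ominus> c"] x b c
    by auto
  then show "gv b = gv c" using gv_mem[OF b] gv_mem[OF c] by blast
qed

lemma gv_pick: assumes b: "b \<in> carrier A"
  shows "(SOME c. c \<in> gv b) \<in> carrier A" "qh ((SOME c. c \<in> gv b) \<ominus> b) = 0"
proof -
  have "qh (b \<ominus> b) = 0" using b linf_zero[OF linf_state[OF h]] by (simp add: a_minus_def r_neg qh_def)
  then have "b \<in> gv b" using b by (simp add: gv_mem)
  then have "(SOME c. c \<in> gv b) \<in> gv b" by (rule someI[of "\<lambda>c. c \<in> gv b"])
  then show "(SOME c. c \<in> gv b) \<in> carrier A" "qh ((SOME c. c \<in> gv b) \<ominus> b) = 0" using b by (auto simp: gv_mem)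
qed

lemma gns_rep_gv: assumes a: "a \<in> carrier A" and b: "b \<in> carrier A" shows "gns_rep A h a (gv b) = gv (a \<otimes> b)"
proof -
  define p where "p = (SOME c. c \<in> gv b)"
  have p: "p \<in> carrier A" "qh (p \<ominus> b) = 0" using gv_pick[OF b] by (auto simp: p_def)
  have "a \<otimes> p \<ominus> a \<otimes> b = a \<otimes> (p \<ominus> b)" using a b p by (simp add: a_minus_def r_distr r_minus)
  then have "qh (a \<otimes> p \<ominus> a \<otimes> b) = 0"
    using qh_mul_le[OF a, of "p \<ominus> b"] qh_nonneg[of "a \<otimes> (p \<ominus> b)"] a b p by simp
  then have "gv (a \<otimes> p) = gv (a \<otimes> b)" using gv_eq a b p by simp
  then show ?thesis using b by (simp add: gns_rep_def gns_space_def p_def)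
qed

lemma gns_vnorm_gv: assumes b: "b \<in> carrier A" shows "gns_vnorm A h (gv b) = qh b"
proof -
  define p where "p = (SOME c. c \<in> gv b)"
  have p: "p \<in> carrier A" "qh (p \<ominus> b) = 0" using gv_pick[OF b] by (auto simp: p_def)
  have "qh x = qh (x \<ominus> \<zero>)" if "x \<in> carrier A" for x using that by (simp add: a_minus_def)
  then have "qh p = qh b" using qh_triangle3[of p b \<zero>] qh_triangle3[of b p \<zero>] qh_diff_commute[of b p] p b by simp
  then show ?thesis by (simp add: gns_vnorm_def Let_def p_def qh_def)
qed

abbreviation "\<tau> \<equiv> gns_rep A h"
abbreviation "Ar \<equiv> reduced_algebra A h"

text \<open>Operators are encoded as functions on classes of vectors, so equality of functions is
  equality on every class and amounts to a vanishing operator norm of the difference.\<close>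

lemma gns_rep_eq: assumes a: "a \<in> carrier A" and b: "b \<in> carrier A" shows "\<tau> a = \<tau> b \<longleftrightarrow> Nh (a \<ominus> b) = 0"
proof -
  have e: "a \<otimes> c \<ominus> b \<otimes> c = (a \<ominus> b) \<otimes> c" if "c \<in> carrier A" for c
    using a b that by (simp add: a_minus_def l_distr l_minus)
  have "\<tau> a = \<tau> b \<longleftrightarrow> (\<forall>c\<in>carrier A. \<tau> a (gv c) = \<tau> b (gv c))"
    unfolding gns_rep_def gns_space_def by (auto simp: fun_eq_iff restrict_def)
  also have "\<dots> \<longleftrightarrow> (\<forall>c\<in>carrier A. qh ((a \<ominus> b) \<otimes> c) = 0)" using a b gv_eq e by (auto simp: gns_rep_gv)
  also have "\<dots> \<longleftrightarrow> Nh (a \<ominus> b) = 0"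
  proof
    assume z: "\<forall>c\<in>carrier A. qh ((a \<ominus> b) \<otimes> c) = 0"
    have "Nh (a \<ominus> b) \<le> 0" by (rule Nh_le) (use z in auto)
    then show "Nh (a \<ominus> b) = 0" using SN.opnorm_nonneg[of "a \<ominus> b"] a b by simp
  next
    assume z: "Nh (a \<ominus> b) = 0"
    have "qh ((a \<ominus> b) \<otimes> c) = 0" if c: "c \<in> carrier A" for c
      using qh_mul_le[of "a \<ominus> b" c] qh_nonneg[of "(a \<ominus> b) \<otimes> c"] z a b c by simp
    then show "\<forall>c\<in>carrier A. qh ((a \<ominus> b) \<otimes> c) = 0" by blast
  qed
  finally show ?thesis .
qed

definition pre :: "('a set \<Rightarrow> 'a set) \<Rightarrow> 'a" where "pre S = (SOME a. a \<in> carrier A \<and> \<tau> a = S)"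

lemma pre: assumes a: "a \<in> carrier A" shows "pre (\<tau> a) \<in> carrier A" "\<tau> (pre (\<tau> a)) = \<tau> a" "Nh (pre (\<tau> a) \<ominus> a) = 0"
proof -
  have "pre (\<tau> a) \<in> carrier A \<and> \<tau> (pre (\<tau> a)) = \<tau> a"
    unfolding pre_def by (rule someI[of "\<lambda>c. c \<in> carrier A \<and> \<tau> c = \<tau> a" a]) (use a in simp)
  then show "pre (\<tau> a) \<in> carrier A" "\<tau> (pre (\<tau> a)) = \<tau> a" "Nh (pre (\<tau> a) \<ominus> a) = 0"
    using gns_rep_eq a by auto
qed

lemma red_carrier: "carrier Ar = \<tau> ` carrier A" and red_one: "\<one>\<^bsub>Ar\<^esub> = \<tau> \<one>" and red_zero: "\<zero>\<^bsub>Ar\<^esub> = \<tau> \<zero>"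
  by (simp_all add: reduced_algebra_def Let_def)

text \<open>The reduced operations act on chosen preimages. Two preimages differ by an element of
  operator norm 0, and such elements form an ideal, so the choice does not matter here or in the
  analogues below.\<close>

lemma red_add: assumes a: "a \<in> carrier A" and b: "b \<in> carrier A" shows "\<tau> a \<oplus>\<^bsub>Ar\<^esub> \<tau> b = \<tau> (a \<oplus> b)"
proof -
  note p = pre[OF a] pre[OF b]
  have "Nh (pre (\<tau> a) \<oplus> pre (\<tau> b) \<ominus> (a \<oplus> b)) = Nh ((pre (\<tau> a) \<ominus> a) \<oplus> (pre (\<tau> b) \<ominus> b))"
    using p a b by (intro arg_cong[where f = Nh] linf_eqI) (simp_all add: linf_simps)
  also have "\<dots> \<le> 0" using SN.opnorm_add[of "pre (\<tau> a) \<ominus> a" "pre (\<tau> b) \<ominus> b"] p a b by simp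
  finally have "\<tau> (pre (\<tau> a) \<oplus> pre (\<tau> b)) = \<tau> (a \<oplus> b)"
    using p a b SN.opnorm_nonneg[of "pre (\<tau> a) \<oplus> pre (\<tau> b) \<ominus> (a \<oplus> b)"] by (simp add: gns_rep_eq)
  then show ?thesis by (simp add: reduced_algebra_def Let_def pre_def)
qed

lemma red_mult: assumes a: "a \<in> carrier A" and b: "b \<in> carrier A" shows "\<tau> a \<otimes>\<^bsub>Ar\<^esub> \<tau> b = \<tau> (a \<otimes> b)"
proof -
  note p = pre[OF a] pre[OF b]
  have "Nh (pre (\<tau> a) \<otimes> pre (\<tau> b) \<ominus> a \<otimes> b) = Nh (pre (\<tau> a) \<otimes> (pre (\<tau> b) \<ominus> b) \<oplus> (pre (\<tau> a) \<ominus> a) \<otimes> b)"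
    using p a b by (intro arg_cong[where f = Nh] linf_eqI) (simp_all add: linf_expand)
  also have "\<dots> \<le> Nh (pre (\<tau> a) \<otimes> (pre (\<tau> b) \<ominus> b)) + Nh ((pre (\<tau> a) \<ominus> a) \<otimes> b)"
    using p a b by (intro SN.opnorm_add) auto
  also have "\<dots> \<le> 0"
    using SN.opnorm_mul[of "pre (\<tau> a)" "pre (\<tau> b) \<ominus> b"] SN.opnorm_mul[of "pre (\<tau> a) \<ominus> a" b] p a b by simp
  finally have "\<tau> (pre (\<tau> a) \<otimes> pre (\<tau> b)) = \<tau> (a \<otimes> b)"
    using p a b SN.opnorm_nonneg[of "pre (\<tau> a) \<otimes> pre (\<tau> b) \<ominus> a \<otimes> b"] by (simp add: gns_rep_eq)
  then show ?thesis by (simp add: reduced_algebra_def Let_def pre_def)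
qed

lemma red_sc: assumes a: "a \<in> carrier A" shows "cscale Ar z (\<tau> a) = \<tau> (cscale A z a)"
proof -
  note p = pre[OF a]
  have "Nh (cscale A z (pre (\<tau> a)) \<ominus> cscale A z a) = Nh (cscale A z (pre (\<tau> a) \<ominus> a))"
    using p a by (intro arg_cong[where f = Nh] linf_eqI) (simp_all add: linf_simps algebra_simps)
  then have "\<tau> (cscale A z (pre (\<tau> a))) = \<tau> (cscale A z a)" using p a by (simp add: gns_rep_eq SN.opnorm_sc)
  then show ?thesis by (simp add: reduced_algebra_def Let_def pre_def)
qed

lemma red_adj: assumes a: "a \<in> carrier A" shows "adj Ar (\<tau> a) = \<tau> (adj A a)"
proof -
  note p = pre[OF a]
  have "adj A (pre (\<tau> a)) \<ominus> adj A a = adj A (pre (\<tau> a) \<ominus> a)" using p a by (simp add: a_minus_def st_add minus_sc st_sc)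
  then have "\<tau> (adj A (pre (\<tau> a))) = \<tau> (adj A a)" using p a by (simp add: gns_rep_eq SN.opnorm_st)
  then show ?thesis by (simp add: reduced_algebra_def Let_def pre_def)
qed

lemma red_norm: assumes a: "a \<in> carrier A" shows "cnorm Ar (\<tau> a) = Nh a"
proof -
  have "{gns_vnorm A h (\<tau> a \<xi>) | \<xi>. \<xi> \<in> gns_space A h \<and> gns_vnorm A h \<xi> \<le> 1}
      = {sqrt (Re (i (adj A (a \<otimes> y) \<otimes> (a \<otimes> y)))) | i y. i \<in> {h} \<and> y \<in> carrier A \<and> sqrt (Re (i (adj A y \<otimes> y))) \<le> 1}"
    (is "?L = ?R")
  proof (intro Set.set_eqI iffI)
    fix v assume "v \<in> ?L"
    then obtain y where "y \<in> carrier A" "v = gns_vnorm A h (\<tau> a (gv y))" "gns_vnorm A h (gv y) \<le> 1"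
      by (auto simp: gns_space_def)
    then show "v \<in> ?R" using a by (auto simp: gns_rep_gv gns_vnorm_gv qh_def)
  next
    fix v assume "v \<in> ?R"
    then obtain y where y: "y \<in> carrier A" "v = qh (a \<otimes> y)" "qh y \<le> 1" by (auto simp: qh_def)
    then have "v = gns_vnorm A h (\<tau> a (gv y))" "gns_vnorm A h (gv y) \<le> 1" using a by (simp_all add: gns_rep_gv gns_vnorm_gv)
    then show "v \<in> ?L" using y(1) unfolding gns_space_def by blast
  qed
  then show ?thesis by (simp add: reduced_algebra_def Let_def SN.opnorm_def)
qed

lemmas red_ops = red_one red_zero red_add red_mult red_sc red_adj

lemma red_star_algebra: "star_algebra Ar"
proof (intro star_algebra.intro star_algebra_axioms.intro ringI abelian_groupI monoidI)
  show "\<one>\<^bsub>Ar\<^esub> \<in> carrier Ar" "\<zero>\<^bsub>Ar\<^esub> \<in> carrier Ar" by (auto simp: red_ops red_carrier)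
  fix S assume "S \<in> carrier Ar"
  then obtain a where a: "a \<in> carrier A" "S = \<tau> a" by (auto simp: red_carrier)
  show "\<zero>\<^bsub>Ar\<^esub> \<oplus>\<^bsub>Ar\<^esub> S = S" "\<one>\<^bsub>Ar\<^esub> \<otimes>\<^bsub>Ar\<^esub> S = S" "S \<otimes>\<^bsub>Ar\<^esub> \<one>\<^bsub>Ar\<^esub> = S" "cscale Ar z S \<in> carrier Ar"
    "cscale Ar 1 S = S" "cscale Ar z (cscale Ar w S) = cscale Ar (z * w) S"
    "cscale Ar (z + w) S = cscale Ar z S \<oplus>\<^bsub>Ar\<^esub> cscale Ar w S" "adj Ar S \<in> carrier Ar" "adj Ar (adj Ar S) = S"
    "adj Ar (cscale Ar z S) = cscale Ar (cnj z) (adj Ar S)" for z w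
    using a(1) by (auto simp: a(2) red_ops red_carrier sc_sc sc_add_left st_sc)
  show "\<exists>y\<in>carrier Ar. y \<oplus>\<^bsub>Ar\<^esub> S = \<zero>\<^bsub>Ar\<^esub>"
    using a(1) by (intro bexI[of _ "\<tau> (\<ominus> a)"]) (auto simp: a(2) red_ops red_carrier l_neg)
  fix S' assume "S' \<in> carrier Ar"
  then obtain b where b: "b \<in> carrier A" "S' = \<tau> b" by (auto simp: red_carrier)
  show "S \<oplus>\<^bsub>Ar\<^esub> S' \<in> carrier Ar" "S \<otimes>\<^bsub>Ar\<^esub> S' \<in> carrier Ar" "S \<oplus>\<^bsub>Ar\<^esub> S' = S' \<oplus>\<^bsub>Ar\<^esub> S"
    "cscale Ar z (S \<oplus>\<^bsub>Ar\<^esub> S') = cscale Ar z S \<oplus>\<^bsub>Ar\<^esub> cscale Ar z S'"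
    "cscale Ar z S \<otimes>\<^bsub>Ar\<^esub> S' = cscale Ar z (S \<otimes>\<^bsub>Ar\<^esub> S')" "S \<otimes>\<^bsub>Ar\<^esub> cscale Ar z S' = cscale Ar z (S \<otimes>\<^bsub>Ar\<^esub> S')"
    "adj Ar (S \<oplus>\<^bsub>Ar\<^esub> S') = adj Ar S \<oplus>\<^bsub>Ar\<^esub> adj Ar S'" "adj Ar (S \<otimes>\<^bsub>Ar\<^esub> S') = adj Ar S' \<otimes>\<^bsub>Ar\<^esub> adj Ar S" for z
    using a(1) b(1) by (auto simp: a(2) b(2) red_ops red_carrier sc_add_right sc_mult_left sc_mult_right st_add st_mult a_comm)
  fix S'' assume "S'' \<in> carrier Ar"
  then obtain c where c: "c \<in> carrier A" "S'' = \<tau> c" by (auto simp: red_carrier)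
  show "S \<oplus>\<^bsub>Ar\<^esub> S' \<oplus>\<^bsub>Ar\<^esub> S'' = S \<oplus>\<^bsub>Ar\<^esub> (S' \<oplus>\<^bsub>Ar\<^esub> S'')" "S \<otimes>\<^bsub>Ar\<^esub> S' \<otimes>\<^bsub>Ar\<^esub> S'' = S \<otimes>\<^bsub>Ar\<^esub> (S' \<otimes>\<^bsub>Ar\<^esub> S'')"
    "(S \<oplus>\<^bsub>Ar\<^esub> S') \<otimes>\<^bsub>Ar\<^esub> S'' = S \<otimes>\<^bsub>Ar\<^esub> S'' \<oplus>\<^bsub>Ar\<^esub> S' \<otimes>\<^bsub>Ar\<^esub> S''"
    "S'' \<otimes>\<^bsub>Ar\<^esub> (S \<oplus>\<^bsub>Ar\<^esub> S') = S'' \<otimes>\<^bsub>Ar\<^esub> S \<oplus>\<^bsub>Ar\<^esub> S'' \<otimes>\<^bsub>Ar\<^esub> S'"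
    using a(1) b(1) c(1) by (auto simp: a(2) b(2) c(2) red_ops a_assoc m_assoc l_distr r_distr)
qed

lemma red_hom: "cstar_hom A Ar \<tau>"
  by (auto simp: cstar_hom_def ring_hom_def red_ops red_carrier)

text \<open>A state vanishing on the kernel of the representation descends; positivity and
  normalisation transfer because all reduced operations come from A.\<close>

lemma red_state:
  assumes \<phi>: "\<phi> \<in> states A" and z: "\<And>a. a \<in> carrier A \<Longrightarrow> Nh a = 0 \<Longrightarrow> \<phi> a = 0"
  obtains \<psi> where "\<psi> \<in> states Ar" "\<And>a. a \<in> carrier A \<Longrightarrow> \<psi> (\<tau> a) = \<phi> a"
proof
  define \<psi> where "\<psi> = (\<lambda>S\<in>carrier Ar. \<phi> (pre S))"
  show e: "\<psi> (\<tau> a) = \<phi> a" if a: "a \<in> carrier A" for a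
    using z[of "pre (\<tau> a) \<ominus> a"] pre[OF a] a linf_diff[OF linf_state[OF \<phi>], of "pre (\<tau> a)" a]
    by (simp add: \<psi>_def red_carrier)
  have "\<psi> (S \<oplus>\<^bsub>Ar\<^esub> S') = \<psi> S + \<psi> S'" if S: "S \<in> carrier Ar" "S' \<in> carrier Ar" for S S'
    using S linf_state[OF \<phi>] by (auto simp: red_carrier red_ops e linf_simps)
  moreover have "\<psi> (cscale Ar z S) = z * \<psi> S" "\<psi> (adj Ar S \<otimes>\<^bsub>Ar\<^esub> S) \<in> \<real>\<^sub>\<ge>\<^sub>0" if S: "S \<in> carrier Ar" for S z
    using S linf_state[OF \<phi>] state_nonneg[OF \<phi>] by (auto simp: red_carrier red_ops e linf_simps)
  moreover have "\<psi> \<one>\<^bsub>Ar\<^esub> = 1" by (simp add: red_ops e state_one[OF \<phi>])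
  ultimately show "\<psi> \<in> states Ar" by (auto simp: states_def \<psi>_def)
qed

lemma h_le_Nh: assumes a: "a \<in> carrier A" shows "cmod (h a) \<le> Nh a"
proof -
  have "qh \<one> = 1" by (simp add: qh_def state_one[OF h])
  then show ?thesis using h_le_qh[of \<one> a] qh_mul_le[OF a, of \<one>] a by simp
qed

lemma red_h: obtains \<psi> where "\<psi> \<in> states Ar" "\<And>a. a \<in> carrier A \<Longrightarrow> \<psi> (\<tau> a) = h a"
proof -
  have "h a = 0" if "a \<in> carrier A" "Nh a = 0" for a using h_le_Nh[OF that(1)] that(2) by simp
  from red_state[OF h this] that show ?thesis by blast
qed

text \<open>The complement identity is mapped forward by the representation, and h itself descends
  to a state; no limits are involved.\<close>

lemma red_bounded: "bounded_star_algebra Ar"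
proof (intro bounded_star_algebra.intro red_star_algebra bounded_star_algebra_axioms.intro)
  show "states Ar \<noteq> {}" using red_h by blast
  fix S assume "S \<in> carrier Ar"
  then obtain a where a: "a \<in> carrier A" "S = \<tau> a" by (auto simp: red_carrier)
  obtain s where s: "s \<in> carrier A" "adj A a \<otimes> a \<oplus> adj A s \<otimes> s = cst (\<parallel>a\<parallel>\<^sup>2 + 1)"
    by (rule star_mult_complement[OF a(1), of "\<parallel>a\<parallel>\<^sup>2 + 1"]) simp
  have "adj Ar S \<otimes>\<^bsub>Ar\<^esub> S \<oplus>\<^bsub>Ar\<^esub> adj Ar (\<tau> s) \<otimes>\<^bsub>Ar\<^esub> \<tau> s = cscale Ar (of_real (\<parallel>a\<parallel>\<^sup>2 + 1)) \<one>\<^bsub>Ar\<^esub>"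
    using a(1) s(1) by (simp add: a(2) red_ops s(2) del: of_real_add)
  moreover have "\<tau> s \<in> carrier Ar" using s(1) by (simp add: red_carrier)
  ultimately show "\<exists>K. \<exists>s\<in>carrier Ar. adj Ar S \<otimes>\<^bsub>Ar\<^esub> S \<oplus>\<^bsub>Ar\<^esub> adj Ar s \<otimes>\<^bsub>Ar\<^esub> s = cscale Ar (of_real K) \<one>\<^bsub>Ar\<^esub>" by blast
qed

end

text \<open>Construction of the tensor product of the identity with a surjective *-homomorphism. It
  is stated for \<open>bounded_star_algebra\<close> so that the target can be the reduced
  algebra.\<close>

locale tensor_right_hom = A: bounded_star_algebra A + B: bounded_star_algebra B + C: bounded_star_algebra C
  for C :: "('c, 'k) cstar_scheme" and A :: "('a, 'm) cstar_scheme" and B :: "('b, 'n) cstar_scheme" +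
  fixes f :: "'a \<Rightarrow> 'b"
  assumes hom: "cstar_hom A B f" and surj: "f ` carrier A = carrier B"
begin

sublocale CA: tensor_factors C A ..
sublocale CB: tensor_factors C B ..

abbreviation mp :: "('c \<times> 'a) list \<Rightarrow> ('c \<times> 'b) list" where "mp xs \<equiv> map (\<lambda>(c, a). (c, f a)) xs"

lemma
  shows f_closed: "a \<in> carrier A \<Longrightarrow> f a \<in> carrier B" and f_mult: "a \<in> carrier A \<Longrightarrow> b \<in> carrier A \<Longrightarrow> f (a \<otimes>\<^bsub>A\<^esub> b) = f a \<otimes>\<^bsub>B\<^esub> f b"
    and f_adj: "a \<in> carrier A \<Longrightarrow> f (adj A a) = adj B (f a)"
    and f_add: "a \<in> carrier A \<Longrightarrow> b \<in> carrier A \<Longrightarrow> f (a \<oplus>\<^bsub>A\<^esub> b) = f a \<oplus>\<^bsub>B\<^esub> f b"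
    and f_sc: "a \<in> carrier A \<Longrightarrow> f (cscale A z a) = cscale B z (f a)"
  using hom by (auto simp: cstar_hom_def ring_hom_def)

lemma f_zero: "f \<zero>\<^bsub>A\<^esub> = \<zero>\<^bsub>B\<^esub>"
  using f_sc[of "\<zero>\<^bsub>A\<^esub>" 0] f_closed by simp

definition pull :: "('b \<Rightarrow> complex) \<Rightarrow> 'a \<Rightarrow> complex" where "pull \<psi> = (\<lambda>a\<in>carrier A. \<psi> (f a))"

lemma pull_state: "\<psi> \<in> states B \<Longrightarrow> pull \<psi> \<in> states A"
  unfolding pull_def by (rule state_pullback_hom[OF hom A.star_algebra_axioms])

lemma pull_apply: "a \<in> carrier A \<Longrightarrow> pull \<psi> a = \<psi> (f a)" by (simp add: pull_def)

lemma mp_closed [simp, intro]: "xs \<in> CA.R \<Longrightarrow> mp xs \<in> CB.R"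
  by (rule alg_tensors_map) (auto simp: f_closed)

lemma mp_surj: "ys \<in> CB.R \<Longrightarrow> \<exists>xs\<in>CA.R. ys = mp xs"
proof (induction ys rule: alg_tensors_induct)
  case (Cons c b ys)
  then obtain xs where xs: "xs \<in> CA.R" "ys = mp xs" by blast
  obtain a where "a \<in> carrier A" "b = f a" using Cons(2) surj by blast
  then show ?case using xs Cons(1) by (intro bexI[of _ "(c, a) # xs"]) auto
qed (auto intro: bexI[of _ "[]"])

lemma mp_mul: "xs \<in> CA.R \<Longrightarrow> ys \<in> CA.R \<Longrightarrow> CB.mul (mp xs) (mp ys) = mp (CA.mul xs ys)"
proof (induction xs rule: alg_tensors_induct)
  case (Cons c a xs)
  have "map (\<lambda>(c', b). (c \<otimes>\<^bsub>C\<^esub> c', f a \<otimes>\<^bsub>B\<^esub> b)) (mp ys) = mp (map (\<lambda>(c', b). (c \<otimes>\<^bsub>C\<^esub> c', a \<otimes>\<^bsub>A\<^esub> b)) ys)"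
    using Cons(5) by (induction ys rule: alg_tensors_induct) (use Cons(2) in \<open>auto simp: f_mult\<close>)
  then show ?case using Cons by (simp add: talg_mult_Cons)
qed simp

lemma mp_scl: "mp (CA.scl z xs) = CB.scl z (mp xs)"
  by (induction xs) (auto simp: talg_scale_def)

lemma mp_ev: assumes "xs \<in> CA.R" shows "talg_functional \<phi> \<psi> (mp xs) = talg_functional \<phi> (pull \<psi>) xs"
  unfolding talg_functional_ev ev_map by (rule ev_cong[OF assms]) (simp add: pull_apply)

lemma mp_star: "xs \<in> CA.R \<Longrightarrow> CB.star (mp xs) = mp (CA.star xs)"
  by (induction xs rule: alg_tensors_induct) (auto simp: talg_adj_def f_adj)

lemma mp_form: "xs \<in> CA.R \<Longrightarrow> ys \<in> CA.R \<Longrightarrow> CB.form (\<phi>, \<psi>) (mp xs) (mp ys) = CA.form (\<phi>, pull \<psi>) xs ys"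
  by (simp add: CB.form_def CA.form_def mp_star mp_mul mp_ev)

text \<open>Surjectivity lifts every test vector, and states of B pull back to states of A, so the
  supremum for B runs over values already counted for A.\<close>

lemma mp_N: assumes x: "x \<in> CA.R" shows "CB.N (mp x) \<le> CA.N x"
proof (rule CB.N_le)
  fix i y assume i: "i \<in> states C \<times> states B" and y: "y \<in> CB.R"
  obtain \<phi> \<psi> where i': "i = (\<phi>, \<psi>)" "\<phi> \<in> states C" "\<psi> \<in> states B" using i by auto
  obtain y' where y': "y' \<in> CA.R" "y = mp y'" using mp_surj[OF y] by blast
  have "CA.q (\<phi>, pull \<psi>) (CA.mul x y') \<le> CA.N x * CA.q (\<phi>, pull \<psi>) y'"
    by (rule CA.q_mul_le) (use i' pull_state x y' in auto)
  then show "CB.q i (CB.mul (mp x) y) \<le> CA.N x * CB.q i y"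
    using x y' by (simp add: CB.q_def CA.q_def i' mp_mul mp_form)
qed (rule CA.N_nonneg[OF x])

lemma mp_d: "x \<in> CA.R \<Longrightarrow> y \<in> CA.R \<Longrightarrow> CB.d (mp x) (mp y) \<le> CA.d x y"
  using mp_N[of "x @ CA.neg y"] by (simp add: CA.d_def CB.d_def mp_scl)

lemma mp_Cy: assumes X: "CA.Cy X" shows "CB.Cy (\<lambda>n. mp (X n))"
  unfolding tens_cauchy_def
proof (intro conjI allI impI)
  note R = CA.Cy_R[OF X]
  show "range (\<lambda>n. mp (X n)) \<subseteq> CB.R" using R by auto
  fix e :: real assume "e > 0"
  then obtain M where "\<And>m n. m \<ge> M \<Longrightarrow> n \<ge> M \<Longrightarrow> CA.d (X m) (X n) < e" using X unfolding tens_cauchy_def by meson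
  then show "\<exists>N. \<forall>m\<ge>N. \<forall>n\<ge>N. CB.d (mp (X m)) (mp (X n)) < e"
    using order_le_less_trans[OF mp_d[OF R R]] by blast
qed

lemma mp_cls: assumes X: "CA.Cy X" and Y: "CA.Cy Y" and eq: "CA.cls X = CA.cls Y"
  shows "CB.cls (\<lambda>n. mp (X n)) = CB.cls (\<lambda>n. mp (Y n))"
proof (rule CB.cls_eqI[OF mp_Cy[OF X] mp_Cy[OF Y] tendsto_sandwich[OF _ _ tendsto_const CA.cls_eqD[OF Y eq]]])
  show "\<forall>\<^sub>F n in sequentially. CB.d (mp (X n)) (mp (Y n)) \<le> CA.d (X n) (Y n)"
    using mp_d CA.Cy_R[OF X] CA.Cy_R[OF Y] by simp
  show "\<forall>\<^sub>F n in sequentially. 0 \<le> CB.d (mp (X n)) (mp (Y n))"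
    using CB.d_nonneg CB.Cy_R[OF mp_Cy[OF X]] CB.Cy_R[OF mp_Cy[OF Y]] by simp
qed

definition F where "F = (\<lambda>t\<in>carrier (tensor C A). CB.cls (\<lambda>n. mp (tens_rep t n)))"

lemma F_cls: assumes X: "CA.Cy X" shows "F (CA.cls X) = CB.cls (\<lambda>n. mp (X n))"
  using mp_cls[OF CA.rep_carrier(1)[OF CA.cls_carrier[OF X]] X] CA.rep_carrier[OF CA.cls_carrier[OF X]] CA.cls_carrier[OF X]
  by (simp add: F_def)

lemma F_tensor_map: "is_tensor_map C A C B id f F"
proof -
  have add: "F (s \<oplus>\<^bsub>CA.T\<^esub> t) = F s \<oplus>\<^bsub>CB.T\<^esub> F t" if s: "s \<in> carrier CA.T" and t: "t \<in> carrier CA.T" for s t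
  proof -
    obtain X where X: "CA.Cy X" "s = CA.cls X" using CA.carrier_cls[OF s] by blast
    obtain Y where Y: "CA.Cy Y" "t = CA.cls Y" using CA.carrier_cls[OF t] by blast
    show ?thesis using X Y by (simp add: CA.add_cls F_cls CA.Cy_append CB.add_cls mp_Cy)
  qed
  have sc: "F (cscale CA.T z t) = cscale CB.T z (F t)" and bd: "cnorm CB.T (F t) \<le> 1 * cnorm CA.T t"
    and cl: "F t \<in> carrier CB.T"
    if t: "t \<in> carrier CA.T" for z t
  proof -
    obtain X where X: "CA.Cy X" "t = CA.cls X" using CA.carrier_cls[OF t] by blast
    show "F (cscale CA.T z t) = cscale CB.T z (F t)" using X by (simp add: CA.scl_cls F_cls CA.Cy_scl CB.scl_cls mp_Cy mp_scl)
    show "F t \<in> carrier CB.T" using X by (simp add: F_cls CB.cls_carrier mp_Cy)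
    show "cnorm CB.T (F t) \<le> 1 * cnorm CA.T t" unfolding X(2) F_cls[OF X(1)] mult_1
      by (rule LIMSEQ_le[OF CB.norm_cls[OF mp_Cy[OF X(1)]] CA.norm_cls[OF X(1)]]) (use mp_N CA.Cy_R[OF X(1)] in auto)
  qed
  have prod: "F (tens_prod C A c a) = tens_prod C B (id c) (f a)" if "c \<in> carrier C" "a \<in> carrier A" for c a
    using F_cls[of "\<lambda>n. [(c, a)]"] that by (simp add: tens_prod_def CA.toa_cls CB.toa_cls)
  show ?thesis unfolding is_tensor_map_def bounded_clinear_map_def
    using add sc cl prod by (auto simp del: id_apply intro!: exI[of _ 1] bd[unfolded mult_1])
qed

text \<open>\<open>tensor_map\<close> is a definite description. Bounded maps agreeing on elementary
  tensors agree on finite sums, hence everywhere by density.\<close>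

lemma tensor_map_unique:
  assumes G: "is_tensor_map C A C B id f G" and t: "t \<in> carrier CA.T" shows "G t = F t"
proof (rule CB.T.linf_eqI)
  have Gc: "G s \<in> carrier CB.T" if "s \<in> carrier CA.T" for s using G that by (auto simp: is_tensor_map_def bounded_clinear_map_def)
  have Fc: "F s \<in> carrier CB.T" if "s \<in> carrier CA.T" for s
    using F_tensor_map that by (auto simp: is_tensor_map_def bounded_clinear_map_def)
  show "G t \<in> carrier CB.T" "F t \<in> carrier CB.T" using Gc Fc t by auto
  have toa: "H (tens_of_alg C A xs) = tens_of_alg C B (mp xs)" if H: "is_tensor_map C A C B id f H" and xs: "xs \<in> CA.R" for H xs
    using xs
  proof (induction xs rule: alg_tensors_induct)
    case Nil
    have "H (cscale CA.T 0 \<zero>\<^bsub>CA.T\<^esub>) = cscale CB.T 0 (H \<zero>\<^bsub>CA.T\<^esub>)"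
      using H CA.T.zero_closed unfolding is_tensor_map_def bounded_clinear_map_def by blast
    moreover have "H \<zero>\<^bsub>CA.T\<^esub> \<in> carrier CB.T"
      using H CA.T.zero_closed unfolding is_tensor_map_def bounded_clinear_map_def by blast
    ultimately have "H \<zero>\<^bsub>CA.T\<^esub> = \<zero>\<^bsub>CB.T\<^esub>" by (metis CA.T.sc_zero CB.T.sc_0)
    then show ?case by (simp add: CA.toa_Nil CB.toa_Nil)
  next
    case (Cons c a xs)
    then show ?case using H by (simp add: CA.toa_Cons CB.toa_Cons f_closed is_tensor_map_def bounded_clinear_map_def)
  qed
  obtain K where K: "\<And>s. s \<in> carrier CA.T \<Longrightarrow> cnorm CB.T (G s) \<le> K * cnorm CA.T s"
    using G unfolding is_tensor_map_def bounded_clinear_map_def by blast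
  obtain L where L: "\<And>s. s \<in> carrier CA.T \<Longrightarrow> cnorm CB.T (F s) \<le> L * cnorm CA.T s"
    using F_tensor_map unfolding is_tensor_map_def bounded_clinear_map_def by blast
  have diff: "H (cdiff CA.T t s) = cdiff CB.T (H t) (H s)" if "is_tensor_map C A C B id f H" "s \<in> carrier CA.T" for H s
    using that t CA.T.sc_closed by (simp add: cdiff_def is_tensor_map_def bounded_clinear_map_def)
  have "cnorm CB.T (cdiff CB.T (G t) (F t)) \<le> 0"
  proof (rule field_le_epsilon)
    fix e :: real assume e: "e > 0"
    define M where "M = \<bar>K\<bar> + \<bar>L\<bar> + 1"
    have M: "M > 0" by (simp add: M_def)
    obtain xs where xs: "xs \<in> CA.R" "cnorm CA.T (cdiff CA.T t (tens_of_alg C A xs)) < e / M"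
      using CA.dense_toa[OF t, of "e / M"] e M by auto
    let ?s = "tens_of_alg C A xs" and ?r = "tens_of_alg C B (mp xs)"
    have sc: "?s \<in> carrier CA.T" "?r \<in> carrier CB.T" and dc: "cdiff CA.T t ?s \<in> carrier CA.T" using xs t by auto
    have 1: "cnorm CB.T (cdiff CB.T (G t) ?r) \<le> K * cnorm CA.T (cdiff CA.T t ?s)"
      using K[OF dc] diff[OF G sc(1)] toa[OF G xs(1)] by simp
    have 2: "cnorm CB.T (cdiff CB.T (F t) ?r) \<le> L * cnorm CA.T (cdiff CA.T t ?s)"
      using L[OF dc] diff[OF F_tensor_map sc(1)] toa[OF F_tensor_map xs(1)] by simp
    have "cnorm CB.T (cdiff CB.T (G t) (F t)) \<le> cnorm CB.T (cdiff CB.T (G t) ?r) + cnorm CB.T (cdiff CB.T (F t) ?r)"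
      using CB.T.nrm_triangle3[of "G t" ?r "F t"] CB.T.nrm_diff_commute[of ?r "F t"] Gc[OF t] Fc[OF t] sc by (simp add: CB.T.cdiff_minus)
    also have "\<dots> \<le> K * cnorm CA.T (cdiff CA.T t ?s) + L * cnorm CA.T (cdiff CA.T t ?s)" using 1 2 by simp
    also have "\<dots> \<le> M * cnorm CA.T (cdiff CA.T t ?s)"
      unfolding distrib_right[symmetric] M_def using CA.T.norm_nonneg[OF dc] by (intro mult_right_mono) auto
    also have "\<dots> \<le> e" using xs(2) M by (simp add: field_simps)
    finally show "cnorm CB.T (cdiff CB.T (G t) (F t)) \<le> 0 + e" by simp
  qed
  then have "cdiff CB.T (G t) (F t) = \<zero>\<^bsub>CB.T\<^esub>"
    using CB.T.norm_nonneg[of "cdiff CB.T (G t) (F t)"] CB.T.norm_eq_0[of "cdiff CB.T (G t) (F t)"] Gc[OF t] Fc[OF t] by simp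
  then have "G t = F t" using CB.T.cdiff_eq_zero Gc[OF t] Fc[OF t] by blast
  then show "g (G t) = g (F t)" for g :: "_ \<Rightarrow> complex" by simp
qed

lemma tensor_map_eq: "tensor_map C A C B id f = F"
  unfolding tensor_map_def
proof (rule the_equality)
  show F: "F \<in> extensional (carrier CA.T) \<and> is_tensor_map C A C B id f F" using F_tensor_map by (simp add: F_def)
  fix G assume "G \<in> extensional (carrier CA.T) \<and> is_tensor_map C A C B id f G"
  then show "G = F" using F tensor_map_unique by (intro extensionalityI[of _ "carrier CA.T"]) auto
qed

lemma tensor_functional_map:
  assumes \<phi>: "\<phi> \<in> states C" and \<psi>: "\<psi> \<in> states B" and t: "t \<in> carrier CA.T"
  shows "tensor_functional \<phi> \<psi> (tensor_map C A C B id f t) = tensor_functional \<phi> (pull \<psi>) t"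
proof -
  obtain X where X: "CA.Cy X" "t = CA.cls X" using CA.carrier_cls[OF t] by blast
  have "(\<lambda>n. talg_functional \<phi> \<psi> (mp (X n))) \<longlonglongrightarrow> tensor_functional \<phi> \<psi> (F t)"
    using CB.tensor_functional_tendsto[OF \<phi> \<psi> mp_Cy[OF X(1)]] X by (simp add: F_cls)
  moreover have "(\<lambda>n. talg_functional \<phi> \<psi> (mp (X n))) \<longlonglongrightarrow> tensor_functional \<phi> (pull \<psi>) t"
    using CA.tensor_functional_tendsto[OF \<phi> pull_state[OF \<psi>] X(1)] X CA.Cy_R[OF X(1)] by (simp add: mp_ev)
  ultimately show ?thesis unfolding tensor_map_eq by (rule LIMSEQ_unique)
qed

lemma ctr_mp: "xs \<in> CA.R \<Longrightarrow> ctr B \<phi> (mp xs) = f (ctr A \<phi> xs)"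
  by (induction xs rule: alg_tensors_induct) (auto simp: f_zero f_add f_sc)

end

context gns begin

text \<open>The reduced algebra is not shown to be complete, so slices in it are obtained from those in \<open>A\<close>.\<close>

lemma slice_reduced:
  assumes C: "bounded_star_algebra C" and \<phi>: "character C \<phi>" and t: "t \<in> carrier (tensor C A)"
  shows "slice Ar \<phi> (tensor_map C A C Ar id \<tau> t) = \<tau> (slice A \<phi> t)"
proof -
  interpret C: bounded_star_algebra C by fact
  interpret Ar: bounded_star_algebra Ar by (rule red_bounded)
  have nz: "\<one> \<noteq> \<zero>" using state_one[OF h] linf_zero[OF linf_state[OF h]] by auto
  interpret bA: bounded_star_algebra A by (rule bounded_star_algebraI[OF nz])
  interpret M: tensor_right_hom C A Ar \<tau> by unfold_locales (auto simp: red_hom red_carrier)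
  have \<phi>s: "\<phi> \<in> states C" using \<phi> by (simp add: character_def)
  obtain \<psi> where \<psi>: "\<psi> \<in> states Ar" "\<And>a. a \<in> carrier A \<Longrightarrow> \<psi> (\<tau> a) = h a"
    using red_h by blast
  \<comment> \<open>The norm of the reduced algebra is the operator norm for the single state h, so
    the state induced by h suffices to compare it with the spatial norm.\<close>
  have nle: "cnorm Ar (ctr Ar \<phi> x) \<le> M.CB.N x" if x: "x \<in> M.CB.R" for x
  proof -
    obtain a where a: "a \<in> carrier A" "ctr Ar \<phi> x = \<tau> a" using M.CB.ctr_closed[OF x] by (auto simp: red_carrier)
    have "Nh a \<le> M.CB.N x"
    proof (rule Nh_le)
      fix w assume w: "w \<in> carrier A"
      then have "\<tau> w \<in> carrier Ar" by (simp add: red_carrier)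
      from M.CB.state_ctr_le_N[OF \<phi> \<psi>(1) x this] show "qh (a \<otimes> w) \<le> M.CB.N x * qh w"
        using a w by (simp add: red_ops \<psi>(2) qh_def)
    qed (rule M.CB.N_nonneg[OF x])
    then show ?thesis using a by (simp add: red_norm)
  qed
  obtain X where X: "M.CA.Cy X" "t = M.CA.cls X" using M.CA.carrier_cls[OF t] by blast
  note R = M.CA.Cy_R[OF X(1)]
  \<comment> \<open>The representative to which the definition of \<open>slice\<close> refers; it
    may differ from the image of X by a null sequence.\<close>
  define Y where "Y = tens_rep (M.CB.cls (\<lambda>n. M.mp (X n)))"
  note rc = M.CB.rep_cls[OF M.mp_Cy[OF X(1)], folded Y_def]
  note YR = M.CB.Cy_R[OF rc(1)]
  have cv: "conv (\<lambda>n. ctr A \<phi> (X n)) (slice A \<phi> t)"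
    using M.CA.slice_conv[OF cstar_algebra_axioms \<phi> X(1)] X(2) by simp
  let ?l = "slice A \<phi> t"
  have lc: "?l \<in> carrier A" using cv by (simp add: conv_def)
  have Yc: "ctr Ar \<phi> (Y n) \<in> carrier Ar" for n using YR by simp
  have cd: "cdiff Ar (\<tau> a) (\<tau> b) = \<tau> (a \<ominus> b)" if "a \<in> carrier A" "b \<in> carrier A" for a b
    using that by (simp add: cdiff_def red_ops minus_sc a_minus_def)
  have tri: "cnorm Ar (cdiff Ar S U) \<le> cnorm Ar (cdiff Ar S V) + cnorm Ar (cdiff Ar V U)"
    and sym: "cnorm Ar (cdiff Ar S V) = cnorm Ar (cdiff Ar V S)"
    and nn: "0 \<le> cnorm Ar (cdiff Ar S V)"
    if SVU: "S \<in> carrier Ar" "V \<in> carrier Ar" "U \<in> carrier Ar" for S V U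
  proof -
    obtain a b c where abc: "a \<in> carrier A" "S = \<tau> a" "b \<in> carrier A" "V = \<tau> b" "c \<in> carrier A" "U = \<tau> c"
      using SVU by (auto simp: red_carrier)
    have "a \<ominus> c = (a \<ominus> b) \<oplus> (b \<ominus> c)" using abc by (intro linf_eqI) (simp_all add: linf_simps)
    then show "cnorm Ar (cdiff Ar S U) \<le> cnorm Ar (cdiff Ar S V) + cnorm Ar (cdiff Ar V U)"
      using abc SN.opnorm_add[of "a \<ominus> b" "b \<ominus> c"] by (simp add: cd red_norm)
    have "a \<ominus> b = \<ominus> (b \<ominus> a)" using abc by (intro linf_eqI) (simp_all add: linf_simps)
    then show "cnorm Ar (cdiff Ar S V) = cnorm Ar (cdiff Ar V S)" using abc Nh_minus[of "b \<ominus> a"] by (simp add: cd red_norm)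
    show "0 \<le> cnorm Ar (cdiff Ar S V)" using abc SN.opnorm_nonneg[of "a \<ominus> b"] by (simp add: cd red_norm)
  qed
  have tlc: "\<tau> ?l \<in> carrier Ar" using lc by (simp add: red_carrier)
  have lim: "(\<lambda>n. cnorm Ar (cdiff Ar (ctr Ar \<phi> (Y n)) (\<tau> ?l))) \<longlonglongrightarrow> 0"
  proof (rule tendsto_sandwich[OF _ _ tendsto_const])
    show "(\<lambda>n. M.CB.d (M.mp (X n)) (Y n) + \<parallel>ctr A \<phi> (X n) \<ominus> ?l\<parallel>) \<longlonglongrightarrow> 0"
      using tendsto_add[OF rc(2), of "\<lambda>n. \<parallel>ctr A \<phi> (X n) \<ominus> ?l\<parallel>" 0] cv by (simp add: conv_def)
    have "cnorm Ar (cdiff Ar (ctr Ar \<phi> (Y n)) (\<tau> ?l)) \<le> M.CB.d (M.mp (X n)) (Y n) + \<parallel>ctr A \<phi> (X n) \<ominus> ?l\<parallel>" for n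
    proof -
      have mc: "ctr Ar \<phi> (M.mp (X n)) \<in> carrier Ar" using R by blast
      have "cnorm Ar (cdiff Ar (ctr Ar \<phi> (M.mp (X n))) (ctr Ar \<phi> (Y n))) \<le> M.CB.d (M.mp (X n)) (Y n)"
        using nle[of "M.mp (X n) @ M.CB.neg (Y n)"] R YR M.mp_closed by (simp add: M.CB.ctr_minus[OF \<phi>s] M.CB.d_def)
      moreover have "cnorm Ar (cdiff Ar (ctr Ar \<phi> (M.mp (X n))) (\<tau> ?l)) \<le> \<parallel>ctr A \<phi> (X n) \<ominus> ?l\<parallel>"
        using Nh_le_nrm[of "ctr A \<phi> (X n) \<ominus> ?l"] R lc by (simp add: M.ctr_mp cd red_norm)
      ultimately show ?thesis using tri[OF Yc mc tlc, of n] sym[OF Yc mc tlc, of n] by simp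
    qed
    then show "\<forall>\<^sub>F n in sequentially. cnorm Ar (cdiff Ar (ctr Ar \<phi> (Y n)) (\<tau> ?l)) \<le> M.CB.d (M.mp (X n)) (Y n) + \<parallel>ctr A \<phi> (X n) \<ominus> ?l\<parallel>" by simp
  qed (use nn[OF Yc tlc tlc] in simp)
  have rep: "tens_rep (tensor_map C A C Ar id \<tau> t) = Y" unfolding M.tensor_map_eq X(2) M.F_cls[OF X(1)] Y_def ..
  show ?thesis unfolding slice_def[of Ar] ctr_def[symmetric] rep
  proof (rule the_equality)
    show "\<tau> ?l \<in> carrier Ar \<and> (\<lambda>n. cnorm Ar (cdiff Ar (ctr Ar \<phi> (Y n)) (\<tau> ?l))) \<longlonglongrightarrow> 0" using tlc lim by blast
    fix m assume "m \<in> carrier Ar \<and> (\<lambda>n. cnorm Ar (cdiff Ar (ctr Ar \<phi> (Y n)) m)) \<longlonglongrightarrow> 0"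
    then have m: "m \<in> carrier Ar" and lm: "(\<lambda>n. cnorm Ar (cdiff Ar (ctr Ar \<phi> (Y n)) m)) \<longlonglongrightarrow> 0" by auto
    have "cnorm Ar (cdiff Ar m (\<tau> ?l)) \<le> 0"
    proof (rule LIMSEQ_le_const[OF tendsto_add[OF lm lim, simplified]], intro exI allI impI)
      fix n
      show "cnorm Ar (cdiff Ar m (\<tau> ?l)) \<le> cnorm Ar (cdiff Ar (ctr Ar \<phi> (Y n)) m) + cnorm Ar (cdiff Ar (ctr Ar \<phi> (Y n)) (\<tau> ?l))"
        using tri[OF m Yc tlc, of n] sym[OF m Yc tlc, of n] by simp
    qed
    moreover obtain b where b: "b \<in> carrier A" "m = \<tau> b" using m by (auto simp: red_carrier)
    ultimately show "m = \<tau> ?l" using lc SN.opnorm_nonneg[of "b \<ominus> ?l"] by (simp add: cd red_norm gns_rep_eq)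
  qed
qed

end

section \<open>Limits of states\<close>

context cstar_algebra begin

text \<open>Hahn-Banach for the upper limit of the sequence, \<open>inf {t. eventually Re \<phi>\<^sub>n a \<le> t}\<close>.\<close>

lemma limit_state:
  assumes \<phi>: "\<And>n. \<phi> n \<in> states A"
  shows "\<exists>\<psi>\<in>states A. \<forall>a\<in>carrier A. \<forall>l. (\<lambda>n. \<phi> n a) \<longlonglongrightarrow> l \<longrightarrow> \<psi> a = l"
proof -
  note lin = linf_state[OF \<phi>]
  define S where "S a = {t. \<forall>\<^sub>F n in sequentially. Re (\<phi> n a) \<le> t}" for a
  \<comment> \<open>The infimum of the eventual upper bounds, that is, the upper limit of the real
    parts.\<close>
  define p where "p a = Inf (S a)" for a
  have b: "\<bar>Re (\<phi> n a)\<bar> \<le> \<parallel>a\<parallel>" if "a \<in> carrier A" for n a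
    using state_norm_le[OF \<phi> that, of n] abs_Re_le_cmod[of "\<phi> n a"] by linarith
  have ne: "\<parallel>a\<parallel> \<in> S a" if "a \<in> carrier A" for a using b[OF that] by (auto simp: S_def abs_le_iff)
  have low: "- \<parallel>a\<parallel> \<le> t" if a: "a \<in> carrier A" and t: "t \<in> S a" for a t
  proof -
    obtain n where "Re (\<phi> n a) \<le> t" using t unfolding S_def by (auto dest: eventually_happens)
    then show ?thesis using b[OF a, of n] by linarith
  qed
  have bdd: "bdd_below (S a)" if "a \<in> carrier A" for a using low[OF that] by (rule bdd_belowI)
  have up: "p a \<le> t" if "a \<in> carrier A" "t \<in> S a" for a t unfolding p_def by (rule cInf_lower[OF that(2) bdd[OF that(1)]])
  have ge: "c \<le> p a" if "a \<in> carrier A" "\<And>t. t \<in> S a \<Longrightarrow> c \<le> t" for a c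
    unfolding p_def by (rule cInf_greatest) (use ne that in auto)
  have "p (a \<oplus> b) \<le> p a + p b" if ab: "a \<in> carrier A" "b \<in> carrier A" for a b
  proof -
    have *: "p (a \<oplus> b) \<le> s + t" if s: "s \<in> S a" and t: "t \<in> S b" for s t
    proof (rule up)
      have "\<forall>\<^sub>F n in sequentially. Re (\<phi> n a) \<le> s" "\<forall>\<^sub>F n in sequentially. Re (\<phi> n b) \<le> t" using s t by (auto simp: S_def)
      then have "\<forall>\<^sub>F n in sequentially. Re (\<phi> n (a \<oplus> b)) \<le> s + t"
        by eventually_elim (use ab lin in \<open>simp add: linf_add\<close>)
      then show "s + t \<in> S (a \<oplus> b)" by (simp add: S_def)
    qed (use ab in simp)
    have "p (a \<oplus> b) - s \<le> p b" if "s \<in> S a" for s by (rule ge) (use *[OF that] ab in \<open>auto simp: algebra_simps\<close>)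
    then have "p (a \<oplus> b) - p b \<le> p a" by (intro ge) (use ab in \<open>auto simp: algebra_simps\<close>)
    then show ?thesis by simp
  qed
  moreover have "p (cscale A (of_real r) a) = r * p a" if r: "r \<ge> 0" and a: "a \<in> carrier A" for r a
  proof (cases "r = 0")
    case True
    have "p \<zero> \<le> 0" by (rule up) (auto simp: S_def linf_zero[OF lin])
    moreover have "0 \<le> p \<zero>" by (rule ge) (use low[of \<zero>] in auto)
    ultimately show ?thesis using True a by simp
  next
    case False
    then have r0: "r > 0" using r by simp
    have S: "t \<in> S (cscale A (of_real r) a) \<longleftrightarrow> t / r \<in> S a" for t
      using r0 a by (simp add: S_def linf_sc[OF lin] field_simps)
    have "p (cscale A (of_real r) a) / r \<le> p a"
    proof (rule ge[OF a])
      fix t assume "t \<in> S a"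
      then have "p (cscale A (of_real r) a) \<le> r * t" by (intro up) (use S a r0 in auto)
      then show "p (cscale A (of_real r) a) / r \<le> t" using r0 by (simp add: field_simps)
    qed
    moreover have "r * p a \<le> p (cscale A (of_real r) a)"
    proof (rule ge)
      fix t assume "t \<in> S (cscale A (of_real r) a)"
      then have "p a \<le> t / r" using S a by (intro up) auto
      then show "r * p a \<le> t" using r0 by (simp add: field_simps)
    qed (use a in simp)
    ultimately show ?thesis using r0 by (simp add: field_simps)
  qed
  ultimately have "sublin p" by (simp add: sublin_def)
  then obtain g where g: "real_linf g" "\<And>a. a \<in> carrier A \<Longrightarrow> g a \<le> p a" using hahn_banach[OF _ zero_closed] by blast
  have gm: "g (\<ominus> a) = - g a" if "a \<in> carrier A" for a
    using g(1) that minus_sc[OF that] by (auto simp: real_linf_def dest!: spec[of _ "-1"])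
  have le: "g a \<le> t" if "a \<in> carrier A" "t \<in> S a" for a t using g(2)[OF that(1)] up[OF that] by linarith
  \<comment> \<open>If the limit exists, the upper limits at a and -a are l and -l, which bound g a
    from both sides.\<close>
  have lim: "g a = l" if a: "a \<in> carrier A" and l: "(\<lambda>n. Re (\<phi> n a)) \<longlonglongrightarrow> l" for a l
  proof -
    have *: "g a \<le> l" if a: "a \<in> carrier A" and l: "(\<lambda>n. Re (\<phi> n a)) \<longlonglongrightarrow> l" for a l
    proof (rule field_le_epsilon)
      fix e :: real assume "e > 0"
      then have "\<forall>\<^sub>F n in sequentially. Re (\<phi> n a) < l + e" using order_tendstoD(2)[OF l] by simp
      then have "l + e \<in> S a" unfolding S_def by (auto elim: eventually_mono)
      then show "g a \<le> l + e" using le a by blast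
    qed
    have "(\<lambda>n. Re (\<phi> n (\<ominus> a))) \<longlonglongrightarrow> - l" using tendsto_minus[OF l] a by (simp add: linf_minus[OF lin])
    from *[OF a l] *[OF _ this] show ?thesis using gm a by simp
  qed
  have "g \<one> = 1" by (rule lim) (simp_all add: state_one[OF \<phi>])
  moreover have "g (adj A a \<otimes> a) \<ge> 0" if a: "a \<in> carrier A" for a
  proof -
    have "Re (\<phi> n (\<ominus> (adj A a \<otimes> a))) \<le> 0" for n
      using state_nonneg[OF \<phi> a] a by (simp add: linf_minus[OF lin] complex_nonneg_Reals_iff)
    then have "g (\<ominus> (adj A a \<otimes> a)) \<le> 0" by (intro le) (use a in \<open>auto simp: S_def\<close>)
    then show ?thesis using gm a by simp
  qed
  ultimately obtain \<psi> where \<psi>: "\<psi> \<in> states A" "\<And>v. herm v \<Longrightarrow> \<psi> v = of_real (g v)"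
    using states_of_real_linf[OF g(1)] by blast
  have "\<psi> a = l" if a: "a \<in> carrier A" and l: "(\<lambda>n. \<phi> n a) \<longlonglongrightarrow> l" for a l
  proof -
    \<comment> \<open>The state agrees with g only on self-adjoint elements, so convergence is split
      into real and imaginary parts.\<close>
    define x where "x = cscale A (1/2) (a \<oplus> adj A a)"
    define y where "y = cscale A (\<i>/2) (adj A a \<ominus> a)"
    have xyc: "x \<in> carrier A" "y \<in> carrier A" using a by (auto simp: x_def y_def)
    have "adj A x = x" "adj A y = y" unfolding x_def y_def
      by (rule linf_eqI, use a in \<open>simp_all add: st_sc st_add a_minus_def minus_sc linf_simps algebra_simps\<close>)+
    then have h: "herm x" "herm y" using xyc by (auto simp: herm_def)
    have axy: "a = x \<oplus> cscale A \<i> y" unfolding x_def y_def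
      by (rule linf_eqI) (use a in \<open>simp_all add: linf_expand field_simps\<close>)
    have "Re (\<phi> n x) = Re (\<phi> n a)" "Re (\<phi> n y) = Im (\<phi> n a)" for n
      unfolding x_def y_def using a by (simp_all add: linf_simps[OF lin] state_st[OF \<phi>])
    then have "g x = Re l" "g y = Im l" using lim[OF xyc(1), of "Re l"] lim[OF xyc(2), of "Im l"] tendsto_Re[OF l] tendsto_Im[OF l] by auto
    then have "\<psi> x = of_real (Re l)" "\<psi> y = of_real (Im l)" using \<psi>(2) h by auto
    then show ?thesis unfolding axy using linf_simps[OF linf_state[OF \<psi>(1)]] xyc by (simp add: complex_eq_iff)
  qed
  then show ?thesis using \<psi>(1) by blast
qed

text \<open>The vector state of the normalised class of c in the GNS representation of
  \<psi>.\<close>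

lemma state_compress:
  assumes \<psi>: "\<psi> \<in> states A" and c: "c \<in> carrier A" and nz: "\<psi> (adj A c \<otimes> c) \<noteq> 0"
  shows "(\<lambda>a\<in>carrier A. \<psi> (adj A c \<otimes> a \<otimes> c) / \<psi> (adj A c \<otimes> c)) \<in> states A"
proof -
  note lin = linf_state[OF \<psi>]
  have "\<psi> (adj A c \<otimes> (adj A a \<otimes> a) \<otimes> c) \<in> \<real>\<^sub>\<ge>\<^sub>0" if "a \<in> carrier A" for a
    using state_nonneg[OF \<psi>, of "a \<otimes> c"] that c by (simp add: st_mult m_assoc)
  moreover have "\<psi> (adj A c \<otimes> c) \<in> \<real>\<^sub>\<ge>\<^sub>0" using state_nonneg[OF \<psi> c] .
  ultimately show ?thesis using c nz
    by (auto simp: states_def r_distr l_distr sc_mult_left sc_mult_right linf_simps[OF lin] add_divide_distrib)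
qed

end

section \<open>Ideals of continuous functions\<close>

lemma Cont_carrier: "f \<in> carrier Cont \<longleftrightarrow> continuous_on UNIV f"
  by (simp add: Cont_def)

lemma Cont_ops: "f \<otimes>\<^bsub>Cont\<^esub> g = (\<lambda>x. f x * g x)" "\<one>\<^bsub>Cont\<^esub> = (\<lambda>x. 1)" "\<zero>\<^bsub>Cont\<^esub> = (\<lambda>x. 0)"
  "f \<oplus>\<^bsub>Cont\<^esub> g = (\<lambda>x. f x + g x)" "cscale Cont z f = (\<lambda>x. z * f x)" "adj Cont f = (\<lambda>x. cnj (f x))"
  "cnorm Cont f = (SUP x. cmod (f x))"
  by (simp_all add: Cont_def)

text \<open>By compactness finitely many members of J have no common zero on Q, so G, the sum of
  their |f|^2, lies in J and is bounded below on Q. Then F is G times the continuous function F / G,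
  suitably extended.\<close>

lemma ideal_contains:
  fixes J :: "('x::t2_space \<Rightarrow> complex) set"
  assumes cpt: "compact (UNIV :: 'x set)" and J: "J \<subseteq> carrier Cont" and zero: "(\<lambda>x. 0) \<in> J"
    and add: "\<And>f g. f \<in> J \<Longrightarrow> g \<in> J \<Longrightarrow> (\<lambda>x. f x + g x) \<in> J"
    and mult: "\<And>f g. f \<in> J \<Longrightarrow> g \<in> carrier Cont \<Longrightarrow> (\<lambda>x. g x * f x) \<in> J"
    and Q: "closed Q" "\<And>x. x \<in> Q \<Longrightarrow> \<exists>f\<in>J. f x \<noteq> 0"
    and F: "F \<in> carrier Cont" "\<And>x. x \<notin> Q \<Longrightarrow> F x = 0"
  shows "F \<in> J"
proof (cases "Q = {}")
  case True
  then have "F = (\<lambda>x. 0)" using F(2) by auto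
  then show ?thesis using zero by simp
next
  case False
  have Qc: "compact Q" using compact_Int_closed[OF cpt Q(1)] by simp
  define U where "U f = {x. f x \<noteq> 0}" for f :: "'x \<Rightarrow> complex"
  have Uo: "open (U f)" if "f \<in> J" for f
  proof -
    have "continuous_on UNIV f" using that J by (auto simp: Cont_carrier)
    then show ?thesis unfolding U_def using open_Collect_neq[of f "\<lambda>x. 0"] by simp
  qed
  obtain K where K: "K \<subseteq> J" "finite K" "Q \<subseteq> (\<Union>f\<in>K. U f)"
  proof -
    have "Q \<subseteq> (\<Union>f\<in>J. U f)" using Q(2) by (auto simp: U_def)
    then show ?thesis using compactE_image[OF Qc, of J U] Uo that by metis
  qed
  define G where "G x = (\<Sum>f\<in>K. cnj (f x) * f x)" for x
  have "(\<lambda>x. \<Sum>f\<in>L. cnj (f x) * f x) \<in> J" if "finite L" "L \<subseteq> J" for L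
    using that
  proof (induction L rule: finite_induct)
    case (insert f L)
    then have f: "f \<in> J" by simp
    then have "(\<lambda>x. cnj (f x)) \<in> carrier Cont" using J by (auto simp: Cont_carrier intro!: continuous_intros)
    then show ?case using insert add[OF mult[OF f]] by simp
  qed (simp add: zero)
  then have GJ: "G \<in> J" using K unfolding G_def by blast
  then have Gc: "continuous_on UNIV G" using J by (auto simp: Cont_carrier)
  define R where "R x = Re (G x)" for x
  have Rc: "continuous_on UNIV R" unfolding R_def by (intro continuous_intros Gc)
  have GR: "G x = of_real (R x)" for x
    unfolding R_def G_def complex_eq_iff by (simp add: algebra_simps)
  have Rpos: "R x > 0" if x: "x \<in> Q" for x
  proof -
    obtain f where f: "f \<in> K" "f x \<noteq> 0" using K(3) x by (auto simp: U_def)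
    have "R x = (\<Sum>f\<in>K. (cmod (f x))\<^sup>2)"
      unfolding R_def G_def Re_sum by (rule sum.cong, rule refl, unfold cmod_power2, simp add: power2_eq_square)
    also have "\<dots> > 0" using f by (intro sum_pos2[OF K(2) f(1)]) auto
    finally show ?thesis .
  qed
  obtain x0 where x0: "x0 \<in> Q" "\<And>x. x \<in> Q \<Longrightarrow> R x0 \<le> R x"
    using continuous_attains_inf[OF Qc False continuous_on_subset[OF Rc]] by auto
  define m where "m = R x0"
  have m: "m > 0" using Rpos x0 by (simp add: m_def)
  \<comment> \<open>The maximum leaves the denominator unchanged on Q and keeps it positive
    elsewhere, where F vanishes anyway.\<close>
  define H where "H x = F x / of_real (max (R x) m)" for x
  have pos: "max (R x) m > 0" for x using m by (simp add: max_def)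
  have "continuous_on UNIV H" unfolding H_def using F(1)
    by (intro continuous_intros Rc) (use pos in \<open>auto simp: Cont_carrier less_imp_neq[symmetric]\<close>)
  then have "(\<lambda>x. H x * G x) \<in> J" using mult[OF GJ] by (simp add: Cont_carrier)
  moreover have "(\<lambda>x. H x * G x) = F"
  proof
    fix x show "H x * G x = F x"
    proof (cases "x \<in> Q")
      case True
      then have "max (R x) m = R x" using x0(2) by (simp add: m_def)
      then show ?thesis using Rpos[OF True] by (simp add: H_def GR)
    qed (simp add: H_def F(2))
  qed
  ultimately show ?thesis by simp
qed

section \<open>Actions on compact metric spaces\<close>

locale compact_action =
  fixes A :: "'a cstar" and \<Delta> :: "'a \<Rightarrow> ('a, 'a) tens" and h :: "'a \<Rightarrow> complex"
    and \<rho> :: "('x::metric_space \<Rightarrow> complex) \<Rightarrow> ('x \<Rightarrow> complex, 'a) tens"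
  assumes compact_UNIV: "compact (UNIV :: 'x set)"
    and cqg: "compact_quantum_group A \<Delta>"
    and haar: "haar_state A \<Delta> h"
    and action: "cqg_action A \<Delta> \<rho>"
begin

abbreviation C :: "('x \<Rightarrow> complex) cstar" where "C \<equiv> Cont"

sublocale C: cstar_algebra C by (rule cstar_algebra_Cont[OF compact_UNIV])
sublocale bC: bounded_star_algebra C by (rule bounded_star_algebra_Cont[OF compact_UNIV])
sublocale G: gns A h
  using cqg haar unfolding compact_quantum_group_def haar_state_def gns_def gns_axioms_def by blast

lemma one_neq_zero: "\<one>\<^bsub>A\<^esub> \<noteq> \<zero>\<^bsub>A\<^esub>"
  using G.state_one[OF G.h] G.linf_zero[OF G.linf_state[OF G.h]] by auto

sublocale bA: bounded_star_algebra A by (rule G.bounded_star_algebraI[OF one_neq_zero])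
sublocale CA: tensor_factors C A ..
sublocale M: tensor_right_hom C A G.Ar G.\<tau>
  by (intro tensor_right_hom.intro tensor_right_hom_axioms.intro bC.bounded_star_algebra_axioms
      bA.bounded_star_algebra_axioms G.red_bounded) (auto simp: G.red_hom G.red_carrier)

abbreviation e :: "'x \<Rightarrow> ('x \<Rightarrow> complex) \<Rightarrow> 'a" where "e x f \<equiv> eval_at A \<rho> f x"

lemma \<rho>_hom: "cstar_hom C (tensor C A) \<rho>" using action by (simp add: cqg_action_def)

lemma \<rho>_closed: "f \<in> carrier C \<Longrightarrow> \<rho> f \<in> carrier (tensor C A)"
  by (rule cstar_hom_closed[OF \<rho>_hom])

lemma dirac_state: "dirac x \<in> states C"
  using dirac_character unfolding character_def by blast

lemma e_hom: "cstar_hom C A (e x)"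
  unfolding eval_at_def by (rule cstar_hom_comp[OF \<rho>_hom CA.slice_hom[OF G.cstar_algebra_axioms dirac_character]])

lemma e_closed: "f \<in> carrier C \<Longrightarrow> e x f \<in> carrier A" by (rule cstar_hom_closed[OF e_hom])

lemma e_mult: "f \<in> carrier C \<Longrightarrow> g \<in> carrier C \<Longrightarrow> e x (\<lambda>z. f z * g z) = e x f \<otimes>\<^bsub>A\<^esub> e x g"
  and e_add: "f \<in> carrier C \<Longrightarrow> g \<in> carrier C \<Longrightarrow> e x (\<lambda>z. f z + g z) = e x f \<oplus>\<^bsub>A\<^esub> e x g"
  and e_one: "e x (\<lambda>z. 1) = \<one>\<^bsub>A\<^esub>"
  and e_sc: "f \<in> carrier C \<Longrightarrow> e x (\<lambda>z. w * f z) = cscale A w (e x f)"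
  and e_adj: "f \<in> carrier C \<Longrightarrow> e x (\<lambda>z. cnj (f z)) = adj A (e x f)"
  using e_hom[of x] by (auto simp: cstar_hom_def ring_hom_def Cont_ops)

lemma cnj_closed: "f \<in> carrier C \<Longrightarrow> (\<lambda>z. cnj (f z)) \<in> carrier C"
  and mult_closed: "f \<in> carrier C \<Longrightarrow> g \<in> carrier C \<Longrightarrow> (\<lambda>z. f z * g z) \<in> carrier C"
  and add_closed: "f \<in> carrier C \<Longrightarrow> g \<in> carrier C \<Longrightarrow> (\<lambda>z. f z + g z) \<in> carrier C"
  and diff_closed: "f \<in> carrier C \<Longrightarrow> g \<in> carrier C \<Longrightarrow> (\<lambda>z. f z - g z) \<in> carrier C"
  and const_closed: "(\<lambda>z. w) \<in> carrier C"
  by (auto simp: Cont_carrier intro!: continuous_intros)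

lemmas C_closed = cnj_closed mult_closed add_closed diff_closed const_closed

lemma e_zero: "e x (\<lambda>z. 0) = \<zero>\<^bsub>A\<^esub>"
  using e_sc[OF const_closed[of 1], where x = x and w = 0] by (simp add: e_one)

lemma e_sq: "f \<in> carrier C \<Longrightarrow> e x (\<lambda>z. cnj (f z) * f z) = adj A (e x f) \<otimes>\<^bsub>A\<^esub> e x f"
  by (simp add: e_mult e_adj cnj_closed)

lemma e_diff: "f \<in> carrier C \<Longrightarrow> g \<in> carrier C \<Longrightarrow> e x (\<lambda>z. f z - g z) = e x f \<ominus>\<^bsub>A\<^esub> e x g"
  using e_add[of f "\<lambda>z. - 1 * g z"] e_sc[of g "-1"] mult_closed[OF const_closed[of "-1"], of g]
  by (simp add: G.minus_sc e_closed a_minus_def)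

lemma act_eq: assumes \<phi>: "\<phi> \<in> states A" and f: "f \<in> carrier C" shows "act \<rho> (dirac x) \<phi> f = \<phi> (e x f)"
  using CA.slice_state[OF G.cstar_algebra_axioms dirac_character \<phi> \<rho>_closed[OF f]] f
  by (simp add: act_def eval_at_def)

lemma act_eq_fun: assumes \<phi>: "\<phi> \<in> states A" shows "act \<rho> (dirac x) \<phi> = (\<lambda>f\<in>carrier C. \<phi> (e x f))"
  using act_eq[OF \<phi>] by (auto simp: fun_eq_iff act_def)

lemma act_state: assumes \<phi>: "\<phi> \<in> states A" shows "act \<rho> (dirac x) \<phi> \<in> states C"
  unfolding act_eq_fun[OF \<phi>] by (rule state_pullback_hom[OF e_hom C.star_algebra_axioms \<phi>])

lemma act_act:
  assumes \<mu>: "\<mu> \<in> states C" and \<phi>: "\<phi> \<in> states A" and \<psi>: "\<psi> \<in> states A"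
  shows "act \<rho> (act \<rho> \<mu> \<phi>) \<psi> = act \<rho> \<mu> (\<lambda>a\<in>carrier A. tensor_functional \<phi> \<psi> (\<Delta> a))"
proof -
  obtain \<rho>_id id_\<Delta> \<alpha> where m: "is_tensor_map C A (tensor C A) A \<rho> id \<rho>_id" "is_tensor_map C A C (tensor A A) id \<Delta> id_\<Delta>"
    "is_associator C A A \<alpha>" "\<And>f. f \<in> carrier C \<Longrightarrow> \<alpha> (\<rho>_id (\<rho> f)) = id_\<Delta> (\<rho> f)"
    using action unfolding cqg_action_def by blast
  have \<Delta>: "cstar_hom A (tensor A A) \<Delta>" using cqg by (simp add: compact_quantum_group_def)
  show ?thesis
    using coaction_states[OF bC.bounded_star_algebra_axioms bA.bounded_star_algebra_axioms \<rho>_hom \<Delta> m \<mu> \<phi> \<psi>]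
    by (auto simp: act_def fun_eq_iff)
qed

lemma haar_conv:
  assumes \<phi>: "\<phi> \<in> states A"
  shows "(\<lambda>a\<in>carrier A. tensor_functional \<phi> h (\<Delta> a)) = h" "(\<lambda>a\<in>carrier A. tensor_functional h \<phi> (\<Delta> a)) = h"
  using haar \<phi> by (auto simp: haar_state_def states_def fun_eq_iff extensional_def)

text \<open>The two invariance properties of h in terms of points: every measure reached from x has
  the same Haar mean as x, and the Haar mean itself is fixed by all states.\<close>

lemma act_haar: "\<phi> \<in> states A \<Longrightarrow> act \<rho> (act \<rho> (dirac x) \<phi>) h = act \<rho> (dirac x) h"
  and act_haar': "\<phi> \<in> states A \<Longrightarrow> act \<rho> (act \<rho> (dirac x) h) \<phi> = act \<rho> (dirac x) h"
  using act_act[OF dirac_state _ G.h] act_act[OF dirac_state G.h] haar_conv by simp_all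

lemma act_reduced: assumes \<psi>: "\<psi> \<in> states G.Ar"
  shows "act (reduced_action A h \<rho>) (dirac x) \<psi> = act \<rho> (dirac x) (M.pull \<psi>)"
  unfolding act_def reduced_action_def using M.tensor_functional_map[OF dirac_state \<psi> \<rho>_closed]
  by (auto simp: fun_eq_iff)

lemma eval_reduced: assumes f: "f \<in> carrier C" shows "eval_at G.Ar (reduced_action A h \<rho>) f x = G.\<tau> (e x f)"
  unfolding eval_at_def reduced_action_def
  by (rule G.slice_reduced[OF bC.bounded_star_algebra_axioms dirac_character \<rho>_closed[OF f]])

text \<open>A norming state for the image pulls back to a state of the function algebra, which is
  bounded by the supremum norm.\<close>

lemma e_norm_le:
  assumes k: "k \<in> carrier C" and le: "\<And>z. cmod (k z) \<le> r" shows "cnorm A (e x k) \<le> r"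
proof -
  obtain \<psi> where \<psi>: "\<psi> \<in> states A" "\<psi> (adj A (e x k) \<otimes>\<^bsub>A\<^esub> e x k) = of_real ((cnorm A (e x k))\<^sup>2)"
    using G.norming_state[OF one_neq_zero e_closed[OF k]] by blast
  have r: "0 \<le> r" using le[of undefined] norm_ge_zero order_trans by blast
  have kk: "(\<lambda>z. cnj (k z) * k z) \<in> carrier C" using k by (intro C_closed)
  have "cmod (act \<rho> (dirac x) \<psi> (\<lambda>z. cnj (k z) * k z)) \<le> cnorm C (\<lambda>z. cnj (k z) * k z)"
    by (rule C.state_norm_le[OF act_state[OF \<psi>(1)] kk])
  also have "\<dots> \<le> r\<^sup>2" unfolding Cont_ops
    by (rule cSUP_least) (use le r in \<open>auto simp: norm_mult power2_eq_square intro!: mult_mono\<close>)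
  finally have "(cnorm A (e x k))\<^sup>2 \<le> r\<^sup>2" using \<psi> kk by (simp add: act_eq e_sq[OF k] norm_power)
  then show ?thesis by (rule power2_le_imp_le) (rule r)
qed

section \<open>States localised at a point\<close>

definition bump :: "'x \<Rightarrow> real \<Rightarrow> 'x \<Rightarrow> complex" where
  "bump y r = (\<lambda>z. of_real (max 0 (r - dist y z)))"

lemma bump_closed: "bump y r \<in> carrier C"
  unfolding bump_def Cont_carrier by (intro continuous_intros)

lemma bump_pos: "r > 0 \<Longrightarrow> bump y r y \<noteq> 0" and bump_zero: "dist y z \<ge> r \<Longrightarrow> bump y r z = 0"
  by (auto simp: bump_def)

text \<open>The vector states of e x (f n) in the GNS representations of \<psi> n concentrate at y,
  and a limit of them evaluates functions at y. The second clause records that \<phi> ignores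
  whatever these representations annihilate: with constant \<psi> n = h it lets \<phi> descend to
  the reduced algebra.\<close>

lemma localized_state:
  assumes \<psi>: "\<And>n. \<psi> n \<in> states A" and f: "\<And>n. f n \<in> carrier C"
    and supp: "\<And>n z. dist y z \<ge> 1 / real (Suc n) \<Longrightarrow> f n z = 0"
    and nz: "\<And>n. \<psi> n (adj A (e x (f n)) \<otimes>\<^bsub>A\<^esub> e x (f n)) \<noteq> 0"
  shows "\<exists>\<phi>\<in>states A. (\<forall>g\<in>carrier C. \<phi> (e x g) = g y) \<and>
    (\<forall>a\<in>carrier A. (\<forall>n. \<forall>b\<in>carrier A. \<psi> n (adj A b \<otimes>\<^bsub>A\<^esub> a \<otimes>\<^bsub>A\<^esub> b) = 0) \<longrightarrow> \<phi> a = 0)"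
proof -
  define \<phi>' where "\<phi>' n = (\<lambda>a\<in>carrier A. \<psi> n (adj A (e x (f n)) \<otimes>\<^bsub>A\<^esub> a \<otimes>\<^bsub>A\<^esub> e x (f n))
    / \<psi> n (adj A (e x (f n)) \<otimes>\<^bsub>A\<^esub> e x (f n)))" for n
  have \<phi>': "\<phi>' n \<in> states A" for n unfolding \<phi>'_def by (rule G.state_compress[OF \<psi> e_closed[OF f] nz])
  obtain \<phi> where \<phi>1: "\<phi> \<in> states A" and \<phi>2: "\<forall>a\<in>carrier A. \<forall>l. (\<lambda>n. \<phi>' n a) \<longlonglongrightarrow> l \<longrightarrow> \<phi> a = l"
    using G.limit_state[of \<phi>', OF \<phi>'] by (elim bexE)
  have \<phi>: "\<phi> a = l" if "a \<in> carrier A" "(\<lambda>n. \<phi>' n a) \<longlonglongrightarrow> l" for a l using \<phi>2 that by simp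
  have "\<phi> a = 0" if a: "a \<in> carrier A" and z: "\<forall>n. \<forall>b\<in>carrier A. \<psi> n (adj A b \<otimes>\<^bsub>A\<^esub> a \<otimes>\<^bsub>A\<^esub> b) = 0" for a
    by (rule \<phi>[OF a]) (use a z e_closed[OF f] in \<open>simp add: \<phi>'_def\<close>)
  moreover have "\<phi> (e x g) = g y" if g: "g \<in> carrier C" for g
  proof (rule \<phi>[OF e_closed[OF g]])
    have gc: "continuous_on UNIV g" using g by (simp add: Cont_carrier)
    show "(\<lambda>n. \<phi>' n (e x g)) \<longlonglongrightarrow> g y"
    proof (rule LIMSEQ_I)
      fix \<epsilon> :: real assume \<epsilon>: "\<epsilon> > 0"
      then obtain \<delta> where \<delta>: "\<delta> > 0" "\<And>z. dist z y < \<delta> \<Longrightarrow> dist (g z) (g y) < \<epsilon> / 2"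
        using gc[unfolded continuous_on_iff, rule_format, of y "\<epsilon> / 2"] by auto
      obtain m where m: "1 / real (Suc m) < \<delta>" using nat_approx_posE[OF \<delta>(1)] by blast
      have "cmod (\<phi>' n (e x g) - g y) < \<epsilon>" if n: "n \<ge> m" for n
      proof -
        have le: "1 / real (Suc n) \<le> 1 / real (Suc m)" using n by (simp add: field_simps)
        have near: "cmod (g z - g y) < \<epsilon> / 2" if nz: "f n z \<noteq> 0" for z
        proof -
          have "\<not> 1 / real (Suc n) \<le> dist y z" using supp nz by blast
          then have "dist z y < \<delta>" using le m dist_commute[of z y] by linarith
          then show ?thesis using \<delta>(2)[of z] by (simp add: dist_norm)
        qed
        define \<mu> where "\<mu> = act \<rho> (dirac x) (\<psi> n)"
        have \<mu>: "\<mu> \<in> states C" unfolding \<mu>_def by (rule act_state[OF \<psi>])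
        define F where "F = f n"
        define k where "k = (\<lambda>z. F z * (g z - g y))"
        \<comment> \<open>Chosen so that |k|^2 + |s|^2 = (\<epsilon>/2)^2 |F|^2. This turns the
          pointwise bound on g - g y into \<mu> (|k|^2) \<le> (\<epsilon>/2)^2 \<mu> (|F|^2);
          wherever F is nonzero the maximum has no effect.\<close>
        define s where "s = (\<lambda>z. F z * of_real (sqrt (max 0 ((\<epsilon>/2)\<^sup>2 - (cmod (g z - g y))\<^sup>2))))"
        have Fc: "F \<in> carrier C" using f by (simp add: F_def)
        have kc: "k \<in> carrier C" unfolding k_def using Fc g by (intro C_closed)
        have sc: "s \<in> carrier C" unfolding s_def using Fc gc by (auto simp: Cont_carrier intro!: continuous_intros)
        define w where "w = \<mu> (adj C F \<otimes>\<^bsub>C\<^esub> F)"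
        have w: "w \<in> \<real>\<^sub>\<ge>\<^sub>0" unfolding w_def by (rule C.state_nonneg[OF \<mu> Fc])
        have wv: "w = \<psi> n (adj A (e x F) \<otimes>\<^bsub>A\<^esub> e x F)"
          unfolding w_def \<mu>_def Cont_ops using Fc by (simp add: act_eq[OF \<psi>] C_closed e_sq)
        then have w0: "Re w > 0" using nz[of n] w by (auto simp: F_def complex_nonneg_Reals_iff complex_eq_iff)
        have "adj C k \<otimes>\<^bsub>C\<^esub> k \<oplus>\<^bsub>C\<^esub> adj C s \<otimes>\<^bsub>C\<^esub> s = cscale C (of_real ((\<epsilon>/2)\<^sup>2)) (adj C F \<otimes>\<^bsub>C\<^esub> F)"
        proof -
          have "cnj (k z) * k z + cnj (s z) * s z = of_real ((\<epsilon>/2)\<^sup>2) * (cnj (F z) * F z)" for z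
          proof (cases "F z = 0")
            case False
            then have "(cmod (g z - g y))\<^sup>2 \<le> (\<epsilon>/2)\<^sup>2" using near[of z] by (intro power_mono) (auto simp: F_def)
            then have "cnj (s z) * s z = cnj (F z) * F z * of_real ((\<epsilon>/2)\<^sup>2 - (cmod (g z - g y))\<^sup>2)"
              unfolding s_def by (simp add: max_def mult_ac flip: of_real_mult) 
            moreover have "cnj (k z) * k z = cnj (F z) * F z * of_real ((cmod (g z - g y))\<^sup>2)"
              unfolding k_def complex_norm_square by simp
            ultimately show ?thesis by (simp add: algebra_simps)
          qed (simp add: k_def s_def)
          then show ?thesis unfolding Cont_ops by (intro ext)
        qed
        then have "\<mu> (adj C k \<otimes>\<^bsub>C\<^esub> k) + \<mu> (adj C s \<otimes>\<^bsub>C\<^esub> s) = of_real ((\<epsilon>/2)\<^sup>2) * w"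
          using C.linf_simps(1,2)[OF C.linf_state[OF \<mu>]] kc sc Fc unfolding w_def by (metis C.m_closed C.st_closed)
        then have "Re (\<mu> (adj C k \<otimes>\<^bsub>C\<^esub> k)) + Re (\<mu> (adj C s \<otimes>\<^bsub>C\<^esub> s)) = (\<epsilon>/2)\<^sup>2 * Re w"
          by (drule_tac arg_cong[where f = Re]) simp
        then have "Re (\<mu> (adj C k \<otimes>\<^bsub>C\<^esub> k)) \<le> (\<epsilon>/2)\<^sup>2 * Re w"
          using C.state_nonneg[OF \<mu> sc] by (simp add: complex_nonneg_Reals_iff)
        then have "(cmod (\<mu> (adj C F \<otimes>\<^bsub>C\<^esub> k)))\<^sup>2 \<le> Re w * ((\<epsilon>/2)\<^sup>2 * Re w)"
          using C.state_cauchy_schwarz(2)[OF \<mu> Fc kc] mult_left_mono[of _ "(\<epsilon>/2)\<^sup>2 * Re w" "Re w"] w0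
          unfolding w_def[symmetric] by (meson less_imp_le order_trans)
        also have "\<dots> = (\<epsilon>/2 * Re w)\<^sup>2" by (simp add: power2_eq_square)
        finally have "cmod (\<mu> (adj C F \<otimes>\<^bsub>C\<^esub> k)) \<le> \<epsilon>/2 * Re w" by (rule power2_le_imp_le) (use \<epsilon> w0 in simp)
        \<comment> \<open>Since functions commute, the compression of e x g by e x F is the value at
          |F|^2 g. The error times the weight w is thus an inner product to which Cauchy-Schwarz
          applies.\<close>
        moreover have "\<mu> (adj C F \<otimes>\<^bsub>C\<^esub> k) = (\<phi>' n (e x g) - g y) * w"
        proof -
          have "\<mu> (adj C F \<otimes>\<^bsub>C\<^esub> k) = \<psi> n (e x (\<lambda>z. cnj (F z) * (F z * (g z - g y))))"
            unfolding \<mu>_def Cont_ops k_def using Fc g by (simp add: act_eq[OF \<psi>] C_closed)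
          also have "e x (\<lambda>z. cnj (F z) * (F z * (g z - g y)))
              = e x (\<lambda>z. cnj (F z) * g z * F z) \<ominus>\<^bsub>A\<^esub> cscale A (g y) (e x (\<lambda>z. cnj (F z) * F z))"
          proof -
            have "(\<lambda>z. cnj (F z) * (F z * (g z - g y))) = (\<lambda>z. cnj (F z) * g z * F z - g y * (cnj (F z) * F z))"
              by (auto simp: algebra_simps)
            then show ?thesis using Fc g by (simp add: e_diff e_sc C_closed)
          qed
          also have "\<psi> n \<dots> = \<psi> n (adj A (e x F) \<otimes>\<^bsub>A\<^esub> e x g \<otimes>\<^bsub>A\<^esub> e x F) - g y * w"
            using Fc g by (simp add: wv G.linf_simps[OF G.linf_state[OF \<psi>]] e_closed e_mult e_adj C_closed)
          also have "\<psi> n (adj A (e x F) \<otimes>\<^bsub>A\<^esub> e x g \<otimes>\<^bsub>A\<^esub> e x F) = \<phi>' n (e x g) * w"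
            using nz[of n] g by (simp add: \<phi>'_def wv F_def e_closed)
          finally show ?thesis by (simp add: algebra_simps)
        qed
        moreover have "cmod w = Re w" using w by (simp add: complex_nonneg_Reals_iff cmod_eq_Re)
        ultimately have "cmod (\<phi>' n (e x g) - g y) * Re w \<le> \<epsilon>/2 * Re w" by (simp add: norm_mult)
        then have "cmod (\<phi>' n (e x g) - g y) \<le> \<epsilon>/2" using w0 by simp
        then show ?thesis using \<epsilon> by simp
      qed
      then show "\<exists>no. \<forall>n\<ge>no. cmod (\<phi>' n (e x g) - g y) < \<epsilon>" by blast
    qed
  qed
  ultimately show ?thesis using \<phi>1 by blast
qed

text \<open>The hull of the kernel of f \<mapsto> \<rho>(f)(x), the candidate for the closed set
  that the definite description in \<open>quotient_space\<close> selects.\<close>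

definition kerset :: "'x \<Rightarrow> 'x set" where
  "kerset x = {y. \<forall>f\<in>carrier C. e x f = \<zero>\<^bsub>A\<^esub> \<longrightarrow> f y = 0}"

lemma kerset_closed: "closed (kerset x)"
proof -
  have "kerset x = (\<Inter>f\<in>{f \<in> carrier C. e x f = \<zero>\<^bsub>A\<^esub>}. {y. f y = 0})" by (auto simp: kerset_def)
  also have "closed \<dots>"
    by (intro closed_INT ballI) (auto simp: Cont_carrier intro!: closed_Collect_eq)
  finally show ?thesis .
qed

text \<open>If f vanishes on the hull, the part of |f|^2 above \<epsilon> lives on a closed set
  disjoint from the hull, so \<open>ideal_contains\<close> puts it in the kernel. The rest is at
  most \<epsilon>, so the image of |f|^2 has norm at most \<epsilon>.\<close>

lemma e_zero_iff_kerset: assumes f: "f \<in> carrier C" shows "e x f = \<zero>\<^bsub>A\<^esub> \<longleftrightarrow> (\<forall>y\<in>kerset x. f y = 0)"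
proof
  assume van: "\<forall>y\<in>kerset x. f y = 0"
  have fc: "continuous_on UNIV f" using f by (simp add: Cont_carrier)
  define k where "k = (\<lambda>z. cnj (f z) * f z)"
  have kc: "k \<in> carrier C" unfolding k_def using f by (intro C_closed)
  have "cnorm A (e x k) \<le> 0"
  proof (rule field_le_epsilon)
    fix \<epsilon> :: real assume \<epsilon>: "\<epsilon> > 0"
    define F where "F = (\<lambda>z. complex_of_real (max 0 ((cmod (f z))\<^sup>2 - \<epsilon>)))"
    have Fc: "F \<in> carrier C" unfolding F_def Cont_carrier by (intro continuous_intros fc)
    define Q where "Q = {z. (cmod (f z))\<^sup>2 \<ge> \<epsilon>}"
    have "F \<in> {f \<in> carrier C. e x f = \<zero>\<^bsub>A\<^esub>}"
    proof (rule ideal_contains[OF compact_UNIV, where Q = Q])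
      show "(\<lambda>z. 0) \<in> {f \<in> carrier C. e x f = \<zero>\<^bsub>A\<^esub>}" using const_closed e_zero by simp
      show "closed Q" unfolding Q_def by (intro closed_Collect_le continuous_intros fc)
      fix z assume "z \<in> Q"
      then have "z \<notin> kerset x" using van \<epsilon> by (auto simp: Q_def)
      then show "\<exists>f\<in>{f \<in> carrier C. e x f = \<zero>\<^bsub>A\<^esub>}. f z \<noteq> 0" by (auto simp: kerset_def)
    qed (use Fc in \<open>auto simp: e_add e_mult C_closed e_closed F_def Q_def\<close>)
    then have "e x (\<lambda>z. k z - F z) = e x k" using kc Fc e_diff[OF kc Fc, of x] e_closed[OF kc] by (simp add: a_minus_def)
    moreover have "cnorm A (e x (\<lambda>z. k z - F z)) \<le> \<epsilon>"
    proof (rule e_norm_le[OF diff_closed[OF kc Fc]])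
      fix z
      have "k z = of_real ((cmod (f z))\<^sup>2)" unfolding k_def complex_norm_square by simp
      then have "k z - F z = of_real (min ((cmod (f z))\<^sup>2) \<epsilon>)" by (simp add: F_def max_def min_def)
      then show "cmod (k z - F z) \<le> \<epsilon>" using \<epsilon> by (simp only: norm_of_real) auto
    qed
    ultimately show "cnorm A (e x k) \<le> 0 + \<epsilon>" by simp
  qed
  then have "(cnorm A (e x f))\<^sup>2 \<le> 0" using G.cstar_identity[OF e_closed[OF f], of x] by (simp add: k_def e_sq[OF f])
  then show "e x f = \<zero>\<^bsub>A\<^esub>" using G.norm_eq_0[OF e_closed[OF f]] by simp
qed (use f in \<open>auto simp: kerset_def\<close>)

text \<open>Uniqueness: closed sets with the same vanishing functions coincide, since bumps separate
  points from closed sets.\<close>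

lemma quotient_space_eq: "quotient_space A \<rho> x = kerset x"
  unfolding quotient_space_def
proof (rule the_equality)
  show "closed (kerset x) \<and> (\<forall>f\<in>carrier C. e x f = \<zero>\<^bsub>A\<^esub> \<longleftrightarrow> (\<forall>y\<in>kerset x. f y = 0))"
    using kerset_closed e_zero_iff_kerset by blast
  fix K assume K: "closed K \<and> (\<forall>f\<in>carrier C. e x f = \<zero>\<^bsub>A\<^esub> \<longleftrightarrow> (\<forall>y\<in>K. f y = 0))"
  have sub: "L \<subseteq> L'" if L': "closed L'" and eq: "\<And>f. f \<in> carrier C \<Longrightarrow> (\<forall>y\<in>L'. f y = 0) \<Longrightarrow> (\<forall>y\<in>L. f y = 0)" for L L' :: "'x set"
  proof
    fix y assume y: "y \<in> L"
    show "y \<in> L'"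
    proof (rule ccontr)
      assume n: "y \<notin> L'"
      then obtain r where r: "r > 0" "ball y r \<subseteq> - L'"
        using L' open_contains_ball[of "- L'"] by (auto simp: closed_def)
      have "\<forall>z\<in>L'. bump y r z = 0" using r(2) by (intro ballI bump_zero) (auto simp: subset_iff not_less[symmetric])
      then show False using eq[OF bump_closed] y bump_pos[OF r(1)] by blast
    qed
  qed
  show "K = kerset x"
    using sub[OF kerset_closed, of x K] sub[of K "kerset x"] K e_zero_iff_kerset[of _ x] by blast
qed

lemma haar_support_iff: "y \<in> haar_support \<rho> h x \<longleftrightarrow>
    (\<forall>U. open U \<and> y \<in> U \<longrightarrow> (\<exists>f\<in>carrier C. (\<forall>z. z \<notin> U \<longrightarrow> f z = 0) \<and> h (e x f) \<noteq> 0))"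
  unfolding haar_support_def prob_support_def by (auto simp: act_eq[OF G.h])

lemma haar_support_subset_reduced_orbit:
  "haar_support \<rho> h x \<subseteq> state_orbit (reduced_algebra A h) (reduced_action A h \<rho>) x"
proof
  fix y assume y: "y \<in> haar_support \<rho> h x"
  have "\<exists>f\<in>carrier C. (\<forall>z. z \<notin> ball y (1 / real (Suc n)) \<longrightarrow> f z = 0) \<and> h (e x f) \<noteq> 0" for n
    using y[unfolded haar_support_iff] by (auto simp del: mem_ball)
  then obtain f where f: "\<And>n. f n \<in> carrier C" "\<And>n z. z \<notin> ball y (1 / real (Suc n)) \<Longrightarrow> f n z = 0" "\<And>n. h (e x (f n)) \<noteq> 0"
    by metis
  \<comment> \<open>The support provides h (e x (f n)) \<noteq> 0; Cauchy-Schwarz against 1 turns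
    this into a nonzero vector.\<close>
  have "h (adj A (e x (f n)) \<otimes>\<^bsub>A\<^esub> e x (f n)) \<noteq> 0" for n
    using G.state_cauchy_schwarz(2)[OF G.h G.one_closed e_closed[OF f(1)[of n], of x]] f(3)[of n] e_closed[OF f(1)] by auto
  then obtain \<phi> where \<phi>: "\<phi> \<in> states A" "\<forall>g\<in>carrier C. \<phi> (e x g) = g y"
    "\<forall>a\<in>carrier A. (\<forall>b\<in>carrier A. h (adj A b \<otimes>\<^bsub>A\<^esub> a \<otimes>\<^bsub>A\<^esub> b) = 0) \<longrightarrow> \<phi> a = 0"
    using localized_state[of "\<lambda>n. h" f y x] G.h f by (auto simp: not_less)
  \<comment> \<open>An element with zero GNS operator for h has zero expectation in all vectors b,
    so \<phi> factors through the reduced algebra.\<close>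
  have "\<phi> a = 0" if a: "a \<in> carrier A" and n: "G.Nh a = 0" for a
  proof (rule \<phi>(3)[rule_format, OF a])
    fix b assume b: "b \<in> carrier A"
    have "cmod (h (adj A b \<otimes>\<^bsub>A\<^esub> (a \<otimes>\<^bsub>A\<^esub> b))) \<le> G.qh b * G.qh (a \<otimes>\<^bsub>A\<^esub> b)" using a b by (intro G.h_le_qh) auto
    moreover have "G.qh (a \<otimes>\<^bsub>A\<^esub> b) = 0" using G.qh_mul_le[OF a b] G.qh_nonneg[of "a \<otimes>\<^bsub>A\<^esub> b"] a b n by simp
    ultimately show "h (adj A b \<otimes>\<^bsub>A\<^esub> a \<otimes>\<^bsub>A\<^esub> b) = 0" using a b by (simp add: G.m_assoc)
  qed
  then obtain \<psi> where \<psi>: "\<psi> \<in> states G.Ar" "\<And>a. a \<in> carrier A \<Longrightarrow> \<psi> (G.\<tau> a) = \<phi> a" using G.red_state[OF \<phi>(1)] by blast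
  have "act (reduced_action A h \<rho>) (dirac x) \<psi> = dirac y"
    unfolding act_reduced[OF \<psi>(1)] act_eq_fun[OF M.pull_state[OF \<psi>(1)]]
    using \<phi>(2) \<psi>(2) e_closed by (auto simp: dirac_def M.pull_apply fun_eq_iff)
  then show "y \<in> state_orbit (reduced_algebra A h) (reduced_action A h \<rho>) x" using \<psi>(1) by (auto simp: state_orbit_def)
qed

lemma reduced_orbit_subset_orbit:
  "state_orbit (reduced_algebra A h) (reduced_action A h \<rho>) x \<subseteq> state_orbit A \<rho> x"
  using M.pull_state by (auto simp: state_orbit_def act_reduced)

text \<open>A state composed with f \<mapsto> \<rho>(f)(x) kills the kernel of that map, so its
  point lies in the hull. Conversely each bump at a point of the hull has nonzero image, and a
  norming state, depending on n, starts the localisation.\<close>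

lemma orbit_eq_kerset: "state_orbit A \<rho> x = kerset x"
proof (intro equalityI subsetI)
  fix y assume "y \<in> state_orbit A \<rho> x"
  then obtain \<phi> where \<phi>: "\<phi> \<in> states A" "act \<rho> (dirac x) \<phi> = dirac y" by (auto simp: state_orbit_def)
  have fy: "\<phi> (e x f) = f y" if "f \<in> carrier C" for f
    using act_eq[OF \<phi>(1) that, of x] unfolding \<phi>(2) using that by (simp add: dirac_def)
  have "f y = 0" if "f \<in> carrier C" "e x f = \<zero>\<^bsub>A\<^esub>" for f
    using fy[OF that(1)] that(2) G.linf_zero[OF G.linf_state[OF \<phi>(1)]] by simp
  then show "y \<in> kerset x" unfolding kerset_def by blast
next
  fix y assume y: "y \<in> kerset x"
  define f where "f n = bump y (1 / real (Suc n))" for n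
  have fc: "f n \<in> carrier C" for n by (simp add: f_def bump_closed)
  have nz: "e x (f n) \<noteq> \<zero>\<^bsub>A\<^esub>" for n using y bump_pos[of "1 / real (Suc n)" y] fc[of n] by (auto simp: kerset_def f_def)
  have "\<exists>\<psi>\<in>states A. \<psi> (adj A (e x (f n)) \<otimes>\<^bsub>A\<^esub> e x (f n)) \<noteq> 0" for n
  proof -
    obtain \<psi> where "\<psi> \<in> states A" "\<psi> (adj A (e x (f n)) \<otimes>\<^bsub>A\<^esub> e x (f n)) = of_real ((cnorm A (e x (f n)))\<^sup>2)"
      using G.norming_state[OF one_neq_zero e_closed[OF fc]] by blast
    then show ?thesis using nz[of n] G.norm_eq_0[OF e_closed[OF fc]] by (intro bexI[of _ \<psi>]) auto
  qed
  then obtain \<psi> where \<psi>: "\<And>n. \<psi> n \<in> states A" "\<And>n. \<psi> n (adj A (e x (f n)) \<otimes>\<^bsub>A\<^esub> e x (f n)) \<noteq> 0" by metis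
  have "f n z = 0" if "dist y z \<ge> 1 / real (Suc n)" for n z using that unfolding f_def by (rule bump_zero)
  then obtain \<phi> where \<phi>: "\<phi> \<in> states A" "\<forall>g\<in>carrier C. \<phi> (e x g) = g y"
    using localized_state[of \<psi> f y x, OF \<psi>(1) fc _ \<psi>(2)] by blast
  have "act \<rho> (dirac x) \<phi> = dirac y" unfolding act_eq_fun[OF \<phi>(1)] using \<phi>(2) by (auto simp: dirac_def fun_eq_iff)
  then show "y \<in> state_orbit A \<rho> x" using \<phi>(1) by (auto simp: state_orbit_def)
qed

lemma orbit_subset_Orb: "state_orbit A \<rho> x \<subseteq> Orb \<rho> h x"
proof
  fix y assume "y \<in> state_orbit A \<rho> x"
  then obtain \<phi> where "\<phi> \<in> states A" "act \<rho> (dirac x) \<phi> = dirac y" by (auto simp: state_orbit_def)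
  then show "y \<in> Orb \<rho> h x" using act_haar[of \<phi> x] by (simp add: Orb_def)
qed

text \<open>The functions with \<mu>(|f|^2) = 0 for the Haar mean \<mu> of x: an ideal whose common
  zero set turns out to be the support.\<close>

definition nullset :: "'x \<Rightarrow> ('x \<Rightarrow> complex) set" where
  "nullset x = {f \<in> carrier C. G.qh (e x f) = 0}"

lemma nullset_ideal:
  assumes "closed Q" "\<And>z. z \<in> Q \<Longrightarrow> \<exists>f\<in>nullset x. f z \<noteq> 0" "F \<in> carrier C" "\<And>z. z \<notin> Q \<Longrightarrow> F z = 0"
  shows "F \<in> nullset x"
proof (rule ideal_contains[OF compact_UNIV _ _ _ _ assms(1) assms(2) assms(3) assms(4)])
  show "nullset x \<subseteq> carrier Cont" by (auto simp: nullset_def)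
  show "(\<lambda>z. 0) \<in> nullset x" using const_closed by (simp add: nullset_def e_zero G.qh_def G.linf_zero[OF G.linf_state[OF G.h]])
  show "(\<lambda>z. f z + g z) \<in> nullset x" if "f \<in> nullset x" "g \<in> nullset x" for f g
    using that G.qh_add[of "e x f" "e x g"] G.qh_nonneg[of "e x f \<oplus>\<^bsub>A\<^esub> e x g"] by (auto simp: nullset_def e_add e_closed C_closed)
  show "(\<lambda>z. g z * f z) \<in> nullset x" if "f \<in> nullset x" "g \<in> carrier Cont" for f g
    using that G.qh_mult_le[of "e x g" "e x f"] G.qh_nonneg[of "e x g \<otimes>\<^bsub>A\<^esub> e x f"] by (auto simp: nullset_def e_mult e_closed C_closed)
qed

lemma h_nullset: assumes "f \<in> nullset x" shows "h (e x f) = 0"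
proof -
  have f: "f \<in> carrier C" "G.qh (e x f) = 0" using assms by (auto simp: nullset_def)
  then show ?thesis using G.h_le_qh[OF G.one_closed e_closed[OF f(1)], of x] e_closed[OF f(1)] by simp
qed

text \<open>If a null f is nonzero at z, then by \<open>nullset_ideal\<close> every function living
  where |f| > \<delta> is null, so z has a null neighbourhood. Conversely, if all null functions
  vanish at z, a bump at z is not null, and its squared modulus detects each neighbourhood.\<close>

lemma haar_support_zero_set: "z \<in> haar_support \<rho> h x \<longleftrightarrow> (\<forall>f\<in>nullset x. f z = 0)"
proof (intro iffI ballI)
  fix f assume z: "z \<in> haar_support \<rho> h x" and f: "f \<in> nullset x"
  have fc: "continuous_on UNIV f" using f by (simp add: nullset_def Cont_carrier)
  show "f z = 0"
  proof (rule ccontr)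
    assume nz: "f z \<noteq> 0"
    define \<delta> where "\<delta> = cmod (f z) / 2"
    have \<delta>: "\<delta> > 0" "\<delta> < cmod (f z)" using nz by (auto simp: \<delta>_def)
    have "open {w. cmod (f w) > \<delta>}" by (intro open_Collect_less continuous_intros fc)
    then obtain F where F: "F \<in> carrier C" "\<And>w. \<not> cmod (f w) > \<delta> \<Longrightarrow> F w = 0" "h (e x F) \<noteq> 0"
      using z[unfolded haar_support_iff, rule_format, of "{w. cmod (f w) > \<delta>}"] \<delta> by auto
    have "F \<in> nullset x"
    proof (rule nullset_ideal[where Q = "{w. cmod (f w) \<ge> \<delta>}"])
      show "closed {w. cmod (f w) \<ge> \<delta>}" by (intro closed_Collect_le continuous_intros fc)
      show "\<exists>f\<in>nullset x. f w \<noteq> 0" if "w \<in> {w. cmod (f w) \<ge> \<delta>}" for w using that f \<delta> by (intro bexI[of _ f]) auto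
    qed (use F in auto)
    then show False using h_nullset F(3) by blast
  qed
next
  assume van: "\<forall>f\<in>nullset x. f z = 0"
  show "z \<in> haar_support \<rho> h x" unfolding haar_support_iff
  proof (intro allI impI)
    fix U assume U: "open U \<and> z \<in> U"
    then obtain r where r: "r > 0" "ball z r \<subseteq> U" using open_contains_ball by blast
    have "bump z r \<notin> nullset x" using van bump_pos[OF r(1)] by blast
    then have "h (e x (\<lambda>w. cnj (bump z r w) * bump z r w)) \<noteq> 0"
      using bump_closed[of z r] by (simp add: nullset_def G.qh_eq_0 e_closed e_sq)
    moreover have "cnj (bump z r w) * bump z r w = 0" if "w \<notin> U" for w
    proof -
      have "w \<notin> ball z r" using that r(2) by blast
      then show ?thesis by (simp add: bump_zero)
    qed
    ultimately show "\<exists>f\<in>carrier C. (\<forall>w. w \<notin> U \<longrightarrow> f w = 0) \<and> h (e x f) \<noteq> 0"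
      by (intro bexI[of _ "\<lambda>w. cnj (bump z r w) * bump z r w"]) (auto intro!: C_closed bump_closed)
  qed
qed

text \<open>Otherwise null functions have no common zero, and the ideal property makes 1
  null.\<close>

lemma haar_support_nonempty: "haar_support \<rho> h x \<noteq> {}"
proof
  assume "haar_support \<rho> h x = {}"
  then have "\<exists>f\<in>nullset x. f z \<noteq> 0" for z using haar_support_zero_set by blast
  then have "(\<lambda>z. 1) \<in> nullset x" by (intro nullset_ideal[of UNIV]) (auto simp: const_closed)
  then show False using h_nullset[of "\<lambda>z. 1" x] by (simp add: e_one G.state_one[OF G.h])
qed

lemma haar_support_closed: "closed (haar_support \<rho> h x)"
  unfolding haar_support_def prob_support_def by (intro closed_Compl open_Union) auto

text \<open>The slice of \<rho>(f) along \<phi> as a continuous function of the point, together with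
  the formula for \<mu> \<otimes> \<phi> as an integral of it.\<close>

lemma right_slice:
  assumes \<phi>: "\<phi> \<in> states A" and f: "f \<in> carrier C"
  shows "(\<lambda>z. \<phi> (e z f)) \<in> carrier C"
    and "\<mu> \<in> states C \<Longrightarrow> tensor_functional \<mu> \<phi> (\<rho> f) = \<mu> (\<lambda>z. \<phi> (e z f))"
proof -
  obtain X where X: "CA.Cy X" "\<rho> f = CA.cls X" using CA.carrier_cls[OF \<rho>_closed[OF f]] by blast
  note R = CA.Cy_R[OF X(1)]
  define g where "g n = (\<lambda>z. talg_functional (dirac z) \<phi> (X n))" for n
  have pc: "(\<lambda>z. talg_functional (dirac z) \<phi> xs) \<in> carrier C \<and>
    (\<mu> \<in> states C \<longrightarrow> \<mu> (\<lambda>z. talg_functional (dirac z) \<phi> xs) = talg_functional \<mu> \<phi> xs)" if "xs \<in> CA.R" for xs \<mu>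
    using that
  proof (induction xs rule: alg_tensors_induct)
    case Nil
    then show ?case using C.linf_zero[OF C.linf_state, of \<mu>] const_closed by (simp add: talg_functional_ev Cont_ops)
  next
    case (Cons a b xs)
    have "(\<lambda>z. \<phi> b * a z) \<in> carrier C" using Cons by (intro C_closed)
    moreover have eq: "(\<lambda>z. talg_functional (dirac z) \<phi> ((a, b) # xs)) = cscale C (\<phi> b) a \<oplus>\<^bsub>C\<^esub> (\<lambda>z. talg_functional (dirac z) \<phi> xs)"
      using Cons by (auto simp: talg_functional_ev Cont_ops dirac_def)
    ultimately show ?case using Cons unfolding eq
      by (auto simp: C.linf_simps[OF C.linf_state] talg_functional_ev)
  qed
  have gc: "g n \<in> carrier C" for n using pc[OF R] by (simp add: g_def)
  have lim: "(\<lambda>n. g n z) \<longlonglongrightarrow> \<phi> (e z f)" for z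
    using CA.tensor_functional_tendsto[OF dirac_state \<phi> X(1), of z] act_eq[OF \<phi> f, of z] f by (simp add: X g_def act_def)
  \<comment> \<open>The bound by the tensor norm has the same constant for all Dirac states, so
    convergence is uniform in z and the limit continuous.\<close>
  have d: "cmod (g m z - g n z) \<le> CA.d (X m) (X n)" for m n z
    using CA.talg_functional_le[of "(dirac z, \<phi>)" "X m @ CA.neg (X n)"] R dirac_state \<phi> CA.bilin_states[OF dirac_state \<phi>]
    by (simp add: g_def CA.d_def talg_functional_ev CA.ev_scl)
  have unif: "\<exists>N. \<forall>n\<ge>N. \<forall>z. cmod (g n z - \<phi> (e z f)) \<le> \<epsilon>" if \<epsilon>: "\<epsilon> > 0" for \<epsilon>
  proof -
    obtain N where N: "\<And>m n. m \<ge> N \<Longrightarrow> n \<ge> N \<Longrightarrow> CA.d (X m) (X n) < \<epsilon>" using X(1) \<epsilon> unfolding tens_cauchy_def by meson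
    have "cmod (g n z - \<phi> (e z f)) \<le> \<epsilon>" if n: "n \<ge> N" for n z
    proof (rule LIMSEQ_le_const2[OF tendsto_norm[OF tendsto_diff[OF tendsto_const lim]]], intro exI allI impI)
      show "cmod (g n z - g m z) \<le> \<epsilon>" if "m \<ge> N" for m using d[of n z m] N[OF n that] by simp
    qed
    then show ?thesis by blast
  qed
  have "uniform_limit UNIV g (\<lambda>z. \<phi> (e z f)) sequentially"
    unfolding uniform_limit_iff eventually_sequentially dist_norm
  proof (intro allI impI)
    fix \<epsilon> :: real assume \<epsilon>: "\<epsilon> > 0"
    then obtain N where N: "\<And>n z. n \<ge> N \<Longrightarrow> cmod (g n z - \<phi> (e z f)) \<le> \<epsilon> / 2" using unif[of "\<epsilon> / 2"] by auto
    have "cmod (g n z - \<phi> (e z f)) < \<epsilon>" if "n \<ge> N" for n z using N[OF that, of z] \<epsilon> by linarith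
    then show "\<exists>N. \<forall>n\<ge>N. \<forall>z\<in>UNIV. cmod (g n z - \<phi> (e z f)) < \<epsilon>" by blast
  qed
  then show Gc: "(\<lambda>z. \<phi> (e z f)) \<in> carrier C"
    using gc unfolding Cont_carrier by (intro uniform_limit_theorem[where F = sequentially]) auto
  assume \<mu>: "\<mu> \<in> states C"
  have "(\<lambda>n. \<mu> (g n)) \<longlonglongrightarrow> \<mu> (\<lambda>z. \<phi> (e z f))"
  proof (rule LIMSEQ_I)
    fix \<epsilon> :: real assume \<epsilon>: "\<epsilon> > 0"
    then obtain N where N: "\<And>n z. n \<ge> N \<Longrightarrow> cmod (g n z - \<phi> (e z f)) \<le> \<epsilon> / 2" using unif[of "\<epsilon> / 2"] by auto
    have "cmod (\<mu> (g n) - \<mu> (\<lambda>z. \<phi> (e z f))) < \<epsilon>" if n: "n \<ge> N" for n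
    proof -
      have "\<mu> (g n) - \<mu> (\<lambda>z. \<phi> (e z f)) = \<mu> (cdiff C (g n) (\<lambda>z. \<phi> (e z f)))"
        using C.linf_cdiff[OF C.linf_state[OF \<mu>] gc Gc] by simp
      also have "cmod \<dots> \<le> cnorm C (cdiff C (g n) (\<lambda>z. \<phi> (e z f)))" using gc Gc by (intro C.state_norm_le[OF \<mu>]) auto
      also have "\<dots> \<le> \<epsilon> / 2" unfolding cdiff_def Cont_ops by (rule cSUP_least) (use N[OF n] in auto)
      finally show ?thesis using \<epsilon> by simp
    qed
    then show "\<exists>no. \<forall>n\<ge>no. cmod (\<mu> (g n) - \<mu> (\<lambda>z. \<phi> (e z f))) < \<epsilon>" by blast
  qed
  moreover have "(\<lambda>n. \<mu> (g n)) \<longlonglongrightarrow> tensor_functional \<mu> \<phi> (\<rho> f)"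
    using CA.tensor_functional_tendsto[OF \<mu> \<phi> X(1)] pc[OF R, of _ \<mu>] \<mu> by (simp add: X(2) g_def)
  ultimately show "tensor_functional \<mu> \<phi> (\<rho> f) = \<mu> (\<lambda>z. \<phi> (e z f))" by (metis LIMSEQ_unique)
qed

text \<open>Faithfulness of the Haar state over the support: \<open>\<mu>\<^sub>x \<triangleleft> \<phi> = \<mu>\<^sub>x\<close>, so the nonnegative function
  \<open>z \<mapsto> \<phi> (\<rho> (\<bar>f\<bar>\<^sup>2) z)\<close> has \<open>\<mu>\<^sub>x\<close>-integral \<open>0\<close>.\<close>

lemma eval_zero_on_support:
  assumes f: "f \<in> nullset x" and y: "y \<in> haar_support \<rho> h x"
  shows "e y f = \<zero>\<^bsub>A\<^esub>"
proof -
  have fc: "f \<in> carrier C" using f by (simp add: nullset_def)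
  define k where "k = (\<lambda>z. cnj (f z) * f z)"
  have kc: "k \<in> carrier C" unfolding k_def using fc by (intro C_closed)
  obtain \<phi> where \<phi>: "\<phi> \<in> states A" "\<phi> (adj A (e y f) \<otimes>\<^bsub>A\<^esub> e y f) = of_real ((cnorm A (e y f))\<^sup>2)"
    using G.norming_state[OF one_neq_zero e_closed[OF fc]] by blast
  let ?\<mu> = "act \<rho> (dirac x) h"
  define g where "g = (\<lambda>z. \<phi> (e z k))"
  have gc: "g \<in> carrier C" unfolding g_def by (rule right_slice(1)[OF \<phi>(1) kc])
  have gpos: "g z \<in> \<real>\<^sub>\<ge>\<^sub>0" for z using G.state_nonneg[OF \<phi>(1) e_closed[OF fc]] by (simp add: g_def k_def e_sq[OF fc])
  have "?\<mu> g = act \<rho> ?\<mu> \<phi> k"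
    unfolding g_def using right_slice(2)[OF \<phi>(1) kc act_state[OF G.h]] kc by (simp add: act_def[of _ ?\<mu>])
  also have "\<dots> = ?\<mu> k" by (simp add: act_haar'[OF \<phi>(1)])
  also have "\<dots> = 0" using f kc by (simp add: act_eq[OF G.h] k_def e_sq[OF fc] nullset_def G.qh_eq_0[OF e_closed[OF fc]])
  finally have \<mu>g: "h (e x g) = 0" using gc by (simp add: act_eq[OF G.h])
  \<comment> \<open>Null functions are defined through squares, so g enters via its root: h (e x g)
    = 0 makes s null, hence s and g vanish at y.\<close>
  define s where "s = (\<lambda>z. complex_of_real (sqrt (Re (g z))))"
  have sc: "s \<in> carrier C" unfolding s_def using gc by (auto simp: Cont_carrier intro!: continuous_intros)
  have "cnj (s z) * s z = g z" for z
    using gpos[of z] by (simp add: s_def complex_nonneg_Reals_iff complex_eq_iff flip: of_real_mult)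
  then have "s \<in> nullset x" using sc \<mu>g e_sq[OF sc, of x] by (simp add: nullset_def G.qh_eq_0 e_closed)
  then have "s y = 0" using y haar_support_zero_set by blast
  then have "g y = 0" using gpos[of y] by (simp add: s_def complex_nonneg_Reals_iff complex_eq_iff)
  then have "cnorm A (e y f) = 0" using \<phi>(2) by (simp add: g_def k_def e_sq[OF fc])
  then show ?thesis using G.norm_eq_0[OF e_closed[OF fc]] by blast
qed

lemma dist_closed: "(\<lambda>z. complex_of_real (dist y z)) \<in> carrier C"
  unfolding Cont_carrier by (intro continuous_intros)

theorem mem_haar_support:
  assumes iso: "isometric_action A \<Delta> h \<rho>"
  shows "x \<in> haar_support \<rho> h x"
proof (rule ccontr)
  assume nx: "x \<notin> haar_support \<rho> h x"
  obtain y where y: "y \<in> haar_support \<rho> h x" using haar_support_nonempty by blast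
  obtain \<Delta>r \<kappa> where kac: "kac_antipode G.Ar \<Delta>r \<kappa>" and iso': "\<forall>x y. eval_at G.Ar (reduced_action A h \<rho>) (\<lambda>z. of_real (dist y z)) x
      = \<kappa> (eval_at G.Ar (reduced_action A h \<rho>) (\<lambda>z. of_real (dist x z)) y)"
    using iso unfolding isometric_action_def isometric_of_reduced_def by blast
  have \<kappa>: "\<kappa> a \<in> carrier G.Ar" "\<kappa> (\<kappa> a) = a" if "a \<in> carrier G.Ar" for a
    using kac that by (auto simp: kac_antipode_def bounded_clinear_map_def)
  have \<kappa>_mult: "\<kappa> (a \<otimes>\<^bsub>G.Ar\<^esub> b) = \<kappa> b \<otimes>\<^bsub>G.Ar\<^esub> \<kappa> a" if "a \<in> carrier G.Ar" "b \<in> carrier G.Ar" for a b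
    using kac that by (simp add: kac_antipode_def)
  obtain \<epsilon> where \<epsilon>: "\<epsilon> > 0" "ball x \<epsilon> \<subseteq> - haar_support \<rho> h x"
    using nx haar_support_closed[of x] open_contains_ball[of "- haar_support \<rho> h x"] by (auto simp: closed_def)
  \<comment> \<open>Cutting the distance off at \<epsilon>/2 makes 1/r continuous, with d_x / r = 1
    outside the small ball. So k lives in a closed ball disjoint from the support and is
    null.\<close>
  define r where "r z = max (dist x z) (\<epsilon>/2)" for z
  have r: "r z > 0" for z using \<epsilon> by (simp add: r_def less_max_iff_disj)
  define g where "g = (\<lambda>z. complex_of_real (1 / r z))"
  define k where "k = (\<lambda>z. 1 - complex_of_real (dist x z) * g z)"
  have gc: "g \<in> carrier C" unfolding g_def Cont_carrier r_def
    by (intro continuous_intros) (use r in \<open>simp add: r_def less_imp_neq[symmetric]\<close>)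
  have kc: "k \<in> carrier C" unfolding k_def by (intro C_closed dist_closed gc)
  have "k \<in> nullset x"
  proof (rule nullset_ideal[where Q = "{z. dist x z \<le> \<epsilon>/2}"])
    show "closed {z. dist x z \<le> \<epsilon>/2}" by (intro closed_Collect_le continuous_intros)
    show "\<exists>f\<in>nullset x. f z \<noteq> 0" if "z \<in> {z. dist x z \<le> \<epsilon>/2}" for z
    proof -
      have "z \<in> ball x \<epsilon>" using that \<epsilon>(1) by simp
      then have "z \<notin> haar_support \<rho> h x" using \<epsilon>(2) by blast
      then show ?thesis using haar_support_zero_set by blast
    qed
    show "k z = 0" if "z \<notin> {z. dist x z \<le> \<epsilon>/2}" for z
    proof -
      have "r z = dist x z" using that by (simp add: r_def)
      then show ?thesis using r[of z] by (simp add: k_def g_def)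
    qed
  qed (rule kc)
  then have "e y k = \<zero>\<^bsub>A\<^esub>" by (rule eval_zero_on_support[OF _ y])
  moreover have "e y k = \<one>\<^bsub>A\<^esub> \<ominus>\<^bsub>A\<^esub> e y (\<lambda>z. of_real (dist x z)) \<otimes>\<^bsub>A\<^esub> e y g"
    unfolding k_def using gc dist_closed by (simp add: e_diff C_closed e_one e_mult)
  ultimately have "\<one>\<^bsub>A\<^esub> = e y (\<lambda>z. of_real (dist x z)) \<otimes>\<^bsub>A\<^esub> e y g"
    using G.cdiff_eq_zero[of "\<one>\<^bsub>A\<^esub>" "e y (\<lambda>z. of_real (dist x z)) \<otimes>\<^bsub>A\<^esub> e y g"] e_closed[OF gc] e_closed[OF dist_closed]
    by (simp add: G.cdiff_minus)
  then have uv: "\<one>\<^bsub>G.Ar\<^esub> = G.\<tau> (e y (\<lambda>z. of_real (dist x z))) \<otimes>\<^bsub>G.Ar\<^esub> G.\<tau> (e y g)"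
    using e_closed[OF gc] e_closed[OF dist_closed] by (simp add: G.red_ops)
  define D where "D = G.\<tau> (e x (\<lambda>z. of_real (dist y z)))"
  have D: "D = \<kappa> (G.\<tau> (e y (\<lambda>z. of_real (dist x z))))" unfolding D_def
    using iso'[rule_format, of y x] unfolding eval_reduced[OF dist_closed] .
  have tc: "G.\<tau> (e y g) \<in> carrier G.Ar" "G.\<tau> (e y (\<lambda>z. of_real (dist x z))) \<in> carrier G.Ar" "D \<in> carrier G.Ar"
    using e_closed[OF gc] e_closed[OF dist_closed] by (auto simp: G.red_carrier D_def)
  \<comment> \<open>Preservation of the unit follows from the involutive and product-reversing
    properties of \<kappa>.\<close>
  have \<kappa>1: "\<kappa> \<one>\<^bsub>G.Ar\<^esub> = \<one>\<^bsub>G.Ar\<^esub>"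
  proof -
    have c: "\<kappa> \<one>\<^bsub>G.Ar\<^esub> \<in> carrier G.Ar" by (rule \<kappa>(1)) simp
    have "\<one>\<^bsub>G.Ar\<^esub> = \<kappa> (\<kappa> \<one>\<^bsub>G.Ar\<^esub> \<otimes>\<^bsub>G.Ar\<^esub> \<one>\<^bsub>G.Ar\<^esub>)" using c by (simp add: \<kappa>(2))
    also have "\<dots> = \<kappa> \<one>\<^bsub>G.Ar\<^esub> \<otimes>\<^bsub>G.Ar\<^esub> \<kappa> (\<kappa> \<one>\<^bsub>G.Ar\<^esub>)" by (rule \<kappa>_mult[OF c]) simp
    also have "\<dots> = \<kappa> \<one>\<^bsub>G.Ar\<^esub>" using c by (simp add: \<kappa>(2))
    finally show ?thesis by simp
  qed
  \<comment> \<open>The reversal of products leaves D on the right, where the state can be bounded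
    by its value at adj D D.\<close>
  have vD: "\<one>\<^bsub>G.Ar\<^esub> = \<kappa> (G.\<tau> (e y g)) \<otimes>\<^bsub>G.Ar\<^esub> D"
    using \<kappa>_mult[OF tc(2,1)] \<kappa>1 by (simp add: D flip: uv)
  obtain \<phi> where \<phi>: "\<phi> \<in> states G.Ar" "act (reduced_action A h \<rho>) (dirac x) \<phi> = dirac y"
    using haar_support_subset_reduced_orbit[of x] y by (auto simp: state_orbit_def)
  have \<phi>e: "\<phi> (G.\<tau> (e x f)) = f y" if f: "f \<in> carrier C" for f
  proof -
    have "dirac y f = M.pull \<phi> (e x f)"
      unfolding \<phi>(2)[symmetric] act_reduced[OF \<phi>(1)] by (rule act_eq[OF M.pull_state[OF \<phi>(1)] f])
    then show ?thesis using f by (simp add: dirac_def M.pull_apply e_closed)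
  qed
  have "adj G.Ar D \<otimes>\<^bsub>G.Ar\<^esub> D = G.\<tau> (e x (\<lambda>z. cnj (of_real (dist y z)) * of_real (dist y z)))"
    unfolding D_def e_sq[OF dist_closed] using e_closed[OF dist_closed] by (simp add: G.red_ops)
  \<comment> \<open>The value is the square of the distance from y to y.\<close>
  then have "\<phi> (adj G.Ar D \<otimes>\<^bsub>G.Ar\<^esub> D) = 0"
    using \<phi>e[OF mult_closed[OF cnj_closed[OF dist_closed] dist_closed], of y] by simp
  \<comment> \<open>Cauchy-Schwarz makes \<phi> vanish on all left multiples of D, the unit among
    them; the double adjoint brings the product into the required form.\<close>
  then have "\<phi> (adj G.Ar (adj G.Ar (\<kappa> (G.\<tau> (e y g)))) \<otimes>\<^bsub>G.Ar\<^esub> D) = 0"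
    using M.B.state_cauchy_schwarz(2)[OF \<phi>(1) M.B.st_closed[OF \<kappa>(1)[OF tc(1)]] tc(3)] by simp
  then have "\<phi> \<one>\<^bsub>G.Ar\<^esub> = 0" using \<kappa>(1)[OF tc(1)] by (simp flip: vD)
  then show False using M.B.state_one[OF \<phi>(1)] by simp
qed

end

theorem corollary2p3:
  fixes A :: "'a cstar"
    and \<Delta> :: "'a \<Rightarrow> ('a, 'a) tens"
    and h :: "'a \<Rightarrow> complex"
    and \<rho> :: "('x::metric_space \<Rightarrow> complex) \<Rightarrow> ('x \<Rightarrow> complex, 'a) tens"
    and x :: 'x
  assumes "compact (UNIV :: 'x set)"
    and "compact_quantum_group A \<Delta>"
    and "haar_state A \<Delta> h"
    and "cqg_action A \<Delta> \<rho>"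
    and "faithful_action A \<rho>"
    and "isometric_action A \<Delta> h \<rho>"
  shows "haar_support \<rho> h x = quotient_space A \<rho> x \<and>
         quotient_space A \<rho> x = Orb \<rho> h x \<and>
         Orb \<rho> h x = state_orbit (reduced_algebra A h) (reduced_action A h \<rho>) x \<and>
         state_orbit (reduced_algebra A h) (reduced_action A h \<rho>) x = state_orbit A \<rho> x"
proof -
  interpret compact_action A \<Delta> h \<rho> by (rule compact_action.intro) fact+
  \<comment> \<open>The support depends only on the Haar mean, so a point with the same mean as x
    has the same support and, by \<open>mem_haar_support\<close>, lies in it.\<close>
  have "Orb \<rho> h x \<subseteq> haar_support \<rho> h x"
  proof
    fix y assume "y \<in> Orb \<rho> h x"
    then have "haar_support \<rho> h y = haar_support \<rho> h x" by (simp add: Orb_def haar_support_def)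
    then show "y \<in> haar_support \<rho> h x" using mem_haar_support[OF assms(6), of y] by simp
  qed
  \<comment> \<open>This inclusion closes the cycle: support, reduced orbit, orbit (equal to the
    hull), \<open>Orb\<close>, support.\<close>
  then show ?thesis
    using haar_support_subset_reduced_orbit[of x] reduced_orbit_subset_orbit[of x] orbit_eq_kerset[of x]
      orbit_subset_Orb[of x] quotient_space_eq[of x] by blast
qed

end
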